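(* Let $m\ge 0$ be an integer, let $c_{j,k}\in\mathbb C$ for integers $j,k\ge 0$ with $j+k\le m$, let $p\in\mathbb R$ and $q=1-p$. Consider the differential operator on $\mathcal S'(\mathbb R^2)$ $$B=\sum_{j+k\le m}c_{j,k}\,(x-qD_y)^j\,(y+pD_x)^k,$$ and let $A$ be the differential operator on $\mathcal S'(\mathbb R)$ with symbol $a(x,\xi)=\sum_{j+k\le m}c_{j,k}\,x^j\xi^k$. Assume that the polynomial $a$ is hypo-elliptic. Then $B$ is regular if and only if $A$ is one-to-one (as an operator on $\mathcal S'(\mathbb R)$).
   Context: $D=-i\,d/dx$, $D_x=-i\partial_x$, $D_y=-i\partial_y$; $(x,y)$ are the variables in $\mathbb R^2$, and $x$, $y$ inside operators denote multiplication by the corresponding variable. The differential operator on $\mathcal S'(\mathbb R)$ with symbol $a(x,\xi)=\sum c_{j,k}x^j\xi^k$ is $A=a(x,D)=\sum c_{j,k}x^jD^k$ (multiplications to the left of derivatives). A polynomial $a(x,\xi)$ on $\mathbb R\times\mathbb R$ (with complex coefficients) is hypo-elliptic if it does not vanish outside a compact set and $$\lim_{|x|+|\xi|\to\infty}\frac{|\partial_xa(x,\xi)|+|\partial_\xi a(x,\xi)|}{|a(x,\xi)|}=0 .$$ A linear operator $B$ on $\mathcal S'(\mathbb R^d)$ is regular if, for every $u\in\mathcal S'(\mathbb R^d)$, $Bu\in\mathcal S(\mathbb R^d)$ implies $u\in\mathcal S(\mathbb R^d)$. *)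

theory Defs
  imports "HOL-Analysis.Analysis"
begin

section \<open>The Schwartz space\<close>

definition partial_deriv :: "'a::euclidean_space \<Rightarrow> ('a \<Rightarrow> complex) \<Rightarrow> 'a \<Rightarrow> complex" where
  "partial_deriv b f x = frechet_derivative f (at x) b"

text \<open>A multi-index is represented by a list of basis vectors; the order of the entries is
  irrelevant for smooth functions.\<close>

definition iter_deriv :: "'a::euclidean_space list \<Rightarrow> ('a \<Rightarrow> complex) \<Rightarrow> 'a \<Rightarrow> complex" where
  "iter_deriv bs f = foldr partial_deriv bs f"

definition smooth :: "('a::euclidean_space \<Rightarrow> complex) \<Rightarrow> bool" where
  "smooth f \<longleftrightarrow> (\<forall>bs\<in>lists Basis. iter_deriv bs f differentiable_on UNIV)"

definition schwartz_space :: "('a::euclidean_space \<Rightarrow> complex) set" where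
  "schwartz_space = {f. smooth f \<and>
     (\<forall>n. \<forall>bs\<in>lists Basis. bdd_above (range (\<lambda>x. norm x ^ n * norm (iter_deriv bs f x))))}"

definition schwartz_seminorm ::
  "nat \<Rightarrow> 'a::euclidean_space list \<Rightarrow> ('a \<Rightarrow> complex) \<Rightarrow> real" where
  "schwartz_seminorm n bs f = (SUP x. norm x ^ n * norm (iter_deriv bs f x))"

definition schwartz_topology :: "('a::euclidean_space \<Rightarrow> complex) topology" where
  "schwartz_topology = topology_generated_by
     {{g \<in> schwartz_space. schwartz_seminorm n bs (\<lambda>x. g x - f x) < r} | n bs f r.
        bs \<in> lists Basis \<and> f \<in> schwartz_space \<and> r > 0}"

section \<open>Tempered distributions\<close>

text \<open>A tempered distribution is a continuous linear functional on the Schwartz space. It is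
  represented by its extension by 0 to all functions, so that equality of distributions is
  equality of the representing HOL functions, and sums and scalar multiples are pointwise.\<close>

definition tempered_distributions :: "(('a::euclidean_space \<Rightarrow> complex) \<Rightarrow> complex) set" where
  "tempered_distributions = {u.
     (\<forall>\<phi>. \<phi> \<notin> schwartz_space \<longrightarrow> u \<phi> = 0) \<and>
     (\<forall>\<phi>\<in>schwartz_space. \<forall>\<psi>\<in>schwartz_space. u (\<lambda>x. \<phi> x + \<psi> x) = u \<phi> + u \<psi>) \<and>
     (\<forall>z. \<forall>\<phi>\<in>schwartz_space. u (\<lambda>x. z * \<phi> x) = z * u \<phi>) \<and>
     continuous_map schwartz_topology euclidean u}"

definition distr_of :: "('a::euclidean_space \<Rightarrow> complex) \<Rightarrow> ('a \<Rightarrow> complex) \<Rightarrow> complex" where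
  "distr_of f \<phi> = (if \<phi> \<in> schwartz_space then LINT x|lborel. f x * \<phi> x else 0)"

text \<open>Multiplication by the coordinate \<open>x \<bullet> b\<close>, and \<open>D\<^sub>b = -\<i> \<partial>\<^sub>b\<close>, both acting on
  distributions by duality.\<close>

definition distr_coord ::
  "'a::euclidean_space \<Rightarrow> (('a \<Rightarrow> complex) \<Rightarrow> complex) \<Rightarrow> ('a \<Rightarrow> complex) \<Rightarrow> complex" where
  "distr_coord b u \<phi> =
     (if \<phi> \<in> schwartz_space then u (\<lambda>x. complex_of_real (x \<bullet> b) * \<phi> x) else 0)"

definition distr_D ::
  "'a::euclidean_space \<Rightarrow> (('a \<Rightarrow> complex) \<Rightarrow> complex) \<Rightarrow> ('a \<Rightarrow> complex) \<Rightarrow> complex" where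
  "distr_D b u \<phi> =
     (if \<phi> \<in> schwartz_space then - u (\<lambda>x. - \<i> * partial_deriv b \<phi> x) else 0)"

definition regular_operator ::
  "((('a::euclidean_space \<Rightarrow> complex) \<Rightarrow> complex) \<Rightarrow> (('a \<Rightarrow> complex) \<Rightarrow> complex)) \<Rightarrow> bool" where
  "regular_operator B \<longleftrightarrow> (\<forall>u\<in>tempered_distributions.
     B u \<in> distr_of ` schwartz_space \<longrightarrow> u \<in> distr_of ` schwartz_space)"

section \<open>Polynomials of degree at most m and the associated operators\<close>

text \<open>The operator \<open>\<Sum> c\<^sub>j\<^sub>k P\<^sup>j Q\<^sup>k\<close>, with powers meaning iterated composition.\<close>

definition operator_poly ::
  "nat \<Rightarrow> (nat \<Rightarrow> nat \<Rightarrow> complex) \<Rightarrow>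
   ((('a::euclidean_space \<Rightarrow> complex) \<Rightarrow> complex) \<Rightarrow> (('a \<Rightarrow> complex) \<Rightarrow> complex)) \<Rightarrow>
   ((('a \<Rightarrow> complex) \<Rightarrow> complex) \<Rightarrow> (('a \<Rightarrow> complex) \<Rightarrow> complex)) \<Rightarrow>
   (('a \<Rightarrow> complex) \<Rightarrow> complex) \<Rightarrow> (('a \<Rightarrow> complex) \<Rightarrow> complex)" where
  "operator_poly m c P Q u =
     (\<lambda>\<phi>. \<Sum>(j, k)\<in>{(j, k). j + k \<le> m}. c j k * (P ^^ j) ((Q ^^ k) u) \<phi>)"

definition symbol_poly :: "nat \<Rightarrow> (nat \<Rightarrow> nat \<Rightarrow> complex) \<Rightarrow> real \<times> real \<Rightarrow> complex" where
  "symbol_poly m c = (\<lambda>(x, \<xi>). \<Sum>(j, k)\<in>{(j, k). j + k \<le> m}.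
     c j k * complex_of_real x ^ j * complex_of_real \<xi> ^ k)"

definition operator_A ::
  "nat \<Rightarrow> (nat \<Rightarrow> nat \<Rightarrow> complex) \<Rightarrow>
   ((real \<Rightarrow> complex) \<Rightarrow> complex) \<Rightarrow> ((real \<Rightarrow> complex) \<Rightarrow> complex)" where
  "operator_A m c = operator_poly m c (distr_coord 1) (distr_D 1)"

definition operator_B ::
  "nat \<Rightarrow> (nat \<Rightarrow> nat \<Rightarrow> complex) \<Rightarrow> real \<Rightarrow> real \<Rightarrow>
   ((real \<times> real \<Rightarrow> complex) \<Rightarrow> complex) \<Rightarrow> ((real \<times> real \<Rightarrow> complex) \<Rightarrow> complex)" where
  "operator_B m c p q = operator_poly m c
     (\<lambda>u \<phi>. distr_coord (1, 0) u \<phi> - complex_of_real q * distr_D (0, 1) u \<phi>)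
     (\<lambda>u \<phi>. distr_coord (0, 1) u \<phi> + complex_of_real p * distr_D (1, 0) u \<phi>)"

definition hypo_elliptic :: "(real \<times> real \<Rightarrow> complex) \<Rightarrow> bool" where
  "hypo_elliptic a \<longleftrightarrow>
     (\<exists>K. compact K \<and> (\<forall>z. z \<notin> K \<longrightarrow> a z \<noteq> 0)) \<and>
     ((\<lambda>z. (norm (partial_deriv (1, 0) a z) + norm (partial_deriv (0, 1) a z)) / norm (a z))
        \<longlongrightarrow> 0) at_infinity"

end

theory Submission
  imports Defs "HOL-Complex_Analysis.Complex_Analysis"
begin

text \<open>
  The Weyl algebra generated by \<open>P = x - q D\<^sub>y\<close> and \<open>Q = y + p D\<^sub>x\<close> satisfies the same relation as the one
  generated by \<open>x\<close> and \<open>D\<close>, because \<open>p + q = 1\<close>, and it commutes with a second such pair. The joint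
  vacuum of the two pairs is a Gaussian with a quadratic phase, and the two creation operators produce an
  orthogonal system \<open>E m n\<close> through which \<open>\<S>'(\<real>\<^sup>2)\<close> is the space of double sequences \<open>U m n\<close> of polynomial growth
  and \<open>\<S>\<close> that of rapidly decreasing ones. In these coordinates \<open>B\<close> acts on the index \<open>m\<close> alone, exactly as
  \<open>A\<close> acts on Hermite coefficients.

  Hence a nonzero \<open>w\<close> with \<open>A w = 0\<close> gives \<open>U m n = w m\<close>, which is annihilated by \<open>B\<close> and does not decay in \<open>n\<close>.
  Conversely, if \<open>A\<close> is injective, then \<open>U\<close> is bounded by \<open>A U\<close> in every polynomial weight, uniformly in \<open>n\<close>. For this,
  the Bargmann transform turns sequences into entire functions and \<open>x, D\<close> into \<open>(\<partial> \<plusminus> z) / \<surd>2\<close> (up to \<open>\<i>\<close>). A Weyl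
  translation to a point \<open>z\<close> replaces the symbol by its Taylor expansion at the phase-space point of \<open>z\<close>, whose
  non-constant coefficients are negligible far out by hypo-ellipticity; this controls the entire function outside
  a disc. Injectivity and compactness remove the disc.
\<close>

text \<open>The pairing of distributions with test functions is bilinear, so \<open>B\<close> acts
  on the coefficients \<open>U m n = u (E m n)\<close> through the transposes of its factors, x + q
  D_y and y - p D_x. They commute with x - p D_y and y + q D_x, and these two pairs define the
  basis. The obstacle is that a solution u of B u = f is only known to grow polynomially in both
  indices, with a power that depends on u, while decay has to be proved. The a priori estimate
  therefore bounds a sequence by its image alone: a growth constant K is assumed in order to make
  suprema finite, but it never enters the conclusion. So each column n obeys the estimate with the
  same constant, although its own K depends on n. Hypo-ellipticity is weaker than ellipticity: the
  only lower bound used is |a| >= c0 > 0 far out, and A is not compared with powers of a harmonic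
  oscillator. Polynomial weights on Fock space take their place, since they change only by a factor
  under translations of length 1, the scale on which the symbol is compared with its Taylor
  expansion.\<close>

section \<open>The Bargmann transform\<close>

text \<open>\<open>x\<close> and \<open>D\<close> on Hermite coefficients; for \<open>n = 0\<close> the truncated index \<open>n - 1\<close> is multiplied by 0.\<close>

definition seq_X :: "(nat \<Rightarrow> complex) \<Rightarrow> nat \<Rightarrow> complex" where
  "seq_X U n = (of_real (sqrt (real (Suc n))) * U (Suc n) + of_real (sqrt (real n)) * U (n - 1)) / of_real (sqrt 2)"

definition seq_Y :: "(nat \<Rightarrow> complex) \<Rightarrow> nat \<Rightarrow> complex" where
  "seq_Y U n = (of_real (sqrt (real (Suc n))) * U (Suc n) - of_real (sqrt (real n)) * U (n - 1)) / (of_real (sqrt 2) * \<i>)"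

definition fun_X :: "(complex \<Rightarrow> complex) \<Rightarrow> complex \<Rightarrow> complex" where
  "fun_X f z = (deriv f z + z * f z) / of_real (sqrt 2)"

definition fun_Y :: "(complex \<Rightarrow> complex) \<Rightarrow> complex \<Rightarrow> complex" where
  "fun_Y f z = (deriv f z - z * f z) / (of_real (sqrt 2) * \<i>)"

text \<open>The functions z^m / sqrt (m!) are orthonormal in Fock space. With this normalisation the
  square roots in \<open>seq_X\<close> and \<open>seq_Y\<close> turn into plain multiplication by z
  and derivation.\<close>

definition bargmann :: "(nat \<Rightarrow> complex) \<Rightarrow> complex \<Rightarrow> complex" where
  "bargmann U z = (\<Sum>m. U m / of_real (sqrt (fact m)) * z ^ m)"

definition poly_growth :: "(nat \<Rightarrow> complex) \<Rightarrow> bool" where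
  "poly_growth U \<longleftrightarrow> (\<exists>K P. \<forall>m. norm (U m) \<le> K * (1 + real m) ^ P)"

text \<open>The square of the left-hand side is a single term of the exponential series of
  r^2.\<close>

lemma power_div_sqrt_fact_le:
  fixes r :: real assumes "r \<ge> 0"
  shows "r ^ m / sqrt (fact m) \<le> exp (r\<^sup>2 / 2)"
proof -
  have "(\<Sum>n\<in>{m}. inverse (fact n) * (r\<^sup>2) ^ n) \<le> (\<Sum>n. inverse (fact n) * (r\<^sup>2) ^ n)"
    by (rule sum_le_suminf) (auto intro!: summable_exp)
  then have "(r\<^sup>2) ^ m / fact m \<le> exp (r\<^sup>2)"
    by (simp add: exp_def field_simps)
  moreover have "(r ^ m / sqrt (fact m))\<^sup>2 = (r\<^sup>2) ^ m / fact m"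
    by (simp add: power_divide power_mult [symmetric] mult.commute)
  moreover have "(exp (r\<^sup>2 / 2))\<^sup>2 = exp (r\<^sup>2)"
    by (simp add: exp_double [symmetric])
  ultimately show ?thesis
    by (metis exp_ge_zero power2_le_imp_le)
qed

text \<open>Passing from m - 2 to m multiplies r^m / sqrt (m!) by r^2 / sqrt (m (m - 1)). The
  denominator cancels one factor 1 + m up to a constant, so each power of 1 + m costs two powers of
  r.\<close>

lemma weighted_power_div_sqrt_fact_le:
  "\<exists>C\<ge>0. \<forall>r\<ge>0. \<forall>m. (1 + real m) ^ M * (r ^ m / sqrt (fact m)) \<le> C * (1 + r) ^ (2 * M) * exp (r\<^sup>2 / 2)"
proof (induction M)
  case 0
  then show ?case using power_div_sqrt_fact_le by (intro exI[of _ 1]) auto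
next
  case (Suc M)
  then obtain C where C: "C \<ge> 0" "\<And>r m. r \<ge> 0 \<Longrightarrow> (1 + real m) ^ M * (r ^ m / sqrt (fact m)) \<le> C * (1 + r) ^ (2 * M) * exp (r\<^sup>2 / 2)"
    by blast
  have "(1 + real m) ^ Suc M * (r ^ m / sqrt (fact m)) \<le> (3 ^ Suc M * C + 2 ^ Suc M) * (1 + r) ^ (2 * Suc M) * exp (r\<^sup>2 / 2)"
    if r: "r \<ge> 0" for r m
  \<comment> \<open>The two indices without a predecessor m - 2 are bounded directly.\<close>
  proof (cases "m < 2")
    case True
    have p: "1 \<le> (1 + r) ^ (2 * Suc M)" using r by (intro one_le_power) auto
    have "(1 + real m) ^ Suc M * (r ^ m / sqrt (fact m)) \<le> 2 ^ Suc M * exp (r\<^sup>2 / 2)"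
      using True r by (intro mult_mono power_div_sqrt_fact_le power_mono) auto
    also have "\<dots> \<le> (2 ^ Suc M * (1 + r) ^ (2 * Suc M)) * exp (r\<^sup>2 / 2)"
      using p by (intro mult_right_mono) auto
    also have "\<dots> \<le> (3 ^ Suc M * C + 2 ^ Suc M) * (1 + r) ^ (2 * Suc M) * exp (r\<^sup>2 / 2)"
      using C(1) r by (intro mult_right_mono) auto
    finally show ?thesis .
  next
    case False
    then obtain k where k: "m = Suc (Suc k)" by (metis Suc_1 add_2_eq_Suc le_add_diff_inverse not_less)
    have f: "fact m = (real (k + 2) * real (k + 1)) * fact k" by (simp add: k algebra_simps)
    have s: "real (k + 1) \<le> sqrt (real (k + 2) * real (k + 1))"
      by (rule real_le_rsqrt) (simp add: power2_eq_square)
    have "r ^ m / sqrt (fact m) = r\<^sup>2 * (r ^ k / sqrt (fact k)) / sqrt (real (k + 2) * real (k + 1))"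
      unfolding f by (simp only: real_sqrt_mult) (simp add: k power2_eq_square field_simps)
    also have "\<dots> \<le> r\<^sup>2 * (r ^ k / sqrt (fact k)) / real (k + 1)"
      using s r by (intro divide_left_mono) auto
    finally have 1: "r ^ m / sqrt (fact m) \<le> r\<^sup>2 * (r ^ k / sqrt (fact k)) / real (k + 1)" .
    \<comment> \<open>The 3 comes from 1 + m = k + 3 <= 3 (k + 1).\<close>
    have "(1 + real m) ^ Suc M * (r ^ m / sqrt (fact m)) \<le> (3 * real (k + 1)) ^ Suc M * (r\<^sup>2 * (r ^ k / sqrt (fact k)) / real (k + 1))"
      using r by (intro mult_mono power_mono 1) (auto simp: k)
    also have "\<dots> = 3 ^ Suc M * r\<^sup>2 * ((1 + real k) ^ M * (r ^ k / sqrt (fact k)))"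
    proof -
      have "(3 * real (k + 1)) ^ Suc M = 3 ^ Suc M * ((1 + real k) ^ M * real (k + 1))"
        by (simp only: power_mult_distrib) (simp add: add.commute)
      then show ?thesis by (simp del: power_Suc)
    qed
    also have "\<dots> \<le> 3 ^ Suc M * (1 + r)\<^sup>2 * (C * (1 + r) ^ (2 * M) * exp (r\<^sup>2 / 2))"
      using r C(1) by (intro C(2) mult_mono power_mono) auto
    also have "\<dots> = (3 ^ Suc M * C) * (1 + r) ^ (2 * Suc M) * exp (r\<^sup>2 / 2)"
      by (simp add: power2_eq_square)
    also have "\<dots> \<le> (3 ^ Suc M * C + 2 ^ Suc M) * (1 + r) ^ (2 * Suc M) * exp (r\<^sup>2 / 2)"
      using r by (intro mult_right_mono) auto
    finally show ?thesis .
  qed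
  then show ?case using C(1) by (intro exI[of _ "3 ^ Suc M * C + 2 ^ Suc M"]) auto
qed

lemma summable_inverse_Suc_square: "summable (\<lambda>m. 1 / (1 + real m)\<^sup>2)"
proof -
  have "summable (\<lambda>n. inverse ((real (Suc n))\<^sup>2))"
    using inverse_power_summable[of 2] by (subst summable_Suc_iff) auto
  then show ?thesis by (simp add: field_simps)
qed

text \<open>Of P + 2 powers of 1 + m, two are spent on the summable factor 1 / (1 + m)^2; each of
  them costs (1 + r)^2, hence the exponent 2 P + 4. One \<open>C\<close> serves all U, K and
  z.\<close>

lemma bargmann_bound:
  "\<exists>C\<ge>0. \<forall>U K z. (\<forall>m. norm (U m) \<le> K * (1 + real m) ^ P) \<longrightarrow>
     summable (\<lambda>m. norm (U m / of_real (sqrt (fact m)) * z ^ m)) \<and>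
     norm (bargmann U z) \<le> C * K * (1 + norm z) ^ (2 * P + 4) * exp ((norm z)\<^sup>2 / 2)"
proof -
  obtain C where C: "C \<ge> 0" "\<And>r m. r \<ge> 0 \<Longrightarrow> (1 + real m) ^ (P+2) * (r ^ m / sqrt (fact m)) \<le> C * (1 + r) ^ (2 * (P+2)) * exp (r\<^sup>2 / 2)"
    using weighted_power_div_sqrt_fact_le by metis
  define S where "S = (\<Sum>m. 1 / (1 + real m)\<^sup>2)"
  have S: "S \<ge> 0" unfolding S_def by (intro suminf_nonneg summable_inverse_Suc_square) auto
  have "summable (\<lambda>m. norm (U m / of_real (sqrt (fact m)) * z ^ m)) \<and>
     norm (bargmann U z) \<le> (C * S) * K * (1 + norm z) ^ (2 * P + 4) * exp ((norm z)\<^sup>2 / 2)"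
    if U: "\<forall>m. norm (U m) \<le> K * (1 + real m) ^ P" for U K z
  proof -
    \<comment> \<open>The bound at m = 0 forces the sign of K; the same device recurs below for
      other constants.\<close>
    have K: "K \<ge> 0" using order_trans[OF norm_ge_zero U[rule_format, of 0]] by simp
    define B where "B = K * (C * (1 + norm z) ^ (2 * (P+2)) * exp ((norm z)\<^sup>2 / 2))"
    have le: "norm (U m / of_real (sqrt (fact m)) * z ^ m) \<le> B * (1 / (1 + real m)\<^sup>2)" for m
    proof -
      have "norm (U m / of_real (sqrt (fact m)) * z ^ m) = norm (U m) * (norm z ^ m / sqrt (fact m))"
        by (simp add: norm_mult norm_divide norm_power)
      also have "\<dots> \<le> (K * (1 + real m) ^ P) * (norm z ^ m / sqrt (fact m))"
        using U by (intro mult_right_mono) auto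
      also have "\<dots> = K * ((1 + real m) ^ (P+2) * (norm z ^ m / sqrt (fact m))) * (1 / (1 + real m)\<^sup>2)"
        unfolding power_add by (simp add: add_nonneg_eq_0_iff)
      also have "\<dots> \<le> B * (1 / (1 + real m)\<^sup>2)"
        unfolding B_def using C(2)[of "norm z" m] K by (intro mult_right_mono mult_left_mono) auto
      finally show ?thesis .
    qed
    have s: "summable (\<lambda>m. norm (U m / of_real (sqrt (fact m)) * z ^ m))"
      by (rule summable_comparison_test'[OF summable_mult[OF summable_inverse_Suc_square, of B]]) (use le in auto)
    have "norm (bargmann U z) \<le> (\<Sum>m. norm (U m / of_real (sqrt (fact m)) * z ^ m))"
      unfolding bargmann_def by (rule summable_norm[OF s])
    also have "\<dots> \<le> (\<Sum>m. B * (1 / (1 + real m)\<^sup>2))"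
      by (intro suminf_le le s summable_mult summable_inverse_Suc_square)
    also have "\<dots> = B * S" unfolding S_def by (rule suminf_mult[OF summable_inverse_Suc_square])
    also have "\<dots> = (C * S) * K * (1 + norm z) ^ (2 * (P + 2)) * exp ((norm z)\<^sup>2 / 2)"
      unfolding B_def by (simp only: mult_ac)
    also have "2 * (P + 2) = 2 * P + 4" by simp
    finally show ?thesis using s by blast
  qed
  then show ?thesis using C(1) S by (intro exI[of _ "C * S"]) auto
qed

lemma bargmann_summable:
  assumes "poly_growth U"
  shows "summable (\<lambda>m. U m / of_real (sqrt (fact m)) * z ^ m)"
proof -
  obtain K P where "\<forall>m. norm (U m) \<le> K * (1 + real m) ^ P" using assms unfolding poly_growth_def by auto
  then have "summable (\<lambda>m. norm (U m / of_real (sqrt (fact m)) * z ^ m))" using bargmann_bound[of P] by blast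
  then show ?thesis by (rule summable_norm_cancel)
qed

text \<open>Since m / sqrt (m!) = sqrt m / sqrt ((m - 1)!), the termwise derivative is again a
  Bargmann series, that of the weighted left shift.\<close>

lemma bargmann_has_deriv:
  assumes "poly_growth U"
  shows "(bargmann U has_field_derivative (\<Sum>m. of_real (sqrt (real (Suc m))) * U (Suc m) / of_real (sqrt (fact m)) * z ^ m)) (at z)"
proof -
  have "((\<lambda>x. \<Sum>n. U n / of_real (sqrt (fact n)) * x ^ n) has_field_derivative
      (\<Sum>n. diffs (\<lambda>n. U n / of_real (sqrt (fact n))) n * z ^ n)) (at z)"
    by (rule termdiffs_strong_converges_everywhere) (rule bargmann_summable[OF assms])
  moreover have "diffs (\<lambda>n. U n / of_real (sqrt (fact n))) m = of_real (sqrt (real (Suc m))) * U (Suc m) / of_real (sqrt (fact m))" for m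
  proof -
    have "of_nat (Suc m) = (of_real (sqrt (real (Suc m))) * of_real (sqrt (real (Suc m))) :: complex)"
      by (metis of_real_mult of_real_of_nat_eq of_nat_0_le_iff real_sqrt_mult_self abs_of_nonneg)
    moreover have "(of_real (sqrt (fact (Suc m))) :: complex) = of_real (sqrt (real (Suc m))) * of_real (sqrt (fact m))"
      by (simp only: fact_Suc real_sqrt_mult of_real_mult)
    moreover have "(of_real (sqrt (real (Suc m))) :: complex) \<noteq> 0" by simp
    ultimately show ?thesis unfolding diffs_def by (simp del: fact_Suc of_nat_Suc)
  qed
  ultimately show ?thesis unfolding bargmann_def[abs_def] by simp
qed

lemma bargmann_entire: "poly_growth U \<Longrightarrow> bargmann U holomorphic_on UNIV"
  using bargmann_has_deriv by (auto simp: holomorphic_on_open)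

section \<open>Sequences of polynomial growth and the transforms of their shifts\<close>

lemma poly_growth_shift_up:
  assumes "poly_growth U" shows "poly_growth (\<lambda>n. of_real (sqrt (real (Suc n))) * U (Suc n))"
proof -
  obtain K P where K: "\<And>m. norm (U m) \<le> K * (1 + real m) ^ P" using assms unfolding poly_growth_def by auto
  have K0: "K \<ge> 0" using order_trans[OF norm_ge_zero K[of 0]] by simp
  have "norm (of_real (sqrt (real (Suc n))) * U (Suc n)) \<le> (2 ^ P * K) * (1 + real n) ^ Suc P" for n
  proof -
    have "sqrt (real (Suc n)) \<le> 1 + real n" by (rule real_le_lsqrt) (auto simp: power2_eq_square algebra_simps)
    moreover have "norm (U (Suc n)) \<le> K * (2 * (1 + real n)) ^ P"
      using K[of "Suc n"] K0 by (elim order_trans) (intro mult_left_mono power_mono, auto)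
    ultimately have "norm (of_real (sqrt (real (Suc n))) * U (Suc n)) \<le> (1 + real n) * (K * (2 * (1 + real n)) ^ P)"
      unfolding norm_mult by (intro mult_mono) auto
    then show ?thesis by (simp only: power_mult_distrib power_Suc mult.assoc mult.left_commute mult.commute)
  qed
  then show ?thesis unfolding poly_growth_def by blast
qed

lemma poly_growth_shift_down:
  assumes "poly_growth U" shows "poly_growth (\<lambda>n. of_real (sqrt (real n)) * U (n - 1))"
proof -
  obtain K P where K: "\<And>m. norm (U m) \<le> K * (1 + real m) ^ P" using assms unfolding poly_growth_def by auto
  have K0: "K \<ge> 0" using order_trans[OF norm_ge_zero K[of 0]] by simp
  have "norm (of_real (sqrt (real n)) * U (n - 1)) \<le> K * (1 + real n) ^ Suc P" for n
  proof -
    have "sqrt (real n) \<le> 1 + real n" by (rule real_le_lsqrt) (auto simp: power2_eq_square algebra_simps)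
    moreover have "norm (U (n - 1)) \<le> K * (1 + real n) ^ P"
      using K[of "n - 1"] K0 by (elim order_trans) (intro mult_left_mono power_mono, auto)
    ultimately have "norm (of_real (sqrt (real n)) * U (n - 1)) \<le> (1 + real n) * (K * (1 + real n) ^ P)"
      unfolding norm_mult by (intro mult_mono) auto
    then show ?thesis by (simp add: mult_ac)
  qed
  then show ?thesis unfolding poly_growth_def by blast
qed

lemma poly_growth_add:
  assumes "poly_growth U" "poly_growth V" shows "poly_growth (\<lambda>n. U n + V n)"
proof -
  obtain K P where K: "\<And>m. norm (U m) \<le> K * (1 + real m) ^ P" using assms unfolding poly_growth_def by auto
  obtain L Q where L: "\<And>m. norm (V m) \<le> L * (1 + real m) ^ Q" using assms unfolding poly_growth_def by auto
  have K0: "K \<ge> 0" using order_trans[OF norm_ge_zero K[of 0]] by simp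
  have L0: "L \<ge> 0" using order_trans[OF norm_ge_zero L[of 0]] by simp
  have "norm (U n + V n) \<le> (K + L) * (1 + real n) ^ (P + Q)" for n
  proof -
    have "norm (U n) \<le> K * (1 + real n) ^ (P + Q)"
      using K[of n] K0 by (elim order_trans) (intro mult_left_mono power_increasing, auto)
    moreover have "norm (V n) \<le> L * (1 + real n) ^ (P + Q)"
      using L[of n] L0 by (elim order_trans) (intro mult_left_mono power_increasing, auto)
    ultimately show ?thesis using norm_triangle_ineq[of "U n" "V n"] by (simp add: distrib_right)
  qed
  then show ?thesis unfolding poly_growth_def by blast
qed

lemma poly_growth_cmult:
  assumes "poly_growth U" shows "poly_growth (\<lambda>n. c * U n)"
proof -
  obtain K P where K: "\<And>m. norm (U m) \<le> K * (1 + real m) ^ P" using assms unfolding poly_growth_def by auto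
  have "norm (c * U n) \<le> (norm c * K) * (1 + real n) ^ P" for n
    using mult_left_mono[OF K[of n], of "norm c"] by (simp add: norm_mult mult_ac)
  then show ?thesis unfolding poly_growth_def by blast
qed

lemma seq_X_alt: "seq_X U = (\<lambda>n. (1 / of_real (sqrt 2)) * (of_real (sqrt (real (Suc n))) * U (Suc n) + of_real (sqrt (real n)) * U (n - 1)))"
  by (auto simp: seq_X_def fun_eq_iff)

lemma seq_Y_alt: "seq_Y U = (\<lambda>n. (1 / (of_real (sqrt 2) * \<i>)) * (of_real (sqrt (real (Suc n))) * U (Suc n) + (-1) * (of_real (sqrt (real n)) * U (n - 1))))"
  by (auto simp: seq_Y_def fun_eq_iff field_simps)

lemma poly_growth_seq_X: "poly_growth U \<Longrightarrow> poly_growth (seq_X U)"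
  unfolding seq_X_alt by (intro poly_growth_cmult poly_growth_add poly_growth_shift_up poly_growth_shift_down)

lemma poly_growth_seq_Y: "poly_growth U \<Longrightarrow> poly_growth (seq_Y U)"
  unfolding seq_Y_alt by (intro poly_growth_cmult poly_growth_add poly_growth_shift_up poly_growth_shift_down)

lemma poly_growth_funpow_X: "poly_growth U \<Longrightarrow> poly_growth ((seq_X ^^ j) U)"
  by (induction j) (auto intro: poly_growth_seq_X)

lemma poly_growth_funpow_Y: "poly_growth U \<Longrightarrow> poly_growth ((seq_Y ^^ j) U)"
  by (induction j) (auto intro: poly_growth_seq_Y)

lemma bargmann_add:
  assumes "poly_growth U" "poly_growth V"
  shows "bargmann (\<lambda>n. U n + V n) z = bargmann U z + bargmann V z"
  using suminf_add[OF bargmann_summable[OF assms(1), of z] bargmann_summable[OF assms(2), of z]]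
  by (simp add: bargmann_def add_divide_distrib distrib_right)

lemma bargmann_cmult:
  assumes "poly_growth U"
  shows "bargmann (\<lambda>n. c * U n) z = c * bargmann U z"
  using suminf_mult[OF bargmann_summable[OF assms, of z], of c]
  by (simp add: bargmann_def mult.assoc)

text \<open>Both claims go into one induction, because additivity of the transform needs polynomial
  growth of the partial sums.\<close>

lemma bargmann_sum:
  assumes "finite I" "\<And>i. i \<in> I \<Longrightarrow> poly_growth (U i)"
  shows "poly_growth (\<lambda>n. \<Sum>i\<in>I. c i * U i n) \<and> bargmann (\<lambda>n. \<Sum>i\<in>I. c i * U i n) z = (\<Sum>i\<in>I. c i * bargmann (U i) z)"
  using assms
proof (induction I rule: finite_induct)
  case empty
  then show ?case by (auto simp: bargmann_def poly_growth_def intro!: exI[of _ 0])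
next
  case (insert i I)
  then have "poly_growth (\<lambda>n. \<Sum>i\<in>I. c i * U i n)" "poly_growth (\<lambda>n. c i * U i n)" by (auto intro: poly_growth_cmult)
  from poly_growth_add[OF this(2,1)] bargmann_add[OF this(2,1), of z] insert show ?case
    by (simp add: bargmann_cmult)
qed

text \<open>After shifting the summation index, sqrt n cancels against sqrt (n!); the term with the
  truncated index is killed by sqrt 0.\<close>

lemma bargmann_shift_down:
  assumes "poly_growth U"
  shows "bargmann (\<lambda>n. of_real (sqrt (real n)) * U (n - 1)) z = z * bargmann U z"
proof -
  let ?g = "\<lambda>n. of_real (sqrt (real n)) * U (n - 1) / of_real (sqrt (fact n)) * z ^ n"
  have "(of_real (sqrt (real (Suc n))) * U n / of_real (sqrt (fact (Suc n)))) = U n / of_real (sqrt (fact n))" for n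
  proof -
    have "(of_real (sqrt (fact (Suc n))) :: complex) = of_real (sqrt (real (Suc n))) * of_real (sqrt (fact n))"
      by (simp only: fact_Suc real_sqrt_mult of_real_mult)
    moreover have "(of_real (sqrt (real (Suc n))) :: complex) \<noteq> 0" by simp
    ultimately show ?thesis by (simp del: fact_Suc of_nat_Suc)
  qed
  then have g: "?g (Suc n) = z * (U n / of_real (sqrt (fact n)) * z ^ n)" for n by (simp del: fact_Suc of_nat_Suc)
  have s: "summable ?g" by (rule bargmann_summable[OF poly_growth_shift_down[OF assms]])
  have "suminf ?g = (\<Sum>n. ?g (Suc n)) + ?g 0" using suminf_split_head[OF s] by simp
  also have "\<dots> = z * bargmann U z" unfolding g bargmann_def using suminf_mult[OF bargmann_summable[OF assms, of z], of z] by simp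
  finally show ?thesis unfolding bargmann_def .
qed

lemma bargmann_shift_up:
  assumes "poly_growth U"
  shows "bargmann (\<lambda>n. of_real (sqrt (real (Suc n))) * U (Suc n)) z = deriv (bargmann U) z"
  using DERIV_imp_deriv[OF bargmann_has_deriv[OF assms]] by (simp add: bargmann_def)

lemma bargmann_seq_X: "poly_growth U \<Longrightarrow> bargmann (seq_X U) = fun_X (bargmann U)"
proof
  fix z assume U: "poly_growth U"
  show "bargmann (seq_X U) z = fun_X (bargmann U) z"
    unfolding seq_X_alt fun_X_def using U
    by (simp only: bargmann_cmult bargmann_add bargmann_shift_up bargmann_shift_down poly_growth_add poly_growth_shift_up poly_growth_shift_down) simp
qed

lemma bargmann_seq_Y: "poly_growth U \<Longrightarrow> bargmann (seq_Y U) = fun_Y (bargmann U)"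
proof
  fix z assume U: "poly_growth U"
  show "bargmann (seq_Y U) z = fun_Y (bargmann U) z"
    unfolding seq_Y_alt fun_Y_def using U
    by (simp only: bargmann_cmult bargmann_add bargmann_shift_up bargmann_shift_down poly_growth_add poly_growth_cmult poly_growth_shift_up poly_growth_shift_down) simp
qed

lemma bargmann_funpow_X: "poly_growth U \<Longrightarrow> bargmann ((seq_X ^^ j) U) = (fun_X ^^ j) (bargmann U)"
  by (induction j) (auto simp: bargmann_seq_X poly_growth_funpow_X)

lemma bargmann_funpow_Y: "poly_growth U \<Longrightarrow> bargmann ((seq_Y ^^ j) U) = (fun_Y ^^ j) (bargmann U)"
  by (induction j) (auto simp: bargmann_seq_Y poly_growth_funpow_Y)

definition seq_poly :: "nat \<Rightarrow> (nat \<Rightarrow> nat \<Rightarrow> complex) \<Rightarrow> (nat \<Rightarrow> complex) \<Rightarrow> nat \<Rightarrow> complex" where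
  "seq_poly m c U n = (\<Sum>(j, k)\<in>{(j, k). j + k \<le> m}. c j k * (seq_X ^^ j) ((seq_Y ^^ k) U) n)"

abbreviation fun_poly :: "nat \<Rightarrow> (nat \<Rightarrow> nat \<Rightarrow> complex) \<Rightarrow> (complex \<Rightarrow> complex) \<Rightarrow> complex \<Rightarrow> complex" where
  "fun_poly m c f z \<equiv> \<Sum>(j, k)\<in>{(j, k). j + k \<le> m}. c j k * (fun_X ^^ j) ((fun_Y ^^ k) f) z"

lemma finite_triangle: "finite {(j, k). j + k \<le> (m::nat)}"
  by (rule finite_subset[of _ "{..m} \<times> {..m}"]) auto

lemma bargmann_seq_poly:
  assumes "poly_growth U"
  shows "poly_growth (seq_poly m c U)"
    and "bargmann (seq_poly m c U) z = fun_poly m c (bargmann U) z"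
proof -
  have *: "seq_poly m c U = (\<lambda>n. \<Sum>i\<in>{(j, k). j + k \<le> m}. c (fst i) (snd i) * ((seq_X ^^ fst i) ((seq_Y ^^ snd i) U)) n)"
    unfolding seq_poly_def[abs_def] by (simp add: case_prod_beta)
  note s = bargmann_sum[OF finite_triangle, where U = "\<lambda>i. (seq_X ^^ fst i) ((seq_Y ^^ snd i) U)" and c = "\<lambda>i. c (fst i) (snd i)", of m,
      OF poly_growth_funpow_X[OF poly_growth_funpow_Y[OF assms]]]
  show "poly_growth (seq_poly m c U)" unfolding * using s by blast
  show "bargmann (seq_poly m c U) z = fun_poly m c (bargmann U) z"
    unfolding * using s assms
    by (simp add: case_prod_beta bargmann_funpow_X bargmann_funpow_Y poly_growth_funpow_Y)
qed

lemma fun_X_holomorphic: "f holomorphic_on UNIV \<Longrightarrow> fun_X f holomorphic_on UNIV"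
  unfolding fun_X_def[abs_def] by (intro holomorphic_intros holomorphic_deriv) auto

lemma fun_Y_holomorphic: "f holomorphic_on UNIV \<Longrightarrow> fun_Y f holomorphic_on UNIV"
  unfolding fun_Y_def[abs_def] by (intro holomorphic_intros holomorphic_deriv) auto

section \<open>A priori estimates for hypo-elliptic symbols\<close>

text \<open>Linearity is required on entire functions only, because \<open>deriv\<close> is additive
  only where the derivatives exist.\<close>

definition entire_linear :: "((complex \<Rightarrow> complex) \<Rightarrow> complex \<Rightarrow> complex) \<Rightarrow> bool" where
  "entire_linear T \<longleftrightarrow> (\<forall>f. f holomorphic_on UNIV \<longrightarrow> T f holomorphic_on UNIV) \<and>
     (\<forall>f g a b. f holomorphic_on UNIV \<longrightarrow> g holomorphic_on UNIV \<longrightarrow>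
        T (\<lambda>z. a * f z + b * g z) = (\<lambda>z. a * T f z + b * T g z))"

lemma entire_linear_fun_X: "entire_linear fun_X"
  unfolding entire_linear_def
proof (intro conjI allI impI ext)
  fix f g :: "complex \<Rightarrow> complex" and a b z
  assume "f holomorphic_on UNIV" "g holomorphic_on UNIV"
  then have "(f has_field_derivative deriv f z) (at z)" "(g has_field_derivative deriv g z) (at z)"
    by (auto intro!: holomorphic_derivI[of _ UNIV])
  then have "((\<lambda>z. a * f z + b * g z) has_field_derivative a * deriv f z + b * deriv g z) (at z)"
    by (auto intro!: derivative_eq_intros)
  then have "deriv (\<lambda>z. a * f z + b * g z) z = a * deriv f z + b * deriv g z" by (rule DERIV_imp_deriv)
  then show "fun_X (\<lambda>z. a * f z + b * g z) z = a * fun_X f z + b * fun_X g z"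
    by (simp add: fun_X_def field_simps)
qed (auto intro: fun_X_holomorphic)

lemma entire_linear_fun_Y: "entire_linear fun_Y"
  unfolding entire_linear_def
proof (intro conjI allI impI ext)
  fix f g :: "complex \<Rightarrow> complex" and a b z
  assume "f holomorphic_on UNIV" "g holomorphic_on UNIV"
  then have "(f has_field_derivative deriv f z) (at z)" "(g has_field_derivative deriv g z) (at z)"
    by (auto intro!: holomorphic_derivI[of _ UNIV])
  then have "((\<lambda>z. a * f z + b * g z) has_field_derivative a * deriv f z + b * deriv g z) (at z)"
    by (auto intro!: derivative_eq_intros)
  then have "deriv (\<lambda>z. a * f z + b * g z) z = a * deriv f z + b * deriv g z" by (rule DERIV_imp_deriv)
  then show "fun_Y (\<lambda>z. a * f z + b * g z) z = a * fun_Y f z + b * fun_Y g z"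
    by (simp add: fun_Y_def field_simps)
qed (auto intro: fun_Y_holomorphic)

lemma entire_linear_funpow: "entire_linear T \<Longrightarrow> entire_linear (T ^^ n)"
  by (induction n) (simp_all add: entire_linear_def)

lemma entire_linear_sum:
  assumes T: "entire_linear T" and "finite I" "\<And>i. i \<in> I \<Longrightarrow> g i holomorphic_on UNIV"
  shows "T (\<lambda>z. \<Sum>i\<in>I. a i * g i z) = (\<lambda>z. \<Sum>i\<in>I. a i * T (g i) z)"
  using assms(2,3)
proof (induction I rule: finite_induct)
  case empty
  show ?case
    using T[unfolded entire_linear_def, THEN conjunct2, rule_format, of "\<lambda>_. 0" "\<lambda>_. 0" 0 0] by simp
next
  case (insert i I)
  have h: "(\<lambda>z. \<Sum>i\<in>I. a i * g i z) holomorphic_on UNIV"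
    using insert by (intro holomorphic_intros) auto
  have "T (\<lambda>z. a i * g i z + 1 * (\<Sum>i\<in>I. a i * g i z)) = (\<lambda>z. a i * T (g i) z + 1 * T (\<lambda>z. \<Sum>i\<in>I. a i * g i z) z)"
    using T h insert.prems[of i] unfolding entire_linear_def by blast
  then show ?case using insert by simp
qed

text \<open>The hypothesis reads S T = (T + x) S, so S T^j = (T + x)^j S, and the binomial theorem
  applies because the scalar x commutes with T. The induction is Pascal's recursion.\<close>

lemma shifted_funpow:
  assumes T: "entire_linear T"
    and S: "\<And>f. f holomorphic_on UNIV \<Longrightarrow> S f holomorphic_on UNIV"
    and c: "\<And>f. f holomorphic_on UNIV \<Longrightarrow> S (T f) = (\<lambda>z. T (S f) z + x * S f z)"
    and f: "f holomorphic_on UNIV"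
  shows "S ((T ^^ j) f) = (\<lambda>z. \<Sum>i\<le>j. of_nat (j choose i) * x ^ (j - i) * (T ^^ i) (S f) z)"
proof (induction j)
  case 0
  then show ?case by simp
next
  case (Suc j)
  have hol: "(T ^^ n) g holomorphic_on UNIV" if "g holomorphic_on UNIV" for g n
    using entire_linear_funpow[OF T, of n] that unfolding entire_linear_def by blast
  have "S ((T ^^ Suc j) f) = (\<lambda>z. T (S ((T ^^ j) f)) z + x * S ((T ^^ j) f) z)"
    using c[OF hol[OF f, of j]] by simp
  also have "\<dots> = (\<lambda>z. (\<Sum>i\<le>j. of_nat (j choose i) * x ^ (j - i) * (T ^^ Suc i) (S f) z)
      + (\<Sum>i\<le>j. of_nat (j choose i) * x ^ (Suc j - i) * (T ^^ i) (S f) z))" (is "?l = ?r")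
  proof -
    have "T (S ((T ^^ j) f)) = (\<lambda>z. \<Sum>i\<le>j. of_nat (j choose i) * x ^ (j - i) * T ((T ^^ i) (S f)) z)"
      unfolding Suc by (intro entire_linear_sum T hol S f) auto
    moreover have "x * S ((T ^^ j) f) z = (\<Sum>i\<le>j. of_nat (j choose i) * x ^ (Suc j - i) * (T ^^ i) (S f) z)" for z
      unfolding Suc sum_distrib_left by (intro sum.cong) (auto simp: Suc_diff_le)
    ultimately show ?thesis by auto
  qed
  also have "\<dots> = (\<lambda>z. \<Sum>i\<le>Suc j. of_nat (Suc j choose i) * x ^ (Suc j - i) * (T ^^ i) (S f) z)"
  proof
    fix z
    let ?t = "\<lambda>i. (T ^^ i) (S f) z"
    have "(\<Sum>i\<le>Suc j. of_nat (Suc j choose i) * x ^ (Suc j - i) * ?t i)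
      = x ^ Suc j * ?t 0 + (\<Sum>i\<le>j. of_nat (Suc j choose Suc i) * x ^ (j - i) * ?t (Suc i))"
      by (subst sum.atMost_Suc_shift) simp
    also have "\<dots> = (\<Sum>i\<le>j. of_nat (j choose i) * x ^ (j - i) * ?t (Suc i)) +
       (x ^ Suc j * ?t 0 + (\<Sum>i\<le>j. of_nat (j choose Suc i) * x ^ (j - i) * ?t (Suc i)))"
      by (simp add: sum.distrib distrib_right)
    also have "x ^ Suc j * ?t 0 + (\<Sum>i\<le>j. of_nat (j choose Suc i) * x ^ (j - i) * ?t (Suc i))
       = (\<Sum>i\<le>Suc j. of_nat (j choose i) * x ^ (Suc j - i) * ?t i)"
      by (subst sum.atMost_Suc_shift) simp
    finally show "(\<Sum>i\<le>j. of_nat (j choose i) * x ^ (j - i) * (T ^^ Suc i) (S f) z) +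
         (\<Sum>i\<le>j. of_nat (j choose i) * x ^ (Suc j - i) * (T ^^ i) (S f) z) =
         (\<Sum>i\<le>Suc j. of_nat (Suc j choose i) * x ^ (Suc j - i) * (T ^^ i) (S f) z)" by simp
  qed
  finally show ?case .
qed

text \<open>The projective translation of Fock space: up to a factor depending only on \<open>w\<close> it is an isometry for the
  weight \<open>exp (- |z|\<^sup>2 / 2)\<close>, and it adds constants to \<open>fun_X\<close> and \<open>fun_Y\<close>.\<close>

definition weyl_shift :: "complex \<Rightarrow> (complex \<Rightarrow> complex) \<Rightarrow> complex \<Rightarrow> complex" where
  "weyl_shift w f z = exp (- cnj w * z) * f (w + z)"

lemma weyl_shift_holomorphic:
  assumes "f holomorphic_on UNIV" shows "weyl_shift w f holomorphic_on UNIV"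
proof -
  have "(f \<circ> (\<lambda>z. w + z)) holomorphic_on UNIV"
    using assms by (intro holomorphic_on_compose_gen[of _ UNIV _ UNIV] holomorphic_intros) auto
  then have "(\<lambda>z. f (w + z)) holomorphic_on UNIV" by (simp add: o_def)
  then show ?thesis unfolding weyl_shift_def[abs_def] by (intro holomorphic_intros) auto
qed

lemma deriv_weyl_shift:
  assumes "f holomorphic_on UNIV"
  shows "deriv (weyl_shift w f) z = exp (- cnj w * z) * (deriv f (w + z) - cnj w * f (w + z))"
proof -
  have "(f has_field_derivative deriv f (w + z)) (at (w + z))"
    using assms by (auto intro!: holomorphic_derivI[of _ UNIV])
  then have "((\<lambda>z. f (w + z)) has_field_derivative deriv f (w + z)) (at z)"
    using DERIV_shift[of f "deriv f (w + z)" z w] by (simp add: add.commute)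
  then have "(weyl_shift w f has_field_derivative exp (- cnj w * z) * (deriv f (w + z) - cnj w * f (w + z))) (at z)"
    unfolding weyl_shift_def[abs_def] by (auto intro!: derivative_eq_intros simp: algebra_simps)
  then show ?thesis by (rule DERIV_imp_deriv)
qed

lemma sqrt2_sq: "(of_real (sqrt 2) :: complex) * of_real (sqrt 2) = 2"
  by (metis of_real_mult of_real_numeral real_sqrt_mult_self abs_numeral)

text \<open>Under the translation d/dz becomes d/dz + cnj w and z becomes z + w. So the sum in
  \<open>fun_X\<close> gains w + cnj w = 2 Re w, and the difference in \<open>fun_Y\<close> gains
  cnj w - w = - 2 i Im w.\<close>

lemma weyl_shift_fun_X:
  assumes "f holomorphic_on UNIV"
  shows "weyl_shift w (fun_X f) = (\<lambda>z. fun_X (weyl_shift w f) z + of_real (sqrt 2 * Re w) * weyl_shift w f z)"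
proof
  fix z
  have cw: "2 * of_real (Re w) = w + cnj w" by (simp add: complex_eq_iff)
  then have "fun_X (weyl_shift w f) z = exp (- cnj w * z) * (deriv f (w + z) + (w + z) * f (w + z) - 2 * of_real (Re w) * f (w + z)) / of_real (sqrt 2)"
    unfolding fun_X_def deriv_weyl_shift[OF assms] cw by (simp add: weyl_shift_def algebra_simps)
  moreover have "of_real (sqrt 2 * Re w) * weyl_shift w f z = exp (- cnj w * z) * (2 * of_real (Re w) * f (w + z)) / of_real (sqrt 2)"
    using sqrt2_sq by (simp add: weyl_shift_def field_simps)
  moreover have "weyl_shift w (fun_X f) z = exp (- cnj w * z) * (deriv f (w + z) + (w + z) * f (w + z)) / of_real (sqrt 2)"
    by (simp add: weyl_shift_def fun_X_def)
  ultimately show "weyl_shift w (fun_X f) z = fun_X (weyl_shift w f) z + of_real (sqrt 2 * Re w) * weyl_shift w f z"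
    by (simp add: add_divide_distrib [symmetric] right_diff_distrib diff_divide_distrib)
qed

lemma weyl_shift_fun_Y:
  assumes "f holomorphic_on UNIV"
  shows "weyl_shift w (fun_Y f) = (\<lambda>z. fun_Y (weyl_shift w f) z + of_real (- sqrt 2 * Im w) * weyl_shift w f z)"
proof
  fix z
  have cw: "2 * \<i> * of_real (Im w) = w - cnj w" by (simp add: complex_eq_iff)
  then have "fun_Y (weyl_shift w f) z = exp (- cnj w * z) * (deriv f (w + z) - (w + z) * f (w + z) + 2 * \<i> * of_real (Im w) * f (w + z)) / (of_real (sqrt 2) * \<i>)"
    unfolding fun_Y_def deriv_weyl_shift[OF assms] cw by (simp add: weyl_shift_def algebra_simps)
  moreover have "of_real (- sqrt 2 * Im w) * weyl_shift w f z = - (exp (- cnj w * z) * (2 * \<i> * of_real (Im w) * f (w + z)) / (of_real (sqrt 2) * \<i>))"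
    using sqrt2_sq by (simp add: weyl_shift_def field_simps)
  moreover have "weyl_shift w (fun_Y f) z = exp (- cnj w * z) * (deriv f (w + z) - (w + z) * f (w + z)) / (of_real (sqrt 2) * \<i>)"
    by (simp add: weyl_shift_def fun_Y_def)
  ultimately show "weyl_shift w (fun_Y f) z = fun_Y (weyl_shift w f) z + of_real (- sqrt 2 * Im w) * weyl_shift w f z"
    by (simp add: add_divide_distrib [symmetric] distrib_left add_divide_distrib)
qed

lemma funpow_X_holomorphic: "f holomorphic_on UNIV \<Longrightarrow> (fun_X ^^ j) f holomorphic_on UNIV"
  by (induction j) (auto intro: fun_X_holomorphic)

lemma funpow_Y_holomorphic: "f holomorphic_on UNIV \<Longrightarrow> (fun_Y ^^ j) f holomorphic_on UNIV"
  by (induction j) (auto intro: fun_Y_holomorphic)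

text \<open>The translation only adds scalars, so the order of the factors survives and no
  commutator of \<open>fun_X\<close> with \<open>fun_Y\<close> appears.\<close>

lemma weyl_shift_words:
  assumes f: "f holomorphic_on UNIV"
  shows "weyl_shift w ((fun_X ^^ j) ((fun_Y ^^ k) f)) z =
    (\<Sum>i\<le>j. \<Sum>l\<le>k. of_nat (j choose i) * of_real (sqrt 2 * Re w) ^ (j - i) *
       (of_nat (k choose l) * of_real (- sqrt 2 * Im w) ^ (k - l)) *
       (fun_X ^^ i) ((fun_Y ^^ l) (weyl_shift w f)) z)"
proof -
  note h = weyl_shift_holomorphic[of _ w]
  have 1: "weyl_shift w ((fun_Y ^^ k) f) = (\<lambda>z. \<Sum>l\<le>k. of_nat (k choose l) * of_real (- sqrt 2 * Im w) ^ (k - l) * (fun_Y ^^ l) (weyl_shift w f) z)"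
    by (rule shifted_funpow[where S = "weyl_shift w", OF entire_linear_fun_Y h weyl_shift_fun_Y[where w = w] f])
  have 2: "weyl_shift w ((fun_X ^^ j) ((fun_Y ^^ k) f)) = (\<lambda>z. \<Sum>i\<le>j. of_nat (j choose i) * of_real (sqrt 2 * Re w) ^ (j - i) * (fun_X ^^ i) (weyl_shift w ((fun_Y ^^ k) f)) z)"
    by (rule shifted_funpow[where S = "weyl_shift w", OF entire_linear_fun_X h weyl_shift_fun_X[where w = w] funpow_Y_holomorphic[OF f]])
  have 3: "(fun_X ^^ i) (weyl_shift w ((fun_Y ^^ k) f)) = (\<lambda>z. \<Sum>l\<le>k. of_nat (k choose l) * of_real (- sqrt 2 * Im w) ^ (k - l) * (fun_X ^^ i) ((fun_Y ^^ l) (weyl_shift w f)) z)" for i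
    unfolding 1 by (rule entire_linear_sum[OF entire_linear_funpow[OF entire_linear_fun_X]]) (auto intro: funpow_Y_holomorphic h f)
  show ?thesis unfolding 2 3 by (simp add: sum_distrib_left mult.assoc)
qed

text \<open>These are the derivatives of order (i, l) of the symbol divided by i! l!. The truncated
  subtractions are harmless, since a binomial coefficient vanishes when j < i or k < l.\<close>

definition taylor_coeff :: "nat \<Rightarrow> (nat \<Rightarrow> nat \<Rightarrow> complex) \<Rightarrow> nat \<Rightarrow> nat \<Rightarrow> real \<times> real \<Rightarrow> complex" where
  "taylor_coeff m c i l = (\<lambda>(x, \<xi>). \<Sum>(j, k)\<in>{(j, k). j + k \<le> m}.
     c j k * (of_nat (j choose i) * of_real x ^ (j - i) * (of_nat (k choose l) * of_real \<xi> ^ (k - l))))"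

lemma taylor_coeff_0: "taylor_coeff m c 0 0 = symbol_poly m c"
  by (simp add: taylor_coeff_def symbol_poly_def fun_eq_iff mult.assoc)

lemma sum_extend_binomial:
  fixes g :: "nat \<Rightarrow> complex"
  assumes "j \<le> m" shows "(\<Sum>i\<le>j. of_nat (j choose i) * g i) = (\<Sum>i\<le>m. of_nat (j choose i) * g i)"
  by (rule sum.mono_neutral_left) (use assms in \<open>auto simp: binomial_eq_0\<close>)

text \<open>The prefactor of the translation is 1 at 0, so a value at w is a value at 0 after
  translation. Expanding the products (X + x)^j (Y + y)^k around the scalars x, y is the Taylor
  expansion of the symbol, with X and Y kept in order.\<close>

lemma fun_poly_at:
  assumes f: "f holomorphic_on UNIV"
  shows "(\<Sum>(j, k)\<in>{(j, k). j + k \<le> m}. c j k * (fun_X ^^ j) ((fun_Y ^^ k) f) w) =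
    (\<Sum>i\<le>m. \<Sum>l\<le>m. taylor_coeff m c i l (sqrt 2 * Re w, - sqrt 2 * Im w) *
        (fun_X ^^ i) ((fun_Y ^^ l) (weyl_shift w f)) 0)"
proof -
  define x :: complex where "x = of_real (sqrt 2 * Re w)"
  define y :: complex where "y = of_real (- sqrt 2 * Im w)"
  define t where "t i l = (fun_X ^^ i) ((fun_Y ^^ l) (weyl_shift w f)) 0" for i l
  have *: "(fun_X ^^ j) ((fun_Y ^^ k) f) w = (\<Sum>i\<le>m. \<Sum>l\<le>m. of_nat (j choose i) * x ^ (j - i) * (of_nat (k choose l) * y ^ (k - l)) * t i l)"
    if "j + k \<le> m" for j k
  proof -
    have "(fun_X ^^ j) ((fun_Y ^^ k) f) w = weyl_shift w ((fun_X ^^ j) ((fun_Y ^^ k) f)) 0"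
      by (simp add: weyl_shift_def)
    also have "\<dots> = (\<Sum>i\<le>j. of_nat (j choose i) * (x ^ (j - i) * (\<Sum>l\<le>k. of_nat (k choose l) * (y ^ (k - l) * t i l))))"
      unfolding weyl_shift_words[OF f] x_def[symmetric] y_def[symmetric] t_def[symmetric]
      by (simp add: sum_distrib_left mult_ac)
    also have "\<dots> = (\<Sum>i\<le>m. of_nat (j choose i) * (x ^ (j - i) * (\<Sum>l\<le>m. of_nat (k choose l) * (y ^ (k - l) * t i l))))"
      using that by (subst sum_extend_binomial[of j m]; simp) (subst sum_extend_binomial[of k m]; simp)
    finally show ?thesis by (simp add: sum_distrib_left mult_ac)
  qed
  have "(\<Sum>(j, k)\<in>{(j, k). j + k \<le> m}. c j k * (fun_X ^^ j) ((fun_Y ^^ k) f) w)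
     = (\<Sum>(j, k)\<in>{(j, k). j + k \<le> m}. c j k * (\<Sum>i\<le>m. \<Sum>l\<le>m. of_nat (j choose i) * x ^ (j - i) * (of_nat (k choose l) * y ^ (k - l)) * t i l))"
    by (rule sum.cong) (auto simp: *)
  also have "\<dots> = (\<Sum>jk\<in>{(j, k). j + k \<le> m}. \<Sum>i\<le>m. \<Sum>l\<le>m. c (fst jk) (snd jk) * (of_nat (fst jk choose i) * x ^ (fst jk - i) * (of_nat (snd jk choose l) * y ^ (snd jk - l))) * t i l)"
    by (simp add: case_prod_beta sum_distrib_left mult.assoc)
  also have "\<dots> = (\<Sum>i\<le>m. \<Sum>l\<le>m. \<Sum>jk\<in>{(j, k). j + k \<le> m}. c (fst jk) (snd jk) * (of_nat (fst jk choose i) * x ^ (fst jk - i) * (of_nat (snd jk choose l) * y ^ (snd jk - l))) * t i l)"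
    by (subst sum.swap, rule sum.cong[OF refl], subst sum.swap, rule refl)
  also have "\<dots> = (\<Sum>i\<le>m. \<Sum>l\<le>m. taylor_coeff m c i l (sqrt 2 * Re w, - sqrt 2 * Im w) * t i l)"
    by (simp add: taylor_coeff_def case_prod_beta sum_distrib_right x_def y_def)
  finally show ?thesis unfolding t_def .
qed

section \<open>Cauchy estimates for words in \<open>fun_X\<close> and \<open>fun_Y\<close>\<close>

lemma deriv_bound_cball:
  assumes g: "g holomorphic_on UNIV" and M: "\<And>z. norm z \<le> r' \<Longrightarrow> norm (g z) \<le> M" and r: "r < r'" and z: "norm z \<le> r"
  shows "norm (deriv g z) \<le> M / (r' - r)"
proof -
  have "norm ((deriv ^^ 1) g z) \<le> fact 1 * M / (r' - r) ^ 1"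
  proof (rule Cauchy_inequality)
    show "g holomorphic_on ball z (r' - r)" using g by (rule holomorphic_on_subset) auto
    show "continuous_on (cball z (r' - r)) g"
      using holomorphic_on_imp_continuous_on[OF g] by (rule continuous_on_subset) auto
    fix x assume "norm (z - x) = r' - r"
    then have "norm x \<le> r'" using norm_triangle_ineq4[of z "z - x"] z by simp
    then show "norm (g x) \<le> M" by (rule M)
  qed (use r in auto)
  then show ?thesis by simp
qed

text \<open>A derivative on a disc is controlled only by the function on a larger disc. Admitting
  every larger radius makes the notion stable under composition.\<close>

definition locally_bounded_op :: "((complex \<Rightarrow> complex) \<Rightarrow> complex \<Rightarrow> complex) \<Rightarrow> bool" where
  "locally_bounded_op T \<longleftrightarrow> (\<forall>r\<ge>0. \<forall>r'>r. \<exists>C\<ge>0. \<forall>g M. g holomorphic_on UNIV \<longrightarrow>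
     (\<forall>z. norm z \<le> r' \<longrightarrow> norm (g z) \<le> M) \<longrightarrow> (\<forall>z. norm z \<le> r \<longrightarrow> norm (T g z) \<le> C * M))"

lemma locally_bounded_op_comp:
  assumes S: "locally_bounded_op S" and T: "locally_bounded_op T" and h: "\<And>g. g holomorphic_on UNIV \<Longrightarrow> T g holomorphic_on UNIV"
  shows "locally_bounded_op (\<lambda>g. S (T g))"
  unfolding locally_bounded_op_def
proof (intro allI impI)
  fix r r' :: real assume r: "0 \<le> r" "r < r'"
  \<comment> \<open>The gap between the radii is shared equally by the two operators.\<close>
  define s where "s = (r + r') / 2"
  have s: "0 \<le> s" "r < s" "s < r'" using r by (auto simp: s_def)
  obtain C where C: "C \<ge> 0" "\<And>g M. g holomorphic_on UNIV \<Longrightarrow>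
     (\<forall>z. norm z \<le> s \<longrightarrow> norm (g z) \<le> M) \<Longrightarrow> (\<forall>z. norm z \<le> r \<longrightarrow> norm (S g z) \<le> C * M)"
    using S[unfolded locally_bounded_op_def, rule_format, OF r(1) s(2)] by blast
  obtain D where D: "D \<ge> 0" "\<And>g M. g holomorphic_on UNIV \<Longrightarrow>
     (\<forall>z. norm z \<le> r' \<longrightarrow> norm (g z) \<le> M) \<Longrightarrow> (\<forall>z. norm z \<le> s \<longrightarrow> norm (T g z) \<le> D * M)"
    using T[unfolded locally_bounded_op_def, rule_format, OF s(1,3)] by blast
  have "norm (S (T g) z) \<le> C * (D * M)" if "g holomorphic_on UNIV" "\<forall>z. norm z \<le> r' \<longrightarrow> norm (g z) \<le> M" "norm z \<le> r" for g M z
    using C(2)[OF h[OF that(1)] D(2)[OF that(1,2)]] that(3) by blast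
  then show "\<exists>C\<ge>0. \<forall>g M. g holomorphic_on UNIV \<longrightarrow>
     (\<forall>z. norm z \<le> r' \<longrightarrow> norm (g z) \<le> M) \<longrightarrow> (\<forall>z. norm z \<le> r \<longrightarrow> norm (S (T g) z) \<le> C * M)"
    using C(1) D(1) by (intro exI[of _ "C * D"]) (auto simp: mult.assoc)
qed

lemma locally_bounded_op_id: "locally_bounded_op (\<lambda>g. g)"
  unfolding locally_bounded_op_def by (intro allI impI exI[of _ 1]) auto

lemma locally_bounded_op_XY: "locally_bounded_op fun_X" "locally_bounded_op fun_Y"
proof -
  have *: "norm (a + b) \<le> 2 * B \<Longrightarrow> norm ((a + b) / of_real (sqrt 2)) \<le> 2 * B"
    "norm (a + b) \<le> 2 * B \<Longrightarrow> norm ((a + b) / (of_real (sqrt 2) * \<i>)) \<le> 2 * B" for a b :: complex and B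
  proof -
    assume "norm (a + b) \<le> 2 * B"
    moreover have "norm (a + b) / sqrt 2 \<le> norm (a + b)" using mult_left_mono[of 1 "sqrt 2" "norm (a + b)"] by (simp add: divide_le_eq)
    ultimately show "norm ((a + b) / of_real (sqrt 2)) \<le> 2 * B" "norm ((a + b) / (of_real (sqrt 2) * \<i>)) \<le> 2 * B"
      by (simp_all add: norm_divide norm_mult)
  qed
  have b: "norm (deriv g z) + norm (z * g z) \<le> 2 * ((1 / (r' - r) + r) * M)"
    if "0 \<le> r" "r < r'" "g holomorphic_on UNIV" "\<forall>z. norm z \<le> r' \<longrightarrow> norm (g z) \<le> M" "norm z \<le> r" for g r r' M z
  proof -
    have "norm (g z) \<le> M" using that by auto
    then have M: "0 \<le> M" by (rule order_trans[OF norm_ge_zero])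
    have "norm (deriv g z) \<le> M / (r' - r)" using that by (intro deriv_bound_cball) auto
    moreover have "norm (z * g z) \<le> r * M" unfolding norm_mult using that M by (intro mult_mono) auto
    ultimately have "norm (deriv g z) + norm (z * g z) \<le> (1 / (r' - r) + r) * M" by (simp add: distrib_right)
    also have "\<dots> \<le> 2 * ((1 / (r' - r) + r) * M)" using M that by simp
    finally show ?thesis .
  qed
  show "locally_bounded_op fun_X" unfolding locally_bounded_op_def
  proof (intro allI impI)
    fix r r' :: real assume r: "0 \<le> r" "r < r'"
    have "norm (fun_X g z) \<le> (2 * (1 / (r' - r) + r)) * M"
      if "g holomorphic_on UNIV" "\<forall>z. norm z \<le> r' \<longrightarrow> norm (g z) \<le> M" "norm z \<le> r" for g M z
      using *(1)[of "deriv g z" "z * g z", OF order_trans[OF norm_triangle_ineq b[OF r that]]]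
      by (simp only: fun_X_def mult.assoc)
    then show "\<exists>C\<ge>0. \<forall>g M. g holomorphic_on UNIV \<longrightarrow>
      (\<forall>z. norm z \<le> r' \<longrightarrow> norm (g z) \<le> M) \<longrightarrow> (\<forall>z. norm z \<le> r \<longrightarrow> norm (fun_X g z) \<le> C * M)"
      using r by (intro exI[of _ "2 * (1 / (r' - r) + r)"]) auto
  qed
  show "locally_bounded_op fun_Y" unfolding locally_bounded_op_def
  proof (intro allI impI)
    fix r r' :: real assume r: "0 \<le> r" "r < r'"
    have "norm (fun_Y g z) \<le> (2 * (1 / (r' - r) + r)) * M"
      if g: "g holomorphic_on UNIV" "\<forall>z. norm z \<le> r' \<longrightarrow> norm (g z) \<le> M" "norm z \<le> r" for g M z
    proof -
      have "norm (deriv g z + - (z * g z)) \<le> 2 * ((1 / (r' - r) + r) * M)"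
        using b[OF r g] norm_triangle_ineq[of "deriv g z" "- (z * g z)"] by simp
      from *(2)[OF this] show ?thesis by (simp only: fun_Y_def mult.assoc diff_conv_add_uminus)
    qed
    then show "\<exists>C\<ge>0. \<forall>g M. g holomorphic_on UNIV \<longrightarrow>
      (\<forall>z. norm z \<le> r' \<longrightarrow> norm (g z) \<le> M) \<longrightarrow> (\<forall>z. norm z \<le> r \<longrightarrow> norm (fun_Y g z) \<le> C * M)"
      using r by (intro exI[of _ "2 * (1 / (r' - r) + r)"]) auto
  qed
qed

text \<open>The gap between the radii 0 and 1 turns the value at the centre into a supremum over the
  unit disc. Summing the constants gives one bound for all words.\<close>

lemma words_bounded:
  "\<exists>C\<ge>0. \<forall>g M. g holomorphic_on UNIV \<longrightarrow> (\<forall>z. norm z \<le> 1 \<longrightarrow> norm (g z) \<le> M) \<longrightarrow>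
     (\<forall>i\<le>m. \<forall>l\<le>m. norm ((fun_X ^^ i) ((fun_Y ^^ l) g) 0) \<le> C * M)"
proof -
  have Y: "locally_bounded_op (fun_Y ^^ l)" for l
  proof (induction l)
    case (Suc l)
    then show ?case using locally_bounded_op_comp[OF locally_bounded_op_XY(2) Suc funpow_Y_holomorphic] by (simp add: o_def)
  qed (simp add: locally_bounded_op_id id_def)
  have XY: "locally_bounded_op (\<lambda>g. (fun_X ^^ i) ((fun_Y ^^ l) g))" for i l
  proof (induction i)
    case (Suc i)
    then show ?case using locally_bounded_op_comp[OF locally_bounded_op_XY(1) Suc funpow_X_holomorphic[OF funpow_Y_holomorphic]] by (simp add: o_def)
  qed (simp add: Y)
  have "\<exists>C\<ge>0. \<forall>g M. g holomorphic_on UNIV \<longrightarrow> (\<forall>z. norm z \<le> 1 \<longrightarrow> norm (g z) \<le> M) \<longrightarrow>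
     (\<forall>z. norm z \<le> 0 \<longrightarrow> norm ((fun_X ^^ i) ((fun_Y ^^ l) g) z) \<le> C * M)" for i l
    using XY[of i l] unfolding locally_bounded_op_def by (elim allE[of _ 0] allE[of _ 1] impE) auto
  then obtain C where C: "\<And>i l. C i l \<ge> 0" "\<And>i l g M. g holomorphic_on UNIV \<Longrightarrow> (\<forall>z. norm z \<le> 1 \<longrightarrow> norm (g z) \<le> M) \<Longrightarrow>
     norm ((fun_X ^^ i) ((fun_Y ^^ l) g) 0) \<le> C i l * M" by (metis norm_zero order_refl)
  have le: "C i l \<le> (\<Sum>i\<le>m. \<Sum>l\<le>m. C i l)" if "i \<le> m" "l \<le> m" for i l
  proof -
    have "C i l \<le> (\<Sum>l\<le>m. C i l)" using that C(1) by (intro member_le_sum) auto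
    also have "\<dots> \<le> (\<Sum>i\<le>m. \<Sum>l\<le>m. C i l)" using that C(1) by (intro member_le_sum[where f = "\<lambda>i. \<Sum>l\<le>m. C i l"]) (auto intro: sum_nonneg)
    finally show ?thesis .
  qed
  have "norm ((fun_X ^^ i) ((fun_Y ^^ l) g) 0) \<le> (\<Sum>i\<le>m. \<Sum>l\<le>m. C i l) * M"
    if "g holomorphic_on UNIV" "\<forall>z. norm z \<le> 1 \<longrightarrow> norm (g z) \<le> M" "i \<le> m" "l \<le> m" for g M i l
  proof -
    have "norm (g 0) \<le> M" using that by auto
    then have M: "0 \<le> M" by (rule order_trans[OF norm_ge_zero])
    show ?thesis using C(2)[OF that(1,2), of i l] mult_right_mono[OF le[OF that(3,4)] M] by linarith
  qed
  then show ?thesis using C(1) by (intro exI[of _ "\<Sum>i\<le>m. \<Sum>l\<le>m. C i l"]) (auto intro!: sum_nonneg)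
qed

section \<open>Consequences of hypo-ellipticity for the symbol\<close>

lemma binomial_expand:
  fixes x s :: complex
  assumes "j \<le> m"
  shows "(x + s) ^ j = (\<Sum>i\<le>m. of_nat (j choose i) * x ^ (j - i) * s ^ i)"
proof -
  have "(x + s) ^ j = (\<Sum>i\<le>j. of_nat (j choose i) * (x ^ (j - i) * s ^ i))"
    using binomial_ring[of s x j] by (simp add: add.commute mult_ac)
  then show ?thesis using sum_extend_binomial[OF assms] by (simp add: mult.assoc)
qed

text \<open>This identifies \<open>taylor_coeff\<close> as the coefficients of a polynomial in (s,
  t), which makes them accessible to interpolation.\<close>

lemma symbol_poly_taylor:
  "symbol_poly m c (x + s, \<xi> + t) =
     (\<Sum>i\<le>m. \<Sum>l\<le>m. taylor_coeff m c i l (x, \<xi>) * of_real s ^ i * of_real t ^ l)"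
proof -
  have "symbol_poly m c (x + s, \<xi> + t) =
    (\<Sum>(j, k)\<in>{(j, k). j + k \<le> m}. c j k * ((of_real x + of_real s) ^ j * (of_real \<xi> + of_real t) ^ k))"
    by (simp add: symbol_poly_def mult.assoc)
  also have "\<dots> = (\<Sum>(j, k)\<in>{(j, k). j + k \<le> m}. c j k *
     ((\<Sum>i\<le>m. of_nat (j choose i) * of_real x ^ (j - i) * of_real s ^ i) *
      (\<Sum>l\<le>m. of_nat (k choose l) * of_real \<xi> ^ (k - l) * of_real t ^ l)))"
    by (rule sum.cong[OF refl], clarify) (subst binomial_expand[of _ m], simp, subst binomial_expand[of _ m], simp, rule refl)
  also have "\<dots> = (\<Sum>jk\<in>{(j, k). j + k \<le> m}. \<Sum>i\<le>m. \<Sum>l\<le>m.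
     c (fst jk) (snd jk) * (of_nat (fst jk choose i) * of_real x ^ (fst jk - i) * (of_nat (snd jk choose l) * of_real \<xi> ^ (snd jk - l))) * of_real s ^ i * of_real t ^ l)"
    by (simp add: case_prod_beta sum_product sum_distrib_left mult_ac) (rule sum.cong[OF refl], rule sum.swap)
  also have "\<dots> = (\<Sum>i\<le>m. \<Sum>l\<le>m. \<Sum>jk\<in>{(j, k). j + k \<le> m}.
     c (fst jk) (snd jk) * (of_nat (fst jk choose i) * of_real x ^ (fst jk - i) * (of_nat (snd jk choose l) * of_real \<xi> ^ (snd jk - l))) * of_real s ^ i * of_real t ^ l)"
    by (subst sum.swap, rule sum.cong[OF refl], subst sum.swap, rule refl)
  also have "\<dots> = (\<Sum>i\<le>m. \<Sum>l\<le>m. taylor_coeff m c i l (x, \<xi>) * of_real s ^ i * of_real t ^ l)"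
    by (simp add: taylor_coeff_def case_prod_beta sum_distrib_right)
  finally show ?thesis .
qed

text \<open>A polynomial of degree at most m is determined by its values at 0, ..., m;
  \<open>W\<close> consists of the coefficients of the Lagrange polynomials for these nodes. What
  matters is that it does not depend on d.\<close>

lemma coefficients_from_values:
  "\<exists>W :: nat \<Rightarrow> nat \<Rightarrow> complex. \<forall>d. \<forall>j\<le>m. d j = (\<Sum>s\<le>m. W j s * (\<Sum>l\<le>m. d l * of_nat s ^ l))"
proof -
  define L :: "nat \<Rightarrow> complex poly" where
    "L s = (\<Prod>r\<in>{..m} - {s}. smult (1 / (of_nat s - of_nat r)) [:- of_nat r, 1:])" for s
  have degL: "degree (L s) \<le> m" if "s \<le> m" for s
  proof -
    have "degree (L s) \<le> sum (degree \<circ> (\<lambda>r. smult (1 / (of_nat s - of_nat r)) [:- of_nat r, 1:] :: complex poly)) ({..m} - {s})"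
      unfolding L_def by (rule degree_prod_sum_le) simp
    also have "\<dots> \<le> sum (\<lambda>_. 1) ({..m} - {s})" by (rule sum_mono) simp
    also have "\<dots> = m" using that by simp
    finally show ?thesis .
  qed
  have evL: "poly (L s) (of_nat t) = (if s = t then 1 else 0)" if "s \<le> m" "t \<le> m" for s t
  proof (cases "s = t")
    case True
    then show ?thesis by (auto simp: L_def poly_prod divide_simps intro!: prod.neutral)
  next
    case False
    then show ?thesis using that by (auto simp: L_def poly_prod intro!: prod_zero bexI[of _ t])
  qed
  have "d j = (\<Sum>s\<le>m. coeff (L s) j * (\<Sum>l\<le>m. d l * of_nat s ^ l))" if j: "j \<le> m" for d :: "nat \<Rightarrow> complex" and j
  proof -
    define p where "p = (\<Sum>l\<le>m. monom (d l) l)"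
    define q where "q = (\<Sum>s\<le>m. smult (poly p (of_nat s)) (L s))"
    have pv: "poly p x = (\<Sum>l\<le>m. d l * x ^ l)" for x by (simp add: p_def poly_sum poly_monom)
    \<comment> \<open>Interpolation reproduces p: both sides have degree at most m and agree at m +
      1 nodes.\<close>
    have "p = q"
    proof (rule poly_eqI_degree[where A = "of_nat ` {..m}"])
      have c: "card (of_nat ` {..m} :: complex set) = Suc m" by (subst card_image) (auto simp: inj_on_def)
      have "degree p \<le> m" unfolding p_def by (rule degree_sum_le) (auto intro: order_trans[OF degree_monom_le])
      then show "degree p < card (of_nat ` {..m} :: complex set)" using c by simp
      have "degree q \<le> m" unfolding q_def by (rule degree_sum_le) (auto simp: degL)
      then show "degree q < card (of_nat ` {..m} :: complex set)" using c by simp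
      fix x :: complex assume "x \<in> of_nat ` {..m}"
      then obtain t where t: "x = of_nat t" "t \<le> m" by auto
      have "poly q x = (\<Sum>s\<le>m. poly p (of_nat s) * (if s = t then 1 else 0))"
        unfolding q_def poly_sum using t evL by (intro sum.cong) auto
      then show "poly p x = poly q x" using t by (simp add: if_distrib cong: if_cong)
    qed
    then have "coeff p j = coeff q j" by simp
    moreover have "coeff p j = d j" using j by (simp add: p_def coeff_sum)
    moreover have "coeff q j = (\<Sum>s\<le>m. coeff (L s) j * (\<Sum>l\<le>m. d l * of_nat s ^ l))"
      by (simp add: q_def coeff_sum pv mult.commute)
    ultimately show ?thesis by simp
  qed
  then show ?thesis by (intro exI[of _ "\<lambda>j s. coeff (L s) j"]) blast
qed

lemma symbol_poly_differentiable: "symbol_poly m c differentiable (at z)"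
proof -
  have *: "symbol_poly m c = (\<lambda>z. \<Sum>jk\<in>{(j, k). j + k \<le> m}. c (fst jk) (snd jk) * of_real (fst z) ^ fst jk * of_real (snd z) ^ snd jk)"
    by (simp add: symbol_poly_def fun_eq_iff case_prod_beta)
  have c: "(\<lambda>z::real \<times> real. complex_of_real (fst z)) differentiable (at z)" 
    by (rule bounded_linear_imp_differentiable) (rule bounded_linear_compose[OF bounded_linear_of_real bounded_linear_fst])
  have d: "(\<lambda>z::real \<times> real. complex_of_real (snd z)) differentiable (at z)" 
    by (rule bounded_linear_imp_differentiable) (rule bounded_linear_compose[OF bounded_linear_of_real bounded_linear_snd])
  show ?thesis unfolding *
    by (intro differentiable_sum finite_triangle ballI differentiable_mult differentiable_const differentiable_power c d)
qed

text \<open>The mean value inequality needs an operator norm, while hypo-ellipticity speaks of the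
  two partial derivatives.\<close>

lemma norm_fderiv_le:
  fixes f :: "real \<times> real \<Rightarrow> complex"
  assumes "f differentiable (at z)"
  shows "onorm (frechet_derivative f (at z)) \<le> norm (partial_deriv (1, 0) f z) + norm (partial_deriv (0, 1) f z)"
proof (rule onorm_bound)
  have lin: "linear (frechet_derivative f (at z))"
    by (rule linear_frechet_derivative[OF assms])
  fix h :: "real \<times> real"
  have "h = fst h *\<^sub>R (1, 0) + snd h *\<^sub>R (0, 1)" by (simp add: prod_eq_iff)
  then have "frechet_derivative f (at z) h = frechet_derivative f (at z) (fst h *\<^sub>R (1, 0) + snd h *\<^sub>R (0, 1))" by simp
  also have "\<dots> = fst h *\<^sub>R partial_deriv (1, 0) f z + snd h *\<^sub>R partial_deriv (0, 1) f z"
    unfolding partial_deriv_def by (simp only: linear_add[OF lin] linear_scale[OF lin])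
  finally have "norm (frechet_derivative f (at z) h) \<le> \<bar>fst h\<bar> * norm (partial_deriv (1, 0) f z) + \<bar>snd h\<bar> * norm (partial_deriv (0, 1) f z)"
    by (metis norm_triangle_ineq norm_scaleR)
  also have "\<dots> \<le> norm h * norm (partial_deriv (1, 0) f z) + norm h * norm (partial_deriv (0, 1) f z)"
    using norm_fst_le[of "fst h" "snd h"] norm_snd_le[of "snd h" "fst h"] by (intro add_mono mult_right_mono) auto
  finally show "norm (frechet_derivative f (at z) h) \<le> (norm (partial_deriv (1, 0) f z) + norm (partial_deriv (0, 1) f z)) * norm h"
    by (simp add: algebra_simps)
qed auto

text \<open>The gradient is a small multiple of |a| at each point, so the mean value inequality
  bounds the variation on a ball by a small multiple of the maximum of |a| there. Once this is at
  most half of the maximum, the maximum is at most 2 |a z|, and the bound becomes relative to the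
  centre.\<close>

lemma hypo_elliptic_slowly_varying:
  assumes hyp: "hypo_elliptic a" and diff: "\<And>z. a differentiable (at z)" and \<rho>: "\<rho> > 0" and \<epsilon>: "\<epsilon> > 0"
  shows "\<exists>R. \<forall>z h. norm z \<ge> R \<longrightarrow> norm h \<le> \<rho> \<longrightarrow> norm (a (z + h) - a z) \<le> \<epsilon> * norm (a z)"
proof -
  obtain K where K: "compact K" "\<And>z. z \<notin> K \<Longrightarrow> a z \<noteq> 0" using hyp unfolding hypo_elliptic_def by blast
  obtain B where B: "\<And>z. z \<in> K \<Longrightarrow> norm z \<le> B" using compact_imp_bounded[OF K(1)] unfolding bounded_iff by blast
  \<comment> \<open>The first bound lets half of the maximum be absorbed, the second leaves
    \<epsilon> after the resulting factor 2.\<close>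
  define e where "e = min (1 / (2 * \<rho>)) (\<epsilon> / (2 * \<rho>))"
  have e: "e > 0" "\<rho> * e \<le> 1 / 2" "\<rho> * e \<le> \<epsilon> / 2" using \<rho> \<epsilon> by (auto simp: e_def min_def field_simps)
  have lim: "((\<lambda>z. (norm (partial_deriv (1, 0) a z) + norm (partial_deriv (0, 1) a z)) / norm (a z)) \<longlongrightarrow> 0) at_infinity"
    using hyp unfolding hypo_elliptic_def by blast
  have "eventually (\<lambda>z. (norm (partial_deriv (1, 0) a z) + norm (partial_deriv (0, 1) a z)) / norm (a z) < e) at_infinity"
    using tendstoD[OF lim e(1)] by eventually_elim simp
  then obtain R0 where R0: "\<And>z. norm z \<ge> R0 \<Longrightarrow> (norm (partial_deriv (1, 0) a z) + norm (partial_deriv (0, 1) a z)) / norm (a z) < e"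
    unfolding eventually_at_infinity by blast
  \<comment> \<open>Adding the radius keeps the whole ball around z outside K and in the range of
    \<open>R0\<close>.\<close>
  define R where "R = max R0 (B + 1) + \<rho>"
  have der: "onorm (frechet_derivative a (at z)) \<le> e * norm (a z)" if "norm z \<ge> max R0 (B + 1)" for z
  proof -
    have "z \<notin> K" using B[of z] that by auto
    then have "norm (a z) > 0" using K(2) by simp
    then have "norm (partial_deriv (1, 0) a z) + norm (partial_deriv (0, 1) a z) \<le> e * norm (a z)"
      using R0[of z] that by (simp add: pos_divide_less_eq)
    then show ?thesis using norm_fderiv_le[OF diff[of z]] by linarith
  qed
  have "norm (a (z + h) - a z) \<le> \<epsilon> * norm (a z)" if z: "norm z \<ge> R" and h: "norm h \<le> \<rho>" for z h
  proof -
    have cont: "continuous_on (cball z \<rho>) (\<lambda>w. norm (a w))"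
      by (intro continuous_on_norm differentiable_imp_continuous_on) (auto simp: differentiable_on_def intro: differentiable_at_withinI diff)
    obtain w where w: "w \<in> cball z \<rho>" "\<And>v. v \<in> cball z \<rho> \<Longrightarrow> norm (a v) \<le> norm (a w)"
      using continuous_attains_sup[OF compact_cball _ cont] \<rho> by auto
    have big: "norm v \<ge> max R0 (B + 1)" if "v \<in> cball z \<rho>" for v
      using norm_triangle_ineq2[of z "z - v"] that z unfolding R_def by (auto simp: dist_norm)
    have lip: "norm (a v - a z) \<le> \<rho> * e * norm (a w)" if v: "v \<in> cball z \<rho>" for v
    proof -
      have "norm (a v - a z) \<le> (e * norm (a w)) * norm (v - z)"
      proof (rule differentiable_bound[where S = "cball z \<rho>" and f' = "\<lambda>x. frechet_derivative a (at x)"])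
        fix x assume x: "x \<in> cball z \<rho>"
        show "(a has_derivative frechet_derivative a (at x)) (at x within cball z \<rho>)"
          using diff[of x] frechet_derivative_works has_derivative_at_withinI by blast
        have "e * norm (a x) \<le> e * norm (a w)" using w(2)[OF x] e by simp
        then show "onorm (frechet_derivative a (at x)) \<le> e * norm (a w)"
          using der[OF big[OF x]] by linarith
      qed (use v \<rho> in auto)
      also have "\<dots> \<le> (e * norm (a w)) * \<rho>" using v e by (intro mult_left_mono) (auto simp: dist_norm norm_minus_commute)
      finally show ?thesis by (simp add: mult_ac)
    qed
    have "norm (a w) \<le> norm (a z) + norm (a w - a z)" using norm_triangle_ineq[of "a z" "a w - a z"] by simp
    also have "norm (a w - a z) \<le> (1 / 2) * norm (a w)"
      using lip[OF w(1)] mult_right_mono[OF e(2), of "norm (a w)"] by simp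
    finally have "norm (a w) \<le> 2 * norm (a z)" by simp
    then have "\<rho> * e * norm (a w) \<le> (\<epsilon> / 2) * (2 * norm (a z))"
      using e \<rho> \<epsilon> by (intro mult_mono) auto
    moreover have "z + h \<in> cball z \<rho>" using h by (simp add: dist_norm)
    ultimately show ?thesis using lip by fastforce
  qed
  then show ?thesis by blast
qed

text \<open>The hypothesis speaks of first derivatives only. Slow variation makes a(z + h) - a(z)
  relatively small at all grid points h in {0, ..., m}^2, and interpolation recovers the higher
  Taylor coefficients from these finitely many differences.\<close>

lemma hypo_elliptic_taylor_coeff:
  assumes hyp: "hypo_elliptic (symbol_poly m c)" and \<epsilon>: "\<epsilon> > 0"
  shows "\<exists>R. \<forall>z. norm z \<ge> R \<longrightarrow> (\<forall>i\<le>m. \<forall>l\<le>m. (i, l) \<noteq> (0, 0) \<longrightarrow>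
     norm (taylor_coeff m c i l z) \<le> \<epsilon> * norm (symbol_poly m c z))"
proof -
  let ?a = "symbol_poly m c"
  obtain W :: "nat \<Rightarrow> nat \<Rightarrow> complex" where W: "\<And>(d :: nat \<Rightarrow> complex) j. j \<le> m \<Longrightarrow> d j = (\<Sum>s\<le>m. W j s * (\<Sum>l\<le>m. d l * of_nat s ^ l))" 
    using coefficients_from_values[of m] by blast
  define S where "S = (\<Sum>i\<le>m. \<Sum>s\<le>m. norm (W i s))"
  have S: "S \<ge> 0" unfolding S_def by (intro sum_nonneg) auto
  have Sle: "(\<Sum>s\<le>m. norm (W i s)) \<le> S" if "i \<le> m" for i
    unfolding S_def using that by (intro member_le_sum[where f = "\<lambda>i. \<Sum>s\<le>m. norm (W i s)"]) (auto intro: sum_nonneg)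
  \<comment> \<open>The grid lies in the ball of radius 2 m + 1; the 1 keeps the radius positive for
    m = 0. Interpolating once in each variable costs the factor S * S.\<close>
  have pos: "2 * real m + 1 > 0" "\<epsilon> / (S * S + 1) > 0"
    using \<epsilon> S by (auto intro!: divide_pos_pos add_nonneg_pos mult_nonneg_nonneg)
  obtain R where R: "\<And>z h. norm z \<ge> R \<Longrightarrow> norm h \<le> 2 * real m + 1 \<Longrightarrow> norm (?a (z + h) - ?a z) \<le> \<epsilon> / (S * S + 1) * norm (?a z)"
    using hypo_elliptic_slowly_varying[OF hyp symbol_poly_differentiable pos] by blast
  have "norm (taylor_coeff m c i l z) \<le> \<epsilon> * norm (?a z)"
    if z: "norm z \<ge> R" and il: "i \<le> m" "l \<le> m" "(i, l) \<noteq> (0, 0)" for z i l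
  proof -
    \<comment> \<open>Removing the constant term turns the values to be interpolated into
      differences a(z + h) - a(z).\<close>
    define d where "d i l = (if (i, l) = (0, 0) then 0 else taylor_coeff m c i l z)" for i l
    have v: "(\<Sum>i\<le>m. (\<Sum>l\<le>m. d i l * of_nat t ^ l) * of_nat s ^ i) = ?a (z + (real s, real t)) - ?a z" (is "?l = _") for s t
    proof -
      have "?a (z + (real s, real t)) = (\<Sum>i\<le>m. \<Sum>l\<le>m. taylor_coeff m c i l z * of_nat s ^ i * of_nat t ^ l)"
        using symbol_poly_taylor[of m c "fst z" "real s" "snd z" "real t"] by (cases z) simp
      also have "\<dots> = (\<Sum>i\<le>m. \<Sum>l\<le>m. d i l * of_nat t ^ l * of_nat s ^ i + (if i = 0 then if l = 0 then ?a z else 0 else 0))"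
        by (intro sum.cong refl) (auto simp: d_def taylor_coeff_0)
      also have "\<dots> = ?l + (\<Sum>i\<le>m. \<Sum>l\<le>m. if i = 0 then if l = 0 then ?a z else 0 else 0)"
        by (simp add: sum.distrib sum_distrib_right)
      also have "(\<Sum>i\<le>m. \<Sum>l\<le>m. if i = 0 then if l = 0 then ?a z else 0 else 0) = (\<Sum>i\<le>m. if i = 0 then ?a z else 0)"
        by (rule sum.cong) auto
      also have "\<dots> = ?a z" by simp
      finally show ?thesis by simp
    qed
    \<comment> \<open>Interpolation in the second variable, then in the first.\<close>
    have "d i l = (\<Sum>t\<le>m. W l t * (\<Sum>l\<le>m. d i l * of_nat t ^ l))" using W[OF il(2), of "d i"] .
    also have "\<dots> = (\<Sum>t\<le>m. W l t * (\<Sum>s\<le>m. W i s * (\<Sum>i\<le>m. (\<Sum>l\<le>m. d i l * of_nat t ^ l) * of_nat s ^ i)))"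
      using W[OF il(1), of "\<lambda>i. \<Sum>l\<le>m. d i l * of_nat _ ^ l"] by simp
    also have "\<dots> = (\<Sum>t\<le>m. W l t * (\<Sum>s\<le>m. W i s * (?a (z + (real s, real t)) - ?a z)))" unfolding v ..
    finally have deq: "d i l = (\<Sum>t\<le>m. W l t * (\<Sum>s\<le>m. W i s * (?a (z + (real s, real t)) - ?a z)))" .
    have "norm (d i l) \<le> (\<Sum>t\<le>m. norm (W l t) * (\<Sum>s\<le>m. norm (W i s) * (\<epsilon> / (S * S + 1) * norm (?a z))))"
      unfolding deq
    proof (intro sum_norm_le, unfold norm_mult, intro mult_left_mono sum_norm_le norm_ge_zero, unfold norm_mult, intro mult_left_mono norm_ge_zero)
      fix s t assume "s \<in> {..m}" "t \<in> {..m}"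
      then have "norm (real s, real t) \<le> 2 * real m + 1"
        using norm_Pair_le[of "real s" "real t"] by simp
      from R[OF z this] show "norm (?a (z + (real s, real t)) - ?a z) \<le> \<epsilon> / (S * S + 1) * norm (?a z)" .
    qed
    also have "\<dots> = (\<Sum>t\<le>m. norm (W l t)) * (\<Sum>s\<le>m. norm (W i s)) * (\<epsilon> / (S * S + 1) * norm (?a z))"
      by (simp only: sum_distrib_right[symmetric] mult.assoc[symmetric])
    also have "\<dots> \<le> S * S * (\<epsilon> / (S * S + 1) * norm (?a z))"
      using S Sle il \<epsilon> pos by (intro mult_right_mono mult_mono mult_nonneg_nonneg less_imp_le[OF pos(2)]) (auto intro: sum_nonneg)
    also have "\<dots> = (S * S / (S * S + 1)) * (\<epsilon> * norm (?a z))" by simp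
    also have "\<dots> \<le> 1 * (\<epsilon> * norm (?a z))"
    proof (intro mult_right_mono)
      have "0 \<le> S * S" using S by simp
      then show "S * S / (S * S + 1) \<le> 1" by (subst divide_le_eq_1_pos) linarith+
    qed (use \<epsilon> in auto)
    finally show ?thesis using il by (auto simp: d_def)
  qed
  then show ?thesis by blast
qed

text \<open>The Taylor coefficient belonging to a monomial of maximal total degree is a nonzero
  constant, yet far out it is at most |a|. If the maximal degree is 0, the symbol itself is
  constant.\<close>

lemma hypo_elliptic_lower_bound:
  assumes hyp: "hypo_elliptic (symbol_poly m c)"
  shows "\<exists>R. \<exists>c0>0. \<forall>z. norm z \<ge> R \<longrightarrow> c0 \<le> norm (symbol_poly m c z)"
proof -
  \<comment> \<open>Otherwise the symbol would vanish everywhere, and the compact exceptional set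
    would be the whole plane.\<close>
  have "\<exists>j k. j + k \<le> m \<and> c j k \<noteq> 0"
  proof (rule ccontr)
    assume "\<not> ?thesis"
    then have "symbol_poly m c z = 0" for z by (auto simp: symbol_poly_def case_prod_beta intro!: sum.neutral)
    moreover obtain K where K: "compact K" "\<And>z. z \<notin> K \<Longrightarrow> symbol_poly m c z \<noteq> 0" using hyp unfolding hypo_elliptic_def by blast
    ultimately have "K = UNIV" by blast
    then show False using K(1) compact_imp_bounded not_bounded_UNIV by metis
  qed
  then have ne: "{jk. fst jk + snd jk \<le> m \<and> c (fst jk) (snd jk) \<noteq> 0} \<noteq> {}" (is "?I \<noteq> _") by force
  have fin: "finite ?I" by (rule finite_subset[OF _ finite_triangle[of m]]) auto
  obtain JK where JK: "JK \<in> ?I" "\<And>jk. jk \<in> ?I \<Longrightarrow> fst jk + snd jk \<le> fst JK + snd JK"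
  proof -
    have "Max ((\<lambda>jk. fst jk + snd jk) ` ?I) \<in> (\<lambda>jk. fst jk + snd jk) ` ?I" using ne fin by (intro Max_in) auto
    then obtain JK where "JK \<in> ?I" "Max ((\<lambda>jk. fst jk + snd jk) ` ?I) = fst JK + snd JK" by auto
    then show ?thesis using that[of JK] fin by (metis (no_types, lifting) Max_ge finite_imageI imageI)
  qed
  obtain J K where e: "JK = (J, K)" by force
  have JKm: "J + K \<le> m" "c J K \<noteq> 0" using JK(1) e by auto
  \<comment> \<open>Any other monomial has j < J or k < K, so that a binomial coefficient vanishes,
    or it exceeds the maximal degree and has coefficient 0.\<close>
  have tc: "taylor_coeff m c J K z = c J K" for z
  proof -
    have "taylor_coeff m c J K z = (\<Sum>jk\<in>{(j, k). j + k \<le> m}. if jk = (J, K) then c J K else 0)"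
      unfolding taylor_coeff_def case_prod_beta
    proof (intro sum.cong refl)
      fix jk assume jk: "jk \<in> {jk. fst jk + snd jk \<le> m}"
      show "c (fst jk) (snd jk) * (of_nat (fst jk choose J) * of_real (fst z) ^ (fst jk - J) * (of_nat (snd jk choose K) * of_real (snd z) ^ (snd jk - K))) = (if jk = (J, K) then c J K else 0)"
      proof (cases "jk = (J, K)")
        case False
        then have "fst jk < J \<or> snd jk < K \<or> fst jk + snd jk > J + K" by (cases jk) auto
        then have "c (fst jk) (snd jk) = 0 \<or> fst jk < J \<or> snd jk < K" using JK(2)[of jk] jk e by force
        then show ?thesis using False by (auto simp: binomial_eq_0)
      qed auto
    qed
    also have "\<dots> = c J K" using JKm by (simp add: sum.delta[OF finite_triangle])
    finally show ?thesis .
  qed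
  show ?thesis
  proof (cases "(J, K) = (0, 0)")
    case True
    then have "symbol_poly m c z = c 0 0" for z using tc taylor_coeff_0[of m c] by auto
    then show ?thesis using JKm True by (intro exI[of _ 0] exI[of _ "norm (c 0 0)"]) auto
  next
    case False
    obtain R where R: "\<And>z i l. norm z \<ge> R \<Longrightarrow> i \<le> m \<Longrightarrow> l \<le> m \<Longrightarrow> (i, l) \<noteq> (0, 0) \<Longrightarrow>
       norm (taylor_coeff m c i l z) \<le> 1 * norm (symbol_poly m c z)"
      using hypo_elliptic_taylor_coeff[OF hyp zero_less_one] by blast
    have "norm (c J K) \<le> norm (symbol_poly m c z)" if "norm z \<ge> R" for z
      using R[OF that, of J K] False JKm tc by auto
    then show ?thesis using JKm by (intro exI[of _ R] exI[of _ "norm (c J K)"]) auto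
  qed
qed

section \<open>Local and weighted global estimates in Fock space\<close>

lemma norm_weyl_shift:
  "norm (weyl_shift w f z) = norm (f (w + z)) * exp (- (norm (w + z))\<^sup>2 / 2) * exp ((norm z)\<^sup>2 / 2) * exp ((norm w)\<^sup>2 / 2)"
proof -
  \<comment> \<open>Polarisation: |w + z|^2 = |w|^2 + |z|^2 + 2 Re (cnj w z).\<close>
  have "- (norm (w + z))\<^sup>2 / 2 + (norm z)\<^sup>2 / 2 + (norm w)\<^sup>2 / 2 = Re (- cnj w * z)"
    by (simp add: cmod_power2) (simp add: power2_eq_square field_simps)
  then have "exp (- (norm (w + z))\<^sup>2 / 2) * exp ((norm z)\<^sup>2 / 2) * exp ((norm w)\<^sup>2 / 2) = exp (Re (- cnj w * z))"
    by (metis exp_add)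
  then show ?thesis by (simp add: weyl_shift_def norm_mult norm_exp_eq_Re mult.assoc)
qed

text \<open>At the phase-space point p of z the leading Taylor term is a(p) f(z). The other words
  are bounded by the supremum over a unit disc and carry coefficients that are small against |a(p)|;
  it remains to divide by |a(p)| >= c0. Since \<open>c0\<close> is fixed before \<epsilon>,
  shrinking \<epsilon> leaves the term D / c0 alone.\<close>

lemma local_estimate:
  assumes hyp: "hypo_elliptic (symbol_poly m c)"
  shows "\<exists>c0>0. \<forall>\<epsilon>>0. \<exists>R\<ge>0. \<forall>f M D z. f holomorphic_on UNIV \<longrightarrow> norm z \<ge> R \<longrightarrow>
     (\<forall>\<zeta>. norm \<zeta> \<le> 1 \<longrightarrow> norm (f (z + \<zeta>)) * exp (- (norm (z + \<zeta>))\<^sup>2 / 2) \<le> M) \<longrightarrow>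
     norm (fun_poly m c f z) * exp (- (norm z)\<^sup>2 / 2) \<le> D \<longrightarrow>
     norm (f z) * exp (- (norm z)\<^sup>2 / 2) \<le> D / c0 + \<epsilon> * M"
proof -
  let ?a = "symbol_poly m c"
  obtain R0 c0 where c0: "c0 > 0" "\<And>z. norm z \<ge> R0 \<Longrightarrow> c0 \<le> norm (?a z)"
    using hypo_elliptic_lower_bound[OF hyp] by blast
  obtain B where B: "B \<ge> 0" "\<And>g M i l. g holomorphic_on UNIV \<Longrightarrow> (\<forall>z. norm z \<le> 1 \<longrightarrow> norm (g z) \<le> M) \<Longrightarrow>
     i \<le> m \<Longrightarrow> l \<le> m \<Longrightarrow> norm ((fun_X ^^ i) ((fun_Y ^^ l) g) 0) \<le> B * M"
    using words_bounded[of m] by blast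
  \<comment> \<open>The number of words times their common bound; exp (1 / 2) is the most that the
    Gaussian weight can cost on the unit disc.\<close>
  define L where "L = real ((m + 1) * (m + 1)) * (B * exp (1 / 2))"
  have L: "L \<ge> 0" using B(1) by (simp add: L_def)
  show ?thesis
  proof (rule exI[of _ c0], intro conjI c0(1) allI impI)
    fix \<epsilon> :: real assume \<epsilon>: "\<epsilon> > 0"
    have "\<epsilon> / (L + 1) > 0" using \<epsilon> L by auto
    then obtain R1 where R1: "\<And>z i l. norm z \<ge> R1 \<Longrightarrow> i \<le> m \<Longrightarrow> l \<le> m \<Longrightarrow> (i, l) \<noteq> (0, 0) \<Longrightarrow>
       norm (taylor_coeff m c i l z) \<le> \<epsilon> / (L + 1) * norm (?a z)"
      using hypo_elliptic_taylor_coeff[OF hyp, of "\<epsilon> / (L + 1)"] by blast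
    have "norm (f z) * exp (- (norm z)\<^sup>2 / 2) \<le> D / c0 + \<epsilon> * M"
      if f: "f holomorphic_on UNIV" and z: "norm z \<ge> max 0 (max R0 R1)"
        and M: "\<And>\<zeta>. norm \<zeta> \<le> 1 \<Longrightarrow> norm (f (z + \<zeta>)) * exp (- (norm (z + \<zeta>))\<^sup>2 / 2) \<le> M"
        and D: "norm (fun_poly m c f z) * exp (- (norm z)\<^sup>2 / 2) \<le> D"
      for f M D z
    proof -
      define p where "p = (sqrt 2 * Re z, - sqrt 2 * Im z)"
      define F where "F = fun_poly m c f z"
      define t where "t i l = (fun_X ^^ i) ((fun_Y ^^ l) (weyl_shift z f)) 0" for i l
      define e where "e = exp ((norm z)\<^sup>2 / 2)"
      have e: "e > 0" "exp (- (norm z)\<^sup>2 / 2) = 1 / e" by (simp_all add: e_def exp_minus field_simps)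
      have "norm p = sqrt 2 * norm z"
      proof -
        have "norm p = sqrt (2 * (norm z)\<^sup>2)"
          by (simp add: p_def norm_Pair cmod_power2 power_mult_distrib)
        then show ?thesis by (simp add: real_sqrt_mult)
      qed
      \<comment> \<open>Thresholds stated for phase-space points can thus be imposed on z
        itself.\<close>
      then have np: "norm p \<ge> norm z" by (simp add: mult_le_cancel_right1)
      have M0: "M \<ge> 0" using order_trans[OF _ M[of 0], of 0] by simp
      have t: "norm (t i l) \<le> B * (exp (1 / 2) * M * e)" if "i \<le> m" "l \<le> m" for i l
        unfolding t_def
      proof (rule B(2)[OF weyl_shift_holomorphic[OF f] _ that], intro allI impI)
        fix \<zeta> :: complex assume \<zeta>: "norm \<zeta> \<le> 1"
        have "norm (weyl_shift z f \<zeta>) \<le> M * exp (1 / 2) * e"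
          unfolding norm_weyl_shift e_def using M[OF \<zeta>] M0 power_mono[OF \<zeta>, of 2]
          by (intro mult_mono) auto
        then show "norm (weyl_shift z f \<zeta>) \<le> exp (1 / 2) * M * e" by (simp add: mult_ac)
      qed
      have "F = (\<Sum>i\<le>m. \<Sum>l\<le>m. taylor_coeff m c i l p * t i l)"
        unfolding F_def t_def p_def by (rule fun_poly_at[OF f])
      also have "\<dots> = (\<Sum>il\<in>{..m} \<times> {..m}. taylor_coeff m c (fst il) (snd il) p * t (fst il) (snd il))"
        by (simp add: sum.cartesian_product case_prod_beta)
      also have "\<dots> = ?a p * f z + (\<Sum>il\<in>{..m} \<times> {..m} - {(0, 0)}. taylor_coeff m c (fst il) (snd il) p * t (fst il) (snd il))"
        by (subst sum.remove[of _ "(0, 0)"]) (auto simp: taylor_coeff_0 t_def weyl_shift_def)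
      finally have "?a p * f z = F - (\<Sum>il\<in>{..m} \<times> {..m} - {(0, 0)}. taylor_coeff m c (fst il) (snd il) p * t (fst il) (snd il))" (is "_ = _ - ?s") by simp
      then have "norm (?a p * f z) \<le> norm F + norm ?s" by (simp only: norm_triangle_ineq4)
      then have 1: "norm (?a p) * norm (f z) \<le> norm F + norm ?s" by (simp only: norm_mult)
      have "norm ?s \<le> (\<Sum>il\<in>{..m} \<times> {..m} - {(0, 0)}. (\<epsilon> / (L + 1) * norm (?a p)) * (B * (exp (1 / 2) * M * e)))"
      proof (rule sum_norm_le, unfold norm_mult, rule mult_mono)
        fix il assume il: "il \<in> {..m} \<times> {..m} - {(0, 0)}"
        then show "norm (taylor_coeff m c (fst il) (snd il) p) \<le> \<epsilon> / (L + 1) * norm (?a p)"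
          using z np by (intro R1) auto
        show "norm (t (fst il) (snd il)) \<le> B * (exp (1 / 2) * M * e)" using il by (intro t) auto
      qed (use \<epsilon> L in auto)
      also have "\<dots> \<le> (\<Sum>il\<in>{..m} \<times> {..m}. (\<epsilon> / (L + 1) * norm (?a p)) * (B * (exp (1 / 2) * M * e)))"
        using \<epsilon> L B(1) M0 e by (intro sum_mono2) auto
      also have "\<dots> = L / (L + 1) * (\<epsilon> * norm (?a p) * M * e)" by (simp add: L_def)
      also have "\<dots> \<le> 1 * (\<epsilon> * norm (?a p) * M * e)"
        using \<epsilon> L M0 e by (intro mult_right_mono) auto
      finally have 2: "norm (?a p) * norm (f z) \<le> norm F + \<epsilon> * norm (?a p) * M * e" using 1 by simp
      have ap: "c0 \<le> norm (?a p)" using z np by (intro c0(2)) auto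
      have 3: "norm (?a p) * (norm (f z) / e) \<le> norm F / e + norm (?a p) * (\<epsilon> * M)"
        using divide_right_mono[OF 2, of e] e by (simp add: add_divide_distrib mult_ac)
      have aux: "x \<le> y / a + b" if "a * x \<le> y + a * b" "a > 0" for a b x y :: real
        using that by (simp add: field_simps)
      have "norm (f z) / e \<le> (norm F / e) / norm (?a p) + \<epsilon> * M"
        by (rule aux[OF 3]) (use ap c0(1) in auto)
      also have "(norm F / e) / norm (?a p) \<le> (norm F / e) / c0"
        using ap c0(1) e by (intro divide_left_mono mult_pos_pos) auto
      also have "\<dots> \<le> D / c0" using D c0(1) e unfolding F_def[symmetric] by (intro divide_right_mono) auto
      finally show ?thesis by (simp only: e(2) times_divide_eq_right mult_1_right)
    qed
    then show "\<exists>R\<ge>0. \<forall>f M D z. f holomorphic_on UNIV \<longrightarrow> norm z \<ge> R \<longrightarrow>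
     (\<forall>\<zeta>. norm \<zeta> \<le> 1 \<longrightarrow> norm (f (z + \<zeta>)) * exp (- (norm (z + \<zeta>))\<^sup>2 / 2) \<le> M) \<longrightarrow>
     norm (fun_poly m c f z) * exp (- (norm z)\<^sup>2 / 2) \<le> D \<longrightarrow>
     norm (f z) * exp (- (norm z)\<^sup>2 / 2) \<le> D / c0 + \<epsilon> * M"
      by (intro exI[of _ "max 0 (max R0 R1)"]) auto
  qed
qed

text \<open>The weight \<open>(1 + |z|)\<^sup>N / (1 + \<delta>|z|)\<^bsup>N + P\<^esup>\<close> makes the supremum finite, so that the small multiple of it in the
  local estimate can be absorbed; the bound is uniform in \<open>\<delta>\<close>, which then tends to 0.\<close>

lemma global_estimate:
  assumes hyp: "hypo_elliptic (symbol_poly m c)"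
  shows "\<exists>R\<ge>0. \<exists>C\<ge>0. \<forall>f K D E. f holomorphic_on UNIV \<longrightarrow>
     (\<forall>z. norm (f z) * exp (- (norm z)\<^sup>2 / 2) \<le> K * (1 + norm z) ^ P) \<longrightarrow>
     (\<forall>z. norm (fun_poly m c f z) * exp (- (norm z)\<^sup>2 / 2) \<le> D / (1 + norm z) ^ N) \<longrightarrow>
     (\<forall>z. norm z \<le> R \<longrightarrow> norm (f z) * exp (- (norm z)\<^sup>2 / 2) \<le> E) \<longrightarrow>
     (\<forall>z. norm (f z) * exp (- (norm z)\<^sup>2 / 2) \<le> C * (D + E) / (1 + norm z) ^ N)"
proof -
  \<comment> \<open>The factor by which the weight can drop under a translation of length at most 1:
    2^N from its numerator, 2^(N + P) from its denominator.\<close>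
  define L :: real where "L = 2 ^ N * 2 ^ (N + P)"
  have L: "L > 0" by (simp add: L_def)
  obtain c0 where c0: "c0 > 0" and loc: "\<And>\<epsilon>. \<epsilon> > 0 \<Longrightarrow> \<exists>R\<ge>0. \<forall>f M D z. f holomorphic_on UNIV \<longrightarrow> norm z \<ge> R \<longrightarrow>
     (\<forall>\<zeta>. norm \<zeta> \<le> 1 \<longrightarrow> norm (f (z + \<zeta>)) * exp (- (norm (z + \<zeta>))\<^sup>2 / 2) \<le> M) \<longrightarrow>
     norm (fun_poly m c f z) * exp (- (norm z)\<^sup>2 / 2) \<le> D \<longrightarrow>
     norm (f z) * exp (- (norm z)\<^sup>2 / 2) \<le> D / c0 + \<epsilon> * M"
    using local_estimate[OF hyp] by blast
  \<comment> \<open>With this multiple the supremum \<open>S\<close> returns as S / 2.\<close>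
  have "1 / (2 * L) > 0" using L by simp
  then obtain R where R: "R \<ge> 0" and est0: "\<forall>f M D z. f holomorphic_on UNIV \<longrightarrow> norm z \<ge> R \<longrightarrow>
     (\<forall>\<zeta>. norm \<zeta> \<le> 1 \<longrightarrow> norm (f (z + \<zeta>)) * exp (- (norm (z + \<zeta>))\<^sup>2 / 2) \<le> M) \<longrightarrow>
     norm (fun_poly m c f z) * exp (- (norm z)\<^sup>2 / 2) \<le> D \<longrightarrow>
     norm (f z) * exp (- (norm z)\<^sup>2 / 2) \<le> D / c0 + 1 / (2 * L) * M"
    using loc[of "1 / (2 * L)"] by blast
  note est = est0[rule_format]
  \<comment> \<open>The factor 2 stems from the absorption, 1 / c0 from the points with norm z >= R,
    and (1 + R)^N from the disc.\<close>
  define C where "C = 2 * (1 / c0 + (1 + R) ^ N)"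
  have C: "C \<ge> 0" using c0 R by (simp add: C_def)
  have "norm (f z) * exp (- (norm z)\<^sup>2 / 2) \<le> C * (D + E) / (1 + norm z) ^ N"
    if f: "f holomorphic_on UNIV"
      and K: "\<And>z. norm (f z) * exp (- (norm z)\<^sup>2 / 2) \<le> K * (1 + norm z) ^ P"
      and D: "\<And>z. norm (fun_poly m c f z) * exp (- (norm z)\<^sup>2 / 2) \<le> D / (1 + norm z) ^ N"
      and E: "\<And>z. norm z \<le> R \<Longrightarrow> norm (f z) * exp (- (norm z)\<^sup>2 / 2) \<le> E"
    for f K D E z
  proof -
    define G where "G z = norm (f z) * exp (- (norm z)\<^sup>2 / 2)" for z
    have G0: "G z \<ge> 0" for z by (simp add: G_def)
    have E0: "E \<ge> 0" using order_trans[OF _ E[of 0], of 0] R by simp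
    have D0: "D \<ge> 0" using order_trans[OF _ D[of 0], of 0] by simp
    have K0: "K \<ge> 0" using order_trans[OF _ K[of 0], of 0] by simp
    define w where "w \<delta> z = (1 + norm z) ^ N / (1 + \<delta> * norm z) ^ (N + P)" for \<delta> and z :: complex
    have main: "w \<delta> z * G z \<le> C * (D + E)" if \<delta>: "0 < \<delta>" "\<delta> \<le> 1" for \<delta> z
    proof -
      have w0: "w \<delta> z > 0" for z using \<delta> by (auto simp: w_def intro!: divide_pos_pos zero_less_power add_pos_nonneg)
      have wle: "w \<delta> z \<le> (1 + norm z) ^ N" for z
      proof -
        have "1 \<le> (1 + \<delta> * norm z) ^ (N + P)" using \<delta> by (intro one_le_power) auto
        moreover from this have "0 < (1 + \<delta> * norm z) ^ (N + P)" by linarith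
        ultimately show ?thesis unfolding w_def using divide_left_mono[of 1 "(1 + \<delta> * norm z) ^ (N + P)" "(1 + norm z) ^ N"] by simp
      qed
      have mod: "w \<delta> z \<le> L * w \<delta> (z + \<zeta>)" if "norm \<zeta> \<le> 1" for z \<zeta>
      proof -
        have 1: "1 + norm z \<le> 2 * (1 + norm (z + \<zeta>))"
          using norm_triangle_ineq4[of "z + \<zeta>" \<zeta>] that norm_ge_zero[of "z + \<zeta>"] by (simp del: norm_ge_zero)
        have "\<delta> * norm (z + \<zeta>) \<le> \<delta> * (norm z + 1)"
          using norm_triangle_ineq[of z \<zeta>] that \<delta> by (intro mult_left_mono) auto
        then have 2: "1 + \<delta> * norm (z + \<zeta>) \<le> 2 * (1 + \<delta> * norm z)"
          using \<delta> mult_nonneg_nonneg[of \<delta> "norm z"] by (simp add: distrib_left del: mult_nonneg_nonneg zero_le_mult_iff)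
        have p: "(1 + \<delta> * norm v) ^ k > 0" for v :: complex and k using \<delta> by (intro zero_less_power add_pos_nonneg) auto
        have "(1 + norm z) ^ N * (1 + \<delta> * norm (z + \<zeta>)) ^ (N + P) \<le> (2 * (1 + norm (z + \<zeta>))) ^ N * (2 * (1 + \<delta> * norm z)) ^ (N + P)"
          using 1 2 \<delta> by (intro mult_mono power_mono) auto
        also have "\<dots> = L * (1 + norm (z + \<zeta>)) ^ N * (1 + \<delta> * norm z) ^ (N + P)"
          unfolding L_def power_mult_distrib by (simp only: mult_ac)
        finally show ?thesis
          unfolding w_def using p[of z "N + P"] p[of "z + \<zeta>" "N + P"] by (simp add: field_simps)
      qed
      define S where "S = (SUP z. w \<delta> z * G z)"
      have bdd: "bdd_above (range (\<lambda>z. w \<delta> z * G z))"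
      proof (rule bdd_aboveI2)
        fix z :: complex
        have a: "\<delta> * (1 + norm z) \<le> 1 + \<delta> * norm z" using \<delta> by (simp add: distrib_left)
        have b: "(\<delta> * (1 + norm z)) ^ (N + P) > 0" using \<delta> by (intro zero_less_power mult_pos_pos add_pos_nonneg) auto
        have "w \<delta> z * G z \<le> w \<delta> z * (K * (1 + norm z) ^ P)"
          using K[of z] w0[of z] unfolding G_def by (intro mult_left_mono) auto
        also have "\<dots> = K * (1 + norm z) ^ (N + P) / (1 + \<delta> * norm z) ^ (N + P)"
          by (simp add: w_def power_add)
        also have "\<dots> \<le> K * (1 + norm z) ^ (N + P) / (\<delta> * (1 + norm z)) ^ (N + P)"
          using a b \<delta> K0 by (intro divide_left_mono power_mono mult_nonneg_nonneg mult_pos_pos zero_less_power) (auto intro: add_pos_nonneg)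
        also have "\<dots> = K / \<delta> ^ (N + P)"
          using \<delta> by (simp add: power_mult_distrib add_nonneg_eq_0_iff)
        finally show "w \<delta> z * G z \<le> K / \<delta> ^ (N + P)" .
      qed
      have Sup: "w \<delta> z * G z \<le> S" for z unfolding S_def by (rule cSUP_upper[OF UNIV_I bdd])
      have S0: "S \<ge> 0" using Sup[of 0] w0[of 0] G0[of 0] by (meson less_imp_le mult_nonneg_nonneg order_trans)
      have "w \<delta> z * G z \<le> D / c0 + (1 + R) ^ N * E + S / 2" for z
      proof (cases "norm z \<ge> R")
        case True
        have "G (z + \<zeta>) \<le> S * L / w \<delta> z" if "norm \<zeta> \<le> 1" for \<zeta>
        proof -
          have "w \<delta> z * G (z + \<zeta>) \<le> L * w \<delta> (z + \<zeta>) * G (z + \<zeta>)"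
            using mod[OF that, of z] G0 by (intro mult_right_mono) auto
          also have "\<dots> \<le> L * S" using Sup[of "z + \<zeta>"] L by (simp add: mult.assoc)
          finally show ?thesis using w0[of z] by (simp add: field_simps)
        qed
        then have "G z \<le> D / (1 + norm z) ^ N / c0 + 1 / (2 * L) * (S * L / w \<delta> z)"
          unfolding G_def by (intro est[OF f True _ D]) auto
        then have "w \<delta> z * G z \<le> w \<delta> z * (D / (1 + norm z) ^ N / c0 + 1 / (2 * L) * (S * L / w \<delta> z))"
          using w0[of z] by (intro mult_left_mono) auto
        also have "\<dots> = (w \<delta> z / (1 + norm z) ^ N) * (D / c0) + S / 2"
          using w0[of z] L by (simp add: distrib_left)
        also have "w \<delta> z / (1 + norm z) ^ N * (D / c0) \<le> 1 * (D / c0)"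
          using wle[of z] D0 c0 by (intro mult_right_mono) (auto simp: divide_le_eq_1 zero_less_power add_pos_nonneg)
        finally have "w \<delta> z * G z \<le> D / c0 + S / 2" by simp
        moreover have "0 \<le> (1 + R) ^ N * E" using E0 R by simp
        ultimately show ?thesis by linarith
      next
        case False
        then have "w \<delta> z * G z \<le> (1 + R) ^ N * E"
          using order_trans[OF wle[of z] power_mono[of "1 + norm z" "1 + R" N]] E[of z] E0 G0[of z] w0[of z] R
          unfolding G_def by (intro mult_mono) auto
        moreover have "D / c0 \<ge> 0" using D0 c0 by simp
        ultimately show ?thesis using S0 by simp
      qed
      then have "S \<le> D / c0 + (1 + R) ^ N * E + S / 2" unfolding S_def by (intro cSUP_least) auto
      then have "S \<le> 2 * (D / c0 + (1 + R) ^ N * E)" by simp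
      also have "\<dots> \<le> C * (D + E)"
      proof -
        have "0 \<le> E / c0 + (1 + R) ^ N * D" using E0 D0 c0 R by simp
        then have "0 \<le> 2 * (E / c0 + (1 + R) ^ N * D)" by simp
        also have "\<dots> = C * (D + E) - 2 * (D / c0 + (1 + R) ^ N * E)"
          by (simp add: C_def distrib_left distrib_right add_divide_distrib)
        finally show ?thesis by simp
      qed
      finally show ?thesis using Sup[of z] by linarith
    qed
    have "((\<lambda>\<delta>. w \<delta> z * G z) \<longlongrightarrow> (1 + norm z) ^ N / (1 + 0 * norm z) ^ (N + P) * G z) (at_right 0)"
      unfolding w_def by (intro tendsto_intros) auto
    then have "((\<lambda>\<delta>. w \<delta> z * G z) \<longlongrightarrow> (1 + norm z) ^ N * G z) (at_right 0)" by simp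
    moreover have "eventually (\<lambda>\<delta>. w \<delta> z * G z \<le> C * (D + E)) (at_right 0)"
      unfolding eventually_at_right_field using main by (intro exI[of _ 1]) auto
    ultimately have "(1 + norm z) ^ N * G z \<le> C * (D + E)"
      by (rule tendsto_upperbound) simp
    moreover have "(1 + norm z) ^ N > 0" by (intro zero_less_power add_pos_nonneg) auto
    ultimately show ?thesis unfolding G_def[symmetric] by (simp add: field_simps)
  qed
  note estimate = this
  show ?thesis
  proof (rule exI[of _ R], rule conjI[OF R], rule exI[of _ C], rule conjI[OF C], intro allI impI, goal_cases)
    case (1 f K D E z)
    show ?case by (rule estimate[OF 1(1) 1(2)[rule_format] 1(3)[rule_format] 1(4)[rule_format]])
  qed
qed

section \<open>Passing between decay of coefficients and decay of entire functions\<close>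

lemma power_mult_power_div_sqrt_fact_le:
  "\<exists>C\<ge>0. \<forall>r\<ge>0. \<forall>m. r ^ N * (r ^ m / sqrt (fact m)) \<le> C * (1 + real m) ^ N * exp (r\<^sup>2 / 2)"
proof (induction N)
  case 0
  then show ?case using power_div_sqrt_fact_le by (intro exI[of _ 1]) auto
next
  case (Suc N)
  then obtain C where C: "C \<ge> 0" "\<And>r m. r \<ge> 0 \<Longrightarrow> r ^ N * (r ^ m / sqrt (fact m)) \<le> C * (1 + real m) ^ N * exp (r\<^sup>2 / 2)"
    by blast
  have "r ^ Suc N * (r ^ m / sqrt (fact m)) \<le> (2 ^ N * C) * (1 + real m) ^ Suc N * exp (r\<^sup>2 / 2)" if r: "r \<ge> 0" for r m
  proof -
    have s: "sqrt (fact (Suc m)) = sqrt (real (Suc m)) * sqrt (fact m)"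
      by (simp only: fact_Suc real_sqrt_mult)
    have sp: "sqrt (real (Suc m)) > 0" by simp
    have le: "sqrt (real (Suc m)) \<le> 1 + real m" by (rule real_le_lsqrt) (auto simp: power2_eq_square algebra_simps)
    \<comment> \<open>One factor r is moved into the monomial, which raises m by one; the price is
      sqrt (m + 1) <= 1 + m.\<close>
    have "r ^ Suc N * (r ^ m / sqrt (fact m)) = sqrt (real (Suc m)) * (r ^ N * (r ^ Suc m / sqrt (fact (Suc m))))"
      unfolding s using sp by (simp del: of_nat_Suc)
    also have "\<dots> \<le> (1 + real m) * (C * (1 + real (Suc m)) ^ N * exp (r\<^sup>2 / 2))"
      by (rule mult_mono[OF le C(2)[OF r]]) (use r in auto)
    also have "\<dots> \<le> (1 + real m) * (C * (2 * (1 + real m)) ^ N * exp (r\<^sup>2 / 2))"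
      using C(1) by (intro mult_left_mono mult_right_mono power_mono) auto
    also have "\<dots> = (2 ^ N * C) * (1 + real m) ^ Suc N * exp (r\<^sup>2 / 2)"
      by (simp only: power_mult_distrib power_Suc mult_ac)
    finally show ?thesis .
  qed
  then show ?case using C(1) by (intro exI[of _ "2 ^ N * C"]) auto
qed

text \<open>Inside the series, (1 + |z|)^N is traded for (1 + m)^N; the two further powers of 1 + m
  make the series converge.\<close>

lemma bargmann_decay:
  "\<exists>C\<ge>0. \<forall>V D z. (\<forall>m. norm (V m) \<le> D / (1 + real m) ^ (N + 2)) \<longrightarrow>
     norm (bargmann V z) * exp (- (norm z)\<^sup>2 / 2) \<le> C * D / (1 + norm z) ^ N"
proof -
  obtain C where C: "C \<ge> 0" "\<And>r m. r \<ge> 0 \<Longrightarrow> r ^ N * (r ^ m / sqrt (fact m)) \<le> C * (1 + real m) ^ N * exp (r\<^sup>2 / 2)"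
    using power_mult_power_div_sqrt_fact_le[of N] by blast
  define S where "S = (\<Sum>m. 1 / (1 + real m)\<^sup>2)"
  have S: "S \<ge> 0" unfolding S_def by (intro suminf_nonneg summable_inverse_Suc_square) auto
  have "norm (bargmann V z) * exp (- (norm z)\<^sup>2 / 2) \<le> (2 ^ N * (1 + C) * S) * D / (1 + norm z) ^ N"
    if V: "\<forall>m. norm (V m) \<le> D / (1 + real m) ^ (N + 2)" for V D z
  proof -
    define r where "r = norm z"
    define e where "e = exp (r\<^sup>2 / 2)"
    have r: "r \<ge> 0" by (simp add: r_def)
    have e: "e > 0" "exp (- r\<^sup>2 / 2) = 1 / e" by (simp_all add: e_def exp_minus field_simps)
    have D: "D \<ge> 0" using order_trans[OF norm_ge_zero V[rule_format, of 0]] by simp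
    have rp: "(1 + r) ^ N > 0" using r by (intro zero_less_power) auto
    have pow: "(1 + r) ^ N \<le> 2 ^ N * (1 + r ^ N)"
    proof -
      have "(1 + r) ^ N \<le> (2 * max 1 r) ^ N" using r by (intro power_mono) auto
      also have "\<dots> = 2 ^ N * (max 1 r) ^ N" by (rule power_mult_distrib)
      also have "(max 1 r) ^ N \<le> 1 + r ^ N" using r by (auto simp: max_def)
      finally show ?thesis by simp
    qed
    have le: "norm (V m / of_real (sqrt (fact m)) * z ^ m) \<le> (2 ^ N * (1 + C) * e * D / (1 + r) ^ N) * (1 / (1 + real m)\<^sup>2)" for m
    proof -
      define t where "t = r ^ m / sqrt (fact m)"
      have t: "0 \<le> t" "t \<le> e" using r power_div_sqrt_fact_le[OF r, of m] by (auto simp: t_def e_def)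
      have n1: "1 \<le> (1 + real m) ^ N" by (rule one_le_power) auto
      have "(1 + r) ^ N * t \<le> 2 ^ N * (t + r ^ N * t)"
        using mult_right_mono[OF pow t(1)] by (simp add: algebra_simps)
      also have "\<dots> \<le> 2 ^ N * (e * (1 + real m) ^ N + C * (1 + real m) ^ N * e)"
        using t C(2)[OF r, of m] mult_mono[OF t(2) n1] e unfolding t_def[symmetric] e_def[symmetric]
        by (intro mult_left_mono add_mono) auto
      finally have a: "(1 + r) ^ N * t \<le> (2 ^ N * (1 + C) * e) * (1 + real m) ^ N" by (simp add: algebra_simps)
      have "norm (V m / of_real (sqrt (fact m)) * z ^ m) = norm (V m) * t"
        by (simp add: norm_mult norm_divide norm_power t_def r_def)
      also have "\<dots> \<le> D / (1 + real m) ^ (N + 2) * t" using V t by (intro mult_right_mono) auto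
      also have "\<dots> \<le> D / (1 + real m) ^ (N + 2) * ((2 ^ N * (1 + C) * e) * (1 + real m) ^ N / (1 + r) ^ N)"
      proof (rule mult_left_mono)
        show "t \<le> (2 ^ N * (1 + C) * e) * (1 + real m) ^ N / (1 + r) ^ N"
          using a rp by (simp add: field_simps)
      qed (use D in auto)
      also have "D / (1 + real m) ^ (N + 2) * ((2 ^ N * (1 + C) * e) * (1 + real m) ^ N / (1 + r) ^ N) =
          (2 ^ N * (1 + C) * e * D / (1 + r) ^ N) * (1 / (1 + real m)\<^sup>2)"
        unfolding power_add by (simp add: add_nonneg_eq_0_iff mult_ac)
      finally show ?thesis .
    qed
    have s: "summable (\<lambda>m. norm (V m / of_real (sqrt (fact m)) * z ^ m))"
      by (rule summable_comparison_test'[OF summable_mult[OF summable_inverse_Suc_square, of "2 ^ N * (1 + C) * e * D / (1 + r) ^ N"]]) (use le in auto)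
    have "norm (bargmann V z) \<le> (\<Sum>m. norm (V m / of_real (sqrt (fact m)) * z ^ m))"
      unfolding bargmann_def by (rule summable_norm[OF s])
    also have "\<dots> \<le> (\<Sum>m. (2 ^ N * (1 + C) * e * D / (1 + r) ^ N) * (1 / (1 + real m)\<^sup>2))"
      by (intro suminf_le le s summable_mult summable_inverse_Suc_square)
    also have "\<dots> = (2 ^ N * (1 + C) * e * D / (1 + r) ^ N) * S" unfolding S_def by (rule suminf_mult[OF summable_inverse_Suc_square])
    finally have "norm (bargmann V z) * (1 / e) \<le> (2 ^ N * (1 + C) * e * D / (1 + r) ^ N) * S * (1 / e)"
      using e by (intro mult_right_mono) auto
    also have "\<dots> = (2 ^ N * (1 + C) * S) * D / (1 + r) ^ N" using e by simp
    finally show ?thesis unfolding r_def[symmetric] e(2) .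
  qed
  then show ?thesis using C(1) S by (intro exI[of _ "2 ^ N * (1 + C) * S"]) auto
qed

text \<open>Differentiation is the weighted left shift of the coefficients, and the weights sqrt 1,
  ..., sqrt m multiply to sqrt (m!).\<close>

lemma higher_deriv_bargmann_0:
  "poly_growth U \<Longrightarrow> (deriv ^^ m) (bargmann U) 0 = of_real (sqrt (fact m)) * U m"
proof (induction m arbitrary: U)
  case 0
  have "bargmann U 0 = (\<Sum>m. if m = 0 then U 0 else 0)"
    unfolding bargmann_def by (rule suminf_cong) auto
  also have "\<dots> = U 0" by (subst suminf_finite[of "{0}"]) auto
  finally show ?case by simp
next
  case (Suc m)
  have "deriv (bargmann U) = bargmann (\<lambda>n. of_real (sqrt (real (Suc n))) * U (Suc n))"
    using bargmann_shift_up[OF Suc.prems] by auto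
  then have "(deriv ^^ Suc m) (bargmann U) 0 = of_real (sqrt (fact m)) * (of_real (sqrt (real (Suc m))) * U (Suc m))"
    using Suc.IH[OF poly_growth_shift_up[OF Suc.prems]] by (simp add: funpow_Suc_right del: funpow.simps)
  also have "\<dots> = of_real (sqrt (fact (Suc m))) * U (Suc m)"
    by (simp only: fact_Suc real_sqrt_mult of_real_mult mult_ac of_nat_mult)
  finally show ?case .
qed

text \<open>A crude Stirling bound; its inductive step is (1 - 1 / (n + 1))^(n + 1) <= 1 /
  e.\<close>

lemma fact_exp_le: "n \<ge> 1 \<Longrightarrow> fact n * exp (real n) \<le> exp 1 * real n ^ (n + 1)"
proof (induction n rule: nat_induct_at_least)
  case base
  then show ?case by simp
next
  case (Suc n)
  have "1 + - 1 / real (n + 1) \<le> exp (- 1 / real (n + 1))" by (rule exp_ge_add_one_self)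
  then have "real n / real (n + 1) \<le> exp (- 1 / real (n + 1))" by (simp add: field_simps)
  then have "(real n / real (n + 1)) ^ (n + 1) \<le> exp (- 1 / real (n + 1)) ^ (n + 1)"
    by (intro power_mono) auto
  also have "\<dots> = exp (real (n + 1) * (- 1 / real (n + 1)))" by (rule exp_of_nat_mult[symmetric])
  also have "\<dots> = exp (- 1)" by simp
  finally have b: "(real n / real (n + 1)) ^ (n + 1) \<le> exp (- 1)" .
  have a: "exp 1 * real n ^ (n + 1) \<le> real (n + 1) ^ (n + 1)"
  proof -
    have aux: "w * x \<le> y" if "x / y \<le> inverse w" "y > 0" "w > 0" for w x y :: real
      using that by (simp add: field_simps)
    have "(real n / real (n + 1)) ^ (n + 1) \<le> inverse (exp 1)" using b by (simp only: exp_minus)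
    then have "real n ^ (n + 1) / real (n + 1) ^ (n + 1) \<le> inverse (exp 1)" by (simp only: power_divide)
    then show ?thesis by (rule aux) auto
  qed
  have "fact (Suc n) * exp (real (Suc n)) = (real (n + 1) * exp 1) * (fact n * exp (real n))"
    by (simp add: exp_add algebra_simps)
  also have "\<dots> \<le> (real (n + 1) * exp 1) * (exp 1 * real n ^ (n + 1))"
    using Suc by (intro mult_left_mono) auto
  also have "\<dots> \<le> (real (n + 1) * exp 1) * (real (n + 1) ^ (n + 1))"
    by (intro mult_left_mono a) auto
  also have "\<dots> = exp 1 * real (Suc n) ^ (Suc n + 1)" by simp
  finally show ?case .
qed

text \<open>Cauchy's inequality on the circle of radius sqrt (m + 1), close to the maximum of r^m
  exp (- r^2 / 2). There decay of order 2 N + 2 in |z| becomes decay of order N + 1 in m + 1, and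
  Stirling's bound costs one of these powers.\<close>

lemma coefficients_decay:
  assumes U: "poly_growth U" and D: "\<And>z. norm (bargmann U z) * exp (- (norm z)\<^sup>2 / 2) \<le> D / (1 + norm z) ^ (2 * N + 2)"
  shows "norm (U m) \<le> 2 * D / (1 + real m) ^ N"
proof -
  \<comment> \<open>The shift by one keeps the radius positive for m = 0.\<close>
  define n where "n = real (m + 1)"
  have n: "n \<ge> 1" "n > 0" by (simp_all add: n_def)
  have D0: "D \<ge> 0" using order_trans[OF _ D[of 0], of 0] by simp
  have cauchy: "norm ((deriv ^^ m) (bargmann U) 0) \<le> fact m * (D / n ^ (N + 1) * exp (n / 2)) / sqrt n ^ m"
  proof (rule Cauchy_inequality)
    show "bargmann U holomorphic_on ball 0 (sqrt n)"
      using bargmann_entire[OF U] by (rule holomorphic_on_subset) auto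
    show "continuous_on (cball 0 (sqrt n)) (bargmann U)"
      using holomorphic_on_imp_continuous_on[OF bargmann_entire[OF U]] by (rule continuous_on_subset) auto
    fix x :: complex assume "norm (0 - x) = sqrt n"
    then have x: "norm x = sqrt n" by simp
    have e: "exp (- (norm x)\<^sup>2 / 2) = 1 / exp (n / 2)" using n by (simp add: x exp_minus field_simps)
    have "norm (bargmann U x) \<le> D / (1 + norm x) ^ (2 * N + 2) * exp (n / 2)"
      using D[of x] unfolding e by (simp add: field_simps)
    also have "\<dots> \<le> D / (sqrt n) ^ (2 * (N + 1)) * exp (n / 2)"
    proof -
      have "sqrt n ^ (2 * (N + 1)) \<le> (1 + sqrt n) ^ (2 * (N + 1))" using n by (intro power_mono) auto
      also have "2 * (N + 1) = 2 * N + 2" by simp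
      finally have "sqrt n ^ (2 * (N + 1)) \<le> (1 + sqrt n) ^ (2 * N + 2)" by simp
      then show ?thesis
        unfolding x using D0 n by (intro mult_right_mono divide_left_mono) (auto intro!: mult_pos_pos add_pos_nonneg zero_less_power)
    qed
    also have "(sqrt n) ^ (2 * (N + 1)) = n ^ (N + 1)" unfolding power_mult using n by simp
    finally show "norm (bargmann U x) \<le> D / n ^ (N + 1) * exp (n / 2)" .
  qed (use n in auto)
  have "fact (m + 1) * exp n \<le> exp 1 * n ^ (m + 2)" using fact_exp_le[of "m + 1"] by (simp add: n_def)
  then have "n * (fact m * exp n) \<le> n * (exp 1 * n ^ (m + 1))" by (simp add: n_def algebra_simps)
  then have fe: "fact m * exp n \<le> exp 1 * n ^ (m + 1)" using n by (simp only: mult_le_cancel_left_pos)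
  have "(sqrt (fact m) * exp (n / 2))\<^sup>2 = fact m * exp n" by (simp add: power_mult_distrib exp_double [symmetric])
  also have "\<dots> \<le> exp 1 * n ^ (m + 1)" by (rule fe)
  \<comment> \<open>Rounding e up to 4 and n^(m + 1) up to n^m n^2 produces a perfect
    square.\<close>
  also have "\<dots> \<le> 4 * (n ^ m * n\<^sup>2)"
  proof -
    have "exp 1 \<le> (4 :: real)" using exp_le by simp
    moreover have "n ^ (m + 1) \<le> n ^ m * n\<^sup>2" using n by (simp add: power2_eq_square)
    ultimately show ?thesis using n by (intro mult_mono) auto
  qed
  also have "\<dots> = (2 * (sqrt n ^ m * n))\<^sup>2" using n by (simp add: power_mult_distrib power_mult[symmetric] mult.commute[of _ 2] power_mult)
  finally have key: "sqrt (fact m) * exp (n / 2) \<le> 2 * (sqrt n ^ m * n)"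
    by (rule power2_le_imp_le) (use n in auto)
  have "sqrt (fact m) * norm (U m) = norm ((deriv ^^ m) (bargmann U) 0)"
    unfolding higher_deriv_bargmann_0[OF U] by (simp add: norm_mult)
  also have "\<dots> \<le> fact m * (D / n ^ (N + 1) * exp (n / 2)) / sqrt n ^ m" by (rule cauchy)
  also have "\<dots> = sqrt (fact m) * (D / (n ^ (N + 1) * sqrt n ^ m) * (sqrt (fact m) * exp (n / 2)))"
  proof -
    have "F * (D / P * E) / s = a * (D / (P * s) * (a * E))" if "F = a * a" for F a P E s :: real
      by (simp add: that)
    from this[of "fact m" "sqrt (fact m)"] show ?thesis by simp
  qed
  finally have "norm (U m) \<le> D / (n ^ (N + 1) * sqrt n ^ m) * (sqrt (fact m) * exp (n / 2))"
    by (simp only: mult_le_cancel_left_pos real_sqrt_gt_zero fact_gt_zero)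
  also have "\<dots> \<le> D / (n ^ (N + 1) * sqrt n ^ m) * (2 * (sqrt n ^ m * n))"
    using D0 n by (intro mult_left_mono key) auto
  also have "\<dots> = 2 * D / n ^ N" using n by simp
  finally show ?thesis by (simp add: n_def add.commute)
qed

section \<open>From bounds on a disc to bounds on finitely many coefficients\<close>

lemma norm_bargmann_le_on_ball:
  assumes U: "poly_growth U" and X: "\<And>m. m < M \<Longrightarrow> norm (U m) \<le> X" and A: "\<And>m. norm (U m) \<le> A" and R: "norm z \<le> R"
  shows "norm (bargmann U z) \<le> X * (\<Sum>m<M. R ^ m / sqrt (fact m)) + A * (\<Sum>m. R ^ (m + M) / sqrt (fact (m + M)))"
proof -
  have pg: "poly_growth (\<lambda>_. 1)" unfolding poly_growth_def by (intro exI[of _ 1] exI[of _ 0]) auto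
  have R0: "R \<ge> 0" using R norm_ge_zero[of z] by linarith
  have A0: "A \<ge> 0" using order_trans[OF norm_ge_zero A[of 0]] .
  have t: "norm (U m / of_real (sqrt (fact m)) * z ^ m) \<le> B * (R ^ m / sqrt (fact m))" if "norm (U m) \<le> B" for m B
  proof -
    have "norm (U m / of_real (sqrt (fact m)) * z ^ m) = norm (U m) * (norm z ^ m / sqrt (fact m))"
      by (simp add: norm_mult norm_divide norm_power)
    also have "\<dots> \<le> B * (R ^ m / sqrt (fact m))"
      using that R order_trans[OF norm_ge_zero that] by (intro mult_mono divide_right_mono power_mono) auto
    finally show ?thesis .
  qed
  have "summable (\<lambda>m. (1::complex) / of_real (sqrt (fact m)) * (of_real R) ^ m)" by (rule bargmann_summable[OF pg])
  then have "summable (\<lambda>m. complex_of_real (R ^ m / sqrt (fact m)))" by (simp add: mult.commute)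
  then have sR: "summable (\<lambda>m. R ^ m / sqrt (fact m))" by (simp only: summable_of_real_iff)
  have s: "summable (\<lambda>m. norm (U m / of_real (sqrt (fact m)) * z ^ m))"
    by (rule summable_comparison_test'[OF summable_mult[OF sR, of A]]) (use t[OF A] in auto)
  have "norm (bargmann U z) \<le> (\<Sum>m. norm (U m / of_real (sqrt (fact m)) * z ^ m))"
    unfolding bargmann_def by (rule summable_norm[OF s])
  also have "\<dots> = (\<Sum>m. norm (U (m + M) / of_real (sqrt (fact (m + M))) * z ^ (m + M))) + (\<Sum>m<M. norm (U m / of_real (sqrt (fact m)) * z ^ m))"
    by (rule suminf_split_initial_segment[OF s])
  also have "\<dots> \<le> (\<Sum>m. A * (R ^ (m + M) / sqrt (fact (m + M)))) + (\<Sum>m<M. X * (R ^ m / sqrt (fact m)))"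
  proof (intro add_mono suminf_le sum_mono)
    show "summable (\<lambda>m. norm (U (m + M) / of_real (sqrt (fact (m + M))) * z ^ (m + M)))"
      using s by (subst summable_iff_shift)
    show "summable (\<lambda>m. A * (R ^ (m + M) / sqrt (fact (m + M))))"
      using sR by (intro summable_mult) (subst summable_iff_shift)
  qed (use t[OF A] t[OF X] in auto)
  also have "(\<Sum>m. A * (R ^ (m + M) / sqrt (fact (m + M)))) = A * (\<Sum>m. R ^ (m + M) / sqrt (fact (m + M)))"
    using sR by (intro suminf_mult) (subst summable_iff_shift)
  finally show ?thesis by (simp add: sum_distrib_left)
qed

text \<open>The full series is the Bargmann series of the constant sequence 1 at the point R, so it
  converges.\<close>

lemma tail_small:
  assumes "\<epsilon> > 0"
  shows "\<exists>M. (\<Sum>m. R ^ (m + M) / sqrt (fact (m + M))) < (\<epsilon> :: real)"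
proof -
  have pg: "poly_growth (\<lambda>_. 1)" unfolding poly_growth_def by (intro exI[of _ 1] exI[of _ 0]) auto
  have "summable (\<lambda>m. (1::complex) / of_real (sqrt (fact m)) * (of_real R) ^ m)" by (rule bargmann_summable[OF pg])
  then have "summable (\<lambda>m. complex_of_real (R ^ m / sqrt (fact m)))" by (simp add: mult.commute)
  then have "summable (\<lambda>m. R ^ m / sqrt (fact m))" by (simp only: summable_of_real_iff)
  from suminf_exist_split[OF assms this] show ?thesis by (auto simp: abs_less_iff)
qed

text \<open>The losses add up: decay 2 N + 4 of the image sequence gives decay 2 N + 2 of its
  transform, which gives decay N of U. What remains uncontrolled is the transform of U on one
  disc.\<close>

lemma seq_estimate_disc:
  assumes hyp: "hypo_elliptic (symbol_poly m c)"
  shows "\<exists>R\<ge>0. \<exists>C\<ge>0. \<forall>U K D E. (\<forall>n. norm (U n) \<le> K * (1 + real n) ^ P) \<longrightarrow>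
     (\<forall>n. norm (seq_poly m c U n) \<le> D / (1 + real n) ^ (2 * N + 4)) \<longrightarrow>
     (\<forall>z. norm z \<le> R \<longrightarrow> norm (bargmann U z) \<le> E) \<longrightarrow>
     (\<forall>n. norm (U n) \<le> C * (D + E) / (1 + real n) ^ N)"
proof -
  obtain R C where R: "R \<ge> 0" and C: "C \<ge> 0" and est0: "\<forall>f K D E. f holomorphic_on UNIV \<longrightarrow>
     (\<forall>z. norm (f z) * exp (- (norm z)\<^sup>2 / 2) \<le> K * (1 + norm z) ^ (2 * P + 4)) \<longrightarrow>
     (\<forall>z. norm (fun_poly m c f z) * exp (- (norm z)\<^sup>2 / 2) \<le> D / (1 + norm z) ^ (2 * N + 2)) \<longrightarrow>
     (\<forall>z. norm z \<le> R \<longrightarrow> norm (f z) * exp (- (norm z)\<^sup>2 / 2) \<le> E) \<longrightarrow>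
     (\<forall>z. norm (f z) * exp (- (norm z)\<^sup>2 / 2) \<le> C * (D + E) / (1 + norm z) ^ (2 * N + 2))"
    using global_estimate[OF hyp, of "2 * P + 4" "2 * N + 2"] by blast
  note est = est0[rule_format]
  obtain B1 where B1: "B1 \<ge> 0" "\<And>U K z. (\<forall>m. norm (U m) \<le> K * (1 + real m) ^ P) \<Longrightarrow>
     norm (bargmann U z) \<le> B1 * K * (1 + norm z) ^ (2 * P + 4) * exp ((norm z)\<^sup>2 / 2)"
    using bargmann_bound[of P] by blast
  obtain B2 where B2: "B2 \<ge> 0" "\<And>V D z. (\<forall>m. norm (V m) \<le> D / (1 + real m) ^ (2 * N + 2 + 2)) \<Longrightarrow>
     norm (bargmann V z) * exp (- (norm z)\<^sup>2 / 2) \<le> B2 * D / (1 + norm z) ^ (2 * N + 2)"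
    using bargmann_decay[of "2 * N + 2"] by blast
  have "norm (U n) \<le> (2 * C * (1 + B2)) * (D + E) / (1 + real n) ^ N"
    if K: "\<forall>n. norm (U n) \<le> K * (1 + real n) ^ P" and D: "\<forall>n. norm (seq_poly m c U n) \<le> D / (1 + real n) ^ (2 * N + 4)"
      and E: "\<forall>z. norm z \<le> R \<longrightarrow> norm (bargmann U z) \<le> E" for U K D E n
  proof -
    have pg: "poly_growth U" using K unfolding poly_growth_def by blast
    have D0: "D \<ge> 0" using order_trans[OF norm_ge_zero D[rule_format, of 0]] by simp
    have E0: "E \<ge> 0" using order_trans[OF norm_ge_zero E[rule_format, of 0]] R by simp
    have "norm (bargmann U z) * exp (- (norm z)\<^sup>2 / 2) \<le> C * (B2 * D + E) / (1 + norm z) ^ (2 * N + 2)" for z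
    proof (rule est[OF bargmann_entire[OF pg], where K = "B1 * K"])
      show "norm (bargmann U z) * exp (- (norm z)\<^sup>2 / 2) \<le> B1 * K * (1 + norm z) ^ (2 * P + 4)" for z
        using mult_right_mono[OF B1(2)[OF K, of z], of "exp (- (norm z)\<^sup>2 / 2)"] by (simp add: mult.assoc flip: exp_add)
      have e: "2 * N + 2 + 2 = 2 * N + 4" by simp
      show "norm (fun_poly m c (bargmann U) z) * exp (- (norm z)\<^sup>2 / 2) \<le> B2 * D / (1 + norm z) ^ (2 * N + 2)" for z
        unfolding bargmann_seq_poly(2)[OF pg, symmetric] by (rule B2(2)[unfolded e, OF D])
      \<comment> \<open>The Gaussian weight is at most 1, so a bound for the unweighted transform
        suffices on the disc.\<close>
      show "norm (bargmann U z) * exp (- (norm z)\<^sup>2 / 2) \<le> E" if "norm z \<le> R" for z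
        using E[rule_format, OF that] by (rule order_trans[rotated]) (simp add: mult_left_le)
    qed
    from coefficients_decay[OF pg this] have "norm (U n) \<le> 2 * (C * (B2 * D + E)) / (1 + real n) ^ N" .
    also have "\<dots> \<le> (2 * C * (1 + B2)) * (D + E) / (1 + real n) ^ N"
    proof (intro divide_right_mono)
      have "0 \<le> 2 * C * (D + B2 * E)" using C D0 E0 B2(1) by simp
      then show "2 * (C * (B2 * D + E)) \<le> 2 * C * (1 + B2) * (D + E)" by (simp add: algebra_simps)
    qed auto
    finally show ?thesis .
  qed
  note estimate = this
  have C': "2 * C * (1 + B2) \<ge> 0" using C B2(1) by simp
  show ?thesis
  proof (rule exI[of _ R], rule conjI[OF R], rule exI[of _ "2 * C * (1 + B2)"], rule conjI[OF C'], intro allI impI, goal_cases)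
    case (1 U K D E n)
    show ?case by (rule estimate[OF 1])
  qed
qed

text \<open>On the disc the transform consists of the first M modes and a tail that is at most a
  small multiple of the weighted supremum of U. This multiple is absorbed, with an M that does not
  depend on U.\<close>

lemma seq_estimate_low_modes:
  assumes hyp: "hypo_elliptic (symbol_poly m c)"
  shows "\<exists>M. \<exists>C\<ge>0. \<forall>U K D X. (\<forall>n. norm (U n) \<le> K * (1 + real n) ^ P) \<longrightarrow>
     (\<forall>n. norm (seq_poly m c U n) \<le> D / (1 + real n) ^ (2 * N + 4)) \<longrightarrow>
     (\<forall>n<M. norm (U n) \<le> X) \<longrightarrow> X \<ge> 0 \<longrightarrow>
     (\<forall>n. norm (U n) \<le> C * (D + X) / (1 + real n) ^ N)"
proof -
  obtain R C where R: "R \<ge> 0" and C: "C \<ge> 0" and est0: "\<forall>U K D E. (\<forall>n. norm (U n) \<le> K * (1 + real n) ^ P) \<longrightarrow>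
     (\<forall>n. norm (seq_poly m c U n) \<le> D / (1 + real n) ^ (2 * N + 4)) \<longrightarrow>
     (\<forall>z. norm z \<le> R \<longrightarrow> norm (bargmann U z) \<le> E) \<longrightarrow>
     (\<forall>n. norm (U n) \<le> C * (D + E) / (1 + real n) ^ N)"
    using seq_estimate_disc[OF hyp, of P N] by blast
  \<comment> \<open>After multiplication by C the tail contributes at most half of the supremum
    \<open>A\<close>.\<close>
  have "1 / (2 * (C + 1)) > 0" using C by simp
  then obtain M where M: "(\<Sum>m. R ^ (m + M) / sqrt (fact (m + M))) < 1 / (2 * (C + 1))"
    using tail_small by blast
  define T where "T = (\<Sum>m<M. R ^ m / sqrt (fact m))"
  have T: "T \<ge> 0" unfolding T_def using R by (intro sum_nonneg) auto
  have "norm (U n) \<le> (2 * C * (1 + T)) * (D + X) / (1 + real n) ^ N"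
    if K: "\<forall>n. norm (U n) \<le> K * (1 + real n) ^ P" and D: "\<forall>n. norm (seq_poly m c U n) \<le> D / (1 + real n) ^ (2 * N + 4)"
      and X: "\<forall>n<M. norm (U n) \<le> X" and X0: "X \<ge> 0" for U K D X n
  proof -
    have pg: "poly_growth U" using K unfolding poly_growth_def by blast
    have D0: "D \<ge> 0" using order_trans[OF norm_ge_zero D[rule_format, of 0]] by simp
    have np: "(1 + real n) ^ N > 0" for n by (intro zero_less_power) auto
    \<comment> \<open>This bound may depend on U; it only makes the supremum \<open>A\<close> finite
      before the absorption.\<close>
    have "bounded (bargmann U ` cball 0 R)"
      by (rule compact_imp_bounded[OF compact_continuous_image[OF continuous_on_subset[OF
            holomorphic_on_imp_continuous_on[OF bargmann_entire[OF pg]] subset_UNIV] compact_cball]])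
    then obtain E0 where "\<forall>x\<in>bargmann U ` cball 0 R. norm x \<le> E0"
      unfolding bounded_iff by blast
    then have "\<forall>z. norm z \<le> R \<longrightarrow> norm (bargmann U z) \<le> E0" by simp
    then have "norm (U n) \<le> C * (D + E0) / (1 + real n) ^ N" for n using est0 K D by blast
    then have "(1 + real n) ^ N * norm (U n) \<le> C * (D + E0)" for n using np[of n] by (simp add: field_simps)
    then have bdd: "bdd_above (range (\<lambda>n. (1 + real n) ^ N * norm (U n)))" by (rule bdd_aboveI2)
    define A where "A = (SUP n. (1 + real n) ^ N * norm (U n))"
    have A: "(1 + real n) ^ N * norm (U n) \<le> A" for n unfolding A_def by (rule cSUP_upper[OF UNIV_I bdd])
    have A0: "A \<ge> 0" by (rule order_trans[OF _ A[of 0]]) simp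
    have UA: "norm (U n) \<le> A" for n
    proof -
      have "1 * norm (U n) \<le> (1 + real n) ^ N * norm (U n)" by (intro mult_right_mono one_le_power) auto
      then show ?thesis using A[of n] by linarith
    qed
    have "norm (bargmann U z) \<le> X * T + A * (1 / (2 * (C + 1)))" if "norm z \<le> R" for z
    proof -
      have "norm (bargmann U z) \<le> X * T + A * (\<Sum>m. R ^ (m + M) / sqrt (fact (m + M)))"
        unfolding T_def by (rule norm_bargmann_le_on_ball[OF pg _ UA that]) (use X in auto)
      then show ?thesis using mult_left_mono[OF less_imp_le[OF M] A0] by linarith
    qed
    then have "norm (U n) \<le> C * (D + (X * T + A * (1 / (2 * (C + 1))))) / (1 + real n) ^ N" for n
      using est0 K D by blast
    then have "(1 + real n) ^ N * norm (U n) \<le> C * (D + (X * T + A * (1 / (2 * (C + 1)))))" for n using np[of n] by (simp add: field_simps)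
    then have "A \<le> C * (D + (X * T + A * (1 / (2 * (C + 1)))))" unfolding A_def by (intro cSUP_least) auto
    also have "\<dots> = C * (D + X * T) + (C / (C + 1)) * A / 2" using C by (simp add: field_simps)
    also have "(C / (C + 1)) * A \<le> 1 * A" using C A0 by (intro mult_right_mono) auto
    finally have "A \<le> 2 * (C * (D + X * T))" by simp
    also have "\<dots> \<le> (2 * C * (1 + T)) * (D + X)"
    proof -
      have "0 \<le> 2 * C * (X + T * D)" using C D0 X0 T by simp
      then show ?thesis by (simp add: algebra_simps)
    qed
    finally have "(1 + real n) ^ N * norm (U n) \<le> (2 * C * (1 + T)) * (D + X)" using A[of n] by linarith
    then show ?thesis using np[of n] by (simp add: field_simps)
  qed
  then show ?thesis using C T by (intro exI[of _ M] exI[of _ "2 * C * (1 + T)"]) auto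
qed

lemma seq_poly_cmult: "seq_poly m c (\<lambda>n. a * U n) n = a * seq_poly m c U n"
proof -
  have X: "seq_X (\<lambda>n. a * U n) = (\<lambda>n. a * seq_X U n)" for U by (auto simp: seq_X_def fun_eq_iff algebra_simps)
  have Y: "seq_Y (\<lambda>n. a * U n) = (\<lambda>n. a * seq_Y U n)" for U by (auto simp: seq_Y_def fun_eq_iff algebra_simps)
  have X': "(seq_X ^^ j) (\<lambda>n. a * U n) = (\<lambda>n. a * (seq_X ^^ j) U n)" for U j
    by (induction j) (simp_all add: X)
  have Y': "(seq_Y ^^ j) (\<lambda>n. a * U n) = (\<lambda>n. a * (seq_Y ^^ j) U n)" for U j
    by (induction j) (simp_all add: Y)
  show ?thesis by (simp add: seq_poly_def X' Y' sum_distrib_left case_prod_beta mult_ac)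
qed

text \<open>Each entry of the image depends on finitely many entries of the sequence, so pointwise
  convergence is enough.\<close>

lemma seq_poly_tendsto:
  assumes "\<And>n. (\<lambda>i. V i n) \<longlonglongrightarrow> W n"
  shows "(\<lambda>i. seq_poly m c (V i) n) \<longlonglongrightarrow> seq_poly m c W n"
proof -
  have X: "(\<lambda>i. (seq_X ^^ j) (V i) n) \<longlonglongrightarrow> (seq_X ^^ j) W n" if "\<And>n. (\<lambda>i. V i n) \<longlonglongrightarrow> W n" for j n V W
  proof (induction j arbitrary: n)
    case (Suc j)
    then show ?case by (simp add: seq_X_def[of "(seq_X ^^ j) _"]) (intro tendsto_intros Suc, auto)
  qed (simp add: that)
  have Y: "(\<lambda>i. (seq_Y ^^ j) (V i) n) \<longlonglongrightarrow> (seq_Y ^^ j) W n" if "\<And>n. (\<lambda>i. V i n) \<longlonglongrightarrow> W n" for j n V W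
  proof (induction j arbitrary: n)
    case (Suc j)
    then show ?case by (simp add: seq_Y_def[of "(seq_Y ^^ j) _"]) (intro tendsto_intros Suc, auto)
  qed (simp add: that)
  show ?thesis unfolding seq_poly_def case_prod_beta
    by (intro tendsto_sum tendsto_mult tendsto_const X Y assms)
qed

text \<open>Compactness: counterexamples normalised on the first M modes are uniformly bounded by
  the preceding estimate, whatever their growth constants K, and a subsequence converges entrywise.
  The limit is annihilated but has size at least 1 on these modes, against injectivity.\<close>

lemma seq_estimate_injective:
  assumes hyp: "hypo_elliptic (symbol_poly m c)"
    and inj: "\<And>U. poly_growth U \<Longrightarrow> (\<And>n. seq_poly m c U n = 0) \<Longrightarrow> (\<And>n. U n = 0)"
  shows "\<exists>C\<ge>0. \<forall>U K D. (\<forall>n. norm (U n) \<le> K * (1 + real n) ^ P) \<longrightarrow>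
     (\<forall>n. norm (seq_poly m c U n) \<le> D / (1 + real n) ^ (2 * N + 4)) \<longrightarrow>
     (\<forall>n. norm (U n) \<le> C * D / (1 + real n) ^ N)"
proof -
  obtain M C where C: "C \<ge> 0" and est0: "\<forall>U K D X. (\<forall>n. norm (U n) \<le> K * (1 + real n) ^ P) \<longrightarrow>
     (\<forall>n. norm (seq_poly m c U n) \<le> D / (1 + real n) ^ (2 * N + 4)) \<longrightarrow>
     (\<forall>n<M. norm (U n) \<le> X) \<longrightarrow> X \<ge> 0 \<longrightarrow>
     (\<forall>n. norm (U n) \<le> C * (D + X) / (1 + real n) ^ N)"
    using seq_estimate_low_modes[OF hyp, of P N] by blast
  have "\<exists>C2\<ge>0. \<forall>U K D. (\<forall>n. norm (U n) \<le> K * (1 + real n) ^ P) \<longrightarrow>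
     (\<forall>n. norm (seq_poly m c U n) \<le> D / (1 + real n) ^ (2 * N + 4)) \<longrightarrow> (\<forall>n<M. norm (U n) \<le> C2 * D)"
  proof (rule ccontr)
    assume neg: "\<not> ?thesis"
    have "\<exists>U K D. (\<forall>n. norm (U n) \<le> K * (1 + real n) ^ P) \<and>
     (\<forall>n. norm (seq_poly m c U n) \<le> D / (1 + real n) ^ (2 * N + 4)) \<and> (\<exists>n<M. norm (U n) > real (Suc i) * D)" for i
    proof -
      have "real (Suc i) \<ge> 0" by simp
      then show ?thesis using neg by (meson not_le)
    qed
    then obtain U K D where U: "\<And>i n. norm (U i n) \<le> K i * (1 + real n) ^ P"
      "\<And>i n. norm (seq_poly m c (U i) n) \<le> D i / (1 + real n) ^ (2 * N + 4)"
      "\<And>i. \<exists>n<M. norm (U i n) > real (Suc i) * D i" by metis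
    \<comment> \<open>Division by this maximum makes the data D i / X i smaller than 1 / (i +
      1).\<close>
    define X where "X i = Max ((\<lambda>n. norm (U i n)) ` {..<M})" for i
    have X: "norm (U i n) \<le> X i" if "n < M" for i n unfolding X_def using that by (intro Max_ge) auto
    have D0: "D i \<ge> 0" for i using order_trans[OF norm_ge_zero U(2)[of i 0]] by simp
    have XD: "X i > real (Suc i) * D i" for i using U(3)[of i] X by (meson less_le_trans)
    have X0: "X i > 0" for i using XD[of i] D0[of i] by (meson le_less_trans mult_nonneg_nonneg of_nat_0_le_iff)
    have Xin: "\<exists>n<M. norm (U i n) = X i" for i
    proof -
      have "M \<noteq> 0" using U(3)[of i] by auto
      then have "X i \<in> (\<lambda>n. norm (U i n)) ` {..<M}" unfolding X_def by (intro Max_in) auto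
      then show ?thesis by auto
    qed
    define V where "V i n = of_real (1 / X i) * U i n" for i n
    have nV: "norm (V i n) = norm (U i n) / X i" for i n using X0[of i] by (simp add: V_def norm_divide)
    have V1: "norm (V i n) \<le> K i / X i * (1 + real n) ^ P" for i n
      unfolding nV using divide_right_mono[OF U(1)[of i n], of "X i"] X0[of i] by simp
    have V2: "norm (seq_poly m c (V i) n) \<le> (1 / real (Suc i)) / (1 + real n) ^ (2 * N + 4)" for i n
    proof -
      have "norm (seq_poly m c (V i) n) = norm (seq_poly m c (U i) n) / X i"
        unfolding V_def[abs_def] seq_poly_cmult using X0[of i] by (simp add: norm_mult norm_divide)
      also have "\<dots> \<le> D i / (1 + real n) ^ (2 * N + 4) / X i" using X0[of i] U(2)[of i n] by (intro divide_right_mono) auto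
      also have "\<dots> = (D i / X i) / (1 + real n) ^ (2 * N + 4)" by simp
      also have "\<dots> \<le> (1 / real (Suc i)) / (1 + real n) ^ (2 * N + 4)"
        using XD[of i] X0[of i] by (intro divide_right_mono) (auto simp: field_simps)
      finally show ?thesis .
    qed
    have V3: "\<forall>n<M. norm (V i n) \<le> 1" for i unfolding nV using X X0[of i] by (auto simp: divide_le_eq_1)
    have V4: "norm (V i n) \<le> 2 * C" for i n
    proof -
      have "norm (V i n) \<le> C * (1 / real (Suc i) + 1) / (1 + real n) ^ N"
        using est0[rule_format, OF V1 V2 V3[rule_format]] by simp
      also have "\<dots> \<le> C * (1 / real (Suc i) + 1) / 1"
        using C by (intro divide_left_mono one_le_power) auto
      also have "\<dots> \<le> C * 2" using C by (auto intro!: mult_left_mono simp: divide_le_eq_1)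
      finally show ?thesis by simp
    qed
    \<comment> \<open>A diagonal subsequence that converges at every index.\<close>
    obtain k where k: "strict_mono (k :: nat \<Rightarrow> nat)" "\<And>n. \<exists>l. (\<lambda>i. V (k i) n) \<longlonglongrightarrow> l"
      using function_convergent_subsequence[of "UNIV :: nat set" V "2 * C"] V4 by auto
    then obtain W where W: "\<And>n. (\<lambda>i. V (k i) n) \<longlonglongrightarrow> W n" by metis
    have "norm (W n) \<le> 2 * C * (1 + real n) ^ 0" for n
      using tendsto_upperbound[OF tendsto_norm[OF W[of n]], of "2 * C"] V4 by simp
    then have pgW: "poly_growth W" unfolding poly_growth_def by blast
    have W0: "seq_poly m c W n = 0" for n
    proof (rule LIMSEQ_unique[OF seq_poly_tendsto[OF W]])
      have "(\<lambda>i. 1 / real (Suc i)) \<longlonglongrightarrow> 0" by (rule LIMSEQ_Suc[OF lim_1_over_n])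
      then have lim: "(\<lambda>i. 1 / real (Suc (k i))) \<longlonglongrightarrow> 0" using LIMSEQ_subseq_LIMSEQ[OF _ k(1)] by (simp add: o_def)
      have le: "norm (seq_poly m c (V (k i)) n) \<le> 1 / real (Suc (k i))" for i
      proof -
        have "1 / real (Suc (k i)) / (1 + real n) ^ (2 * N + 4) \<le> 1 / real (Suc (k i)) / 1"
          by (intro divide_left_mono one_le_power) auto
        then show ?thesis using V2[of "k i" n] by simp
      qed
      show "(\<lambda>i. seq_poly m c (V (k i)) n) \<longlonglongrightarrow> 0"
        by (rule Lim_null_comparison[OF always_eventually[OF allI[OF le]] lim])
    qed
    \<comment> \<open>The normalisation is on the maximum; the sum dominates it and passes to
      entrywise limits directly.\<close>
    have "(\<lambda>i. \<Sum>n<M. norm (V (k i) n)) \<longlonglongrightarrow> (\<Sum>n<M. norm (W n))" by (intro tendsto_intros W)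
    moreover have "1 \<le> (\<Sum>n<M. norm (V i n))" for i
    proof -
      obtain n where "n < M" "norm (U i n) = X i" using Xin by blast
      then show ?thesis using member_le_sum[of n "{..<M}" "\<lambda>n. norm (V i n)"] X0[of i] by (simp add: nV)
    qed
    ultimately have "1 \<le> (\<Sum>n<M. norm (W n))" by (intro tendsto_lowerbound[of _ _ sequentially]) auto
    then show False using inj[OF pgW W0] by simp
  qed
  then obtain C2 where C2: "C2 \<ge> 0" "\<And>U K D. (\<forall>n. norm (U n) \<le> K * (1 + real n) ^ P) \<Longrightarrow>
     (\<forall>n. norm (seq_poly m c U n) \<le> D / (1 + real n) ^ (2 * N + 4)) \<Longrightarrow> (\<forall>n<M. norm (U n) \<le> C2 * D)" by blast
  have "norm (U n) \<le> (C * (1 + C2)) * D / (1 + real n) ^ N"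
    if K: "\<forall>n. norm (U n) \<le> K * (1 + real n) ^ P" and D: "\<forall>n. norm (seq_poly m c U n) \<le> D / (1 + real n) ^ (2 * N + 4)"
    for U K D n
  proof -
    have D0: "D \<ge> 0" using order_trans[OF norm_ge_zero D[rule_format, of 0]] by simp
    have "norm (U n) \<le> C * (D + C2 * D) / (1 + real n) ^ N"
      using est0[rule_format, OF K[rule_format] D[rule_format] C2(2)[OF K D, rule_format]] C2(1) D0 by simp
    then show ?thesis by (simp add: algebra_simps)
  qed
  then show ?thesis using C C2(1) by (intro exI[of _ "C * (1 + C2)"]) auto
qed

section \<open>Schwartz functions and tempered distributions\<close>

lemma iter_deriv_Nil [simp]: "iter_deriv [] f = f"
  by (simp add: iter_deriv_def)

lemma iter_deriv_Cons [simp]: "iter_deriv (b # bs) f = partial_deriv b (iter_deriv bs f)"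
  by (simp add: iter_deriv_def)

lemma iter_deriv_append: "iter_deriv (bs @ cs) f = iter_deriv bs (iter_deriv cs f)"
  by (simp add: iter_deriv_def)

lemma partial_derivI: "(f has_derivative f') (at x) \<Longrightarrow> partial_deriv b f x = f' b"
  by (simp add: partial_deriv_def frechet_derivative_at[symmetric])

lemma smooth_iff: "smooth f \<longleftrightarrow> (\<forall>bs\<in>lists Basis. \<forall>x. iter_deriv bs f differentiable (at x))"
  by (simp add: smooth_def differentiable_on_def)

lemma smooth_differentiable: "smooth f \<Longrightarrow> bs \<in> lists Basis \<Longrightarrow> iter_deriv bs f differentiable (at x)"
  by (simp add: smooth_iff)

lemma smooth_partial_deriv:
  assumes "smooth f" "b \<in> Basis" shows "smooth (partial_deriv b f)"
  unfolding smooth_iff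
proof (intro ballI allI)
  fix bs x assume "bs \<in> lists (Basis :: 'a set)"
  then have "bs @ [b] \<in> lists Basis" using assms(2) by simp
  from smooth_differentiable[OF assms(1) this] show "iter_deriv bs (partial_deriv b f) differentiable (at x)"
    by (simp add: iter_deriv_append)
qed

lemma partial_deriv_add:
  assumes "f differentiable (at x)" "g differentiable (at x)"
  shows "partial_deriv b (\<lambda>x. f x + g x) x = partial_deriv b f x + partial_deriv b g x"
  using has_derivative_add[OF assms[unfolded frechet_derivative_works]]
  by (simp add: partial_derivI[where f = "\<lambda>x. f x + g x"] partial_deriv_def[of b f] partial_deriv_def[of b g])

lemma partial_deriv_mult:
  assumes "f differentiable (at x)" "g differentiable (at x)"
  shows "partial_deriv b (\<lambda>x. f x * g x) x = partial_deriv b f x * g x + f x * partial_deriv b g x"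
  using has_derivative_mult[OF assms[unfolded frechet_derivative_works]]
  by (simp add: partial_derivI[where f = "\<lambda>x. f x * g x"] partial_deriv_def[of b f] partial_deriv_def[of b g])

lemma partial_deriv_const [simp]: "partial_deriv b (\<lambda>x. c) x = 0"
  by (rule partial_derivI[OF has_derivative_const])

lemma partial_deriv_cmult:
  assumes "f differentiable (at x)"
  shows "partial_deriv b (\<lambda>x. c * f x) x = c * partial_deriv b f x"
  using partial_deriv_mult[of "\<lambda>_. c" x f b] assms by simp

lemma partial_deriv_cnj:
  assumes "f differentiable (at x)"
  shows "partial_deriv b (\<lambda>x. cnj (f x)) x = cnj (partial_deriv b f x)"
  using has_derivative_cnj[OF assms[unfolded frechet_derivative_works]]
  by (simp add: partial_derivI[where f = "\<lambda>x. cnj (f x)"] partial_deriv_def[of b f])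

lemma has_derivative_coord: "((\<lambda>x::'a::euclidean_space. complex_of_real (x \<bullet> b)) has_derivative (\<lambda>h. complex_of_real (h \<bullet> b))) (at x)"
  by (intro derivative_eq_intros) (auto intro!: derivative_eq_intros)

lemma differentiable_coord: "(\<lambda>x::'a::euclidean_space. complex_of_real (x \<bullet> b)) differentiable (at x)"
  using has_derivative_coord differentiable_def by blast

lemma partial_deriv_coord: "partial_deriv c (\<lambda>x::'a::euclidean_space. complex_of_real (x \<bullet> b)) x = complex_of_real (c \<bullet> b)"
  by (rule partial_derivI[OF has_derivative_coord])

lemma differentiable_cnj: "f differentiable (at x) \<Longrightarrow> (\<lambda>x. cnj (f x)) differentiable (at x)"
  using has_derivative_cnj unfolding differentiable_def by blast

lemma iter_deriv_add:
  assumes "smooth f" "smooth g" "bs \<in> lists Basis"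
  shows "iter_deriv bs (\<lambda>x. f x + g x) = (\<lambda>x. iter_deriv bs f x + iter_deriv bs g x)"
  using assms(3)
proof (induction bs)
  case (Cons b bs)
  show ?case
    by (rule ext) (simp add: Cons.IH partial_deriv_add smooth_differentiable assms(1,2) Cons.hyps)
qed simp

lemma smooth_add:
  assumes "smooth f" "smooth g" shows "smooth (\<lambda>x. f x + g x)"
  using assms iter_deriv_add[OF assms] by (simp add: smooth_iff differentiable_add)

lemma iter_deriv_cmult:
  assumes "smooth f" "bs \<in> lists Basis"
  shows "iter_deriv bs (\<lambda>x. c * f x) = (\<lambda>x. c * iter_deriv bs f x)"
  using assms(2)
proof (induction bs)
  case (Cons b bs)
  show ?case
    by (rule ext) (simp add: Cons.IH partial_deriv_cmult smooth_differentiable assms(1) Cons.hyps)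
qed simp

lemma smooth_cmult:
  assumes "smooth f" shows "smooth (\<lambda>x. c * f x)"
  using assms iter_deriv_cmult[OF assms] by (simp add: smooth_iff differentiable_mult)

lemma iter_deriv_cnj:
  assumes "smooth f" "bs \<in> lists Basis"
  shows "iter_deriv bs (\<lambda>x. cnj (f x)) = (\<lambda>x. cnj (iter_deriv bs f x))"
  using assms(2)
proof (induction bs)
  case (Cons b bs)
  show ?case
    by (rule ext) (simp add: Cons.IH partial_deriv_cnj smooth_differentiable assms(1) Cons.hyps)
qed simp

lemma smooth_cnj:
  assumes "smooth f" shows "smooth (\<lambda>x. cnj (f x))"
  using assms iter_deriv_cnj[OF assms] by (simp add: smooth_iff differentiable_cnj)

definition coord_mult :: "'a::euclidean_space \<Rightarrow> ('a \<Rightarrow> complex) \<Rightarrow> 'a \<Rightarrow> complex" where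
  "coord_mult b f x = complex_of_real (x \<bullet> b) * f x"

text \<open>These are the commutator terms in the Leibniz rule for a coordinate function.\<close>
fun deletions :: "'a \<Rightarrow> 'a list \<Rightarrow> 'a list list" where
  "deletions b [] = []"
| "deletions b (c # cs) = (if b = c then [cs] else []) @ map (Cons c) (deletions b cs)"

lemma deletions_in_lists: "cs \<in> lists A \<Longrightarrow> ds \<in> set (deletions b cs) \<Longrightarrow> ds \<in> lists A"
proof -
  have "set cs \<subseteq> A \<Longrightarrow> ds \<in> set (deletions b cs) \<Longrightarrow> set ds \<subseteq> A"
    by (induction cs arbitrary: ds) (fastforce split: if_splits)+
  then show "cs \<in> lists A \<Longrightarrow> ds \<in> set (deletions b cs) \<Longrightarrow> ds \<in> lists A" by auto
qed

lemma norm_sum_list_le: "norm (\<Sum>l\<leftarrow>ls. g l) \<le> (\<Sum>l\<leftarrow>ls. norm (g l :: complex))"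
  by (induction ls) (auto intro: order_trans[OF norm_triangle_ineq])

lemma sum_list_differentiable:
  assumes "\<And>l. l \<in> set ls \<Longrightarrow> g l differentiable (at x)"
  shows "(\<lambda>x. \<Sum>l\<leftarrow>ls. (g l x :: complex)) differentiable (at x)"
  using assms by (induction ls) (auto intro: differentiable_add)

lemma partial_deriv_sum_list:
  assumes "\<And>l. l \<in> set ls \<Longrightarrow> g l differentiable (at x)"
  shows "partial_deriv c (\<lambda>x. \<Sum>l\<leftarrow>ls. g l x) x = (\<Sum>l\<leftarrow>ls. partial_deriv c (g l) x)"
  using assms
proof (induction ls)
  case (Cons l ls)
  then show ?case
    using partial_deriv_add[of "g l" x "\<lambda>x. \<Sum>l\<leftarrow>ls. g l x" c] sum_list_differentiable[of ls g x] by simp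
qed simp

text \<open>A coordinate function has constant first derivatives, so at most one entry of
  \<open>bs\<close> can fall on it, and only an entry equal to b gives a nonzero term.\<close>

lemma iter_deriv_coord_mult:
  assumes f: "smooth f" and b: "b \<in> Basis" and "bs \<in> lists Basis"
  shows "iter_deriv bs (coord_mult b f) = (\<lambda>x. complex_of_real (x \<bullet> b) * iter_deriv bs f x + (\<Sum>l\<leftarrow>deletions b bs. iter_deriv l f x))"
  using assms(3)
proof (induction bs)
  case Nil
  then show ?case by (simp add: coord_mult_def[abs_def])
next
  case (Cons c bs)
  then have c: "c \<in> Basis" "bs \<in> lists Basis" by auto
  note d = smooth_differentiable[OF f c(2)]
  have ds: "iter_deriv l f differentiable (at x)" if "l \<in> set (deletions b bs)" for l x
    using smooth_differentiable[OF f deletions_in_lists[OF c(2) that]] .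
  have "partial_deriv c (iter_deriv bs (coord_mult b f)) x = complex_of_real (x \<bullet> b) * partial_deriv c (iter_deriv bs f) x
      + complex_of_real (c \<bullet> b) * iter_deriv bs f x + (\<Sum>l\<leftarrow>deletions b bs. partial_deriv c (iter_deriv l f) x)" for x
    unfolding Cons.IH
    by (subst partial_deriv_add) (auto intro!: differentiable_mult differentiable_coord d sum_list_differentiable ds
        simp: partial_deriv_mult[OF differentiable_coord d] partial_deriv_coord partial_deriv_sum_list[OF ds])
  then show ?case using b c by (auto simp: fun_eq_iff inner_Basis o_def)
qed

lemma smooth_coord_mult:
  assumes f: "smooth f" and b: "b \<in> Basis" shows "smooth (coord_mult b f)"
  unfolding smooth_iff
proof (intro ballI allI)
  fix bs x assume bs: "bs \<in> lists (Basis :: 'a set)"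
  show "iter_deriv bs (coord_mult b f) differentiable (at x)"
    unfolding iter_deriv_coord_mult[OF f b bs]
    by (intro differentiable_add differentiable_mult differentiable_coord sum_list_differentiable
        smooth_differentiable[OF f] bs deletions_in_lists[OF bs])
qed

section \<open>Seminorms and closure properties of the Schwartz space\<close>

lemma schwartz_iff:
  "f \<in> schwartz_space \<longleftrightarrow> smooth f \<and> (\<forall>n. \<forall>bs\<in>lists Basis. \<exists>C. \<forall>x. norm x ^ n * norm (iter_deriv bs f x) \<le> C)"
  by (auto simp: schwartz_space_def bdd_above_def)

lemma schwartz_smooth: "f \<in> schwartz_space \<Longrightarrow> smooth f"
  by (simp add: schwartz_iff)

lemma schwartz_seminorm_upper:
  assumes "f \<in> schwartz_space" "bs \<in> lists Basis"
  shows "norm x ^ n * norm (iter_deriv bs f x) \<le> schwartz_seminorm n bs f"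
  unfolding schwartz_seminorm_def using assms by (intro cSUP_upper) (auto simp: schwartz_space_def)

lemma schwartz_seminorm_le:
  "(\<And>x. norm x ^ n * norm (iter_deriv bs f x) \<le> C) \<Longrightarrow> schwartz_seminorm n bs f \<le> C"
  unfolding schwartz_seminorm_def by (intro cSUP_least) auto

lemma schwartz_seminorm_nonneg:
  assumes "f \<in> schwartz_space" "bs \<in> lists Basis" shows "0 \<le> schwartz_seminorm n bs f"
  by (rule order_trans[OF _ schwartz_seminorm_upper[OF assms, of 0]]) simp

lemma schwartz_add:
  assumes "f \<in> schwartz_space" "g \<in> schwartz_space" shows "(\<lambda>x. f x + g x) \<in> schwartz_space"
    and "bs \<in> lists Basis \<Longrightarrow> schwartz_seminorm n bs (\<lambda>x. f x + g x) \<le> schwartz_seminorm n bs f + schwartz_seminorm n bs g"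
proof -
  have *: "norm x ^ n * norm (iter_deriv bs (\<lambda>x. f x + g x) x) \<le> schwartz_seminorm n bs f + schwartz_seminorm n bs g"
    if "bs \<in> lists Basis" for n bs x
  proof -
    have "norm x ^ n * norm (iter_deriv bs (\<lambda>x. f x + g x) x) \<le> norm x ^ n * (norm (iter_deriv bs f x) + norm (iter_deriv bs g x))"
      unfolding iter_deriv_add[OF schwartz_smooth[OF assms(1)] schwartz_smooth[OF assms(2)] that]
      by (intro mult_left_mono norm_triangle_ineq) auto
    then show ?thesis using schwartz_seminorm_upper[OF assms(1) that, of x n] schwartz_seminorm_upper[OF assms(2) that, of x n]
      by (simp add: distrib_left)
  qed
  then show "(\<lambda>x. f x + g x) \<in> schwartz_space"
    unfolding schwartz_iff using smooth_add[OF assms[THEN schwartz_smooth]] by blast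
  show "bs \<in> lists Basis \<Longrightarrow> schwartz_seminorm n bs (\<lambda>x. f x + g x) \<le> schwartz_seminorm n bs f + schwartz_seminorm n bs g"
    using * by (rule schwartz_seminorm_le)
qed

lemma schwartz_cmult:
  assumes "f \<in> schwartz_space" shows "(\<lambda>x. c * f x) \<in> schwartz_space"
    and "bs \<in> lists Basis \<Longrightarrow> schwartz_seminorm n bs (\<lambda>x. c * f x) \<le> norm c * schwartz_seminorm n bs f"
proof -
  have *: "norm x ^ n * norm (iter_deriv bs (\<lambda>x. c * f x) x) \<le> norm c * schwartz_seminorm n bs f"
    if "bs \<in> lists Basis" for n bs x
    unfolding iter_deriv_cmult[OF schwartz_smooth[OF assms(1)] that]
    using mult_left_mono[OF schwartz_seminorm_upper[OF assms that, of x n], of "norm c"] by (simp add: norm_mult mult_ac)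
  then show "(\<lambda>x. c * f x) \<in> schwartz_space"
    unfolding schwartz_iff using smooth_cmult[OF assms[THEN schwartz_smooth]] by blast
  show "bs \<in> lists Basis \<Longrightarrow> schwartz_seminorm n bs (\<lambda>x. c * f x) \<le> norm c * schwartz_seminorm n bs f"
    using * by (rule schwartz_seminorm_le)
qed

lemma schwartz_diff:
  assumes "f \<in> schwartz_space" "g \<in> schwartz_space" shows "(\<lambda>x. f x - g x) \<in> schwartz_space"
  using schwartz_add(1)[OF assms(1) schwartz_cmult(1)[OF assms(2), of "-1"]] by simp

lemma schwartz_cnj:
  assumes "f \<in> schwartz_space" shows "(\<lambda>x. cnj (f x)) \<in> schwartz_space"
  using assms smooth_cnj[of f] iter_deriv_cnj[of f] unfolding schwartz_iff by auto

lemma schwartz_zero: "(\<lambda>x. 0) \<in> schwartz_space"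
proof -
  have "iter_deriv bs (\<lambda>x. 0) = (\<lambda>x::'a. 0)" for bs by (induction bs) auto
  then show ?thesis unfolding schwartz_iff smooth_iff by (auto intro: exI[of _ 0])
qed

lemma schwartz_sum:
  "finite I \<Longrightarrow> (\<And>i. i \<in> I \<Longrightarrow> f i \<in> schwartz_space) \<Longrightarrow> (\<lambda>x. \<Sum>i\<in>I. f i x) \<in> schwartz_space"
  by (induction I rule: finite_induct) (auto intro: schwartz_zero schwartz_add(1))

lemma schwartz_partial_deriv:
  assumes "f \<in> schwartz_space" "b \<in> Basis" shows "partial_deriv b f \<in> schwartz_space"
    and "schwartz_seminorm n bs (partial_deriv b f) = schwartz_seminorm n (bs @ [b]) f"
proof -
  have *: "iter_deriv bs (partial_deriv b f) = iter_deriv (bs @ [b]) f" for bs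
    by (simp add: iter_deriv_append)
  have "\<exists>C. \<forall>x. norm x ^ n * norm (iter_deriv (bs @ [b]) f x) \<le> C" if "bs \<in> lists Basis" for n bs
    using assms that unfolding schwartz_iff by (metis append_in_lists_conv lists.simps)
  then show "partial_deriv b f \<in> schwartz_space"
    using smooth_partial_deriv[OF schwartz_smooth[OF assms(1)] assms(2)] unfolding schwartz_iff * by blast
  show "schwartz_seminorm n bs (partial_deriv b f) = schwartz_seminorm n (bs @ [b]) f"
    by (simp add: schwartz_seminorm_def *)
qed

lemma schwartz_coord_mult:
  assumes f: "f \<in> schwartz_space" and b: "b \<in> Basis" shows "coord_mult b f \<in> schwartz_space"
    and "bs \<in> lists Basis \<Longrightarrow> schwartz_seminorm n bs (coord_mult b f) \<le>
      schwartz_seminorm (Suc n) bs f + (\<Sum>l\<leftarrow>deletions b bs. schwartz_seminorm n l f)"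
proof -
  have *: "norm x ^ n * norm (iter_deriv bs (coord_mult b f) x) \<le> schwartz_seminorm (Suc n) bs f + (\<Sum>l\<leftarrow>deletions b bs. schwartz_seminorm n l f)"
    if bs: "bs \<in> lists Basis" for n bs x
  proof -
    have "norm (iter_deriv bs (coord_mult b f) x) \<le> norm (complex_of_real (x \<bullet> b) * iter_deriv bs f x) + norm (\<Sum>l\<leftarrow>deletions b bs. iter_deriv l f x)"
      unfolding iter_deriv_coord_mult[OF schwartz_smooth[OF f] b bs] by (rule norm_triangle_ineq)
    also have "\<dots> \<le> norm x * norm (iter_deriv bs f x) + (\<Sum>l\<leftarrow>deletions b bs. norm (iter_deriv l f x))"
    proof (rule add_mono)
      show "norm (complex_of_real (x \<bullet> b) * iter_deriv bs f x) \<le> norm x * norm (iter_deriv bs f x)"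
        using Basis_le_norm[OF b, of x] by (simp add: norm_mult mult_right_mono)
      show "norm (\<Sum>l\<leftarrow>deletions b bs. iter_deriv l f x) \<le> (\<Sum>l\<leftarrow>deletions b bs. norm (iter_deriv l f x))"
        by (rule norm_sum_list_le)
    qed
    finally have "norm x ^ n * norm (iter_deriv bs (coord_mult b f) x) \<le> norm x ^ n * (norm x * norm (iter_deriv bs f x) + (\<Sum>l\<leftarrow>deletions b bs. norm (iter_deriv l f x)))"
      by (intro mult_left_mono) auto
    also have "\<dots> = norm x ^ Suc n * norm (iter_deriv bs f x) + (\<Sum>l\<leftarrow>deletions b bs. norm x ^ n * norm (iter_deriv l f x))"
      by (simp add: distrib_left sum_list_const_mult mult_ac)
    also have "\<dots> \<le> schwartz_seminorm (Suc n) bs f + (\<Sum>l\<leftarrow>deletions b bs. schwartz_seminorm n l f)"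
      by (intro add_mono schwartz_seminorm_upper f bs sum_list_mono deletions_in_lists[OF bs])
    finally show ?thesis .
  qed
  then show "coord_mult b f \<in> schwartz_space"
    unfolding schwartz_iff using smooth_coord_mult[OF schwartz_smooth[OF f] b] by blast
  show "bs \<in> lists Basis \<Longrightarrow> schwartz_seminorm n bs (coord_mult b f) \<le>
      schwartz_seminorm (Suc n) bs f + (\<Sum>l\<leftarrow>deletions b bs. schwartz_seminorm n l f)"
    using * by (rule schwartz_seminorm_le)
qed

text \<open>For the modulus of a linear functional this is continuity, see
  \<open>tempered_iff\<close>. Admitting arbitrary real functions lets seminorms and L^1 norms be
  added and composed with operators without mentioning open sets.\<close>

definition schwartz_bounded :: "(('a::euclidean_space \<Rightarrow> complex) \<Rightarrow> real) \<Rightarrow> bool" where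
  "schwartz_bounded p \<longleftrightarrow> (\<exists>F C. finite F \<and> F \<subseteq> UNIV \<times> lists Basis \<and> C \<ge> 0 \<and>
     (\<forall>\<phi>\<in>schwartz_space. p \<phi> \<le> C * (\<Sum>(n, bs)\<in>F. schwartz_seminorm n bs \<phi>)))"

lemma schwartz_bounded_seminorm: "bs \<in> lists Basis \<Longrightarrow> schwartz_bounded (schwartz_seminorm n bs)"
  unfolding schwartz_bounded_def by (intro exI[of _ "{(n, bs)}"] exI[of _ 1]) auto

lemma schwartz_bounded_mono:
  "schwartz_bounded p \<Longrightarrow> (\<And>\<phi>. \<phi> \<in> schwartz_space \<Longrightarrow> r \<phi> \<le> p \<phi>) \<Longrightarrow> schwartz_bounded r"
  unfolding schwartz_bounded_def by (meson order_trans)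

lemma schwartz_bounded_add:
  assumes "schwartz_bounded p" "schwartz_bounded r" shows "schwartz_bounded (\<lambda>\<phi>. p \<phi> + r \<phi>)"
proof -
  obtain F C where F: "finite F" "F \<subseteq> UNIV \<times> lists Basis" "C \<ge> 0" "\<And>\<phi>. \<phi> \<in> schwartz_space \<Longrightarrow> p \<phi> \<le> C * (\<Sum>(n, bs)\<in>F. schwartz_seminorm n bs \<phi>)"
    using assms(1) unfolding schwartz_bounded_def by blast
  obtain G D where G: "finite G" "G \<subseteq> UNIV \<times> lists Basis" "D \<ge> 0" "\<And>\<phi>. \<phi> \<in> schwartz_space \<Longrightarrow> r \<phi> \<le> D * (\<Sum>(n, bs)\<in>G. schwartz_seminorm n bs \<phi>)"
    using assms(2) unfolding schwartz_bounded_def by blast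
  have "p \<phi> + r \<phi> \<le> (C + D) * (\<Sum>(n, bs)\<in>F \<union> G. schwartz_seminorm n bs \<phi>)" if \<phi>: "\<phi> \<in> schwartz_space" for \<phi>
  proof -
    have nn: "0 \<le> (case x of (n, bs) \<Rightarrow> schwartz_seminorm n bs \<phi>)" if "x \<in> F \<union> G" for x
    proof -
      have "x \<in> UNIV \<times> lists Basis" using that F(2) G(2) by blast
      then have "snd x \<in> lists Basis" by (simp only: mem_Times_iff)
      from schwartz_seminorm_nonneg[OF \<phi> this] show ?thesis by (simp add: case_prod_beta)
    qed
    have "(\<Sum>(n, bs)\<in>F. schwartz_seminorm n bs \<phi>) \<le> (\<Sum>(n, bs)\<in>F \<union> G. schwartz_seminorm n bs \<phi>)"
      "(\<Sum>(n, bs)\<in>G. schwartz_seminorm n bs \<phi>) \<le> (\<Sum>(n, bs)\<in>F \<union> G. schwartz_seminorm n bs \<phi>)"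
      using F(1) G(1) nn by (auto intro!: sum_mono2)
    then show ?thesis using F(4)[OF \<phi>] G(4)[OF \<phi>] F(3) G(3)
      by (smt (verit) distrib_right mult_left_mono)
  qed
  then show ?thesis unfolding schwartz_bounded_def
    using F(1,2,3) G(1,2,3) by (intro exI[of _ "F \<union> G"] exI[of _ "C + D"]) auto
qed

lemma schwartz_bounded_cmult:
  assumes "schwartz_bounded p" "c \<ge> 0" shows "schwartz_bounded (\<lambda>\<phi>. c * p \<phi>)"
proof -
  obtain F C where F: "finite F" "F \<subseteq> UNIV \<times> lists Basis" "C \<ge> 0" "\<And>\<phi>. \<phi> \<in> schwartz_space \<Longrightarrow> p \<phi> \<le> C * (\<Sum>(n, bs)\<in>F. schwartz_seminorm n bs \<phi>)"
    using assms(1) unfolding schwartz_bounded_def by blast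
  then show ?thesis unfolding schwartz_bounded_def
    using assms(2) by (intro exI[of _ F] exI[of _ "c * C"]) (auto simp: mult.assoc intro!: mult_left_mono)
qed

lemma schwartz_bounded_zero: "schwartz_bounded (\<lambda>\<phi>. 0)"
  unfolding schwartz_bounded_def by (intro exI[of _ "{}"] exI[of _ 0]) auto

lemma schwartz_bounded_sum:
  "finite I \<Longrightarrow> (\<And>i. i \<in> I \<Longrightarrow> schwartz_bounded (p i)) \<Longrightarrow> schwartz_bounded (\<lambda>\<phi>. \<Sum>i\<in>I. p i \<phi>)"
  by (induction I rule: finite_induct) (auto intro: schwartz_bounded_zero schwartz_bounded_add)

lemma schwartz_bounded_sum_list:
  "(\<And>l. l \<in> set ls \<Longrightarrow> schwartz_bounded (p l)) \<Longrightarrow> schwartz_bounded (\<lambda>\<phi>. \<Sum>l\<leftarrow>ls. p l \<phi>)"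
  by (induction ls) (auto intro: schwartz_bounded_zero schwartz_bounded_add)

text \<open>For linear operators this is continuity, expressed seminorm by seminorm. Linearity is
  kept apart and enters only in \<open>tempered_pullback\<close>.\<close>

definition schwartz_op :: "(('a::euclidean_space \<Rightarrow> complex) \<Rightarrow> 'a \<Rightarrow> complex) \<Rightarrow> bool" where
  "schwartz_op T \<longleftrightarrow> (\<forall>\<phi>\<in>schwartz_space. T \<phi> \<in> schwartz_space) \<and>
     (\<forall>n. \<forall>bs\<in>lists Basis. schwartz_bounded (\<lambda>\<phi>. schwartz_seminorm n bs (T \<phi>)))"

lemma schwartz_op_closed: "schwartz_op T \<Longrightarrow> \<phi> \<in> schwartz_space \<Longrightarrow> T \<phi> \<in> schwartz_space"
  by (simp add: schwartz_op_def)

lemma schwartz_bounded_compose: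
  assumes p: "schwartz_bounded p" and T: "schwartz_op T" shows "schwartz_bounded (\<lambda>\<phi>. p (T \<phi>))"
proof -
  obtain F C where F: "finite F" "F \<subseteq> UNIV \<times> lists Basis" "C \<ge> 0" "\<And>\<phi>. \<phi> \<in> schwartz_space \<Longrightarrow> p \<phi> \<le> C * (\<Sum>(n, bs)\<in>F. schwartz_seminorm n bs \<phi>)"
    using p unfolding schwartz_bounded_def by blast
  have "schwartz_bounded (\<lambda>\<phi>. C * (\<Sum>x\<in>F. schwartz_seminorm (fst x) (snd x) (T \<phi>)))"
  proof (intro schwartz_bounded_cmult schwartz_bounded_sum F(1,3))
    fix x assume "x \<in> F"
    then have "x \<in> UNIV \<times> lists Basis" using F(2) by blast
    then have "snd x \<in> lists Basis" by (simp only: mem_Times_iff)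
    then show "schwartz_bounded (\<lambda>\<phi>. schwartz_seminorm (fst x) (snd x) (T \<phi>))" using T by (simp only: schwartz_op_def)
  qed
  then show ?thesis
    by (rule schwartz_bounded_mono) (use F(4) T in \<open>auto simp: schwartz_op_def case_prod_beta\<close>)
qed

lemma schwartz_op_compose:
  assumes "schwartz_op S" "schwartz_op T" shows "schwartz_op (\<lambda>\<phi>. S (T \<phi>))"
  unfolding schwartz_op_def
proof (intro conjI ballI allI)
  fix n bs assume "bs \<in> lists (Basis :: 'a set)"
  then have "schwartz_bounded (\<lambda>\<phi>. schwartz_seminorm n bs (S \<phi>))" using assms(1) by (simp only: schwartz_op_def)
  then show "schwartz_bounded (\<lambda>\<phi>. schwartz_seminorm n bs (S (T \<phi>)))"
    by (rule schwartz_bounded_compose[OF _ assms(2)])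
qed (rule schwartz_op_closed[OF assms(1) schwartz_op_closed[OF assms(2)]])

lemma schwartz_op_id: "schwartz_op (\<lambda>\<phi>. \<phi>)"
  by (simp add: schwartz_op_def schwartz_bounded_seminorm)

lemma schwartz_op_funpow: "schwartz_op T \<Longrightarrow> schwartz_op (T ^^ n)"
  by (induction n) (auto simp: o_def id_def schwartz_op_id intro: schwartz_op_compose)

lemma schwartz_op_add:
  assumes "schwartz_op S" "schwartz_op T" shows "schwartz_op (\<lambda>\<phi> x. S \<phi> x + T \<phi> x)"
  unfolding schwartz_op_def
proof (intro conjI ballI allI)
  fix n bs assume bs: "bs \<in> lists (Basis :: 'a set)"
  have "schwartz_bounded (\<lambda>\<phi>. schwartz_seminorm n bs (S \<phi>) + schwartz_seminorm n bs (T \<phi>))"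
    using assms bs by (intro schwartz_bounded_add) (auto simp: schwartz_op_def)
  then show "schwartz_bounded (\<lambda>\<phi>. schwartz_seminorm n bs (\<lambda>x. S \<phi> x + T \<phi> x))"
    by (rule schwartz_bounded_mono) (rule schwartz_add(2)[OF schwartz_op_closed[OF assms(1)] schwartz_op_closed[OF assms(2)] bs])
qed (rule schwartz_add(1)[OF schwartz_op_closed[OF assms(1)] schwartz_op_closed[OF assms(2)]])

lemma schwartz_op_cmult:
  assumes "schwartz_op T" shows "schwartz_op (\<lambda>\<phi> x. c * T \<phi> x)"
  unfolding schwartz_op_def
proof (intro conjI ballI allI)
  fix n bs assume bs: "bs \<in> lists (Basis :: 'a set)"
  have "schwartz_bounded (\<lambda>\<phi>. norm c * schwartz_seminorm n bs (T \<phi>))"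
    using assms bs by (intro schwartz_bounded_cmult) (auto simp: schwartz_op_def)
  then show "schwartz_bounded (\<lambda>\<phi>. schwartz_seminorm n bs (\<lambda>x. c * T \<phi> x))"
    by (rule schwartz_bounded_mono) (rule schwartz_cmult(2)[OF schwartz_op_closed[OF assms] bs])
qed (rule schwartz_cmult(1)[OF schwartz_op_closed[OF assms]])

lemma schwartz_op_partial_deriv:
  assumes "b \<in> Basis" shows "schwartz_op (partial_deriv b)"
  unfolding schwartz_op_def
proof (intro conjI ballI allI)
  fix n bs assume bs: "bs \<in> lists (Basis :: 'a set)"
  have "schwartz_bounded (schwartz_seminorm n (bs @ [b]))" using bs assms by (intro schwartz_bounded_seminorm) auto
  then show "schwartz_bounded (\<lambda>\<phi>. schwartz_seminorm n bs (partial_deriv b \<phi>))"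
    by (rule schwartz_bounded_mono) (simp add: schwartz_partial_deriv(2)[OF _ assms])
qed (intro schwartz_partial_deriv assms)

lemma schwartz_op_coord_mult:
  assumes "b \<in> Basis" shows "schwartz_op (coord_mult b)"
  unfolding schwartz_op_def
proof (intro conjI ballI allI)
  fix n bs assume bs: "bs \<in> lists (Basis :: 'a set)"
  have "schwartz_bounded (\<lambda>f. schwartz_seminorm (Suc n) bs f + (\<Sum>l\<leftarrow>deletions b bs. schwartz_seminorm n l f))"
    by (intro schwartz_bounded_add schwartz_bounded_sum_list schwartz_bounded_seminorm bs deletions_in_lists[OF bs])
  then show "schwartz_bounded (\<lambda>\<phi>. schwartz_seminorm n bs (coord_mult b \<phi>))"
    by (rule schwartz_bounded_mono) (intro schwartz_coord_mult(2) assms bs)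
qed (intro schwartz_coord_mult assms)

section \<open>Continuity in the Schwartz topology as a bound by seminorms\<close>

lemma openin_schwartz_nbhd:
  assumes "openin schwartz_topology U" "f \<in> U"
  shows "f \<in> schwartz_space \<and> (\<exists>F r. finite F \<and> F \<subseteq> UNIV \<times> lists Basis \<and> r > 0 \<and>
    (\<forall>g\<in>schwartz_space. (\<forall>(n, bs)\<in>F. schwartz_seminorm n bs (\<lambda>x. g x - f x) < r) \<longrightarrow> g \<in> U))"
proof -
  have "generate_topology_on {{g \<in> schwartz_space. schwartz_seminorm n bs (\<lambda>x. g x - f x) < r} | n bs f r.
        bs \<in> lists Basis \<and> f \<in> schwartz_space \<and> r > 0} U"
    using assms(1) unfolding schwartz_topology_def openin_topology_generated_by_iff .
  then show ?thesis using assms(2)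
  proof (induction arbitrary: f rule: generate_topology_on.induct)
    case Empty
    then show ?case by simp
  next
    case (Int a b)
    then have fab: "f \<in> a" "f \<in> b" by auto
    obtain F r where F: "f \<in> schwartz_space" "finite F" "F \<subseteq> UNIV \<times> lists Basis" "r > 0"
      "\<forall>g\<in>schwartz_space. (\<forall>(n, bs)\<in>F. schwartz_seminorm n bs (\<lambda>x. g x - f x) < r) \<longrightarrow> g \<in> a"
      using Int.IH(1)[OF fab(1)] by blast
    obtain G s where G: "finite G" "G \<subseteq> UNIV \<times> lists Basis" "s > 0"
      "\<forall>g\<in>schwartz_space. (\<forall>(n, bs)\<in>G. schwartz_seminorm n bs (\<lambda>x. g x - f x) < s) \<longrightarrow> g \<in> b"
      using Int.IH(2)[OF fab(2)] by blast
    have "g \<in> a \<inter> b" if "g \<in> schwartz_space" "\<forall>(n, bs)\<in>F \<union> G. schwartz_seminorm n bs (\<lambda>x. g x - f x) < min r s" for g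
    proof -
      have "\<forall>(n, bs)\<in>F. schwartz_seminorm n bs (\<lambda>x. g x - f x) < r" "\<forall>(n, bs)\<in>G. schwartz_seminorm n bs (\<lambda>x. g x - f x) < s"
        using that(2) by auto
      then show ?thesis using F(5) G(4) that(1) by blast
    qed
    then show ?case using F(1-4) G(1-3) by (intro conjI exI[of _ "F \<union> G"] exI[of _ "min r s"]) auto
  next
    case (UN K)
    then obtain k where k: "k \<in> K" "f \<in> k" by blast
    obtain F r where F: "f \<in> schwartz_space" "finite F" "F \<subseteq> UNIV \<times> lists Basis" "r > 0"
      "\<forall>g\<in>schwartz_space. (\<forall>(n, bs)\<in>F. schwartz_seminorm n bs (\<lambda>x. g x - f x) < r) \<longrightarrow> g \<in> k"
      using UN.IH[OF k] by blast
    show ?case using F k(1) by (intro conjI exI[of _ F] exI[of _ r]) auto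
  next
    case (Basis s)
    then obtain n bs f0 r where s: "s = {g \<in> schwartz_space. schwartz_seminorm n bs (\<lambda>x. g x - f0 x) < r}" "bs \<in> lists Basis" "f0 \<in> schwartz_space" "r > 0"
      by blast
    have f: "f \<in> schwartz_space" "schwartz_seminorm n bs (\<lambda>x. f x - f0 x) < r" using Basis s by auto
    \<comment> \<open>Subbasic sets are balls about some other centre \<open>f0\<close>; the
      triangle inequality leaves room for a ball of radius t about f.\<close>
    define t where "t = r - schwartz_seminorm n bs (\<lambda>x. f x - f0 x)"
    have "g \<in> s" if g: "g \<in> schwartz_space" "schwartz_seminorm n bs (\<lambda>x. g x - f x) < t" for g
      using schwartz_add(2)[OF schwartz_diff[OF g(1) f(1)] schwartz_diff[OF f(1) s(3)] s(2), of n] g by (simp add: s t_def)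
    then show ?case using f s by (intro conjI exI[of _ "{(n, bs)}"] exI[of _ t]) (auto simp: t_def)
  qed
qed

lemma topspace_schwartz_topology: "topspace schwartz_topology = (schwartz_space :: ('a::euclidean_space \<Rightarrow> complex) set)"
proof
  show "topspace schwartz_topology \<subseteq> (schwartz_space :: ('a \<Rightarrow> complex) set)"
    unfolding schwartz_topology_def topology_generated_by_topspace by auto
  show "(schwartz_space :: ('a \<Rightarrow> complex) set) \<subseteq> topspace schwartz_topology"
  proof
    fix f :: "'a \<Rightarrow> complex" assume f: "f \<in> schwartz_space"
    have "openin schwartz_topology {g \<in> schwartz_space. schwartz_seminorm 0 [] (\<lambda>x. g x - f x) < 1}"
      unfolding schwartz_topology_def
      by (rule topology_generated_by_Basis, rule CollectI, rule exI[of _ 0], rule exI[of _ "[]"], rule exI[of _ f], rule exI[of _ 1])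
        (use f in simp)
    moreover have "f \<in> {g \<in> schwartz_space. schwartz_seminorm 0 [] (\<lambda>x. g x - f x) < 1}"
      using f by (auto simp: schwartz_seminorm_def)
    ultimately show "f \<in> topspace schwartz_topology" using openin_subset by blast
  qed
qed

lemma openin_schwartz_ball:
  assumes "finite F" "F \<subseteq> UNIV \<times> lists Basis" "r > 0" "f \<in> schwartz_space"
  shows "openin schwartz_topology {g \<in> schwartz_space. \<forall>(n, bs)\<in>F. schwartz_seminorm n bs (\<lambda>x. g x - f x) < r}"
  using assms(1,2)
proof (induction F rule: finite_induct)
  case empty
  then show ?case using openin_topspace[of schwartz_topology] by (simp add: topspace_schwartz_topology)
next
  case (insert x F)
  obtain n bs where x: "x = (n, bs)" by force
  have "openin schwartz_topology {g \<in> schwartz_space. schwartz_seminorm n bs (\<lambda>x. g x - f x) < r}"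
    unfolding schwartz_topology_def using insert x assms by (intro topology_generated_by_Basis) auto
  moreover have "openin schwartz_topology {g \<in> schwartz_space. \<forall>(n, bs)\<in>F. schwartz_seminorm n bs (\<lambda>x. g x - f x) < r}"
    using insert by auto
  ultimately have "openin schwartz_topology ({g \<in> schwartz_space. schwartz_seminorm n bs (\<lambda>x. g x - f x) < r} \<inter>
     {g \<in> schwartz_space. \<forall>(n, bs)\<in>F. schwartz_seminorm n bs (\<lambda>x. g x - f x) < r})" by (rule openin_Int)
  also have "\<dots> = {g \<in> schwartz_space. \<forall>(n, bs)\<in>insert x F. schwartz_seminorm n bs (\<lambda>x. g x - f x) < r}"
    by (auto simp: x)
  finally show ?case .
qed

text \<open>The usual argument for linear functionals on a locally convex space: a neighbourhood of
  0 on which |u| < 1 yields a bound by scaling, and additivity spreads a bound to continuity at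
  every point.\<close>

lemma tempered_iff:
  "u \<in> tempered_distributions \<longleftrightarrow> (\<forall>\<phi>. \<phi> \<notin> schwartz_space \<longrightarrow> u \<phi> = 0) \<and>
     (\<forall>\<phi>\<in>schwartz_space. \<forall>\<psi>\<in>schwartz_space. u (\<lambda>x. \<phi> x + \<psi> x) = u \<phi> + u \<psi>) \<and>
     (\<forall>z. \<forall>\<phi>\<in>schwartz_space. u (\<lambda>x. z * \<phi> x) = z * u \<phi>) \<and>
     schwartz_bounded (\<lambda>\<phi>. norm (u \<phi>))"
proof -
  have "continuous_map schwartz_topology euclidean u \<longleftrightarrow> schwartz_bounded (\<lambda>\<phi>. norm (u \<phi>))"
    if add: "\<And>\<phi> \<psi>. \<phi> \<in> schwartz_space \<Longrightarrow> \<psi> \<in> schwartz_space \<Longrightarrow> u (\<lambda>x. \<phi> x + \<psi> x) = u \<phi> + u \<psi>"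
      and scale: "\<And>z \<phi>. \<phi> \<in> schwartz_space \<Longrightarrow> u (\<lambda>x. z * \<phi> x) = z * u \<phi>"
  proof
    assume c: "continuous_map schwartz_topology euclidean u"
    have u0: "u (\<lambda>x. 0) = 0" using scale[OF schwartz_zero, of 0] by simp
    have "openin schwartz_topology {g \<in> topspace schwartz_topology. u g \<in> ball 0 1}"
      by (rule openin_continuous_map_preimage[OF c]) auto
    moreover have "(\<lambda>x. 0) \<in> {g \<in> topspace schwartz_topology. u g \<in> ball 0 1}"
      by (simp add: topspace_schwartz_topology schwartz_zero u0)
    ultimately obtain F r where F: "finite F" "F \<subseteq> UNIV \<times> lists Basis" "r > 0"
      "\<And>g. g \<in> schwartz_space \<Longrightarrow> (\<forall>(n, bs)\<in>F. schwartz_seminorm n bs g < r) \<Longrightarrow> norm (u g) < 1"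
      using openin_schwartz_nbhd[of "{g \<in> topspace schwartz_topology. u g \<in> ball 0 1}" "\<lambda>x. 0"] by auto
    have "norm (u \<phi>) \<le> (1 / r) * (\<Sum>(n, bs)\<in>F. schwartz_seminorm n bs \<phi>)" if \<phi>: "\<phi> \<in> schwartz_space" for \<phi>
    proof -
      define s where "s = (\<Sum>x\<in>F. schwartz_seminorm (fst x) (snd x) \<phi>)"
      have nn: "schwartz_seminorm (fst x) (snd x) \<phi> \<ge> 0" if "x \<in> F" for x
        using that F(2) by (intro schwartz_seminorm_nonneg[OF \<phi>]) auto
      have s: "s \<ge> 0" unfolding s_def by (intro sum_nonneg nn)
      have "norm (u \<phi>) * r \<le> s + e" if e: "e > 0" for e
      proof -
        \<comment> \<open>The slack e avoids a division by 0 when all seminorms involved vanish on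
          the test function.\<close>
        define t where "t = r / (s + e)"
        have t: "t > 0" using s e F(3) by (simp add: t_def)
        have "norm (u (\<lambda>x. complex_of_real t * \<phi> x)) < 1"
        proof (rule F(4)[OF schwartz_cmult(1)[OF \<phi>]], clarify)
          fix n bs assume nb: "(n, bs) \<in> F"
          have "schwartz_seminorm n bs (\<lambda>x. complex_of_real t * \<phi> x) \<le> t * schwartz_seminorm n bs \<phi>"
            using schwartz_cmult(2)[OF \<phi>, of bs n "complex_of_real t"] nb F(2) t by auto
          also have "schwartz_seminorm n bs \<phi> \<le> s" unfolding s_def
            using member_le_sum[OF nb, of "\<lambda>x. schwartz_seminorm (fst x) (snd x) \<phi>"] nn F(1) by auto
          also have "t * s < r" using s e F(3) by (simp add: t_def field_simps)
          finally show "schwartz_seminorm n bs (\<lambda>x. complex_of_real t * \<phi> x) < r" using t by simp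
        qed
        then have "t * norm (u \<phi>) < 1" using t by (simp add: scale[OF \<phi>] norm_mult)
        then show ?thesis using s e by (simp add: t_def field_simps)
      qed
      then have "norm (u \<phi>) * r \<le> s" by (rule field_le_epsilon)
      then show ?thesis using F(3) by (simp add: s_def case_prod_beta field_simps)
    qed
    then show "schwartz_bounded (\<lambda>\<phi>. norm (u \<phi>))"
      unfolding schwartz_bounded_def using F by (intro exI[of _ F] exI[of _ "1 / r"]) auto
  next
    assume "schwartz_bounded (\<lambda>\<phi>. norm (u \<phi>))"
    then obtain F C where F: "finite F" "F \<subseteq> UNIV \<times> lists Basis" "C \<ge> 0"
      "\<And>\<phi>. \<phi> \<in> schwartz_space \<Longrightarrow> norm (u \<phi>) \<le> C * (\<Sum>(n, bs)\<in>F. schwartz_seminorm n bs \<phi>)"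
      unfolding schwartz_bounded_def by blast
    have *: "\<exists>U. openin schwartz_topology U \<and> f \<in> U \<and> (\<forall>g\<in>U. u g \<in> V)" if V: "open V" and f: "f \<in> schwartz_space" "u f \<in> V" for V f
    proof -
      obtain e where e: "e > 0" "ball (u f) e \<subseteq> V" using V f(2) openE by blast
      \<comment> \<open>The summand 1 keeps the denominator positive when F is empty or C is
        0.\<close>
      define r where "r = e / (C * card F + 1)"
      have r: "r > 0" using e F(3) by (auto simp: r_def intro!: divide_pos_pos add_nonneg_pos)
      let ?U = "{g \<in> schwartz_space. \<forall>(n, bs)\<in>F. schwartz_seminorm n bs (\<lambda>x. g x - f x) < r}"
      have "u g \<in> V" if g: "g \<in> ?U" for g
      proof -
        have gS: "g \<in> schwartz_space" using g by simp
        have "u g = u f + u (\<lambda>x. g x - f x)" using add[OF f(1) schwartz_diff[OF gS f(1)]] by simp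
        then have "dist (u f) (u g) = norm (u (\<lambda>x. g x - f x))" by (simp add: dist_norm)
        also have "\<dots> \<le> C * (\<Sum>(n, bs)\<in>F. schwartz_seminorm n bs (\<lambda>x. g x - f x))"
          by (rule F(4)[OF schwartz_diff[OF gS f(1)]])
        also have "\<dots> \<le> C * (\<Sum>x\<in>F. r)" using g F(3) by (intro mult_left_mono sum_mono) auto
        also have "\<dots> < (C * card F + 1) * r" using r by (simp add: algebra_simps)
        also have "\<dots> = e" using F(3) by (simp add: r_def add_nonneg_eq_0_iff)
        finally show ?thesis using e(2) by auto
      qed
      moreover have "schwartz_seminorm n bs (\<lambda>x. f x - f x) < r" if "bs \<in> lists Basis" for n bs
        using schwartz_cmult(2)[OF schwartz_zero that, of n 0] r by simp
      then have "f \<in> ?U" using f(1) F(2) by auto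
      ultimately show ?thesis using openin_schwartz_ball[OF F(1,2) r f(1)] by blast
    qed
    show "continuous_map schwartz_topology euclidean u"
      unfolding continuous_map_def topspace_schwartz_topology
    proof (intro conjI allI impI)
      fix V :: "complex set" assume "openin euclidean V"
      then have V: "open V" by simp
      show "openin schwartz_topology {f \<in> schwartz_space. u f \<in> V}"
      proof (subst openin_subopen, intro ballI)
        fix f assume "f \<in> {f \<in> schwartz_space. u f \<in> V}"
        then obtain U where U: "openin schwartz_topology U" "f \<in> U" "\<forall>g\<in>U. u g \<in> V" using *[OF V] by blast
        moreover have "U \<subseteq> schwartz_space" using openin_subset[OF U(1)] by (simp add: topspace_schwartz_topology)
        ultimately show "\<exists>T. openin schwartz_topology T \<and> f \<in> T \<and> T \<subseteq> {f \<in> schwartz_space. u f \<in> V}"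
          by (intro exI[of _ U]) auto
      qed
    qed auto
  qed
  note continuous_iff = this
  show ?thesis unfolding tempered_distributions_def mem_Collect_eq
    by (intro conj_cong refl continuous_iff) auto
qed

section \<open>Integration of Schwartz functions over a Euclidean space\<close>

definition weight :: "'a::euclidean_space \<Rightarrow> real" where
  "weight x = (\<Prod>b\<in>Basis. 1 / (1 + (x \<bullet> b)\<^sup>2))"

lemma weight_pos: "weight x > 0"
  unfolding weight_def by (intro prod_pos) (auto intro!: divide_pos_pos add_pos_nonneg)

lemma weight_measurable [measurable]: "weight \<in> borel_measurable borel"
proof -
  have "continuous_on UNIV (weight :: 'a \<Rightarrow> real)"
    unfolding weight_def[abs_def] by (intro continuous_intros) (auto simp: add_nonneg_eq_0_iff)
  then show ?thesis by (rule borel_measurable_continuous_onI)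
qed

text \<open>On the half-line the primitive arctan has the finite limit pi / 2; the other half
  follows by reflection.\<close>

lemma nn_integral_inverse_1_plus_square: "(\<integral>\<^sup>+x. ennreal (1 / (1 + x\<^sup>2)) \<partial>lborel) < \<infinity>"
proof -
  let ?f = "\<lambda>x::real. 1 / (1 + x\<^sup>2)"
  have p: "1 + x\<^sup>2 > (0::real)" for x by (intro add_pos_nonneg) auto
  have 1: "(\<integral>\<^sup>+x. ennreal (?f x) * indicator {0..} x \<partial>lborel) = ennreal (pi / 2 - arctan 0)"
  proof (rule nn_integral_FTC_atLeast[where F = arctan])
    show "DERIV arctan x :> ?f x" for x using DERIV_arctan[of x] by (simp add: inverse_eq_divide)
    show "0 \<le> ?f x" for x using p[of x] by simp
    show "(arctan \<longlongrightarrow> pi / 2) at_top" by (rule tendsto_arctan_at_top)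
  qed simp
  have 2: "(\<integral>\<^sup>+x. ennreal (?f x) * indicator {..0} x \<partial>lborel) = (\<integral>\<^sup>+x. ennreal (?f x) * indicator {0..} x \<partial>lborel)"
    by (subst nn_integral_real_affine[where c = "-1" and t = 0]) (auto intro!: nn_integral_cong split: split_indicator)
  have "(\<integral>\<^sup>+x. ennreal (?f x) \<partial>lborel) \<le> (\<integral>\<^sup>+x. ennreal (?f x) * indicator {0..} x + ennreal (?f x) * indicator {..0} x \<partial>lborel)"
    by (intro nn_integral_mono) (auto split: split_indicator)
  also have "\<dots> = (\<integral>\<^sup>+x. ennreal (?f x) * indicator {0..} x \<partial>lborel) + (\<integral>\<^sup>+x. ennreal (?f x) * indicator {..0} x \<partial>lborel)"
    by (rule nn_integral_add) auto
  also have "\<dots> < \<infinity>" unfolding 2 1 by simp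
  finally show ?thesis .
qed

text \<open>The product form of \<open>weight\<close> reduces integrability in every dimension to
  the integral of 1 / (1 + t^2) on the line.\<close>

lemma integrable_weight: "integrable lborel (weight :: 'a::euclidean_space \<Rightarrow> real)"
proof (rule integrableI_bounded)
  show "(weight :: 'a \<Rightarrow> real) \<in> borel_measurable lborel" by simp
  have "(\<integral>\<^sup>+x. ennreal (norm (weight (x::'a))) \<partial>lborel) = (\<integral>\<^sup>+x. (\<Prod>b\<in>Basis. ennreal (1 / (1 + ((x::'a) \<bullet> b)\<^sup>2))) \<partial>lborel)"
  proof (rule nn_integral_cong)
    fix x :: 'a
    have "norm (weight x) = (\<Prod>b\<in>Basis. 1 / (1 + (x \<bullet> b)\<^sup>2))" using weight_pos[of x] by (simp add: weight_def)
    also have "ennreal \<dots> = (\<Prod>b\<in>Basis. ennreal (1 / (1 + (x \<bullet> b)\<^sup>2)))"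
      by (rule prod_ennreal[symmetric]) (auto simp: add_nonneg_nonneg)
    finally show "ennreal (norm (weight x)) = (\<Prod>b\<in>Basis. ennreal (1 / (1 + (x \<bullet> b)\<^sup>2)))" .
  qed
  also have "\<dots> = (\<Prod>b\<in>(Basis :: 'a set). (\<integral>\<^sup>+x. ennreal (1 / (1 + x\<^sup>2)) \<partial>lborel))"
    by (rule nn_integral_lborel_prod[where f = "\<lambda>b x. ennreal (1 / (1 + x\<^sup>2))"]) auto
  also have "\<dots> < \<infinity>" using nn_integral_inverse_1_plus_square by (simp add: power_less_top_ennreal)
  finally show "(\<integral>\<^sup>+x. ennreal (norm (weight (x::'a))) \<partial>lborel) < \<infinity>" .
qed

text \<open>With d the dimension, the reciprocal of the weight is at most (1 + |x|^2)^d <= 2^d (1 +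
  |x|^(2 d)), so two seminorms without derivatives suffice.\<close>

lemma schwartz_weight:
  fixes \<phi> :: "'a::euclidean_space \<Rightarrow> complex"
  assumes \<phi>: "\<phi> \<in> schwartz_space"
  shows "norm (\<phi> x) \<le> 2 ^ DIM('a) * (schwartz_seminorm 0 [] \<phi> + schwartz_seminorm (2 * DIM('a)) [] \<phi>) * weight x"
proof -
  define d where "d = DIM('a)"
  define t where "t = (norm x)\<^sup>2"
  have t: "t \<ge> 0" by (simp add: t_def)
  have "weight x * (\<Prod>b\<in>Basis. (1 + (x \<bullet> b)\<^sup>2)) = 1"
    unfolding weight_def prod.distrib[symmetric] by (rule prod.neutral) (auto simp: add_nonneg_eq_0_iff)
  then have "inverse (weight x) = (\<Prod>b\<in>Basis. (1 + (x \<bullet> b)\<^sup>2))" by (rule inverse_unique)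
  also have "\<dots> \<le> (\<Prod>b\<in>(Basis :: 'a set). (1 + t))"
    unfolding t_def by (intro prod_mono conjI add_mono order_refl) (auto simp: Basis_le_norm abs_le_square_iff[symmetric])
  also have "\<dots> = (1 + t) ^ d" by (simp add: d_def)
  also have "\<dots> \<le> (2 * max 1 t) ^ d" using t by (intro power_mono) auto
  also have "\<dots> = 2 ^ d * (max 1 t) ^ d" by (rule power_mult_distrib)
  also have "(max 1 t) ^ d \<le> 1 + t ^ d" using t by (auto simp: max_def)
  finally have 1: "inverse (weight x) \<le> 2 ^ d * (1 + norm x ^ (2 * d))" by (simp add: t_def power_mult[symmetric])
  have "norm (\<phi> x) * inverse (weight x) \<le> norm (\<phi> x) * (2 ^ d * (1 + norm x ^ (2 * d)))"
    by (intro mult_left_mono 1) auto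
  also have "\<dots> = 2 ^ d * (norm x ^ 0 * norm (iter_deriv [] \<phi> x) + norm x ^ (2 * d) * norm (iter_deriv [] \<phi> x))"
    by (simp add: algebra_simps)
  also have "\<dots> \<le> 2 ^ d * (schwartz_seminorm 0 [] \<phi> + schwartz_seminorm (2 * d) [] \<phi>)"
    by (intro mult_left_mono add_mono schwartz_seminorm_upper \<phi>) auto
  finally show ?thesis using weight_pos[of x] by (simp add: d_def field_simps)
qed

lemma schwartz_bounded_by_weight:
  assumes "\<phi> \<in> schwartz_space" shows "\<exists>C\<ge>0. \<forall>x. norm (\<phi> x) \<le> C * weight x"
  using schwartz_weight[OF assms] schwartz_seminorm_nonneg[OF assms, of "[]"]
  by (intro exI[of _ "2 ^ DIM('a) * (schwartz_seminorm 0 [] \<phi> + schwartz_seminorm (2 * DIM('a)) [] \<phi>)"]) auto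

lemma schwartz_continuous: "\<phi> \<in> schwartz_space \<Longrightarrow> continuous_on UNIV \<phi>"
  using smooth_differentiable[of \<phi> "[]"] schwartz_smooth[of \<phi>]
  by (auto intro!: differentiable_imp_continuous_on simp: differentiable_on_def)

lemma schwartz_measurable: "\<phi> \<in> schwartz_space \<Longrightarrow> \<phi> \<in> borel_measurable borel"
  by (intro borel_measurable_continuous_onI schwartz_continuous)

lemma integrable_by_weight:
  fixes f :: "'a::euclidean_space \<Rightarrow> complex"
  assumes "f \<in> borel_measurable borel" "\<And>x. norm (f x) \<le> C * weight x"
  shows "integrable lborel f"
  by (rule Bochner_Integration.integrable_bound[OF integrable_mult_right[OF integrable_weight, of C]])
    (use assms weight_pos in \<open>auto intro!: always_eventually intro: order_trans[OF _ abs_ge_self]\<close>)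

lemma schwartz_integrable: "\<phi> \<in> schwartz_space \<Longrightarrow> integrable lborel \<phi>"
  using schwartz_bounded_by_weight[of \<phi>] integrable_by_weight[OF schwartz_measurable[of \<phi>]] by blast

lemma schwartz_sup_bound: "\<phi> \<in> schwartz_space \<Longrightarrow> norm (\<phi> x) \<le> schwartz_seminorm 0 [] \<phi>"
  using schwartz_seminorm_upper[of \<phi> "[]" x 0] by simp

lemma schwartz_mult_integrable:
  assumes "\<phi> \<in> schwartz_space" "\<psi> \<in> schwartz_space" shows "integrable lborel (\<lambda>x. \<phi> x * \<psi> x)"
proof -
  obtain C where C: "C \<ge> 0" "\<And>x. norm (\<phi> x) \<le> C * weight x" using schwartz_bounded_by_weight[OF assms(1)] by blast
  have "norm (\<phi> x * \<psi> x) \<le> (C * schwartz_seminorm 0 [] \<psi>) * weight x" for x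
    using mult_mono[OF C(2)[of x] schwartz_sup_bound[OF assms(2), of x]] C(1) weight_pos[of x]
    by (simp add: norm_mult mult_ac)
  then show ?thesis
    by (intro integrable_by_weight[of _ "C * schwartz_seminorm 0 [] \<psi>"] borel_measurable_times schwartz_measurable assms)
qed

lemma schwartz_bounded_L1: "schwartz_bounded (\<lambda>\<phi>::'a::euclidean_space \<Rightarrow> complex. LINT x|lborel. norm (\<phi> x))"
proof -
  let ?I = "LINT x|lborel. weight (x::'a)"
  have I: "?I \<ge> 0" by (intro integral_nonneg_AE always_eventually allI less_imp_le weight_pos)
  have "schwartz_bounded (\<lambda>\<phi>::'a \<Rightarrow> complex. (?I * 2 ^ DIM('a)) * (schwartz_seminorm 0 [] \<phi> + schwartz_seminorm (2 * DIM('a)) [] \<phi>))"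
    using I by (intro schwartz_bounded_cmult schwartz_bounded_add schwartz_bounded_seminorm) auto
  then show ?thesis
  proof (rule schwartz_bounded_mono)
    fix \<phi> :: "'a \<Rightarrow> complex" assume \<phi>: "\<phi> \<in> schwartz_space"
    have "(LINT x|lborel. norm (\<phi> x)) \<le> (LINT x::'a|lborel. (2 ^ DIM('a) * (schwartz_seminorm 0 [] \<phi> + schwartz_seminorm (2 * DIM('a)) [] \<phi>)) * weight x)"
      by (rule integral_mono) (auto intro!: integrable_norm schwartz_integrable \<phi> integrable_weight schwartz_weight)
    then show "(LINT x|lborel. norm (\<phi> x)) \<le> (?I * 2 ^ DIM('a)) * (schwartz_seminorm 0 [] \<phi> + schwartz_seminorm (2 * DIM('a)) [] \<phi>)"
      by (simp add: mult_ac)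
  qed
qed

text \<open>The two factors are treated differently on purpose: the L^1 norm is a bounded function
  of \<phi>, and the supremum of \<psi> can be tracked along a family.\<close>

lemma norm_integral_mult_le:
  assumes "\<phi> \<in> schwartz_space" "\<psi> \<in> schwartz_space"
  shows "norm (LINT x|lborel. \<phi> x * \<psi> x) \<le> schwartz_seminorm 0 [] \<psi> * (LINT x|lborel. norm (\<phi> x))"
proof -
  have "norm (LINT x|lborel. \<phi> x * \<psi> x) \<le> (LINT x|lborel. norm (\<phi> x * \<psi> x))" by (rule integral_norm_bound)
  also have "\<dots> \<le> (LINT x|lborel. schwartz_seminorm 0 [] \<psi> * norm (\<phi> x))"
  proof (rule integral_mono)
    show "integrable lborel (\<lambda>x. norm (\<phi> x * \<psi> x))" by (rule integrable_norm[OF schwartz_mult_integrable[OF assms]])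
    show "integrable lborel (\<lambda>x. schwartz_seminorm 0 [] \<psi> * norm (\<phi> x))"
      by (rule integrable_mult_right[OF integrable_norm[OF schwartz_integrable[OF assms(1)]]])
    show "norm (\<phi> x * \<psi> x) \<le> schwartz_seminorm 0 [] \<psi> * norm (\<phi> x)" for x
      using mult_right_mono[OF schwartz_sup_bound[OF assms(2), of x], of "norm (\<phi> x)"] by (simp add: norm_mult mult_ac)
  qed
  finally show ?thesis by simp
qed

lemma schwartz_bounded_integral:
  assumes "\<psi> \<in> schwartz_space" shows "schwartz_bounded (\<lambda>\<phi>. norm (LINT x|lborel. \<phi> x * \<psi> x))"
proof -
  have "0 \<le> schwartz_seminorm 0 [] \<psi>" by (rule schwartz_seminorm_nonneg[OF assms]) simp
  from schwartz_bounded_cmult[OF schwartz_bounded_L1 this] show ?thesis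
    by (rule schwartz_bounded_mono) (rule norm_integral_mult_le[OF _ assms])
qed

lemma weight_translate:
  assumes "b \<in> Basis" "\<bar>s\<bar> \<le> 1" shows "weight (x + s *\<^sub>R b) \<le> 3 ^ DIM('a) * weight (x::'a::euclidean_space)"
proof -
  have "weight (x + s *\<^sub>R b) \<le> (\<Prod>c\<in>(Basis::'a set). 3 * (1 / (1 + (x \<bullet> c)\<^sup>2)))"
    unfolding weight_def
  proof (rule prod_mono, intro conjI)
    fix c :: 'a assume c: "c \<in> Basis"
    define t where "t = (s *\<^sub>R b) \<bullet> c"
    have t: "\<bar>t\<bar> \<le> 1" using assms c by (auto simp: t_def inner_Basis)
    have y: "(x + s *\<^sub>R b) \<bullet> c = x \<bullet> c + t" by (simp add: t_def inner_add_left)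
    have "t\<^sup>2 \<le> 1" using t by (simp add: abs_square_le_1)
    \<comment> \<open>This square together with t^2 <= 1 is the origin of the constant 3.\<close>
    moreover have "0 \<le> (2 * (x \<bullet> c) + 3 * t)\<^sup>2" by simp
    ultimately have "1 + (x \<bullet> c)\<^sup>2 \<le> 3 * (1 + (x \<bullet> c + t)\<^sup>2)" by (simp add: power2_eq_square algebra_simps)
    moreover have "0 < 1 + (x \<bullet> c)\<^sup>2" "0 < 1 + (x \<bullet> c + t)\<^sup>2" by (auto intro: add_pos_nonneg)
    ultimately show "1 / (1 + ((x + s *\<^sub>R b) \<bullet> c)\<^sup>2) \<le> 3 * (1 / (1 + (x \<bullet> c)\<^sup>2))"
      unfolding y by (simp add: field_simps)
  qed auto
  then show ?thesis by (simp only: prod.distrib prod_constant weight_def)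
qed

lemma has_vector_derivative_along:
  assumes "f differentiable (at (x + s *\<^sub>R b))"
  shows "((\<lambda>s. f (x + s *\<^sub>R b)) has_vector_derivative partial_deriv b f (x + s *\<^sub>R b)) (at s within S)"
proof -
  have "((\<lambda>s. x + s *\<^sub>R b) has_derivative (\<lambda>h. h *\<^sub>R b)) (at s)" by (auto intro!: derivative_eq_intros)
  from diff_chain_at[OF this assms[unfolded frechet_derivative_works]]
  have "((\<lambda>s. f (x + s *\<^sub>R b)) has_derivative (\<lambda>h. frechet_derivative f (at (x + s *\<^sub>R b)) (h *\<^sub>R b))) (at s)" by (simp add: o_def)
  also have "(\<lambda>h. frechet_derivative f (at (x + s *\<^sub>R b)) (h *\<^sub>R b)) = (\<lambda>h. h *\<^sub>R partial_deriv b f (x + s *\<^sub>R b))"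
    using linear_scale[OF linear_frechet_derivative[OF assms]] by (simp add: partial_deriv_def)
  finally show ?thesis by (auto simp: has_vector_derivative_def intro: has_derivative_at_withinI)
qed

text \<open>By translation invariance every difference quotient of f has integral 0, and dominated
  convergence passes to the derivative. No slicing of the integral along b is required.\<close>

lemma integral_partial_deriv_zero:
  fixes f :: "'a::euclidean_space \<Rightarrow> complex"
  assumes b: "b \<in> Basis" and d: "\<And>x. f differentiable (at x)"
    and f: "\<And>x. norm (f x) \<le> C * weight x" and f': "\<And>x. norm (partial_deriv b f x) \<le> C * weight x"
    and m: "partial_deriv b f \<in> borel_measurable borel"
  shows "(LINT x|lborel. partial_deriv b f x) = 0"
proof -
  have C: "C \<ge> 0" using order_trans[OF norm_ge_zero f[of 0]] weight_pos[of "0::'a"] by (simp add: zero_le_mult_iff)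
  have cont: "continuous_on UNIV f" using d by (auto intro!: differentiable_imp_continuous_on simp: differentiable_on_def)
  have fm [measurable]: "f \<in> borel_measurable borel" by (rule borel_measurable_continuous_onI[OF cont])
  have fi: "integrable lborel f" by (rule integrable_by_weight[OF fm f])
  \<comment> \<open>Increments of length at most 1, the range in which
    \<open>weight_translate\<close> supplies a dominating function.\<close>
  define t where "t n = 1 / real (Suc n)" for n
  have t: "t n > 0" "t n \<le> 1" for n by (auto simp: t_def divide_le_eq)
  define s where "s n x = (f (x + t n *\<^sub>R b) - f x) / of_real (t n)" for n x
  have tr: "integrable lborel (\<lambda>x. f (x + v))" "(LINT x|lborel. f (x + v)) = (LINT x|lborel. f x)" for v
  proof -
    have "integrable (distr lborel borel ((+) v)) f" "(LINT x|distr lborel borel ((+) v). f x) = (LINT x|lborel. f x)"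
      using fi by (simp_all add: lborel_distr_plus)
    then show "integrable lborel (\<lambda>x. f (x + v))" "(LINT x|lborel. f (x + v)) = (LINT x|lborel. f x)"
      by (simp_all add: integrable_distr_eq integral_distr add.commute)
  qed
  have "(LINT x|lborel. s n x) = 0" for n
    unfolding s_def using fi tr by simp
  moreover have "(\<lambda>n. LINT x|lborel. s n x) \<longlonglongrightarrow> (LINT x|lborel. partial_deriv b f x)"
  proof (rule integral_dominated_convergence)
    show "partial_deriv b f \<in> borel_measurable lborel" using m by simp
    show "s n \<in> borel_measurable lborel" for n unfolding s_def[abs_def] by measurable
    show "integrable lborel (\<lambda>x::'a. (C * 3 ^ DIM('a)) * weight x)" by (rule integrable_mult_right[OF integrable_weight])
    show "AE x in lborel. (\<lambda>n. s n x) \<longlonglongrightarrow> partial_deriv b f x"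
    proof (intro always_eventually allI)
      fix x
      have "((\<lambda>s. f (x + s *\<^sub>R b)) has_vector_derivative partial_deriv b f x) (at 0)"
        using has_vector_derivative_along[of f x 0 b UNIV] d by simp
      then have lim: "((\<lambda>h. norm (f (x + (0 + h) *\<^sub>R b) - f (x + 0 *\<^sub>R b) - h *\<^sub>R partial_deriv b f x) / norm h) \<longlongrightarrow> 0) (at 0)"
        unfolding has_vector_derivative_def has_derivative_at by blast
      have "t \<longlonglongrightarrow> 0" unfolding t_def[abs_def] by (rule LIMSEQ_Suc[OF lim_1_over_n])
      then have "filterlim t (at 0) sequentially"
        using t by (auto simp: filterlim_at intro!: always_eventually less_imp_neq[symmetric])
      from filterlim_compose[OF lim this]
      have "(\<lambda>n. norm (f (x + t n *\<^sub>R b) - f x - t n *\<^sub>R partial_deriv b f x) / norm (t n)) \<longlonglongrightarrow> 0" by simp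
      also have "(\<lambda>n. norm (f (x + t n *\<^sub>R b) - f x - t n *\<^sub>R partial_deriv b f x) / norm (t n)) = (\<lambda>n. norm (s n x - partial_deriv b f x))"
      proof
        fix n
        have "s n x - partial_deriv b f x = (f (x + t n *\<^sub>R b) - f x - t n *\<^sub>R partial_deriv b f x) / of_real (t n)"
          using t(1)[of n] by (simp add: s_def scaleR_conv_of_real field_simps)
        then show "norm (f (x + t n *\<^sub>R b) - f x - t n *\<^sub>R partial_deriv b f x) / norm (t n) = norm (s n x - partial_deriv b f x)"
          by (simp add: norm_divide)
      qed
      finally show "(\<lambda>n. s n x) \<longlonglongrightarrow> partial_deriv b f x"
        using tendsto_norm_zero_iff LIM_zero_iff by blast
    qed
    show "AE x in lborel. norm (s n x) \<le> (C * 3 ^ DIM('a)) * weight x" for n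
    proof (intro always_eventually allI)
      fix x
      have "norm (f (x + t n *\<^sub>R b) - f (x + 0 *\<^sub>R b)) \<le> (C * 3 ^ DIM('a) * weight x) * norm (t n - 0)"
      proof (rule differentiable_bound[where S = "{0..t n}" and f = "\<lambda>s. f (x + s *\<^sub>R b)" and f' = "\<lambda>s h. h *\<^sub>R partial_deriv b f (x + s *\<^sub>R b)"])
        fix r assume r: "r \<in> {0..t n}"
        show "((\<lambda>s. f (x + s *\<^sub>R b)) has_derivative (\<lambda>h. h *\<^sub>R partial_deriv b f (x + r *\<^sub>R b))) (at r within {0..t n})"
          using has_vector_derivative_along[OF d] by (simp add: has_vector_derivative_def)
        have "norm (partial_deriv b f (x + r *\<^sub>R b)) \<le> C * (3 ^ DIM('a) * weight x)"
          using order_trans[OF f' mult_left_mono[OF weight_translate[OF b, of r x] C]] r t[of n] by simp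
        then show "onorm (\<lambda>h. h *\<^sub>R partial_deriv b f (x + r *\<^sub>R b)) \<le> C * 3 ^ DIM('a) * weight x"
        proof (intro onorm_bound)
          fix h :: real
          assume "norm (partial_deriv b f (x + r *\<^sub>R b)) \<le> C * (3 ^ DIM('a) * weight x)"
          from mult_left_mono[OF this, of "\<bar>h\<bar>"]
          show "norm (h *\<^sub>R partial_deriv b f (x + r *\<^sub>R b)) \<le> C * 3 ^ DIM('a) * weight x * norm h" by (simp add: mult_ac)
        qed (use C weight_pos[of x] in auto)
      qed (use t[of n] in auto)
      then show "norm (s n x) \<le> (C * 3 ^ DIM('a)) * weight x"
        using t[of n] by (simp add: s_def norm_divide divide_le_eq)
    qed
  qed
  ultimately show ?thesis by (simp add: LIMSEQ_const_iff)
qed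

lemma integration_by_parts:
  assumes b: "b \<in> Basis" and \<phi>: "\<phi> \<in> schwartz_space" and \<psi>: "\<psi> \<in> schwartz_space"
  shows "(LINT x|lborel. partial_deriv b \<phi> x * \<psi> x) = - (LINT x|lborel. \<phi> x * partial_deriv b \<psi> x)"
proof -
  note \<phi>' = schwartz_partial_deriv(1)[OF \<phi> b] and \<psi>' = schwartz_partial_deriv(1)[OF \<psi> b]
  have d\<phi>: "\<phi> differentiable (at x)" and d\<psi>: "\<psi> differentiable (at x)" for x
    using smooth_differentiable[OF schwartz_smooth[OF \<phi>], of "[]"] smooth_differentiable[OF schwartz_smooth[OF \<psi>], of "[]"] by auto
  have pd: "partial_deriv b (\<lambda>x. \<phi> x * \<psi> x) = (\<lambda>x. partial_deriv b \<phi> x * \<psi> x + \<phi> x * partial_deriv b \<psi> x)"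
    by (rule ext, rule partial_deriv_mult[OF d\<phi> d\<psi>])
  obtain C where C: "C \<ge> 0" "\<And>x. norm (\<phi> x) \<le> C * weight x" using schwartz_bounded_by_weight[OF \<phi>] by blast
  obtain C' where C': "C' \<ge> 0" "\<And>x. norm (partial_deriv b \<phi> x) \<le> C' * weight x" using schwartz_bounded_by_weight[OF \<phi>'] by blast
  define S where "S = schwartz_seminorm 0 [] \<psi> + schwartz_seminorm 0 [] (partial_deriv b \<psi>)"
  have S0: "schwartz_seminorm 0 [] \<psi> \<ge> 0" "schwartz_seminorm 0 [] (partial_deriv b \<psi>) \<ge> 0"
    by (auto intro!: schwartz_seminorm_nonneg \<psi> \<psi>')
  have S: "norm (\<psi> x) \<le> S" "norm (partial_deriv b \<psi> x) \<le> S" "0 \<le> S" for x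
    using schwartz_sup_bound[OF \<psi>, of x] schwartz_sup_bound[OF \<psi>', of x] S0 by (auto simp: S_def)
  have 1: "norm (\<phi> x * \<psi> x) \<le> (C * S) * weight x" "norm (\<phi> x * partial_deriv b \<psi> x) \<le> (C * S) * weight x"
    "norm (partial_deriv b \<phi> x * \<psi> x) \<le> (C' * S) * weight x" for x
    using mult_mono[OF C(2)[of x] S(1)[of x]] mult_mono[OF C(2)[of x] S(2)[of x]] mult_mono[OF C'(2)[of x] S(1)[of x]] C(1) C'(1) weight_pos[of x]
    by (simp_all add: norm_mult mult_ac)
  have 2: "(LINT x|lborel. partial_deriv b (\<lambda>x. \<phi> x * \<psi> x) x) = 0"
  proof (rule integral_partial_deriv_zero[where C = "C * S + C' * S", OF b])
    show "(\<lambda>x. \<phi> x * \<psi> x) differentiable at x" for x by (rule differentiable_mult[OF d\<phi> d\<psi>])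
    show "norm (\<phi> x * \<psi> x) \<le> (C * S + C' * S) * weight x" for x
      using 1(1)[of x] C'(1) S(3) weight_pos[of x] by (simp add: distrib_right add_increasing2)
    show "norm (partial_deriv b (\<lambda>x. \<phi> x * \<psi> x) x) \<le> (C * S + C' * S) * weight x" for x
      unfolding pd using norm_triangle_ineq[of "partial_deriv b \<phi> x * \<psi> x" "\<phi> x * partial_deriv b \<psi> x"] 1(2,3)[of x]
      by (simp add: distrib_right)
    show "partial_deriv b (\<lambda>x. \<phi> x * \<psi> x) \<in> borel_measurable borel"
      unfolding pd by (intro borel_measurable_add borel_measurable_times schwartz_measurable \<phi> \<psi> \<phi>' \<psi>')
  qed
  then show ?thesis
    unfolding pd by (simp add: schwartz_mult_integrable \<phi> \<psi> \<phi>' \<psi>' eq_neg_iff_add_eq_0)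
qed

section \<open>Expansions in an orthogonal basis of Schwartz functions\<close>

text \<open>Polynomial growth of each seminorm in the index is what rapidly decaying coefficients
  can outweigh, so that series over the family converge in the Schwartz space.\<close>

definition schwartz_family :: "(nat \<Rightarrow> 'a::euclidean_space \<Rightarrow> complex) \<Rightarrow> bool" where
  "schwartz_family e \<longleftrightarrow> (\<forall>i. e i \<in> schwartz_space) \<and>
     (\<forall>n. \<forall>bs\<in>lists Basis. \<exists>C N. C \<ge> 0 \<and> (\<forall>i. schwartz_seminorm n bs (e i) \<le> C * (1 + real i) ^ N))"

definition rapid_decay :: "(nat \<Rightarrow> complex) \<Rightarrow> bool" where
  "rapid_decay d \<longleftrightarrow> (\<forall>N. \<exists>C. \<forall>i. norm (d i) \<le> C / (1 + real i) ^ N)"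

lemma rapid_decay_cmult:
  assumes "rapid_decay d" shows "rapid_decay (\<lambda>i. c * d i)"
  unfolding rapid_decay_def
proof
  fix N
  obtain C where "\<And>i. norm (d i) \<le> C / (1 + real i) ^ N" using assms unfolding rapid_decay_def by blast
  from mult_left_mono[OF this norm_ge_zero[of c]]
  show "\<exists>C. \<forall>i. norm (c * d i) \<le> C / (1 + real i) ^ N" by (intro exI[of _ "norm c * C"]) (simp add: norm_mult)
qed

lemma rapid_decay_poly_growth_summable:
  assumes "rapid_decay d" "\<And>i. 0 \<le> a i" "\<And>i. a i \<le> C * (1 + real i) ^ N"
  shows "summable (\<lambda>i. norm (d i) * a i)"
proof -
  have C: "C \<ge> 0" using order_trans[OF assms(2)[of 0] assms(3)[of 0]] by simp
  obtain D where D: "\<And>i. norm (d i) \<le> D / (1 + real i) ^ (N + 2)" using assms(1) unfolding rapid_decay_def by blast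
  have D0: "D \<ge> 0" using order_trans[OF norm_ge_zero D[of 0]] by simp
  have "norm (norm (d i) * a i) \<le> (D * C) * (1 / (1 + real i)\<^sup>2)" for i
  proof -
    have "norm (d i) * a i \<le> D / (1 + real i) ^ (N + 2) * (C * (1 + real i) ^ N)"
      using D[of i] assms(2,3)[of i] D0 by (intro mult_mono) auto
    also have "\<dots> = (D * C) * (1 / (1 + real i)\<^sup>2)" unfolding power_add by (simp add: add_nonneg_eq_0_iff)
    finally show ?thesis using assms(2)[of i] by simp
  qed
  then show ?thesis by (intro summable_comparison_test'[OF summable_mult[OF summable_inverse_Suc_square, of "D * C"]]) auto
qed

lemma schwartz_family_summable:
  assumes "schwartz_family e" "rapid_decay d" "bs \<in> lists Basis"
  shows "summable (\<lambda>i. norm (d i) * schwartz_seminorm n bs (e i))"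
proof -
  obtain C N where "\<And>i. schwartz_seminorm n bs (e i) \<le> C * (1 + real i) ^ N"
    using assms(1,3) unfolding schwartz_family_def by blast
  then show ?thesis
    using assms by (intro rapid_decay_poly_growth_summable[of d _ C N]) (auto simp: schwartz_family_def intro!: schwartz_seminorm_nonneg)
qed

lemma frechet_derivative_expand:
  fixes f :: "'a::euclidean_space \<Rightarrow> complex"
  assumes "f differentiable (at x)"
  shows "frechet_derivative f (at x) h = (\<Sum>b\<in>Basis. (h \<bullet> b) *\<^sub>R partial_deriv b f x)"
proof -
  have lin: "linear (frechet_derivative f (at x))" by (rule linear_frechet_derivative[OF assms])
  have "frechet_derivative f (at x) h = frechet_derivative f (at x) (\<Sum>b\<in>Basis. (h \<bullet> b) *\<^sub>R b)"
    by (simp add: euclidean_representation)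
  also have "\<dots> = (\<Sum>b\<in>Basis. (h \<bullet> b) *\<^sub>R partial_deriv b f x)"
    by (simp add: linear_sum[OF lin] linear_scale[OF lin] partial_deriv_def)
  finally show ?thesis .
qed

text \<open>One summable sequence dominates the derivatives in operator norm on the whole space, so
  the series may be differentiated termwise everywhere at once.\<close>

lemma has_derivative_termwise:
  fixes g :: "nat \<Rightarrow> 'a::euclidean_space \<Rightarrow> complex"
  assumes d: "\<And>i x. g i differentiable (at x)"
    and K: "\<And>b i x. b \<in> Basis \<Longrightarrow> norm (partial_deriv b (g i) x) \<le> K b i" "\<And>b. b \<in> Basis \<Longrightarrow> summable (K b)"
    and s: "\<And>x. summable (\<lambda>i. g i x)"
  shows "((\<lambda>x. \<Sum>i. g i x) has_derivative (\<lambda>h. \<Sum>i. frechet_derivative (g i) (at x) h)) (at x)"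
proof -
  define K' where "K' i = (\<Sum>b\<in>Basis. K b i)" for i
  have K's: "summable K'" unfolding K'_def[abs_def] by (intro summable_sum K(2))
  have fb: "norm (frechet_derivative (g i) (at x) h) \<le> K' i * norm h" for i x h
  proof -
    have "norm (frechet_derivative (g i) (at x) h) \<le> (\<Sum>b\<in>Basis. K b i * norm h)"
      unfolding frechet_derivative_expand[OF d]
    proof (rule sum_norm_le)
      fix b :: 'a assume b: "b \<in> Basis"
      have "\<bar>h \<bullet> b\<bar> * norm (partial_deriv b (g i) x) \<le> norm h * K b i"
        using Basis_le_norm[OF b, of h] K(1)[OF b, of i x] by (intro mult_mono) auto
      then show "norm ((h \<bullet> b) *\<^sub>R partial_deriv b (g i) x) \<le> K b i * norm h" by (simp add: mult.commute)
    qed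
    then show ?thesis by (simp add: K'_def sum_distrib_right)
  qed
  have fs: "summable (\<lambda>i. norm (frechet_derivative (g i) (at x) h))" for x h
    by (rule summable_comparison_test'[OF summable_mult2[OF K's, of "norm h"]]) (use fb in auto)
  have "\<exists>G. \<forall>x\<in>UNIV. (\<lambda>n. g n x) sums G x \<and> (G has_derivative (\<lambda>h. \<Sum>i. frechet_derivative (g i) (at x) h)) (at x within UNIV)"
  proof (rule has_derivative_series[where x = 0])
    show "(g n has_derivative frechet_derivative (g n) (at x)) (at x within UNIV)" for n x
      using d[of n x] frechet_derivative_works by auto
    show "(\<lambda>n. g n 0) sums suminf (\<lambda>n. g n 0)" by (rule summable_sums[OF s])
    fix e :: real assume e: "e > 0"
    obtain M where M: "\<And>n. n \<ge> M \<Longrightarrow> norm (\<Sum>i. K' (i + n)) < e" using suminf_exist_split[OF e K's] by blast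
    have "norm ((\<Sum>i<n. frechet_derivative (g i) (at x) h) - (\<Sum>i. frechet_derivative (g i) (at x) h)) \<le> e * norm h" if n: "n \<ge> M" for n x h
    proof -
      have "(\<Sum>i. frechet_derivative (g i) (at x) h) = (\<Sum>i. frechet_derivative (g (i + n)) (at x) h) + (\<Sum>i<n. frechet_derivative (g i) (at x) h)"
        by (rule suminf_split_initial_segment[OF summable_norm_cancel[OF fs]])
      then have "norm ((\<Sum>i<n. frechet_derivative (g i) (at x) h) - (\<Sum>i. frechet_derivative (g i) (at x) h)) = norm (\<Sum>i. frechet_derivative (g (i + n)) (at x) h)"
        by (simp add: norm_minus_commute)
      also have "\<dots> \<le> (\<Sum>i. norm (frechet_derivative (g (i + n)) (at x) h))"
        using fs[of x h] by (intro summable_norm) (subst summable_iff_shift)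
      also have "\<dots> \<le> (\<Sum>i. K' (i + n) * norm h)"
      proof (rule suminf_le)
        show "summable (\<lambda>i. norm (frechet_derivative (g (i + n)) (at x) h))" using fs[of x h] by (subst summable_iff_shift)
        show "summable (\<lambda>i. K' (i + n) * norm h)" using K's by (intro summable_mult2) (subst summable_iff_shift)
      qed (rule fb)
      also have "\<dots> = (\<Sum>i. K' (i + n)) * norm h" using K's by (intro suminf_mult2[symmetric]) (subst summable_iff_shift)
      also have "\<dots> \<le> e * norm h" using M[OF n] by (intro mult_right_mono) auto
      finally show ?thesis .
    qed
    then show "\<forall>\<^sub>F n in sequentially. \<forall>x\<in>UNIV. \<forall>h. norm ((\<Sum>i<n. frechet_derivative (g i) (at x) h) - (\<Sum>i. frechet_derivative (g i) (at x) h)) \<le> e * norm h"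
      unfolding eventually_sequentially by blast
  qed auto
  then obtain G where G: "\<And>x. (\<lambda>n. g n x) sums G x" "\<And>x. (G has_derivative (\<lambda>h. \<Sum>i. frechet_derivative (g i) (at x) h)) (at x)" by auto
  have "G = (\<lambda>x. \<Sum>i. g i x)" using G(1) by (auto simp: sums_iff)
  then show ?thesis using G(2) by simp
qed

definition schwartz_series :: "(nat \<Rightarrow> complex) \<Rightarrow> (nat \<Rightarrow> 'a::euclidean_space \<Rightarrow> complex) \<Rightarrow> 'a \<Rightarrow> complex" where
  "schwartz_series d e x = (\<Sum>i. d i * e i x)"

text \<open>The order 0 seminorms for \<open>b # bs\<close> dominate the differentiated series, so
  termwise differentiation can be iterated along the list.\<close>

lemma schwartz_series_iter_deriv:
  assumes e: "schwartz_family e" and d: "rapid_decay d" and bs: "bs \<in> lists Basis"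
  shows "(\<forall>x. summable (\<lambda>i. norm (d i * iter_deriv bs (e i) x))) \<and> iter_deriv bs (schwartz_series d e) = (\<lambda>x. \<Sum>i. d i * iter_deriv bs (e i) x)
    \<and> (\<forall>x. iter_deriv bs (schwartz_series d e) differentiable (at x))"
proof -
  have eS: "e i \<in> schwartz_space" for i using e by (simp add: schwartz_family_def)
  have le: "norm (d i * iter_deriv bs (e i) x) \<le> norm (d i) * schwartz_seminorm 0 bs (e i)" if "bs \<in> lists Basis" for bs i x
    using schwartz_seminorm_upper[OF eS that, of x 0] by (simp add: norm_mult mult_left_mono)
  have s: "summable (\<lambda>i. norm (d i * iter_deriv bs (e i) x))" if "bs \<in> lists Basis" for bs x
    by (rule summable_comparison_test'[OF schwartz_family_summable[OF e d that, of 0]]) (use le[OF that] in auto)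
  have df: "(\<lambda>x. d i * iter_deriv bs (e i) x) differentiable (at x)" if "bs \<in> lists Basis" for bs i x
    by (intro differentiable_mult differentiable_const smooth_differentiable[OF schwartz_smooth[OF eS] that])
  have pd: "partial_deriv b (\<lambda>x. d i * iter_deriv bs (e i) x) x = d i * iter_deriv (b # bs) (e i) x" if "bs \<in> lists Basis" for b bs i x
    using partial_deriv_cmult[OF smooth_differentiable[OF schwartz_smooth[OF eS] that]] by simp
  have der: "((\<lambda>x. \<Sum>i. d i * iter_deriv bs (e i) x) has_derivative (\<lambda>h. \<Sum>i. frechet_derivative (\<lambda>x. d i * iter_deriv bs (e i) x) (at x) h)) (at x)"
    if bs: "bs \<in> lists Basis" for bs x
  proof (rule has_derivative_termwise[OF df[OF bs], where K = "\<lambda>b i. norm (d i) * schwartz_seminorm 0 (b # bs) (e i)"])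
    fix b :: 'a assume b: "b \<in> Basis"
    then have bbs: "b # bs \<in> lists Basis" using bs by simp
    show "norm (partial_deriv b (\<lambda>x. d i * iter_deriv bs (e i) x) x) \<le> norm (d i) * schwartz_seminorm 0 (b # bs) (e i)" for i x
      unfolding pd[OF bs] by (rule le[OF bbs])
    show "summable (\<lambda>i. norm (d i) * schwartz_seminorm 0 (b # bs) (e i))" by (rule schwartz_family_summable[OF e d bbs])
  qed (rule summable_norm_cancel[OF s[OF bs]])
  have eq: "iter_deriv bs (schwartz_series d e) = (\<lambda>x. \<Sum>i. d i * iter_deriv bs (e i) x)" if "bs \<in> lists Basis" for bs
    using that
  proof (induction bs)
    case Nil
    then show ?case by (simp add: schwartz_series_def[abs_def])
  next
    case (Cons b bs)
    show ?case
    proof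
      fix x
      have "iter_deriv (b # bs) (schwartz_series d e) x = (\<Sum>i. frechet_derivative (\<lambda>x. d i * iter_deriv bs (e i) x) (at x) b)"
        using partial_derivI[OF der[OF Cons.hyps(2)]] by (simp add: Cons.IH)
      also have "\<dots> = (\<Sum>i. d i * iter_deriv (b # bs) (e i) x)"
        using pd[OF Cons.hyps(2)] by (simp add: partial_deriv_def)
      finally show "iter_deriv (b # bs) (schwartz_series d e) x = (\<Sum>i. d i * iter_deriv (b # bs) (e i) x)" .
    qed
  qed
  show ?thesis using s[OF bs] eq[OF bs] der[OF bs] by (auto simp: differentiable_def)
qed

lemma schwartz_series_schwartz:
  assumes e: "schwartz_family e" and d: "rapid_decay d"
  shows "schwartz_series d e \<in> schwartz_space"
    and "bs \<in> lists Basis \<Longrightarrow> schwartz_seminorm n bs (schwartz_series d e) \<le> (\<Sum>i. norm (d i) * schwartz_seminorm n bs (e i))"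
proof -
  have *: "norm x ^ n * norm (iter_deriv bs (schwartz_series d e) x) \<le> (\<Sum>i. norm (d i) * schwartz_seminorm n bs (e i))"
    if bs: "bs \<in> lists Basis" for n bs x
  proof -
    have eS: "e i \<in> schwartz_space" for i using e by (simp add: schwartz_family_def)
    have s: "summable (\<lambda>i. norm (d i * iter_deriv bs (e i) x))" using schwartz_series_iter_deriv[OF e d bs] by blast
    have "norm (iter_deriv bs (schwartz_series d e) x) \<le> (\<Sum>i. norm (d i * iter_deriv bs (e i) x))"
      using schwartz_series_iter_deriv[OF e d bs] summable_norm[OF s] by simp
    then have "norm x ^ n * norm (iter_deriv bs (schwartz_series d e) x) \<le> norm x ^ n * (\<Sum>i. norm (d i * iter_deriv bs (e i) x))"
      by (intro mult_left_mono) auto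
    also have "\<dots> = (\<Sum>i. norm x ^ n * norm (d i * iter_deriv bs (e i) x))" by (rule suminf_mult[OF s, symmetric])
    also have "\<dots> \<le> (\<Sum>i. norm (d i) * schwartz_seminorm n bs (e i))"
    proof (rule suminf_le[OF _ summable_mult[OF s] schwartz_family_summable[OF e d bs]])
      fix i show "norm x ^ n * norm (d i * iter_deriv bs (e i) x) \<le> norm (d i) * schwartz_seminorm n bs (e i)"
        using mult_left_mono[OF schwartz_seminorm_upper[OF eS bs, of x n i], of "norm (d i)"] by (simp add: norm_mult mult_ac)
    qed
    finally show ?thesis .
  qed
  show "schwartz_series d e \<in> schwartz_space"
    unfolding schwartz_iff smooth_iff using * schwartz_series_iter_deriv[OF e d] by blast
  show "bs \<in> lists Basis \<Longrightarrow> schwartz_seminorm n bs (schwartz_series d e) \<le> (\<Sum>i. norm (d i) * schwartz_seminorm n bs (e i))"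
    using * by (rule schwartz_seminorm_le)
qed

lemma schwartz_linear_sum:
  assumes "\<And>\<phi> \<psi>. \<phi> \<in> schwartz_space \<Longrightarrow> \<psi> \<in> schwartz_space \<Longrightarrow> u (\<lambda>x. \<phi> x + \<psi> x) = u \<phi> + (u \<psi> :: complex)"
    and "\<And>z \<phi>. \<phi> \<in> schwartz_space \<Longrightarrow> u (\<lambda>x. z * \<phi> x) = z * u \<phi>"
    and "finite I" "\<And>i. i \<in> I \<Longrightarrow> e i \<in> schwartz_space"
  shows "u (\<lambda>x. \<Sum>i\<in>I. d i * e i x) = (\<Sum>i\<in>I. d i * u (e i))"
  using assms(3,4)
proof (induction I rule: finite_induct)
  case empty
  then show ?case using assms(2)[OF schwartz_zero, of 0] by simp
next
  case (insert i I)
  then have "(\<lambda>x. d i * e i x) \<in> schwartz_space" "(\<lambda>x. \<Sum>i\<in>I. d i * e i x) \<in> schwartz_space"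
    by (auto intro!: schwartz_cmult(1) schwartz_sum)
  then show ?case using insert assms(1)[of "\<lambda>x. d i * e i x" "\<lambda>x. \<Sum>i\<in>I. d i * e i x"] by (simp add: assms(2))
qed

text \<open>Linearity and boundedness of u are assumed one by one, since the result is also applied
  to integrals against a fixed function, which are not extended by 0 as the elements of
  \<open>tempered_distributions\<close> are.\<close>

lemma schwartz_series_sums:
  assumes e: "schwartz_family e" and d: "rapid_decay d"
    and add: "\<And>\<phi> \<psi>. \<phi> \<in> schwartz_space \<Longrightarrow> \<psi> \<in> schwartz_space \<Longrightarrow> u (\<lambda>x. \<phi> x + \<psi> x) = u \<phi> + (u \<psi> :: complex)"
    and scale: "\<And>z \<phi>. \<phi> \<in> schwartz_space \<Longrightarrow> u (\<lambda>x. z * \<phi> x) = z * u \<phi>"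
    and bdd: "schwartz_bounded (\<lambda>\<phi>. norm (u \<phi>))"
  shows "(\<lambda>i. d i * u (e i)) sums u (schwartz_series d e)"
proof -
  have eS: "e i \<in> schwartz_space" for i using e by (simp add: schwartz_family_def)
  obtain F C where F: "finite F" "F \<subseteq> UNIV \<times> lists Basis" "C \<ge> 0"
    "\<And>\<phi>. \<phi> \<in> schwartz_space \<Longrightarrow> norm (u \<phi>) \<le> C * (\<Sum>(n, bs)\<in>F. schwartz_seminorm n bs \<phi>)"
    using bdd unfolding schwartz_bounded_def by blast
  \<comment> \<open>The tail from M on. It decays rapidly again, so the remainder of the series is a
    Schwartz function to which u can be applied.\<close>
  define d' where "d' M i = (if i < M then 0 else d i)" for M i
  have d': "rapid_decay (d' M)" for M
    unfolding rapid_decay_def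
  proof
    fix N
    obtain D where D: "\<And>i. norm (d i) \<le> D / (1 + real i) ^ N" using d unfolding rapid_decay_def by blast
    have "D \<ge> 0" using order_trans[OF norm_ge_zero D[of 0]] by simp
    then show "\<exists>C. \<forall>i. norm (d' M i) \<le> C / (1 + real i) ^ N"
      using D by (intro exI[of _ D]) (auto simp: d'_def)
  qed
  have split: "u (schwartz_series d e) = (\<Sum>i<M. d i * u (e i)) + u (schwartz_series (d' M) e)" for M
  proof -
    have "schwartz_series d e x = (\<Sum>i<M. d i * e i x) + schwartz_series (d' M) e x" for x
    proof -
      have s: "summable (\<lambda>i. d i * e i x)" "summable (\<lambda>i. d' M i * e i x)"
        using schwartz_series_iter_deriv[OF e d, of "[]"] schwartz_series_iter_deriv[OF e d'[of M], of "[]"] by (auto intro: summable_norm_cancel)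
      have "(\<lambda>i. if i < M then d i * e i x else 0) sums (\<Sum>i<M. d i * e i x)"
        using sums_If_finite_set[of "{..<M}" "\<lambda>i. d i * e i x"] by simp
      from sums_add[OF this summable_sums[OF s(2)]]
      have "(\<lambda>i. d i * e i x) sums ((\<Sum>i<M. d i * e i x) + (\<Sum>i. d' M i * e i x))"
        by (rule sums_cong[THEN iffD1, rotated]) (auto simp: d'_def)
      then show ?thesis by (simp add: schwartz_series_def sums_iff)
    qed
    then have eq: "schwartz_series d e = (\<lambda>x. (\<Sum>i<M. d i * e i x) + schwartz_series (d' M) e x)" by auto
    have "(\<lambda>x. \<Sum>i<M. d i * e i x) \<in> schwartz_space"
      by (rule schwartz_sum) (auto intro: schwartz_cmult(1)[OF eS])
    moreover have "u (\<lambda>x. \<Sum>i<M. d i * e i x) = (\<Sum>i<M. d i * u (e i))"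
      by (rule schwartz_linear_sum[OF add scale]) (auto intro: eS)
    ultimately show ?thesis unfolding eq using add[OF _ schwartz_series_schwartz(1)[OF e d'[of M]]] by simp
  qed
  have tail: "(\<lambda>M. schwartz_seminorm n bs (schwartz_series (d' M) e)) \<longlonglongrightarrow> 0" if bs: "bs \<in> lists Basis" for n bs
  proof (rule Lim_null_comparison)
    have s: "summable (\<lambda>i. norm (d i) * schwartz_seminorm n bs (e i))" by (rule schwartz_family_summable[OF e d bs])
    show "(\<lambda>M. \<Sum>i. norm (d (i + M)) * schwartz_seminorm n bs (e (i + M))) \<longlonglongrightarrow> 0"
      by (rule suminf_exist_split2[OF s])
    have "schwartz_seminorm n bs (schwartz_series (d' M) e) \<le> (\<Sum>i. norm (d (i + M)) * schwartz_seminorm n bs (e (i + M)))" for M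
    proof -
      have "schwartz_seminorm n bs (schwartz_series (d' M) e) \<le> (\<Sum>i. norm (d' M i) * schwartz_seminorm n bs (e i))"
        by (rule schwartz_series_schwartz(2)[OF e d' bs])
      also have "\<dots> = (\<Sum>i. norm (d' M (i + M)) * schwartz_seminorm n bs (e (i + M))) + (\<Sum>i<M. norm (d' M i) * schwartz_seminorm n bs (e i))"
        by (rule suminf_split_initial_segment[OF schwartz_family_summable[OF e d' bs]])
      also have "\<dots> = (\<Sum>i. norm (d (i + M)) * schwartz_seminorm n bs (e (i + M)))" by (simp add: d'_def)
      finally show ?thesis .
    qed
    then show "\<forall>\<^sub>F M in sequentially. norm (schwartz_seminorm n bs (schwartz_series (d' M) e)) \<le> (\<Sum>i. norm (d (i + M)) * schwartz_seminorm n bs (e (i + M)))"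
      using schwartz_seminorm_nonneg[OF schwartz_series_schwartz(1)[OF e d'] bs] by (intro always_eventually allI) simp
  qed
  have "(\<lambda>M. u (schwartz_series (d' M) e)) \<longlonglongrightarrow> 0"
  proof (rule Lim_null_comparison[OF always_eventually[OF allI[OF F(4)[OF schwartz_series_schwartz(1)[OF e d']]]]])
    have "(\<lambda>M. C * (\<Sum>x\<in>F. schwartz_seminorm (fst x) (snd x) (schwartz_series (d' M) e))) \<longlonglongrightarrow> C * (\<Sum>x\<in>F. 0)"
    proof (intro tendsto_intros tail)
      fix x assume "x \<in> F"
      then have "x \<in> UNIV \<times> lists Basis" using F(2) by blast
      then show "snd x \<in> lists Basis" by (simp only: mem_Times_iff)
    qed
    then show "(\<lambda>M. C * (\<Sum>(n, bs)\<in>F. schwartz_seminorm n bs (schwartz_series (d' M) e))) \<longlonglongrightarrow> 0"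
      by (simp add: case_prod_beta)
  qed
  from tendsto_diff[OF tendsto_const[of "u (schwartz_series d e)"] this]
  have lim: "(\<lambda>M. u (schwartz_series d e) - u (schwartz_series (d' M) e)) \<longlonglongrightarrow> u (schwartz_series d e)" by simp
  have "u (schwartz_series d e) - u (schwartz_series (d' M) e) = (\<Sum>i<M. d i * u (e i))" for M using split[of M] by simp
  with lim show ?thesis unfolding sums_def by simp
qed

lemma schwartz_family_cnj:
  assumes "schwartz_family e" shows "schwartz_family (\<lambda>i x. cnj (e i x))"
proof -
  have "schwartz_seminorm n bs (\<lambda>x. cnj (e i x)) = schwartz_seminorm n bs (e i)" if "bs \<in> lists Basis" for n bs i
    using assms iter_deriv_cnj[OF schwartz_smooth[of "e i"] that] by (simp add: schwartz_seminorm_def schwartz_family_def)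
  moreover have "(\<lambda>x. cnj (e i x)) \<in> schwartz_space" for i
    using assms by (intro schwartz_cnj) (simp add: schwartz_family_def)
  ultimately show ?thesis using assms by (simp only: schwartz_family_def) simp
qed

lemma tempered_distr_of:
  assumes f: "f \<in> schwartz_space" shows "distr_of f \<in> tempered_distributions"
  unfolding tempered_iff
proof (intro conjI allI ballI impI)
  show "distr_of f (\<lambda>x. \<phi> x + \<psi> x) = distr_of f \<phi> + distr_of f \<psi>" if "\<phi> \<in> schwartz_space" "\<psi> \<in> schwartz_space" for \<phi> \<psi>
    using that f by (simp add: distr_of_def schwartz_add(1) distrib_left schwartz_mult_integrable)
  show "distr_of f (\<lambda>x. z * \<phi> x) = z * distr_of f \<phi>" if "\<phi> \<in> schwartz_space" for z \<phi>
    using that f by (simp add: distr_of_def schwartz_cmult(1) mult.left_commute)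
  show "schwartz_bounded (\<lambda>\<phi>. norm (distr_of f \<phi>))"
    using schwartz_bounded_integral[OF f] by (rule schwartz_bounded_mono) (simp add: distr_of_def mult.commute)
qed (simp add: distr_of_def)

text \<open>The properties that turn test functions into rapidly decaying sequences and tempered
  distributions into sequences of polynomial growth. In \<open>basis_decay\<close> one bounded p
  serves all indices.\<close>

locale schwartz_basis =
  fixes e :: "nat \<Rightarrow> 'a::euclidean_space \<Rightarrow> complex" and c0 :: real
  assumes basis_family: "schwartz_family e"
    and basis_orthogonal: "(LINT x|lborel. e i x * cnj (e j x)) = (if i = j then of_real c0 else 0)"
    and basis_c0: "c0 > 0"
    and basis_decay: "\<exists>p. schwartz_bounded p \<and> (\<forall>\<phi>\<in>schwartz_space. \<forall>i. (1 + real i) ^ N * norm (LINT x|lborel. \<phi> x * cnj (e i x)) \<le> p \<phi>)"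
    and basis_complete: "\<phi> \<in> schwartz_space \<Longrightarrow> (\<And>i. (LINT x|lborel. \<phi> x * cnj (e i x)) = 0) \<Longrightarrow> \<phi> x = 0"
begin

lemma basis_schwartz: "e i \<in> schwartz_space"
  using basis_family by (simp add: schwartz_family_def)

text \<open>The conjugate belongs to the inner product, whereas a distribution is tested on
  \<open>e i\<close> itself; the conjugations below reconcile the two conventions.\<close>

definition coeff :: "('a \<Rightarrow> complex) \<Rightarrow> nat \<Rightarrow> complex" where
  "coeff \<phi> i = (LINT x|lborel. \<phi> x * cnj (e i x)) / of_real c0"

lemma coeff_add: "\<phi> \<in> schwartz_space \<Longrightarrow> \<psi> \<in> schwartz_space \<Longrightarrow> coeff (\<lambda>x. \<phi> x + \<psi> x) i = coeff \<phi> i + coeff \<psi> i"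
  by (simp add: coeff_def distrib_right schwartz_mult_integrable schwartz_cnj basis_schwartz add_divide_distrib)

lemma coeff_cmult: "coeff (\<lambda>x. z * \<phi> x) i = z * coeff \<phi> i"
  by (simp add: coeff_def mult.assoc)

lemma coeff_e: "coeff (e i) j = (if i = j then 1 else 0)"
  using basis_c0 by (simp add: coeff_def basis_orthogonal)

lemma coeff_bound: "\<exists>p. schwartz_bounded p \<and> (\<forall>\<phi>\<in>schwartz_space. \<forall>i. norm (coeff \<phi> i) \<le> p \<phi> / (1 + real i) ^ N)"
proof -
  obtain p where p: "schwartz_bounded p" "\<And>\<phi> i. \<phi> \<in> schwartz_space \<Longrightarrow> (1 + real i) ^ N * norm (LINT x|lborel. \<phi> x * cnj (e i x)) \<le> p \<phi>"
    using basis_decay[of N] by blast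
  have "norm (coeff \<phi> i) \<le> ((1 / c0) * p \<phi>) / (1 + real i) ^ N" if "\<phi> \<in> schwartz_space" for \<phi> i
  proof -
    have np: "(1 + real i) ^ N > 0" by (intro zero_less_power) auto
    have "norm (coeff \<phi> i) = norm (LINT x|lborel. \<phi> x * cnj (e i x)) / c0" using basis_c0 by (simp add: coeff_def norm_divide)
    moreover have "norm (LINT x|lborel. \<phi> x * cnj (e i x)) \<le> p \<phi> / (1 + real i) ^ N" using p(2)[OF that, of i] np by (simp add: field_simps)
    from divide_right_mono[OF this, of c0] have "norm (LINT x|lborel. \<phi> x * cnj (e i x)) / c0 \<le> ((1 / c0) * p \<phi>) / (1 + real i) ^ N"
      using basis_c0 by (simp add: mult.commute)
    ultimately show ?thesis by simp
  qed
  then show ?thesis using schwartz_bounded_cmult[OF p(1), of "1 / c0"] basis_c0 by (intro exI[of _ "\<lambda>\<phi>. (1 / c0) * p \<phi>"]) auto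
qed

lemma coeff_rapid: "\<phi> \<in> schwartz_space \<Longrightarrow> rapid_decay (coeff \<phi>)"
  unfolding rapid_decay_def using coeff_bound by blast

text \<open>The difference of both sides has vanishing coefficients, because the series may be
  integrated term by term, and completeness makes it 0.\<close>

lemma expansion:
  assumes \<phi>: "\<phi> \<in> schwartz_space" shows "schwartz_series (coeff \<phi>) e = \<phi>"
proof
  fix x
  let ?s = "schwartz_series (coeff \<phi>) e"
  note sS = schwartz_series_schwartz(1)[OF basis_family coeff_rapid[OF \<phi>]]
  have "(LINT x|lborel. (\<phi> x - ?s x) * cnj (e j x)) = 0" for j
  proof -
    have "(\<lambda>i. coeff \<phi> i * (LINT x|lborel. e i x * cnj (e j x))) sums (LINT x|lborel. ?s x * cnj (e j x))"
      by (rule schwartz_series_sums[OF basis_family coeff_rapid[OF \<phi>], where u = "\<lambda>\<phi>. LINT x|lborel. \<phi> x * cnj (e j x)"])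
        (auto simp: distrib_right schwartz_mult_integrable schwartz_cnj basis_schwartz mult.assoc intro!: schwartz_bounded_integral)
    moreover have "(\<lambda>i. coeff \<phi> i * (LINT x|lborel. e i x * cnj (e j x))) sums (coeff \<phi> j * of_real c0)"
      using sums_single[of j "\<lambda>i. coeff \<phi> i * of_real c0"] unfolding basis_orthogonal
      by (rule sums_cong[THEN iffD1, rotated]) auto
    ultimately have "(LINT x|lborel. ?s x * cnj (e j x)) = coeff \<phi> j * of_real c0" by (rule sums_unique2)
    then show ?thesis
      using basis_c0 by (simp add: left_diff_distrib schwartz_mult_integrable schwartz_cnj basis_schwartz \<phi> sS coeff_def)
  qed
  then have "\<phi> x - ?s x = 0" by (rule basis_complete[OF schwartz_diff[OF \<phi> sS]])
  then show "?s x = \<phi> x" by simp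
qed

lemma tempered_expansion:
  assumes "u \<in> tempered_distributions" "\<phi> \<in> schwartz_space"
  shows "(\<lambda>i. coeff \<phi> i * u (e i)) sums u \<phi>"
  using schwartz_series_sums[OF basis_family coeff_rapid[OF assms(2)], of u] assms(1) expansion[OF assms(2)]
  by (simp add: tempered_iff)

lemma tempered_eqI:
  assumes "u \<in> tempered_distributions" "v \<in> tempered_distributions" "\<And>i. u (e i) = v (e i)"
  shows "u = v"
proof
  fix \<phi> show "u \<phi> = v \<phi>"
  proof (cases "\<phi> \<in> schwartz_space")
    case True
    then show ?thesis using tempered_expansion[OF assms(1) True] tempered_expansion[OF assms(2) True] assms(3)
      by (auto intro: sums_unique2)
  next
    case False
    then show ?thesis using assms(1,2) by (simp add: tempered_iff)
  qed
qed

lemma tempered_poly_growth: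
  assumes "u \<in> tempered_distributions" shows "poly_growth (\<lambda>i. u (e i))"
proof -
  obtain F C where F: "finite F" "F \<subseteq> UNIV \<times> lists Basis" "C \<ge> 0"
    "\<And>\<phi>. \<phi> \<in> schwartz_space \<Longrightarrow> norm (u \<phi>) \<le> C * (\<Sum>(n, bs)\<in>F. schwartz_seminorm n bs \<phi>)"
    using assms unfolding tempered_iff schwartz_bounded_def by blast
  have "\<exists>K N. \<forall>i. (\<Sum>(n, bs)\<in>F. schwartz_seminorm n bs (e i)) \<le> K * (1 + real i) ^ N"
    using F(1,2)
  proof (induction F rule: finite_induct)
    case empty
    then show ?case by (auto intro: exI[of _ 0])
  next
    case (insert x F)
    obtain n bs where x: "x = (n, bs)" by force
    then have "(n, bs) \<in> UNIV \<times> lists Basis" using insert by blast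
    then have bs: "bs \<in> lists Basis" by (simp only: mem_Times_iff snd_conv)
    obtain C N where C: "C \<ge> 0" "\<And>i. schwartz_seminorm n bs (e i) \<le> C * (1 + real i) ^ N"
      using basis_family bs unfolding schwartz_family_def by blast
    obtain K M where K: "\<And>i. (\<Sum>(n, bs)\<in>F. schwartz_seminorm n bs (e i)) \<le> K * (1 + real i) ^ M" using insert by blast
    have "(\<Sum>(n, bs)\<in>insert x F. schwartz_seminorm n bs (e i)) \<le> (C + \<bar>K\<bar>) * (1 + real i) ^ (N + M)" for i
    proof -
      have "C * (1 + real i) ^ N \<le> C * (1 + real i) ^ (N + M)" using C(1) by (intro mult_left_mono power_increasing) auto
      moreover have "K * (1 + real i) ^ M \<le> \<bar>K\<bar> * (1 + real i) ^ (N + M)" by (intro mult_mono power_increasing) auto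
      ultimately show ?thesis using insert(1,2) C(2)[of i] K[of i] by (simp add: x distrib_right)
    qed
    then show ?case by blast
  qed
  then obtain K N where K: "\<And>i. (\<Sum>(n, bs)\<in>F. schwartz_seminorm n bs (e i)) \<le> K * (1 + real i) ^ N" by blast
  have "norm (u (e i)) \<le> (C * K) * (1 + real i) ^ N" for i
    using order_trans[OF F(4)[OF basis_schwartz] mult_left_mono[OF K F(3)]] by (simp add: mult.assoc)
  then show ?thesis unfolding poly_growth_def by blast
qed

text \<open>The coefficients of a test function decay with order P + 2, with a bounded functional as
  constant. This pays for the growth P of U and leaves a convergent series.\<close>

lemma tempered_from_coefficients:
  assumes "poly_growth U" shows "\<exists>u\<in>tempered_distributions. \<forall>i. u (e i) = U i"
proof -
  obtain K P where K: "\<And>i. norm (U i) \<le> K * (1 + real i) ^ P" using assms unfolding poly_growth_def by blast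
  have K0: "K \<ge> 0" using order_trans[OF norm_ge_zero K[of 0]] by simp
  obtain p where p: "schwartz_bounded p" "\<And>\<phi> i. \<phi> \<in> schwartz_space \<Longrightarrow> norm (coeff \<phi> i) \<le> p \<phi> / (1 + real i) ^ (P + 2)"
    using coeff_bound by blast
  define S where "S = (\<Sum>i. 1 / (1 + real i)\<^sup>2)"
  have S: "S \<ge> 0" unfolding S_def by (intro suminf_nonneg summable_inverse_Suc_square) auto
  define u where "u \<phi> = (if \<phi> \<in> schwartz_space then \<Sum>i. coeff \<phi> i * U i else 0)" for \<phi>
  have le: "norm (coeff \<phi> i * U i) \<le> (p \<phi> * K) * (1 / (1 + real i)\<^sup>2)" if "\<phi> \<in> schwartz_space" for \<phi> i
  proof -
    have "norm (coeff \<phi> i * U i) \<le> (p \<phi> / (1 + real i) ^ (P + 2)) * (K * (1 + real i) ^ P)"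
      unfolding norm_mult using order_trans[OF norm_ge_zero p(2)[OF that, of i]]
      by (intro mult_mono p(2)[OF that] K) auto
    also have "\<dots> = (p \<phi> * K) * (1 / (1 + real i)\<^sup>2)" unfolding power_add by (simp add: add_nonneg_eq_0_iff)
    finally show ?thesis .
  qed
  have s: "summable (\<lambda>i. norm (coeff \<phi> i * U i))" if "\<phi> \<in> schwartz_space" for \<phi>
    by (rule summable_comparison_test'[OF summable_mult[OF summable_inverse_Suc_square, of "p \<phi> * K"]]) (use le[OF that] in auto)
  have "u \<in> tempered_distributions" unfolding tempered_iff
  proof (intro conjI allI ballI impI)
    show "u (\<lambda>x. \<phi> x + \<psi> x) = u \<phi> + u \<psi>" if "\<phi> \<in> schwartz_space" "\<psi> \<in> schwartz_space" for \<phi> \<psi>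
      using that suminf_add[OF summable_norm_cancel[OF s[OF that(1)]] summable_norm_cancel[OF s[OF that(2)]]]
      by (simp add: u_def schwartz_add(1) coeff_add distrib_right)
    show "u (\<lambda>x. z * \<phi> x) = z * u \<phi>" if "\<phi> \<in> schwartz_space" for z \<phi>
      using that suminf_mult[OF summable_norm_cancel[OF s[OF that]], of z]
      by (simp add: u_def schwartz_cmult(1) coeff_cmult mult.assoc)
    have "schwartz_bounded (\<lambda>\<phi>. (K * S) * p \<phi>)" using K0 S by (intro schwartz_bounded_cmult p(1)) auto
    then show "schwartz_bounded (\<lambda>\<phi>. norm (u \<phi>))"
    proof (rule schwartz_bounded_mono)
      fix \<phi> :: "'a \<Rightarrow> complex" assume \<phi>: "\<phi> \<in> schwartz_space"
      have "norm (\<Sum>i. coeff \<phi> i * U i) \<le> (\<Sum>i. norm (coeff \<phi> i * U i))" by (rule summable_norm[OF s[OF \<phi>]])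
      also have "\<dots> \<le> (\<Sum>i. (p \<phi> * K) * (1 / (1 + real i)\<^sup>2))"
        by (intro suminf_le le[OF \<phi>] s[OF \<phi>] summable_mult summable_inverse_Suc_square)
      also have "\<dots> = (p \<phi> * K) * S" unfolding S_def by (rule suminf_mult[OF summable_inverse_Suc_square])
      finally show "norm (u \<phi>) \<le> (K * S) * p \<phi>" using \<phi> by (simp add: u_def mult_ac)
    qed
  qed (simp add: u_def)
  moreover have "u (e j) = U j" for j
  proof -
    have "(\<lambda>i. coeff (e j) i * U i) sums U j"
      using sums_single[of j U] by (rule sums_cong[THEN iffD1, rotated]) (auto simp: coeff_e)
    then show ?thesis by (simp add: u_def basis_schwartz sums_iff)
  qed
  ultimately show ?thesis by blast
qed

text \<open>\<open>distr_of\<close> is a bilinear pairing, so the values are conjugates of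
  coefficients of the conjugate function.\<close>

lemma distr_of_rapid:
  assumes "f \<in> schwartz_space" shows "rapid_decay (\<lambda>i. distr_of f (e i))"
proof -
  have "distr_of f (e i) = cnj (of_real c0 * coeff (\<lambda>x. cnj (f x)) i)" for i
    using basis_c0 Bochner_Integration.integral_cnj[of lborel "\<lambda>x. f x * e i x"] by (simp add: distr_of_def basis_schwartz coeff_def)
  then show ?thesis
    using rapid_decay_cmult[OF coeff_rapid[OF schwartz_cnj[OF assms]], of "of_real c0"] by (simp add: rapid_decay_def norm_mult)
qed

lemma rapid_imp_distr_of:
  assumes u: "u \<in> tempered_distributions" and r: "rapid_decay (\<lambda>i. u (e i))"
  shows "u \<in> distr_of ` schwartz_space"
proof -
  \<comment> \<open>For the bilinear pairing the dual family is the conjugated one, scaled by 1 /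
    c0.\<close>
  define \<psi> where "\<psi> = schwartz_series (\<lambda>i. (1 / of_real c0) * u (e i)) (\<lambda>i x. cnj (e i x))"
  note r' = rapid_decay_cmult[OF r, of "1 / of_real c0"]
  have \<psi>: "\<psi> \<in> schwartz_space" unfolding \<psi>_def by (rule schwartz_series_schwartz(1)[OF schwartz_family_cnj[OF basis_family] r'])
  have "distr_of \<psi> (e j) = u (e j)" for j
  proof -
    have "(\<lambda>i. (1 / of_real c0) * u (e i) * (LINT x|lborel. cnj (e i x) * e j x)) sums (LINT x|lborel. \<psi> x * e j x)"
      unfolding \<psi>_def
      by (rule schwartz_series_sums[OF schwartz_family_cnj[OF basis_family] r', where u = "\<lambda>\<phi>. LINT x|lborel. \<phi> x * e j x"])
        (auto simp: distrib_right schwartz_mult_integrable basis_schwartz mult.assoc intro!: schwartz_bounded_integral)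
    moreover have "(\<lambda>i. (1 / of_real c0) * u (e i) * (LINT x|lborel. cnj (e i x) * e j x)) sums u (e j)"
      using sums_single[of j "\<lambda>i. u (e i)"]
      by (rule sums_cong[THEN iffD1, rotated]) (use basis_c0 basis_orthogonal[of j] in \<open>auto simp: mult.commute\<close>)
    ultimately have "(LINT x|lborel. \<psi> x * e j x) = u (e j)" by (rule sums_unique2)
    then show ?thesis by (simp add: distr_of_def basis_schwartz)
  qed
  then have "u = distr_of \<psi>" by (intro tempered_eqI u tempered_distr_of \<psi>) auto
  then show ?thesis using \<psi> by blast
qed

end

section \<open>Completeness of the polynomial multiples of a Gaussian\<close>

lemma schwartz_weight_power:
  fixes \<phi> :: "'a::euclidean_space \<Rightarrow> complex"
  assumes \<phi>: "\<phi> \<in> schwartz_space"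
  shows "\<exists>C. \<forall>x. (1 + norm x) ^ k * norm (\<phi> x) \<le> C * weight x"
proof -
  have "\<forall>\<phi>\<in>schwartz_space. \<exists>C. \<forall>x::'a. (1 + norm x) ^ k * norm (\<phi> x) \<le> C * weight x" for k
  proof (induction k)
    case 0
    then show ?case using schwartz_bounded_by_weight by auto
  next
    case (Suc k)
    show ?case
    proof
      fix \<phi> :: "'a \<Rightarrow> complex" assume \<phi>: "\<phi> \<in> schwartz_space"
      obtain C where C: "\<And>x. (1 + norm x) ^ k * norm (\<phi> x) \<le> C * weight x" using Suc \<phi> by blast
      have "\<forall>b\<in>Basis. \<exists>C. \<forall>x. (1 + norm x) ^ k * norm (coord_mult b \<phi> x) \<le> C * weight x"
        using Suc schwartz_coord_mult(1)[OF \<phi>] by blast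
      then obtain D where D: "\<And>b x. b \<in> Basis \<Longrightarrow> (1 + norm x) ^ k * norm (coord_mult b \<phi> x) \<le> D b * weight x" by metis
      have "(1 + norm x) ^ Suc k * norm (\<phi> x) \<le> (C + (\<Sum>b\<in>Basis. D b)) * weight x" for x
      proof -
        \<comment> \<open>The norm is at most the sum of the absolute coordinates, and a coordinate
          times a Schwartz function is again covered by the induction hypothesis.\<close>
        have "norm x * norm (\<phi> x) \<le> (\<Sum>b\<in>Basis. \<bar>x \<bullet> b\<bar>) * norm (\<phi> x)" by (intro mult_right_mono norm_le_l1) auto
        also have "\<dots> = (\<Sum>b\<in>Basis. norm (coord_mult b \<phi> x))" by (simp add: coord_mult_def norm_mult sum_distrib_right)
        finally have "(1 + norm x) ^ k * (norm x * norm (\<phi> x)) \<le> (1 + norm x) ^ k * (\<Sum>b\<in>Basis. norm (coord_mult b \<phi> x))"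
          by (intro mult_left_mono) auto
        also have "\<dots> \<le> (\<Sum>b\<in>Basis. D b * weight x)" unfolding sum_distrib_left by (intro sum_mono D)
        finally show ?thesis using C[of x] by (simp add: algebra_simps sum_distrib_left)
      qed
      then show "\<exists>C. \<forall>x. (1 + norm x) ^ Suc k * norm (\<phi> x) \<le> C * weight x" by blast
    qed
  qed
  then show ?thesis using \<phi> by blast
qed

lemma real_polynomial_function_bound:
  "real_polynomial_function p \<Longrightarrow> \<exists>C k. C \<ge> 0 \<and> (\<forall>x::'a::euclidean_space. \<bar>p x\<bar> \<le> C * (1 + norm x) ^ k)"
proof (induction rule: real_polynomial_function.induct)
  case (linear f)
  then obtain K where K: "\<And>x. norm (f x) \<le> norm x * K" "K > 0" using bounded_linear.pos_bounded by blast
  have "\<bar>f x\<bar> \<le> K * (1 + norm x) ^ 1" for x using K(1)[of x] K(2) by (simp add: algebra_simps)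
  then show ?case using K(2) by (intro exI[of _ K] exI[of _ 1]) auto
next
  case (const c)
  show ?case by (intro exI[of _ "\<bar>c\<bar>"] exI[of _ 0]) auto
next
  case (add f g)
  then obtain C k D l where *: "C \<ge> 0" "\<And>x. \<bar>f x\<bar> \<le> C * (1 + norm x) ^ k" "D \<ge> 0" "\<And>x. \<bar>g x\<bar> \<le> D * (1 + norm x) ^ l" by blast
  have "\<bar>f x + g x\<bar> \<le> (C + D) * (1 + norm x) ^ (k + l)" for x
  proof -
    have "C * (1 + norm x) ^ k \<le> C * (1 + norm x) ^ (k + l)" "D * (1 + norm x) ^ l \<le> D * (1 + norm x) ^ (k + l)"
      using *(1,3) by (auto intro!: mult_left_mono power_increasing)
    then show ?thesis using *(2)[of x] *(4)[of x] by (simp add: distrib_right)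
  qed
  then show ?case using *(1,3) by (intro exI[of _ "C + D"] exI[of _ "k + l"]) auto
next
  case (mult f g)
  then obtain C k D l where *: "C \<ge> 0" "\<And>x. \<bar>f x\<bar> \<le> C * (1 + norm x) ^ k" "D \<ge> 0" "\<And>x. \<bar>g x\<bar> \<le> D * (1 + norm x) ^ l" by blast
  have "\<bar>f x * g x\<bar> \<le> (C * D) * (1 + norm x) ^ (k + l)" for x
    using mult_mono[OF *(2)[of x] *(4)[of x]] *(1) by (simp add: abs_mult power_add mult_ac)
  then show ?case using *(1,3) by (intro exI[of _ "C * D"] exI[of _ "k + l"]) auto
qed

lemma norm_square_eq_sum: "(norm x)\<^sup>2 = (\<Sum>b\<in>Basis. (x \<bullet> b)\<^sup>2)" for x :: "'a::euclidean_space"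
  unfolding power2_norm_eq_inner by (subst euclidean_inner) (simp add: power2_eq_square)

lemma real_polynomial_function_norm_square: "real_polynomial_function (\<lambda>x::'a::euclidean_space. (norm x)\<^sup>2)"
proof -
  show ?thesis by (simp add: norm_square_eq_sum real_polynomial_function_sum real_polynomial_function_power real_polynomial_function.intros(1) bounded_linear_inner_left)
qed

text \<open>The partial sums of the series of exp q are polynomials, so their moments vanish. They
  are dominated by exp |q|, which the Gaussian cancels up to exp K by the condition on q.\<close>

lemma gaussian_moments_exp:
  fixes \<Phi> :: "'a::euclidean_space \<Rightarrow> complex"
  assumes cont: "continuous_on UNIV \<Phi>" and decay: "\<And>k. \<exists>C. \<forall>x. (1 + norm x) ^ k * norm (\<Phi> x) \<le> C * weight x"
    and zero: "\<And>p. real_polynomial_function p \<Longrightarrow> (LINT x|lborel. \<Phi> x * of_real (p x * exp (- s * (norm x)\<^sup>2))) = 0"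
    and q: "real_polynomial_function q" and qK: "\<And>x. \<bar>q x\<bar> \<le> s * (norm x)\<^sup>2 + K"
    and p: "real_polynomial_function p"
  shows "(LINT x|lborel. \<Phi> x * of_real (p x * exp (- s * (norm x)\<^sup>2) * exp (q x))) = 0"
proof -
  have contp: "continuous_on UNIV r" if "real_polynomial_function r" for r :: "'a \<Rightarrow> real"
    using that by (intro continuous_on_polymonial_function) (simp add: real_polynomial_function_eq)
  obtain C k where C: "C \<ge> 0" "\<And>x. \<bar>p x\<bar> \<le> C * (1 + norm x) ^ k" using real_polynomial_function_bound[OF p] by blast
  obtain D where D: "\<And>x. (1 + norm x) ^ k * norm (\<Phi> x) \<le> D * weight x" using decay by blast
  define E where "E N x = (\<Sum>n<N. q x ^ n / fact n)" for N x
  have E1: "(\<lambda>N. E N x) \<longlonglongrightarrow> exp (q x)" for x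
    using exp_converges[of "q x"] by (simp add: sums_def E_def divide_inverse mult.commute)
  have E2: "\<bar>E N x\<bar> \<le> exp \<bar>q x\<bar>" for N x
  proof -
    have "\<bar>E N x\<bar> \<le> (\<Sum>n<N. \<bar>q x\<bar> ^ n /\<^sub>R fact n)" unfolding E_def by (rule order_trans[OF sum_abs]) (simp add: power_abs abs_mult divide_inverse mult.commute)
    also have "\<dots> \<le> exp \<bar>q x\<bar>" unfolding exp_def by (intro sum_le_suminf) (use summable_exp[of "\<bar>q x\<bar>"] in auto)
    finally show ?thesis .
  qed
  have Ep: "real_polynomial_function (E N)" for N
    unfolding E_def[abs_def] divide_inverse
    by (intro real_polynomial_function_sum real_polynomial_function.intros(4) real_polynomial_function_power q real_polynomial_function.intros(2)) auto
  define f where "f N x = \<Phi> x * of_real (p x * E N x * exp (- s * (norm x)\<^sup>2))" for N x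
  have "(\<lambda>N. LINT x|lborel. f N x) \<longlonglongrightarrow> (LINT x|lborel. \<Phi> x * of_real (p x * exp (- s * (norm x)\<^sup>2) * exp (q x)))"
  proof (rule integral_dominated_convergence)
    show "(\<lambda>x. \<Phi> x * of_real (p x * exp (- s * (norm x)\<^sup>2) * exp (q x))) \<in> borel_measurable lborel"
      unfolding measurable_lborel1 measurable_lborel2
      by (intro borel_measurable_continuous_onI continuous_intros cont contp p q)
    show "f N \<in> borel_measurable lborel" for N
      unfolding f_def[abs_def] measurable_lborel1 measurable_lborel2
      by (intro borel_measurable_continuous_onI continuous_intros cont contp p Ep)
    show "integrable lborel (\<lambda>x::'a. (C * D * exp K) * weight x)" by (rule integrable_mult_right[OF integrable_weight])
    show "AE x in lborel. (\<lambda>N. f N x) \<longlonglongrightarrow> \<Phi> x * of_real (p x * exp (- s * (norm x)\<^sup>2) * exp (q x))"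
    proof (intro always_eventually allI)
      fix x
      have "(\<lambda>N. f N x) \<longlonglongrightarrow> \<Phi> x * of_real (p x * exp (q x) * exp (- s * (norm x)\<^sup>2))"
        unfolding f_def by (intro tendsto_intros E1)
      then show "(\<lambda>N. f N x) \<longlonglongrightarrow> \<Phi> x * of_real (p x * exp (- s * (norm x)\<^sup>2) * exp (q x))" by (simp add: mult_ac)
    qed
    show "AE x in lborel. norm (f N x) \<le> (C * D * exp K) * weight x" for N
    proof (intro always_eventually allI)
      fix x
      have "\<bar>E N x\<bar> * exp (- s * (norm x)\<^sup>2) \<le> exp (s * (norm x)\<^sup>2 + K) * exp (- s * (norm x)\<^sup>2)"
        using order_trans[OF E2[of N x]] qK[of x] by (intro mult_right_mono) auto
      also have "\<dots> = exp K" by (simp flip: exp_add)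
      finally have 1: "\<bar>E N x\<bar> * exp (- s * (norm x)\<^sup>2) \<le> exp K" .
      have "norm (f N x) = norm (\<Phi> x) * \<bar>p x\<bar> * (\<bar>E N x\<bar> * exp (- s * (norm x)\<^sup>2))"
        by (simp add: f_def norm_mult abs_mult)
      also have "\<dots> \<le> norm (\<Phi> x) * (C * (1 + norm x) ^ k) * exp K"
        using C 1 by (intro mult_mono mult_nonneg_nonneg) auto
      also have "\<dots> = C * exp K * ((1 + norm x) ^ k * norm (\<Phi> x))" by simp
      also have "\<dots> \<le> C * exp K * (D * weight x)" using C(1) by (intro mult_left_mono D) auto
      finally show "norm (f N x) \<le> (C * D * exp K) * weight x" by (simp add: mult_ac)
    qed
  qed
  moreover have "(LINT x|lborel. f N x) = 0" for N
    unfolding f_def by (rule zero[OF real_polynomial_function.intros(4)[OF p Ep]])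
  ultimately show ?thesis by (simp add: LIMSEQ_const_iff)
qed

lemma exp_minus_norm_square_le_weight: "exp (- (norm x)\<^sup>2) \<le> weight (x::'a::euclidean_space)"
proof -
  have "exp (- (norm x)\<^sup>2) = exp (\<Sum>b\<in>Basis. - (x \<bullet> b)\<^sup>2)"
    by (simp add: sum_negf norm_square_eq_sum)
  also have "\<dots> = (\<Prod>b\<in>Basis. exp (- (x \<bullet> b)\<^sup>2))" by (rule exp_sum) simp
  also have "\<dots> \<le> weight x" unfolding weight_def
  proof (rule prod_mono, intro conjI)
    fix b
    have "1 + (x \<bullet> b)\<^sup>2 \<le> exp ((x \<bullet> b)\<^sup>2)" by (rule exp_ge_add_one_self)
    moreover have "0 < 1 + (x \<bullet> b)\<^sup>2" by (intro add_pos_nonneg) auto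
    ultimately show "exp (- (x \<bullet> b)\<^sup>2) \<le> 1 / (1 + (x \<bullet> b)\<^sup>2)" by (simp add: exp_minus field_simps)
  qed auto
  finally show ?thesis .
qed

lemma gaussian_integral_nonzero: "(LINT x|lborel. complex_of_real (exp (- (norm (x::'a::euclidean_space))\<^sup>2))) \<noteq> 0"
proof
  have m: "(\<lambda>x::'a. exp (- (norm x)\<^sup>2)) \<in> borel_measurable borel"
    by (intro borel_measurable_continuous_onI continuous_intros)
  have i: "integrable lborel (\<lambda>x::'a. exp (- (norm x)\<^sup>2))"
    by (rule Bochner_Integration.integrable_bound[OF integrable_weight]) (use m exp_minus_norm_square_le_weight weight_pos in \<open>auto intro!: always_eventually simp: abs_of_pos[OF weight_pos]\<close>)
  assume "(LINT x|lborel. complex_of_real (exp (- (norm (x::'a))\<^sup>2))) = 0"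
  then have "(LINT x|lborel. exp (- (norm (x::'a))\<^sup>2)) = 0" by (simp only: integral_complex_of_real of_real_eq_0_iff)
  then have "AE x in (lborel :: 'a measure). exp (- (norm x)\<^sup>2) = 0"
    using integral_nonneg_eq_0_iff_AE[OF i] by auto
  then have "AE x in (lborel :: 'a measure). False" by simp
  then have "emeasure (lborel :: 'a measure) UNIV = 0" by (simp add: AE_iff_measurable[where N = UNIV])
  then show False by simp
qed

text \<open>Expanding \<open>exp (- s |x|\<^sup>2)\<close> into its power series, vanishing moments against a Gaussian imply vanishing moments
  against a Gaussian of half the variance; the translated Gaussians then concentrate at \<open>y\<close>.\<close>

lemma gaussian_complete:
  fixes \<Phi> :: "'a::euclidean_space \<Rightarrow> complex"
  assumes cont: "continuous_on UNIV \<Phi>" and decay: "\<And>k. \<exists>C. \<forall>x. (1 + norm x) ^ k * norm (\<Phi> x) \<le> C * weight x"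
    and s: "s > 0"
    and zero: "\<And>p. real_polynomial_function p \<Longrightarrow> (LINT x|lborel. \<Phi> x * of_real (p x * exp (- s * (norm x)\<^sup>2))) = 0"
  shows "\<Phi> y = 0"
proof -
  define S where "S j = 2 ^ j * s" for j :: nat
  have S: "S j > 0" for j using s by (simp add: S_def)
  have dbl: "(LINT x|lborel. \<Phi> x * of_real (p x * exp (- S j * (norm x)\<^sup>2))) = 0" if "real_polynomial_function p" for p j
    using that
  proof (induction j arbitrary: p)
    case 0
    then show ?case using zero by (simp add: S_def)
  next
    case (Suc j)
    \<comment> \<open>The extreme admissible choice q = - S j |x|^2, with K = 0.\<close>
    have "(LINT x|lborel. \<Phi> x * of_real (p x * exp (- S j * (norm x)\<^sup>2) * exp (- S j * (norm x)\<^sup>2))) = 0"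
      by (rule gaussian_moments_exp[OF cont decay Suc.IH _ _ Suc.prems, where K = 0])
        (use S[of j] in \<open>auto intro!: real_polynomial_function.intros(4) real_polynomial_function.intros(2) real_polynomial_function_norm_square simp: abs_mult\<close>)
    moreover have e: "exp (- S j * r) * exp (- S j * r) = exp (- S (Suc j) * r)" for r
      by (simp add: S_def flip: exp_add)
    ultimately show ?case by (simp only: mult.assoc e)
  qed
  \<comment> \<open>The factor exp (2 S j (x . y)) moves the centre to y. It is admissible because 2
    |x . y| <= |x|^2 + |y|^2.\<close>
  have tr: "(LINT x|lborel. \<Phi> x * of_real (exp (- S j * (norm (x - y))\<^sup>2))) = 0" for j
  proof -
    have "(LINT x|lborel. \<Phi> x * of_real (1 * exp (- S j * (norm x)\<^sup>2) * exp (2 * S j * (x \<bullet> y)))) = 0"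
    proof (rule gaussian_moments_exp[OF cont decay dbl, where K = "S j * (norm y)\<^sup>2"])
      show "real_polynomial_function (\<lambda>x. 2 * S j * (x \<bullet> y))"
        by (intro real_polynomial_function.intros(4) real_polynomial_function.intros(2) real_polynomial_function.intros(1) bounded_linear_inner_left)
      show "\<bar>2 * S j * (x \<bullet> y)\<bar> \<le> S j * (norm x)\<^sup>2 + S j * (norm y)\<^sup>2" for x
      proof -
        have "2 * \<bar>x \<bullet> y\<bar> \<le> 2 * (norm x * norm y)" using Cauchy_Schwarz_ineq2[of x y] by simp
        also have "\<dots> \<le> (norm x)\<^sup>2 + (norm y)\<^sup>2" using sum_squares_bound[of "norm x" "norm y"] by simp
        finally have "S j * (2 * \<bar>x \<bullet> y\<bar>) \<le> S j * ((norm x)\<^sup>2 + (norm y)\<^sup>2)" using S[of j] by (intro mult_left_mono) auto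
        then show ?thesis using S[of j] by (simp add: abs_mult algebra_simps)
      qed
    qed (auto intro: real_polynomial_function.intros(2))
    then have a: "(LINT x|lborel. of_real (exp (- S j * (norm y)\<^sup>2)) * (\<Phi> x * of_real (exp (- S j * (norm x)\<^sup>2) * exp (2 * S j * (x \<bullet> y))))) = 0" by simp
    have "exp (- S j * (norm y)\<^sup>2) * (exp (- S j * (norm x)\<^sup>2) * exp (2 * S j * (x \<bullet> y))) = exp (- S j * (norm (x - y))\<^sup>2)" for x
      by (simp add: power2_norm_eq_inner inner_diff inner_commute algebra_simps flip: exp_add)
    then have e: "of_real (exp (- S j * (norm y)\<^sup>2)) * (\<Phi> x * of_real (exp (- S j * (norm x)\<^sup>2) * exp (2 * S j * (x \<bullet> y)))) = \<Phi> x * of_real (exp (- S j * (norm (x - y))\<^sup>2))" for x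
      by (metis (no_types, lifting) mult.left_commute of_real_mult)
    show ?thesis using a unfolding e .
  qed
  \<comment> \<open>At this length scale the substitution x = y + r z turns the narrow Gaussian into
    a fixed one.\<close>
  define r where "r j = 1 / sqrt (S j)" for j
  have r: "r j > 0" "S j * (r j)\<^sup>2 = 1" for j using S[of j] by (simp_all add: r_def power_divide)
  have m\<Phi> [measurable]: "\<Phi> \<in> borel_measurable borel" by (rule borel_measurable_continuous_onI[OF cont])
  have sc: "(LINT z|lborel. \<Phi> (y + r j *\<^sub>R z) * of_real (exp (- (norm z)\<^sup>2))) = 0" for j
  proof -
    let ?g = "\<lambda>x. \<Phi> x * of_real (exp (- S j * (norm (x - y))\<^sup>2))"
    have gm: "?g \<in> borel_measurable borel" by (intro borel_measurable_continuous_onI continuous_intros cont)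
    have "0 = (LINT x|density (distr lborel borel (\<lambda>x. y + r j *\<^sub>R x)) (\<lambda>_. ennreal (\<bar>r j\<bar> ^ DIM('a))). ?g x)"
      using tr[of j] lborel_affine[of "r j" y] r(1)[of j] by simp
    also have "\<dots> = (LINT x|distr lborel borel (\<lambda>x. y + r j *\<^sub>R x). (\<bar>r j\<bar> ^ DIM('a)) *\<^sub>R ?g x)"
      by (rule integral_density) (use gm in auto)
    also have "\<dots> = (LINT x|lborel. (\<bar>r j\<bar> ^ DIM('a)) *\<^sub>R ?g (y + r j *\<^sub>R x))"
      by (rule integral_distr) (use gm in \<open>auto intro!: borel_measurable_scaleR\<close>)
    also have "\<dots> = (\<bar>r j\<bar> ^ DIM('a)) *\<^sub>R (LINT x|lborel. ?g (y + r j *\<^sub>R x))" by simp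
    finally have "(LINT x|lborel. ?g (y + r j *\<^sub>R x)) = 0" using r(1)[of j] by simp
    moreover have "S j * (norm (r j *\<^sub>R x))\<^sup>2 = (norm x)\<^sup>2" for x :: 'a
      using r(2)[of j] by (simp add: power_mult_distrib flip: mult.assoc)
    ultimately show ?thesis by simp
  qed
  obtain C where C: "\<And>x. norm (\<Phi> x) \<le> C * weight x" using decay[of 0] by auto
  have w1: "weight x \<le> 1" for x :: 'a unfolding weight_def by (rule prod_le_1) (auto simp: add_nonneg_nonneg divide_le_eq add_pos_nonneg)
  have C0: "C \<ge> 0" using order_trans[OF norm_ge_zero C[of 0]] weight_pos[of "0::'a"] by (simp add: zero_le_mult_iff)
  have "(\<lambda>j. LINT z|lborel. \<Phi> (y + r j *\<^sub>R z) * of_real (exp (- (norm z)\<^sup>2))) \<longlonglongrightarrow> (LINT z|lborel. \<Phi> y * of_real (exp (- (norm (z::'a))\<^sup>2)))"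
  proof (rule integral_dominated_convergence)
    show "(\<lambda>z::'a. \<Phi> y * of_real (exp (- (norm z)\<^sup>2))) \<in> borel_measurable lborel"
      unfolding measurable_lborel1 measurable_lborel2 by (intro borel_measurable_continuous_onI continuous_intros)
    show "(\<lambda>z::'a. \<Phi> (y + r j *\<^sub>R z) * of_real (exp (- (norm z)\<^sup>2))) \<in> borel_measurable lborel" for j
      unfolding measurable_lborel1 measurable_lborel2
      by (intro borel_measurable_continuous_onI continuous_intros continuous_on_compose2[OF cont]) auto
    show "integrable lborel (\<lambda>z::'a. C * weight z)" by (rule integrable_mult_right[OF integrable_weight])
    show "AE z::'a in lborel. (\<lambda>j. \<Phi> (y + r j *\<^sub>R z) * of_real (exp (- (norm z)\<^sup>2))) \<longlonglongrightarrow> \<Phi> y * of_real (exp (- (norm z)\<^sup>2))"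
    proof (intro always_eventually allI)
      fix z :: 'a
      have "(\<lambda>j. r j * r j) \<longlonglongrightarrow> 0"
      proof -
        have "(\<lambda>j. (1 / s) * (1 / 2) ^ j) \<longlonglongrightarrow> (1 / s) * 0" by (intro tendsto_intros LIMSEQ_realpow_zero) auto
        moreover have "r j * r j = (1 / s) * (1 / 2) ^ j" for j using r(2)[of j] S[of j] s by (simp add: S_def field_simps power2_eq_square)
        ultimately show ?thesis by simp
      qed
      then have "(\<lambda>j. sqrt (r j * r j)) \<longlonglongrightarrow> sqrt 0" by (rule tendsto_real_sqrt)
      then have "r \<longlonglongrightarrow> 0" using r(1) by (simp add: less_imp_le)
      then have "(\<lambda>j. y + r j *\<^sub>R z) \<longlonglongrightarrow> y + 0 *\<^sub>R z" by (intro tendsto_intros)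
      then have "(\<lambda>j. \<Phi> (y + r j *\<^sub>R z)) \<longlonglongrightarrow> \<Phi> y"
        using continuous_on_tendsto_compose[OF cont, of "\<lambda>j. y + r j *\<^sub>R z" y] by simp
      then show "(\<lambda>j. \<Phi> (y + r j *\<^sub>R z) * of_real (exp (- (norm z)\<^sup>2))) \<longlonglongrightarrow> \<Phi> y * of_real (exp (- (norm z)\<^sup>2))"
        by (intro tendsto_intros)
    qed
    show "AE z::'a in lborel. norm (\<Phi> (y + r j *\<^sub>R z) * of_real (exp (- (norm z)\<^sup>2))) \<le> C * weight z" for j
    proof (intro always_eventually allI)
      fix z :: 'a
      have "norm (\<Phi> (y + r j *\<^sub>R z)) \<le> C" using order_trans[OF C mult_left_mono[OF w1 C0]] by simp
      then show "norm (\<Phi> (y + r j *\<^sub>R z) * of_real (exp (- (norm z)\<^sup>2))) \<le> C * weight z"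
        unfolding norm_mult using exp_minus_norm_square_le_weight[of z] C0 by (intro mult_mono) auto
    qed
  qed
  then have "(LINT z|lborel. \<Phi> y * of_real (exp (- (norm (z::'a))\<^sup>2))) = 0" unfolding sc by (simp add: LIMSEQ_const_iff)
  then show ?thesis using gaussian_integral_nonzero[where 'a = 'a] by simp
qed

section \<open>Sobolev inequalities on lines and in the plane\<close>

lemma sobolev_slice:
  fixes g g' :: "real \<Rightarrow> complex"
  assumes d: "\<And>t. (g has_vector_derivative g' t) (at t)" and c: "continuous_on UNIV g'"
    and lim: "(\<lambda>n. g (real n)) \<longlonglongrightarrow> 0"
  shows "ennreal ((norm (g x))\<^sup>2) \<le> (\<integral>\<^sup>+t. ennreal ((norm (g t))\<^sup>2 + (norm (g' t))\<^sup>2) \<partial>lborel)"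
proof (cases "(\<integral>\<^sup>+t. ennreal ((norm (g t))\<^sup>2 + (norm (g' t))\<^sup>2) \<partial>lborel) = \<infinity>")
  case False
  define h where "h t = (norm (g t))\<^sup>2 + (norm (g' t))\<^sup>2" for t
  have cg: "continuous_on UNIV g" using d by (intro continuous_at_imp_continuous_on ballI has_vector_derivative_continuous) auto
  have hc: "continuous_on UNIV h" unfolding h_def by (intro continuous_intros c cg)
  have h0: "h t \<ge> 0" for t by (simp add: h_def)
  obtain I where I: "(\<integral>\<^sup>+t. ennreal (h t) \<partial>lborel) = ennreal I" "I \<ge> 0"
    using False unfolding h_def by (cases "(\<integral>\<^sup>+t. ennreal ((norm (g t))\<^sup>2 + (norm (g' t))\<^sup>2) \<partial>lborel)") (auto simp: top_ennreal_def)
  have le: "(norm (g x))\<^sup>2 \<le> (norm (g (real n)))\<^sup>2 + I" if n: "x \<le> real n" for n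
  proof -
    \<comment> \<open>The derivative of |g|^2 is 2 (g . g'), at most |g|^2 + |g'|^2 in absolute
      value. Integrating from x to an integer n bounds |g x|^2 up to |g n|^2, which tends to
      0.\<close>
    define H where "H t = - (norm (g t))\<^sup>2" for t
    define H' where "H' t = - (2 * (g t \<bullet> g' t))" for t
    have H: "(H has_vector_derivative H' t) (at t within {x..real n})" for t
    proof -
      have "((\<lambda>t. g t \<bullet> g t) has_vector_derivative (g t \<bullet> g' t + g' t \<bullet> g t)) (at t)"
        by (rule bounded_bilinear.has_vector_derivative[OF bounded_bilinear_inner d d])
      from has_vector_derivative_minus[OF this] show ?thesis
        by (auto simp: H_def[abs_def] H'_def power2_norm_eq_inner inner_commute intro: has_vector_derivative_at_within)
    qed
    have "(\<integral>t. indicator {x..real n} t *\<^sub>R H' t \<partial>lborel) = H (real n) - H x"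
      by (rule integral_FTC_Icc[OF n H]) (unfold H'_def, intro continuous_intros continuous_on_subset[OF c] continuous_on_subset[OF cg], auto)
    moreover have "(\<integral>t. indicator {x..real n} t *\<^sub>R H' t \<partial>lborel) \<le> I"
    proof -
      have "set_integrable lborel {x..real n} H'"
        by (rule borel_integrable_atLeastAtMost') (unfold H'_def[abs_def], intro continuous_intros continuous_on_subset[OF c] continuous_on_subset[OF cg], auto)
      then have i: "integrable lborel (\<lambda>t. indicator {x..real n} t *\<^sub>R H' t)" by (simp add: set_integrable_def)
      have "ennreal (\<integral>t. indicator {x..real n} t *\<^sub>R H' t \<partial>lborel) \<le> ennreal (\<integral>t. norm (indicator {x..real n} t *\<^sub>R H' t) \<partial>lborel)"
        by (intro ennreal_leI order_trans[OF _ integral_norm_bound]) simp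
      also have "\<dots> = (\<integral>\<^sup>+t. ennreal (norm (indicator {x..real n} t *\<^sub>R H' t)) \<partial>lborel)"
        by (rule nn_integral_eq_integral[symmetric]) (use integrable_norm[OF i] in auto)
      also have "\<dots> \<le> (\<integral>\<^sup>+t. ennreal (h t) \<partial>lborel)"
      proof (intro nn_integral_mono ennreal_leI)
        fix t
        have "\<bar>H' t\<bar> \<le> 2 * (norm (g t) * norm (g' t))" unfolding H'_def using Cauchy_Schwarz_ineq2[of "g t" "g' t"] by (simp add: abs_mult)
        also have "\<dots> \<le> h t" unfolding h_def using sum_squares_bound[of "norm (g t)" "norm (g' t)"] by simp
        finally show "norm (indicator {x..real n} t *\<^sub>R H' t) \<le> h t" using h0[of t] by (simp split: split_indicator)
      qed
      finally show ?thesis unfolding I(1) using I(2) by (simp add: ennreal_le_iff)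
    qed
    ultimately show ?thesis by (simp add: H_def)
  qed
  have "(\<lambda>n. (norm (g (real n)))\<^sup>2 + I) \<longlonglongrightarrow> (norm (0::complex))\<^sup>2 + I" by (intro tendsto_intros lim)
  then have "(norm (g x))\<^sup>2 \<le> (norm (0::complex))\<^sup>2 + I"
    by (rule tendsto_lowerbound) (use le in \<open>auto simp: eventually_sequentially intro!: exI[of _ "nat \<lceil>x\<rceil>"] le\<close>)
  then show ?thesis using I unfolding h_def[symmetric] by (simp add: ennreal_leI)
qed simp

definition L2_square :: "('a::euclidean_space \<Rightarrow> complex) \<Rightarrow> real" where
  "L2_square f = (LINT x|lborel. (norm (f x))\<^sup>2)"

lemma L2_square_integrable: "f \<in> schwartz_space \<Longrightarrow> integrable lborel (\<lambda>x. (norm (f x))\<^sup>2)"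
  using integrable_norm[OF schwartz_mult_integrable[of f f]] by (simp add: norm_mult power2_eq_square)

lemma L2_square_nonneg: "0 \<le> L2_square f"
  unfolding L2_square_def by (rule integral_nonneg_AE) auto

lemma L2_square_eq: "complex_of_real (L2_square f) = (LINT x|lborel. f x * cnj (f x))"
  unfolding L2_square_def integral_complex_of_real[symmetric] by (simp only: complex_norm_square)

lemma schwartz_tendsto_zero:
  assumes f: "f \<in> schwartz_space" and z: "\<And>n. real n \<le> norm (z n)"
  shows "(\<lambda>n. f (z n)) \<longlonglongrightarrow> 0"
proof (rule Lim_null_comparison)
  show "(\<lambda>n. schwartz_seminorm 1 [] f * (1 / real n)) \<longlonglongrightarrow> 0"
    using tendsto_mult[OF tendsto_const lim_1_over_n, of "schwartz_seminorm 1 [] f"] by simp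
  have "norm (f (z n)) \<le> schwartz_seminorm 1 [] f * (1 / real n)" if n: "n \<ge> 1" for n
  proof -
    have "real n * norm (f (z n)) \<le> norm (z n) ^ 1 * norm (iter_deriv [] f (z n))" using z[of n] by (simp add: mult_right_mono)
    also have "\<dots> \<le> schwartz_seminorm 1 [] f" by (rule schwartz_seminorm_upper[OF f]) simp
    finally show ?thesis using n by (simp add: field_simps)
  qed
  then show "\<forall>\<^sub>F n in sequentially. norm (f (z n)) \<le> schwartz_seminorm 1 [] f * (1 / real n)"
    unfolding eventually_sequentially by blast
qed

lemma sobolev_line:
  assumes f: "f \<in> schwartz_space" and b: "b \<in> Basis" and x: "x \<bullet> b = 0"
  shows "ennreal ((norm (f (x + r *\<^sub>R b)))\<^sup>2) \<le> (\<integral>\<^sup>+s. ennreal ((norm (f (x + s *\<^sub>R b)))\<^sup>2 + (norm (partial_deriv b f (x + s *\<^sub>R b)))\<^sup>2) \<partial>lborel)"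
proof (rule sobolev_slice[where g = "\<lambda>s. f (x + s *\<^sub>R b)" and g' = "\<lambda>s. partial_deriv b f (x + s *\<^sub>R b)"])
  show "((\<lambda>s. f (x + s *\<^sub>R b)) has_vector_derivative partial_deriv b f (x + t *\<^sub>R b)) (at t)" for t
    using smooth_differentiable[OF schwartz_smooth[OF f], of "[]"] by (intro has_vector_derivative_along) simp
  show "continuous_on UNIV (\<lambda>s. partial_deriv b f (x + s *\<^sub>R b))"
    by (intro continuous_on_compose2[OF schwartz_continuous[OF schwartz_partial_deriv(1)[OF f b]]] continuous_intros) auto
  \<comment> \<open>Since x has no component along b, the point lies at distance at least n from the
    origin.\<close>
  have "real n \<le> norm (x + real n *\<^sub>R b)" for n
    using Basis_le_norm[OF b, of "x + real n *\<^sub>R b"] b x by (simp add: inner_add_left)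
  then show "(\<lambda>n. f (x + real n *\<^sub>R b)) \<longlonglongrightarrow> 0" by (rule schwartz_tendsto_zero[OF f])
qed

lemma sobolev_real:
  assumes f: "f \<in> schwartz_space" shows "(norm (f (x::real)))\<^sup>2 \<le> (\<Sum>bs\<in>{[], [1]}. L2_square (iter_deriv bs f))"
proof -
  have d: "partial_deriv 1 f \<in> schwartz_space" by (rule schwartz_partial_deriv(1)[OF f]) simp
  have "ennreal ((norm (f x))\<^sup>2) \<le> (\<integral>\<^sup>+s. ennreal ((norm (f s))\<^sup>2 + (norm (partial_deriv 1 f s))\<^sup>2) \<partial>lborel)"
    using sobolev_line[OF f, of 1 0 x] by simp
  also have "\<dots> = ennreal (LINT s|lborel. (norm (f s))\<^sup>2 + (norm (partial_deriv 1 f s))\<^sup>2)"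
    by (rule nn_integral_eq_integral) (auto intro!: Bochner_Integration.integrable_add L2_square_integrable f d)
  also have "(LINT s|lborel. (norm (f s))\<^sup>2 + (norm (partial_deriv 1 f s))\<^sup>2) = L2_square f + L2_square (partial_deriv 1 f)"
    unfolding L2_square_def by (rule Bochner_Integration.integral_add) (auto intro!: L2_square_integrable f d)
  finally show ?thesis by (simp add: ennreal_le_iff L2_square_nonneg del: ennreal_plus)
qed

text \<open>The inequality along lines is used in the first direction, and then in the second for f
  and for its first partial derivative; this produces exactly these four words, the last being the
  mixed derivative.\<close>

lemma sobolev_plane:
  assumes f: "f \<in> schwartz_space"
  shows "(norm (f (z::real \<times> real)))\<^sup>2 \<le> (\<Sum>bs\<in>{[], [(1, 0)], [(0, 1)], [(0, 1), (1, 0)]}. L2_square (iter_deriv bs f))"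
proof -
  have B: "(1, 0) \<in> (Basis :: (real \<times> real) set)" "(0, 1) \<in> (Basis :: (real \<times> real) set)" by (auto simp: Basis_prod_def)
  let ?f1 = "partial_deriv (1, 0) f" and ?f2 = "partial_deriv (0, 1) f"
  let ?f21 = "partial_deriv (0, 1) ?f1"
  have S: "?f1 \<in> schwartz_space" "?f2 \<in> schwartz_space" "?f21 \<in> schwartz_space"
    by (intro schwartz_partial_deriv(1) f B)+
  define H where "H z = (norm (f z))\<^sup>2 + (norm (?f2 z))\<^sup>2 + ((norm (?f1 z))\<^sup>2 + (norm (?f21 z))\<^sup>2)" for z
  have Hi: "integrable lborel H" unfolding H_def[abs_def]
    by (intro Bochner_Integration.integrable_add L2_square_integrable f S)
  have c: "g \<in> schwartz_space \<Longrightarrow> continuous_on UNIV (\<lambda>t. g (s, t))" "g \<in> schwartz_space \<Longrightarrow> continuous_on UNIV (\<lambda>t. g (t, s))"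
    for g :: "real \<times> real \<Rightarrow> complex" and s
    by (auto intro!: continuous_on_compose2[OF schwartz_continuous[of g]] continuous_intros)
  have inner: "ennreal ((norm (f (s, y)))\<^sup>2 + (norm (?f1 (s, y)))\<^sup>2) \<le> (\<integral>\<^sup>+t. ennreal (H (s, t)) \<partial>lborel)" for s y
  proof -
    have "ennreal ((norm (f (s, y)))\<^sup>2) \<le> (\<integral>\<^sup>+t. ennreal ((norm (f (s, t)))\<^sup>2 + (norm (?f2 (s, t)))\<^sup>2) \<partial>lborel)"
      using sobolev_line[OF f B(2), of "(s, 0)" y] by simp
    moreover have "ennreal ((norm (?f1 (s, y)))\<^sup>2) \<le> (\<integral>\<^sup>+t. ennreal ((norm (?f1 (s, t)))\<^sup>2 + (norm (?f21 (s, t)))\<^sup>2) \<partial>lborel)"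
      using sobolev_line[OF S(1) B(2), of "(s, 0)" y] by simp
    ultimately have "ennreal ((norm (f (s, y)))\<^sup>2) + ennreal ((norm (?f1 (s, y)))\<^sup>2) \<le>
      (\<integral>\<^sup>+t. ennreal ((norm (f (s, t)))\<^sup>2 + (norm (?f2 (s, t)))\<^sup>2) \<partial>lborel) + (\<integral>\<^sup>+t. ennreal ((norm (?f1 (s, t)))\<^sup>2 + (norm (?f21 (s, t)))\<^sup>2) \<partial>lborel)"
      by (rule add_mono)
    also have "\<dots> = (\<integral>\<^sup>+t. ennreal ((norm (f (s, t)))\<^sup>2 + (norm (?f2 (s, t)))\<^sup>2) + ennreal ((norm (?f1 (s, t)))\<^sup>2 + (norm (?f21 (s, t)))\<^sup>2) \<partial>lborel)"
      by (rule nn_integral_add[symmetric]; unfold measurable_lborel1 measurable_lborel2; intro measurable_compose[OF _ measurable_ennreal] borel_measurable_continuous_onI continuous_intros c f S)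
    also have "\<dots> = (\<integral>\<^sup>+t. ennreal (H (s, t)) \<partial>lborel)" by (simp add: H_def flip: ennreal_plus)
    finally show ?thesis by (simp flip: ennreal_plus)
  qed
  obtain x y where z: "z = (x, y)" by force
  have "ennreal ((norm (f z))\<^sup>2) \<le> (\<integral>\<^sup>+s. ennreal ((norm (f (s, y)))\<^sup>2 + (norm (?f1 (s, y)))\<^sup>2) \<partial>lborel)"
    using sobolev_line[OF f B(1), of "(0, y)" x] by (simp add: z)
  also have "\<dots> \<le> (\<integral>\<^sup>+s. \<integral>\<^sup>+t. ennreal (H (s, t)) \<partial>lborel \<partial>lborel)"
    by (intro nn_integral_mono inner)
  also have "\<dots> = (\<integral>\<^sup>+z. ennreal (H z) \<partial>(lborel \<Otimes>\<^sub>M lborel))"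
    using borel_measurable_integrable[OF Hi] by (intro lborel.nn_integral_fst) (simp add: lborel_prod)
  also have "\<dots> = (\<integral>\<^sup>+z. ennreal (H z) \<partial>lborel)" by (simp add: lborel_prod)
  also have "\<dots> = ennreal (LINT z|lborel. H z)"
    by (rule nn_integral_eq_integral[OF Hi]) (auto simp: H_def)
  also have "(LINT z|lborel. H z) = L2_square f + L2_square ?f2 + (L2_square ?f1 + L2_square ?f21)"
    unfolding L2_square_def H_def by (simp add: L2_square_integrable f S)
  finally show ?thesis by (simp add: ennreal_le_iff L2_square_nonneg add_ac del: ennreal_plus)
qed

section \<open>Words in coordinates and derivatives\<close>

lemma partial_deriv_sum:
  assumes "finite I" "\<And>i. i \<in> I \<Longrightarrow> f i differentiable (at x)"
  shows "partial_deriv b (\<lambda>x. \<Sum>i\<in>I. a i * f i x) x = (\<Sum>i\<in>I. a i * partial_deriv b (f i) x)"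
  using assms
proof (induction I rule: finite_induct)
  case (insert i I)
  have "(\<lambda>x. \<Sum>i\<in>I. a i * f i x) differentiable (at x)"
    by (intro differentiable_sum insert ballI differentiable_mult differentiable_const insert.prems) simp
  moreover have "(\<lambda>x. a i * f i x) differentiable (at x)"
    by (intro differentiable_mult differentiable_const insert.prems) simp
  ultimately show ?case using insert by (simp add: partial_deriv_add partial_deriv_cmult)
qed simp

definition generator :: "bool \<times> 'a::euclidean_space \<Rightarrow> ('a \<Rightarrow> complex) \<Rightarrow> 'a \<Rightarrow> complex" where
  "generator g = (if fst g then coord_mult (snd g) else partial_deriv (snd g))"

definition apply_word :: "(bool \<times> 'a::euclidean_space) list \<Rightarrow> ('a \<Rightarrow> complex) \<Rightarrow> 'a \<Rightarrow> complex" where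
  "apply_word w f = foldr generator w f"

lemma generator_schwartz: "f \<in> schwartz_space \<Longrightarrow> snd g \<in> Basis \<Longrightarrow> generator g f \<in> schwartz_space"
  by (simp add: generator_def schwartz_coord_mult(1) schwartz_partial_deriv(1))

lemma apply_word_schwartz: "f \<in> schwartz_space \<Longrightarrow> snd ` set w \<subseteq> Basis \<Longrightarrow> apply_word w f \<in> schwartz_space"
  by (induction w) (auto simp: apply_word_def intro: generator_schwartz)

lemma generator_sum:
  assumes "finite I" "\<And>i. i \<in> I \<Longrightarrow> f i \<in> schwartz_space"
  shows "generator g (\<lambda>x. \<Sum>i\<in>I. a i * f i x) = (\<lambda>x. \<Sum>i\<in>I. a i * generator g (f i) x)"
proof
  fix x
  have "f i differentiable (at x)" if "i \<in> I" for i
    using smooth_differentiable[OF schwartz_smooth[OF assms(2)[OF that]], of "[]"] by simp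
  then show "generator g (\<lambda>x. \<Sum>i\<in>I. a i * f i x) x = (\<Sum>i\<in>I. a i * generator g (f i) x)"
    using assms(1) by (auto simp: generator_def coord_mult_def partial_deriv_sum sum_distrib_left mult_ac)
qed

lemma apply_word_sum:
  assumes "finite I" "\<And>i. i \<in> I \<Longrightarrow> f i \<in> schwartz_space" "snd ` set w \<subseteq> Basis"
  shows "apply_word w (\<lambda>x. \<Sum>i\<in>I. a i * f i x) = (\<lambda>x. \<Sum>i\<in>I. a i * apply_word w (f i) x)"
  using assms(3)
proof (induction w)
  case (Cons g w)
  have "apply_word w (f i) \<in> schwartz_space" if "i \<in> I" for i
    using Cons.prems assms(2)[OF that] by (intro apply_word_schwartz) auto
  then show ?case using Cons generator_sum[OF assms(1), of "\<lambda>i. apply_word w (f i)" g a] by (simp add: apply_word_def)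
qed (simp add: apply_word_def)

text \<open>Cauchy-Schwarz over the K summands. Words destroy the orthogonality of the basis
  functions, so the cross terms cannot simply be dropped.\<close>

lemma L2_square_sum_le:
  assumes "\<And>k. k < K \<Longrightarrow> f k \<in> schwartz_space"
  shows "L2_square (\<lambda>x. \<Sum>k<K. a k * f k x) \<le> real K * (\<Sum>k<K. (norm (a k))\<^sup>2 * L2_square (f k))"
proof -
  have S: "(\<lambda>x. \<Sum>k<K. a k * f k x) \<in> schwartz_space"
    by (rule schwartz_sum) (auto intro: schwartz_cmult(1) assms)
  have pt: "(norm (\<Sum>k<K. a k * f k x))\<^sup>2 \<le> real K * (\<Sum>k<K. (norm (a k))\<^sup>2 * (norm (f k x))\<^sup>2)" for x
  proof -
    have "(norm (\<Sum>k<K. a k * f k x))\<^sup>2 \<le> (\<Sum>k<K. norm (a k * f k x))\<^sup>2"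
      by (intro power_mono norm_sum) auto
    also have "\<dots> \<le> real (card {..<K}) * (\<Sum>k<K. (norm (a k * f k x))\<^sup>2)"
      using sum_squared_le_sum_of_squares[of "\<lambda>k. norm (a k * f k x)" "{..<K}"] by (simp add: mult.commute)
    finally show ?thesis by (simp add: norm_mult power_mult_distrib)
  qed
  have i: "integrable lborel (\<lambda>x. \<Sum>k<K. (norm (a k))\<^sup>2 * (norm (f k x))\<^sup>2)"
    by (intro Bochner_Integration.integrable_sum integrable_mult_right L2_square_integrable assms) simp
  have "L2_square (\<lambda>x. \<Sum>k<K. a k * f k x) \<le> (LINT x|lborel. real K * (\<Sum>k<K. (norm (a k))\<^sup>2 * (norm (f k x))\<^sup>2))"
    unfolding L2_square_def by (intro integral_mono pt L2_square_integrable[OF S] integrable_mult_right i)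
  also have "\<dots> = real K * (\<Sum>k<K. (norm (a k))\<^sup>2 * L2_square (f k))"
    unfolding L2_square_def by (simp add: L2_square_integrable assms)
  finally show ?thesis .
qed

text \<open>The index may grow polynomially instead of by a bounded shift: with two indices coded
  into one, a neighbour in one direction can be far away in the code.\<close>

definition band_operator :: "(nat \<Rightarrow> 'a \<Rightarrow> complex) \<Rightarrow> (('a \<Rightarrow> complex) \<Rightarrow> 'a \<Rightarrow> complex) \<Rightarrow> bool" where
  "band_operator e G \<longleftrightarrow> (\<exists>(K :: nat) T (J :: nat \<Rightarrow> nat \<Rightarrow> nat) C N. C \<ge> 0 \<and>
     (\<forall>i. G (e i) = (\<lambda>x. \<Sum>k<K. T k i * e (J k i) x)) \<and>
     (\<forall>i. \<forall>k<K. norm (T k i) \<le> C * (1 + real i) ^ N \<and> 1 + real (J k i) \<le> C * (1 + real i) ^ N))"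

text \<open>\<open>H\<close> is (a product of operators) of the form annihilation times creation: its powers yield the decay
  of the coefficients. The words in \<open>W\<close> are the derivatives in a Sobolev inequality.\<close>

locale ladder_basis =
  fixes e :: "nat \<Rightarrow> 'a::euclidean_space \<Rightarrow> complex" and c0 s0 :: real and \<omega> :: "'a \<Rightarrow> complex"
    and H :: "('a \<Rightarrow> complex) \<Rightarrow> 'a \<Rightarrow> complex" and \<mu> :: "nat \<Rightarrow> real" and W :: "'a list set"
  assumes e_schwartz: "e i \<in> schwartz_space"
    and band: "snd g \<in> Basis \<Longrightarrow> band_operator e (generator g)"
    and orthogonal: "(LINT x|lborel. e i x * cnj (e j x)) = (if i = j then of_real c0 else 0)"
    and c0: "c0 > 0"
    and H: "schwartz_op H"
    and H_eigen: "\<phi> \<in> schwartz_space \<Longrightarrow> (LINT x|lborel. H \<phi> x * cnj (e i x)) = of_real (\<mu> i) * (LINT x|lborel. \<phi> x * cnj (e i x))"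
    and \<mu>: "1 + real i \<le> (\<mu> i)\<^sup>2" "\<mu> i \<ge> 1"
    and gaussian: "e 0 x = \<omega> x * of_real (exp (- s0 * (norm x)\<^sup>2))" and s0: "s0 > 0"
    and \<omega>: "norm (\<omega> x) = 1" "continuous_on UNIV \<omega>"
    and W: "finite W" "W \<subseteq> lists Basis"
    and sobolev: "f \<in> schwartz_space \<Longrightarrow> (norm (f x))\<^sup>2 \<le> (\<Sum>bs\<in>W. L2_square (iter_deriv bs f))"
begin

text \<open>The letter next to the basis function acts first and leaves K basis functions, to which
  the bound for the remaining word applies; hence the induction from the right end.\<close>

lemma L2_word_bound:
  "snd ` set w \<subseteq> Basis \<Longrightarrow> \<exists>C N. C \<ge> 0 \<and> (\<forall>i. L2_square (apply_word w (e i)) \<le> C * (1 + real i) ^ N)"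
proof (induction w rule: rev_induct)
  case Nil
  have "complex_of_real (L2_square (e i)) = of_real c0" for i by (simp add: L2_square_eq orthogonal)
  then have "L2_square (e i) = c0" for i by simp
  then show ?case using c0 by (intro exI[of _ c0] exI[of _ 0]) (auto simp: apply_word_def)
next
  case (snoc g w)
  then have w: "snd ` set w \<subseteq> Basis" and g: "snd g \<in> Basis" by auto
  obtain C N where C: "C \<ge> 0" "\<And>i. L2_square (apply_word w (e i)) \<le> C * (1 + real i) ^ N" using snoc.IH[OF w] by blast
  obtain K :: nat and T and J :: "nat \<Rightarrow> nat \<Rightarrow> nat" and D M where D0: "D \<ge> 0 \<and> (\<forall>i. generator g (e i) = (\<lambda>x. \<Sum>k<K. T k i * e (J k i) x)) \<and>
    (\<forall>i. \<forall>k<K. norm (T k i) \<le> D * (1 + real i) ^ M \<and> 1 + real (J k i) \<le> D * (1 + real i) ^ M)"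
    using band[OF g] unfolding band_operator_def by (elim exE) (rule that)
  then have D: "D \<ge> 0" "\<And>i. generator g (e i) = (\<lambda>x. \<Sum>k<K. T k i * e (J k i) x)"
    "\<And>i k. k < K \<Longrightarrow> norm (T k i) \<le> D * (1 + real i) ^ M" "\<And>i k. k < K \<Longrightarrow> 1 + real (J k i) \<le> D * (1 + real i) ^ M"
    by blast+
  have "L2_square (apply_word (w @ [g]) (e i)) \<le> (real K * real K * D\<^sup>2 * C * D ^ N) * (1 + real i) ^ (2 * M + M * N)" for i
  proof -
    have "apply_word (w @ [g]) (e i) = (\<lambda>x. \<Sum>k<K. T k i * apply_word w (e (J k i)) x)"
      using apply_word_sum[OF _ _ w, of "{..<K}" "\<lambda>k. e (J k i)" "\<lambda>k. T k i"] e_schwartz by (simp add: apply_word_def D(2))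
    then have "L2_square (apply_word (w @ [g]) (e i)) \<le> real K * (\<Sum>k<K. (norm (T k i))\<^sup>2 * L2_square (apply_word w (e (J k i))))"
      using L2_square_sum_le[of K "\<lambda>k. apply_word w (e (J k i))"] apply_word_schwartz[OF e_schwartz w] by simp
    also have "\<dots> \<le> real K * (\<Sum>k<K. (D * (1 + real i) ^ M)\<^sup>2 * (C * (D * (1 + real i) ^ M) ^ N))"
    proof (intro mult_left_mono sum_mono mult_mono)
      fix k assume k: "k \<in> {..<K}"
      show "(norm (T k i))\<^sup>2 \<le> (D * (1 + real i) ^ M)\<^sup>2" using D(3)[of k i] k by (intro power_mono) auto
      have "L2_square (apply_word w (e (J k i))) \<le> C * (1 + real (J k i)) ^ N" by (rule C(2))
      also have "\<dots> \<le> C * (D * (1 + real i) ^ M) ^ N" using D(4)[of k i] k C(1) by (intro mult_left_mono power_mono) auto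
      finally show "L2_square (apply_word w (e (J k i))) \<le> C * (D * (1 + real i) ^ M) ^ N" .
    qed (auto simp: L2_square_nonneg)
    also have "\<dots> = (real K * real K * D\<^sup>2 * C * D ^ N) * (1 + real i) ^ (2 * M + M * N)"
      by (simp add: power_mult_distrib power_add power_mult[symmetric] mult_ac)
    finally show ?thesis .
  qed
  then show ?case using C(1) D(1) by (intro exI[of _ "real K * real K * D\<^sup>2 * C * D ^ N"] exI[of _ "2 * M + M * N"]) auto
qed

lemma sum_poly_bound:
  assumes "finite A" "\<And>a. a \<in> A \<Longrightarrow> \<exists>C N. C \<ge> 0 \<and> (\<forall>i. f a i \<le> C * (1 + real i) ^ N)"
  shows "\<exists>C N. C \<ge> 0 \<and> (\<forall>i. (\<Sum>a\<in>A. f a i) \<le> C * (1 + real i) ^ N)"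
  using assms
proof (induction A rule: finite_induct)
  case empty
  then show ?case by (intro exI[of _ 0]) auto
next
  case (insert a A)
  obtain C N D M where *: "C \<ge> 0" "\<And>i. f a i \<le> C * (1 + real i) ^ N" "D \<ge> 0" "\<And>i. (\<Sum>a\<in>A. f a i) \<le> D * (1 + real i) ^ M"
    using insert by (metis insertI1 insertI2)
  have "(\<Sum>a\<in>insert a A. f a i) \<le> (C + D) * (1 + real i) ^ (N + M)" for i
  proof -
    have "C * (1 + real i) ^ N \<le> C * (1 + real i) ^ (N + M)" "D * (1 + real i) ^ M \<le> D * (1 + real i) ^ (N + M)"
      using *(1,3) by (auto intro!: mult_left_mono power_increasing)
    then show ?thesis using *(2)[of i] *(4)[of i] insert(1,2) by (simp add: distrib_right)
  qed
  then show ?case using *(1,3) by (intro exI[of _ "C + D"] exI[of _ "N + M"]) auto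
qed

lemma iter_deriv_eq_apply_word: "iter_deriv bs f = apply_word (map (Pair False) bs) f"
  by (induction bs) (auto simp: apply_word_def generator_def)

text \<open>The Sobolev inequality reduces the supremum to L^2 bounds for the words lengthened by
  its derivatives.\<close>

lemma sup_word_bound:
  assumes w: "snd ` set w \<subseteq> Basis"
  shows "\<exists>C N. C \<ge> 0 \<and> (\<forall>i x. norm (apply_word w (e i) x) \<le> C * (1 + real i) ^ N)"
proof -
  have "\<exists>C N. C \<ge> 0 \<and> (\<forall>i. (\<Sum>bs\<in>W. L2_square (iter_deriv bs (apply_word w (e i)))) \<le> C * (1 + real i) ^ N)"
  proof (rule sum_poly_bound[OF W(1)])
    fix bs assume "bs \<in> W"
    then have "set bs \<subseteq> Basis" using W(2) by auto
    then have "snd ` set (map (Pair False) bs @ w) \<subseteq> Basis" using w by auto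
    from L2_word_bound[OF this] show "\<exists>C N. C \<ge> 0 \<and> (\<forall>i. L2_square (iter_deriv bs (apply_word w (e i))) \<le> C * (1 + real i) ^ N)"
      by (simp add: iter_deriv_eq_apply_word apply_word_def)
  qed
  then obtain C N where C: "C \<ge> 0" "\<And>i. (\<Sum>bs\<in>W. L2_square (iter_deriv bs (apply_word w (e i)))) \<le> C * (1 + real i) ^ N" by blast
  have "norm (apply_word w (e i) x) \<le> (C + 1) * (1 + real i) ^ N" for i x
  proof -
    let ?n = "norm (apply_word w (e i) x)"
    have "?n\<^sup>2 \<le> C * (1 + real i) ^ N" using sobolev[OF apply_word_schwartz[OF e_schwartz w], of i x] C(2)[of i] by linarith
    \<comment> \<open>A bound for the square passes to the norm by t <= t^2 + 1.\<close>
    moreover have "?n \<le> ?n\<^sup>2 + 1"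
    proof -
      have "2 * ?n \<le> ?n\<^sup>2 + 1" using sum_squares_bound[of ?n 1] by simp
      moreover have "0 \<le> ?n" by simp
      ultimately show ?thesis by linarith
    qed
    moreover have "1 \<le> (1 + real i) ^ N" by (rule one_le_power) simp
    ultimately show ?thesis unfolding distrib_right mult_1_left by linarith
  qed
  then show ?thesis using C(1) by (intro exI[of _ "C + 1"] exI[of _ N]) auto
qed

text \<open>Each factor |x| is at most the sum of the |x . b|, and each of these is one more letter,
  so the induction runs over all words at once.\<close>

lemma weighted_word_bound:
  "snd ` set w \<subseteq> Basis \<Longrightarrow> \<exists>C N. C \<ge> 0 \<and> (\<forall>i x. norm x ^ n * norm (apply_word w (e i) x) \<le> C * (1 + real i) ^ N)"
proof (induction n arbitrary: w)
  case 0
  then show ?case using sup_word_bound by simp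
next
  case (Suc n)
  have "\<exists>C N. C \<ge> 0 \<and> (\<forall>i x. norm x ^ n * norm (apply_word ((True, b) # w) (e i) x) \<le> C * (1 + real i) ^ N)" if "b \<in> Basis" for b
    using Suc.prems that by (intro Suc.IH) auto
  then obtain A B where AB: "\<And>b. b \<in> Basis \<Longrightarrow> A b \<ge> 0 \<and> (\<forall>i x. norm x ^ n * norm (apply_word ((True, b) # w) (e i) x) \<le> A b * (1 + real i) ^ B b)"
    by metis
  define f where "f b i = A b * (1 + real i) ^ B b" for b i
  have f: "\<And>b i x. b \<in> Basis \<Longrightarrow> norm x ^ n * norm (apply_word ((True, b) # w) (e i) x) \<le> f b i"
    "\<And>b. b \<in> Basis \<Longrightarrow> \<exists>C N. C \<ge> 0 \<and> (\<forall>i. f b i \<le> C * (1 + real i) ^ N)"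
  proof -
    show "norm x ^ n * norm (apply_word ((True, b) # w) (e i) x) \<le> f b i" if "b \<in> Basis" for b i x
      using AB[OF that] unfolding f_def by blast
    show "\<exists>C N. C \<ge> 0 \<and> (\<forall>i. f b i \<le> C * (1 + real i) ^ N)" if "b \<in> Basis" for b
      unfolding f_def using conjunct1[OF AB[OF that]] by (intro exI[of _ "A b"] exI[of _ "B b"] conjI allI order_refl)
  qed
  have "\<exists>C N. C \<ge> 0 \<and> (\<forall>i. (\<Sum>b\<in>(Basis :: 'a set). f b i) \<le> C * (1 + real i) ^ N)"
    by (rule sum_poly_bound[OF finite_Basis]) (rule f(2))
  then obtain C N where C: "C \<ge> 0" "\<And>i. (\<Sum>b\<in>(Basis :: 'a set). f b i) \<le> C * (1 + real i) ^ N" by blast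
  have "norm x ^ Suc n * norm (apply_word w (e i) x) \<le> C * (1 + real i) ^ N" for i x
  proof -
    have "norm x * norm (apply_word w (e i) x) \<le> (\<Sum>b\<in>Basis. \<bar>x \<bullet> b\<bar>) * norm (apply_word w (e i) x)"
      by (intro mult_right_mono norm_le_l1) auto
    also have "\<dots> = (\<Sum>b\<in>Basis. norm (apply_word ((True, b) # w) (e i) x))"
      by (simp add: apply_word_def generator_def coord_mult_def norm_mult sum_distrib_right)
    finally have "norm x ^ n * (norm x * norm (apply_word w (e i) x)) \<le> norm x ^ n * (\<Sum>b\<in>Basis. norm (apply_word ((True, b) # w) (e i) x))"
      by (intro mult_left_mono) auto
    also have "\<dots> \<le> (\<Sum>b\<in>Basis. f b i)" unfolding sum_distrib_left by (intro sum_mono f(1))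
    also have "\<dots> \<le> C * (1 + real i) ^ N" by (rule C(2))
    finally show ?thesis by (simp add: mult_ac)
  qed
  then show ?case using C(1) by blast
qed

lemma e_family: "schwartz_family e"
  unfolding schwartz_family_def
proof (intro conjI allI ballI e_schwartz)
  fix n bs assume "bs \<in> lists (Basis :: 'a set)"
  then have "snd ` set (map (Pair False) bs) \<subseteq> Basis" by auto
  from weighted_word_bound[OF this, of n] show "\<exists>C N. C \<ge> 0 \<and> (\<forall>i. schwartz_seminorm n bs (e i) \<le> C * (1 + real i) ^ N)"
    unfolding iter_deriv_eq_apply_word[symmetric] by (meson schwartz_seminorm_le)
qed

text \<open>Applying H multiplies the integral against \<open>e i\<close> by \<open>\<mu> i\<close>,
  whose square is at least 1 + i. The power r = 2 (N + M) yields the N powers wanted and M more to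
  compensate the growth of the supremum of \<open>e i\<close>.\<close>

lemma decay: "\<exists>p. schwartz_bounded p \<and> (\<forall>\<phi>\<in>schwartz_space. \<forall>i. (1 + real i) ^ N * norm (LINT x|lborel. \<phi> x * cnj (e i x)) \<le> p \<phi>)"
proof -
  obtain C M where C: "C \<ge> 0" "\<And>i. schwartz_seminorm 0 [] (e i) \<le> C * (1 + real i) ^ M"
    using e_family unfolding schwartz_family_def by (metis lists.Nil)
  define r where "r = 2 * (N + M)"
  have Hr: "(LINT x|lborel. (H ^^ r) \<phi> x * cnj (e i x)) = of_real (\<mu> i) ^ r * (LINT x|lborel. \<phi> x * cnj (e i x))"
    if "\<phi> \<in> schwartz_space" for \<phi> i r
  proof (induction r)
    case (Suc r)
    then show ?case using H_eigen[OF schwartz_op_closed[OF schwartz_op_funpow[OF H] that], of r i] by simp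
  qed simp
  have "(1 + real i) ^ N * norm (LINT x|lborel. \<phi> x * cnj (e i x)) \<le> C * (LINT x|lborel. norm ((H ^^ r) \<phi> x))"
    if \<phi>: "\<phi> \<in> schwartz_space" for \<phi> i
  proof -
    note HS = schwartz_op_closed[OF schwartz_op_funpow[OF H] \<phi>, of r]
    let ?c = "norm (LINT x|lborel. \<phi> x * cnj (e i x))" and ?I = "LINT x|lborel. norm ((H ^^ r) \<phi> x)"
    have I0: "?I \<ge> 0" by (rule integral_nonneg_AE) auto
    have p: "(1 + real i) ^ M > 0" by (intro zero_less_power) auto
    have s: "schwartz_seminorm 0 [] (\<lambda>x. cnj (e i x)) = schwartz_seminorm 0 [] (e i)"
      by (simp add: schwartz_seminorm_def)
    have "(1 + real i) ^ M * ((1 + real i) ^ N * ?c) = (1 + real i) ^ (N + M) * ?c" by (simp add: power_add)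
    also have "\<dots> \<le> ((\<mu> i)\<^sup>2) ^ (N + M) * ?c" by (intro mult_right_mono power_mono \<mu>) auto
    also have "\<dots> = norm (LINT x|lborel. (H ^^ r) \<phi> x * cnj (e i x))"
    proof -
      have "((\<mu> i)\<^sup>2) ^ (N + M) = \<mu> i ^ r" by (simp only: r_def power_mult)
      then show ?thesis unfolding Hr[OF \<phi>] using \<mu>(2)[of i] by (simp add: norm_mult norm_power)
    qed
    also have "\<dots> \<le> schwartz_seminorm 0 [] (e i) * ?I"
      using norm_integral_mult_le[OF HS schwartz_cnj[OF e_schwartz[of i]]] unfolding s .
    also have "\<dots> \<le> (C * (1 + real i) ^ M) * ?I" by (intro mult_right_mono C(2) I0)
    also have "\<dots> = (1 + real i) ^ M * (C * ?I)" by simp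
    finally show ?thesis using p by (simp only: mult_le_cancel_left_pos)
  qed
  moreover have "schwartz_bounded (\<lambda>\<phi>. C * (LINT x|lborel. norm ((H ^^ r) \<phi> x)))"
    by (intro schwartz_bounded_cmult C(1) schwartz_bounded_compose[OF schwartz_bounded_L1 schwartz_op_funpow[OF H]])
  ultimately show ?thesis by blast
qed

text \<open>This span is stable under coordinates by the band property, so it contains every
  polynomial multiple of \<open>e 0\<close>.\<close>

inductive_set span_e :: "('a \<Rightarrow> complex) set" where
  span_e_base: "e i \<in> span_e"
| span_e_zero: "(\<lambda>x. 0) \<in> span_e"
| span_e_add: "f \<in> span_e \<Longrightarrow> g \<in> span_e \<Longrightarrow> (\<lambda>x. f x + g x) \<in> span_e"
| span_e_cmult: "f \<in> span_e \<Longrightarrow> (\<lambda>x. a * f x) \<in> span_e"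

lemma span_e_sum: "finite I \<Longrightarrow> (\<And>i. i \<in> I \<Longrightarrow> f i \<in> span_e) \<Longrightarrow> (\<lambda>x. \<Sum>i\<in>I. f i x) \<in> span_e"
  by (induction I rule: finite_induct) (auto intro: span_e_zero span_e_add)

lemma span_e_schwartz: "f \<in> span_e \<Longrightarrow> f \<in> schwartz_space"
  by (induction rule: span_e.induct) (auto intro: e_schwartz schwartz_zero schwartz_add(1) schwartz_cmult(1))

lemma span_e_coord_mult:
  assumes b: "b \<in> Basis" shows "f \<in> span_e \<Longrightarrow> coord_mult b f \<in> span_e"
proof (induction rule: span_e.induct)
  case (span_e_base i)
  obtain K T J where "generator (True, b) (e i) = (\<lambda>x. \<Sum>k<(K::nat). T k i * e (J k i) x)"
    using band[of "(True, b)"] b unfolding band_operator_def by auto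
  then show ?case by (auto simp: generator_def intro!: span_e_sum span_e.span_e_cmult span_e.span_e_base)
next
  case span_e_zero
  then show ?case using span_e.span_e_zero by (simp add: coord_mult_def[abs_def])
next
  case (span_e_add f g)
  then show ?case using span_e.span_e_add[of "coord_mult b f" "coord_mult b g"] by (simp add: coord_mult_def[abs_def] distrib_left)
next
  case (span_e_cmult f a)
  then show ?case using span_e.span_e_cmult[of "coord_mult b f" a] by (simp add: coord_mult_def[abs_def] mult.left_commute)
qed

lemma span_e_poly_mult:
  assumes "real_polynomial_function p" shows "f \<in> span_e \<Longrightarrow> (\<lambda>x. of_real (p x) * f x) \<in> span_e"
  using assms
proof (induction arbitrary: f rule: real_polynomial_function.induct)
  case (linear h)
  note f = linear(2)
  from linear(1) interpret bounded_linear h .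
  have hx: "h x = (\<Sum>b\<in>Basis. (x \<bullet> b) * h b)" for x
  proof -
    have "h x = h (\<Sum>b\<in>Basis. (x \<bullet> b) *\<^sub>R b)" by (simp add: euclidean_representation)
    then show ?thesis by (simp add: sum scaleR)
  qed
  have "of_real (h x) * f x = (\<Sum>b\<in>Basis. of_real (h b) * coord_mult b f x)" for x
    by (subst hx) (simp add: coord_mult_def sum_distrib_left mult_ac)
  then show ?case using f by (auto intro!: span_e_sum span_e_cmult span_e_coord_mult)
next
  case (add p q)
  then show ?case using span_e_add[of "\<lambda>x. of_real (p x) * f x" "\<lambda>x. of_real (q x) * f x"] by (simp add: distrib_right)
next
  case (mult p q)
  from mult(3)[OF mult(4)[OF mult(5)]] show ?case by (simp add: mult.assoc)
qed (auto intro: span_e_cmult)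

lemma complete:
  assumes \<phi>: "\<phi> \<in> schwartz_space" and z: "\<And>i. (LINT x|lborel. \<phi> x * cnj (e i x)) = 0"
  shows "\<phi> x = 0"
proof -
  have span: "(LINT x|lborel. \<phi> x * cnj (f x)) = 0" if "f \<in> span_e" for f
    using that
  proof (induction rule: span_e.induct)
    case (span_e_add f g)
    then show ?case using schwartz_mult_integrable[OF \<phi> schwartz_cnj[OF span_e_schwartz]] by (simp add: distrib_left)
  next
    case (span_e_cmult f a)
    then show ?case by (simp add: mult.left_commute)
  qed (simp_all add: z)
  \<comment> \<open>The function \<open>e 0\<close> is a Gaussian up to the unimodular factor
    \<omega>, so all Gaussian moments of this product vanish.\<close>
  have "\<phi> x * cnj (\<omega> x) = 0"
  proof (rule gaussian_complete[where \<Phi> = "\<lambda>x. \<phi> x * cnj (\<omega> x)" and s = s0, OF _ _ s0])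
    show "continuous_on UNIV (\<lambda>x. \<phi> x * cnj (\<omega> x))" by (intro continuous_intros schwartz_continuous \<phi> \<omega>)
    show "\<exists>C. \<forall>x. (1 + norm x) ^ k * norm (\<phi> x * cnj (\<omega> x)) \<le> C * weight x" for k
      using schwartz_weight_power[OF \<phi>] by (simp add: norm_mult \<omega>)
    fix p :: "'a \<Rightarrow> real" assume "real_polynomial_function p"
    from span[OF span_e_poly_mult[OF this span_e_base[of 0]]]
    show "(LINT x|lborel. \<phi> x * cnj (\<omega> x) * of_real (p x * exp (- s0 * (norm x)\<^sup>2))) = 0"
      by (simp add: gaussian mult_ac)
  qed
  then show ?thesis using \<omega>(1)[of x] by auto
qed

sublocale schwartz_basis e c0
  by (unfold_locales; fact e_family orthogonal c0 decay complete)

end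

section \<open>Ladder operators on Gaussians\<close>

lemma schwartz_op_zero: "schwartz_op (\<lambda>\<phi> x. 0)"
  unfolding schwartz_op_def
proof (intro conjI ballI allI schwartz_zero)
  fix n bs assume "bs \<in> lists (Basis :: 'a set)"
  then have "schwartz_seminorm n bs (\<lambda>x::'a. 0) \<le> 0" using schwartz_cmult(2)[OF schwartz_zero, of bs n 0] by simp
  then show "schwartz_bounded (\<lambda>\<phi>::'a \<Rightarrow> complex. schwartz_seminorm n bs (\<lambda>x::'a. 0))"
    by (intro schwartz_bounded_mono[OF schwartz_bounded_zero])
qed

lemma schwartz_op_sum:
  "finite I \<Longrightarrow> (\<And>i. i \<in> I \<Longrightarrow> schwartz_op (T i)) \<Longrightarrow> schwartz_op (\<lambda>\<phi> x. \<Sum>i\<in>I. T i \<phi> x)"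
proof (induction I rule: finite_induct)
  case (insert i I)
  then have "schwartz_op (\<lambda>\<phi> x. T i \<phi> x + (\<Sum>i\<in>I. T i \<phi> x))" by (intro schwartz_op_add) auto
  then show ?case using insert by simp
qed (simp add: schwartz_op_zero)

text \<open>The common form of all annihilation and creation operators; on polynomial multiples of a
  Gaussian the commutator of two such operators is a scalar, see
  \<open>first_order_commutator\<close>.\<close>

definition first_order :: "('a::euclidean_space \<Rightarrow> complex) \<Rightarrow> ('a \<Rightarrow> complex) \<Rightarrow> ('a \<Rightarrow> complex) \<Rightarrow> 'a \<Rightarrow> complex" where
  "first_order l d f x = (\<Sum>b\<in>Basis. l b * coord_mult b f x + d b * partial_deriv b f x)"

abbreviation adj_first_order :: "('a::euclidean_space \<Rightarrow> complex) \<Rightarrow> ('a \<Rightarrow> complex) \<Rightarrow> ('a \<Rightarrow> complex) \<Rightarrow> 'a \<Rightarrow> complex" where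
  "adj_first_order l d \<equiv> first_order (\<lambda>b. cnj (l b)) (\<lambda>b. - cnj (d b))"

lemma schwartz_op_first_order: "schwartz_op (first_order l d)"
proof -
  have "schwartz_op (\<lambda>\<phi> x. \<Sum>b\<in>(Basis::'a set). l b * coord_mult b \<phi> x + d b * partial_deriv b \<phi> x)"
    by (intro schwartz_op_sum schwartz_op_add schwartz_op_cmult schwartz_op_coord_mult schwartz_op_partial_deriv) auto
  then show ?thesis by (simp add: first_order_def[abs_def])
qed

text \<open>Coordinates are symmetric, and derivatives are skew by integration by parts; hence the
  sign and the conjugates in \<open>adj_first_order\<close>.\<close>

lemma first_order_adjoint:
  assumes \<phi>: "\<phi> \<in> schwartz_space" and \<psi>: "\<psi> \<in> schwartz_space"
  shows "(LINT x|lborel. first_order l d \<phi> x * cnj (\<psi> x)) = (LINT x|lborel. \<phi> x * cnj (adj_first_order l d \<psi> x))"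
proof -
  note i = schwartz_mult_integrable
  have d\<psi>: "\<psi> differentiable (at x)" for x
    using smooth_differentiable[OF schwartz_smooth[OF \<psi>], of "[]"] by simp
  have 1: "integrable lborel (\<lambda>x. coord_mult b \<phi> x * cnj (\<psi> x))" "integrable lborel (\<lambda>x. partial_deriv b \<phi> x * cnj (\<psi> x))"
    "integrable lborel (\<lambda>x. \<phi> x * cnj (coord_mult b \<psi> x))" "integrable lborel (\<lambda>x. \<phi> x * cnj (partial_deriv b \<psi> x))" if "b \<in> Basis" for b
    using that by (auto intro!: i schwartz_cnj schwartz_coord_mult(1) schwartz_partial_deriv(1) \<phi> \<psi>)
  have 2: "(LINT x|lborel. partial_deriv b \<phi> x * cnj (\<psi> x)) = - (LINT x|lborel. \<phi> x * cnj (partial_deriv b \<psi> x))" if "b \<in> Basis" for b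
    using integration_by_parts[OF that \<phi> schwartz_cnj[OF \<psi>]] by (simp add: partial_deriv_cnj[OF d\<psi>])
  have 3: "(LINT x|lborel. coord_mult b \<phi> x * cnj (\<psi> x)) = (LINT x|lborel. \<phi> x * cnj (coord_mult b \<psi> x))" for b
    by (simp add: coord_mult_def mult_ac)
  have "(LINT x|lborel. first_order l d \<phi> x * cnj (\<psi> x)) =
      (LINT x|lborel. (\<Sum>b\<in>Basis. l b * (coord_mult b \<phi> x * cnj (\<psi> x)) + d b * (partial_deriv b \<phi> x * cnj (\<psi> x))))"
    by (simp add: first_order_def sum_distrib_right distrib_right mult.assoc)
  also have "\<dots> = (\<Sum>b\<in>Basis. l b * (LINT x|lborel. coord_mult b \<phi> x * cnj (\<psi> x)) + d b * (LINT x|lborel. partial_deriv b \<phi> x * cnj (\<psi> x)))"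
    using 1 by (subst Bochner_Integration.integral_sum) (auto intro!: sum.cong)
  also have "\<dots> = (\<Sum>b\<in>Basis. l b * (LINT x|lborel. \<phi> x * cnj (coord_mult b \<psi> x)) + - d b * (LINT x|lborel. \<phi> x * cnj (partial_deriv b \<psi> x)))"
    by (intro sum.cong refl) (simp add: 2 3)
  also have "\<dots> = (LINT x|lborel. (\<Sum>b\<in>Basis. l b * (\<phi> x * cnj (coord_mult b \<psi> x)) + - d b * (\<phi> x * cnj (partial_deriv b \<psi> x))))"
    using 1 by (subst Bochner_Integration.integral_sum) (auto intro!: sum.cong)
  also have "\<dots> = (LINT x|lborel. \<phi> x * cnj (adj_first_order l d \<psi> x))"
    by (simp add: first_order_def sum_distrib_left right_diff_distrib mult_ac)
  finally show ?thesis .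
qed

lemma first_order_adjoint':
  assumes "\<phi> \<in> schwartz_space" "\<psi> \<in> schwartz_space"
  shows "(LINT x|lborel. adj_first_order l d \<phi> x * cnj (\<psi> x)) = (LINT x|lborel. \<phi> x * cnj (first_order l d \<psi> x))"
  using first_order_adjoint[OF assms, of "\<lambda>b. cnj (l b)" "\<lambda>b. - cnj (d b)"] by simp

text \<open>\<open>v0\<close> is a complex Gaussian, whose logarithm has the constant Hessian \<open>Q\<close>; \<open>PG\<close> consists of its
  polynomial multiples.\<close>

locale gaussian_space =
  fixes v0 :: "'a::euclidean_space \<Rightarrow> complex" and Q :: "'a \<Rightarrow> 'a \<Rightarrow> complex"
  assumes v0_deriv: "(v0 has_derivative (\<lambda>h. \<Sum>b\<in>Basis. of_real (h \<bullet> b) * (\<Sum>c\<in>Basis. Q b c * coord_mult c v0 x))) (at x)"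
    and Q_sym: "b \<in> Basis \<Longrightarrow> c \<in> Basis \<Longrightarrow> Q b c = Q c b"
    and v0_decay: "\<exists>C. \<forall>x. norm x ^ n * norm (v0 x) \<le> C"
begin

inductive_set PG :: "('a \<Rightarrow> complex) set" where
  PG_base: "v0 \<in> PG"
| PG_zero: "(\<lambda>x. 0) \<in> PG"
| PG_add: "f \<in> PG \<Longrightarrow> g \<in> PG \<Longrightarrow> (\<lambda>x. f x + g x) \<in> PG"
| PG_cmult: "f \<in> PG \<Longrightarrow> (\<lambda>x. a * f x) \<in> PG"
| PG_coord: "f \<in> PG \<Longrightarrow> b \<in> Basis \<Longrightarrow> coord_mult b f \<in> PG"

lemma PG_sum: "finite I \<Longrightarrow> (\<And>i. i \<in> I \<Longrightarrow> f i \<in> PG) \<Longrightarrow> (\<lambda>x. \<Sum>i\<in>I. f i x) \<in> PG"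
  by (induction I rule: finite_induct) (auto intro: PG.intros)

lemma differentiable_coord_mult: "f differentiable (at x) \<Longrightarrow> coord_mult b f differentiable (at x)"
  unfolding coord_mult_def[abs_def] by (intro differentiable_mult differentiable_coord)

lemma partial_deriv_coord_mult:
  "f differentiable (at x) \<Longrightarrow> partial_deriv b (coord_mult c f) x = of_real (b \<bullet> c) * f x + coord_mult c (partial_deriv b f) x"
  unfolding coord_mult_def[abs_def] by (simp add: partial_deriv_mult[OF differentiable_coord] partial_deriv_coord)

lemma partial_deriv_v0: "b \<in> Basis \<Longrightarrow> partial_deriv b v0 = (\<lambda>x. \<Sum>c\<in>Basis. Q b c * coord_mult c v0 x)"
proof
  fix x assume b: "b \<in> Basis"
  have "partial_deriv b v0 x = (\<Sum>b'\<in>Basis. of_real (b \<bullet> b') * (\<Sum>c\<in>Basis. Q b' c * coord_mult c v0 x))"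
    by (rule partial_derivI[OF v0_deriv])
  also have "\<dots> = (\<Sum>b'\<in>Basis. if b' = b then \<Sum>c\<in>Basis. Q b c * coord_mult c v0 x else 0)"
    using b by (intro sum.cong) (auto simp: inner_Basis)
  finally show "partial_deriv b v0 x = (\<Sum>c\<in>Basis. Q b c * coord_mult c v0 x)" using b by simp
qed

lemma PG_differentiable: "f \<in> PG \<Longrightarrow> f differentiable (at x)"
proof (induction rule: PG.induct)
  case PG_base
  show ?case using v0_deriv differentiable_def by blast
qed (auto intro: differentiable_coord_mult differentiable_add differentiable_mult)

lemma PG_partial_deriv: "f \<in> PG \<Longrightarrow> b \<in> Basis \<Longrightarrow> partial_deriv b f \<in> PG"
proof (induction rule: PG.induct)
  case PG_base
  then show ?case by (simp add: partial_deriv_v0) (intro PG_sum PG.intros finite_Basis)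
next
  case PG_zero
  have "partial_deriv b (\<lambda>x. 0) = (\<lambda>x::'a. 0)" by (rule ext) simp
  then show ?case using PG.PG_zero by simp
next
  case (PG_add f g)
  have "partial_deriv b (\<lambda>x. f x + g x) = (\<lambda>x. partial_deriv b f x + partial_deriv b g x)"
    by (rule ext, rule partial_deriv_add) (intro PG_differentiable PG_add)+
  then show ?case using PG.PG_add PG_add by simp
next
  case (PG_cmult f a)
  have "partial_deriv b (\<lambda>x. a * f x) = (\<lambda>x. a * partial_deriv b f x)"
    by (rule ext, rule partial_deriv_cmult) (intro PG_differentiable PG_cmult)
  then show ?case using PG.PG_cmult PG_cmult by simp
next
  case (PG_coord f c)
  have "partial_deriv b (coord_mult c f) = (\<lambda>x. of_real (b \<bullet> c) * f x + coord_mult c (partial_deriv b f) x)"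
    by (rule ext, rule partial_deriv_coord_mult) (intro PG_differentiable PG_coord)
  then show ?case using PG.PG_add[OF PG.PG_cmult[OF PG_coord(1)] PG.PG_coord[OF PG_coord(3)[OF PG_coord(4)] PG_coord(2)]] by simp
qed

lemma PG_decay: "f \<in> PG \<Longrightarrow> \<exists>C. \<forall>x. norm x ^ n * norm (f x) \<le> C"
proof (induction arbitrary: n rule: PG.induct)
  case (PG_add f g)
  obtain C D where "\<And>x. norm x ^ n * norm (f x) \<le> C" "\<And>x. norm x ^ n * norm (g x) \<le> D" using PG_add by metis
  moreover have "norm x ^ n * norm (f x + g x) \<le> norm x ^ n * norm (f x) + norm x ^ n * norm (g x)" for x
    unfolding distrib_left[symmetric] by (intro mult_left_mono norm_triangle_ineq) auto
  ultimately have "norm x ^ n * norm (f x + g x) \<le> C + D" for x by (meson add_mono order_trans)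
  then show ?case by blast
next
  case (PG_cmult f a)
  obtain C where "\<And>x. norm x ^ n * norm (f x) \<le> C" using PG_cmult by metis
  from mult_left_mono[OF this norm_ge_zero[of a]] have "norm x ^ n * norm (a * f x) \<le> norm a * C" for x
    by (simp add: norm_mult mult_ac)
  then show ?case by blast
next
  case (PG_coord f b)
  obtain C where C: "\<And>x. norm x ^ Suc n * norm (f x) \<le> C" using PG_coord by metis
  have "norm x ^ n * norm (coord_mult b f x) \<le> C" for x
  proof -
    have "norm (coord_mult b f x) \<le> norm x * norm (f x)"
      using Basis_le_norm[OF PG_coord(2), of x] by (simp add: coord_mult_def norm_mult mult_right_mono)
    then have "norm x ^ n * norm (coord_mult b f x) \<le> norm x ^ n * (norm x * norm (f x))" by (intro mult_left_mono) auto
    then show ?thesis using C[of x] by (simp add: mult_ac)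
  qed
  then show ?case by blast
qed (auto intro: v0_decay)

lemma PG_schwartz: "f \<in> PG \<Longrightarrow> f \<in> schwartz_space"
proof -
  assume f: "f \<in> PG"
  have "iter_deriv bs f \<in> PG" if "bs \<in> lists Basis" for bs
    using that by (induction bs) (auto intro: f PG_partial_deriv)
  then show ?thesis unfolding schwartz_iff smooth_iff by (auto intro: PG_differentiable PG_decay)
qed

text \<open>An induction along the construction of the class; for the Gaussian itself the claim is
  the symmetry of Q.\<close>

lemma PG_sym: "f \<in> PG \<Longrightarrow> b \<in> Basis \<Longrightarrow> c \<in> Basis \<Longrightarrow> partial_deriv b (partial_deriv c f) x = partial_deriv c (partial_deriv b f) x"
proof (induction arbitrary: x rule: PG.induct)
  case PG_base
  have e: "partial_deriv b (partial_deriv c v0) x = Q c b * v0 x + (\<Sum>a\<in>Basis. Q c a * (of_real (x \<bullet> a) * (\<Sum>a'\<in>Basis. Q b a' * (of_real (x \<bullet> a') * v0 x))))"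
    if "b \<in> Basis" "c \<in> Basis" for b c
  proof -
    have "partial_deriv b (partial_deriv c v0) x = (\<Sum>a\<in>Basis. Q c a * partial_deriv b (coord_mult a v0) x)"
      unfolding partial_deriv_v0[OF that(2)]
      by (rule partial_deriv_sum) (auto intro: PG_differentiable PG.intros)
    also have "\<dots> = (\<Sum>a\<in>Basis. Q c a * (of_real (b \<bullet> a) * v0 x)) + (\<Sum>a\<in>Basis. Q c a * coord_mult a (partial_deriv b v0) x)"
      by (simp add: partial_deriv_coord_mult PG_differentiable PG.PG_base distrib_left sum.distrib)
    also have "(\<Sum>a\<in>Basis. Q c a * (of_real (b \<bullet> a) * v0 x)) = (\<Sum>a\<in>Basis. if a = b then Q c b * v0 x else 0)"
      using that by (intro sum.cong) (auto simp: inner_Basis)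
    also have "\<dots> = Q c b * v0 x" using that by simp
    finally show ?thesis by (simp add: partial_deriv_v0[OF that(1)] coord_mult_def)
  qed
  have "(\<Sum>a\<in>Basis. Q c a * (of_real (x \<bullet> a) * (\<Sum>a'\<in>Basis. Q b a' * (of_real (x \<bullet> a') * v0 x))))
    = (\<Sum>a\<in>Basis. Q b a * (of_real (x \<bullet> a) * (\<Sum>a'\<in>Basis. Q c a' * (of_real (x \<bullet> a') * v0 x))))"
    unfolding sum_distrib_left by (subst sum.swap) (simp add: mult_ac)
  then show ?case using e[OF PG_base] e[OF PG_base(2,1)] Q_sym[OF PG_base] by simp
next
  case PG_zero
  have "partial_deriv b (\<lambda>x. 0) = (\<lambda>x::'a. 0)" for b :: 'a by (rule ext) simp
  then show ?case by simp
next
  case (PG_add f g)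
  have "partial_deriv b (\<lambda>x. f x + g x) = (\<lambda>x. partial_deriv b f x + partial_deriv b g x)" for b
    by (rule ext, rule partial_deriv_add) (intro PG_differentiable PG_add)+
  then show ?case using PG_add by (simp add: partial_deriv_add PG_differentiable PG_partial_deriv)
next
  case (PG_cmult f a)
  have "partial_deriv b (\<lambda>x. a * f x) = (\<lambda>x. a * partial_deriv b f x)" for b
    by (rule ext, rule partial_deriv_cmult) (intro PG_differentiable PG_cmult)
  then show ?case using PG_cmult by (simp add: partial_deriv_cmult PG_differentiable PG_partial_deriv)
next
  case (PG_coord f a)
  have e: "partial_deriv b (coord_mult a f) = (\<lambda>x. of_real (b \<bullet> a) * f x + coord_mult a (partial_deriv b f) x)" for b
    by (rule ext, rule partial_deriv_coord_mult) (intro PG_differentiable PG_coord)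
  have "partial_deriv b (partial_deriv c (coord_mult a f)) x = of_real (c \<bullet> a) * partial_deriv b f x + (of_real (b \<bullet> a) * partial_deriv c f x + coord_mult a (partial_deriv b (partial_deriv c f)) x)"
    if "b \<in> Basis" "c \<in> Basis" for b c
    unfolding e using that PG_coord
    by (subst partial_deriv_add) (auto simp: partial_deriv_cmult partial_deriv_coord_mult PG_differentiable PG_partial_deriv
        intro!: differentiable_mult differentiable_coord_mult)
  note second = this
  have "coord_mult a (partial_deriv b (partial_deriv c f)) x = coord_mult a (partial_deriv c (partial_deriv b f)) x"
    using PG_coord by (simp add: coord_mult_def)
  then show ?case using second[of b c] second[of c b] PG_coord by simp
qed

lemma PG_first_order: "f \<in> PG \<Longrightarrow> first_order l d f \<in> PG"
  unfolding first_order_def[abs_def] by (intro PG_sum PG_add PG_cmult PG_coord PG_partial_deriv finite_Basis)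

lemma first_order_cmult: "f \<in> PG \<Longrightarrow> first_order l d (\<lambda>x. a * f x) = (\<lambda>x. a * first_order l d f x)"
  by (rule ext) (simp add: first_order_def coord_mult_def partial_deriv_cmult PG_differentiable sum_distrib_left distrib_left mult_ac)

lemma first_order_zero: "first_order l d (\<lambda>x. 0) = (\<lambda>x. 0)"
  by (rule ext) (simp add: first_order_def coord_mult_def)

text \<open>When both products are expanded into double sums, all terms cancel in pairs, the second
  derivatives by \<open>PG_sym\<close>, except those in which a derivative hits a
  coordinate.\<close>

lemma first_order_commutator:
  assumes f: "f \<in> PG"
  shows "first_order l d (first_order l' d' f) x =
    first_order l' d' (first_order l d f) x + (\<Sum>b\<in>Basis. d b * l' b - l b * d' b) * f x"
proof -
  define X where "X b = complex_of_real (x \<bullet> b)" for b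
  define F where "F b = partial_deriv b f x" for b
  define S where "S b c = partial_deriv b (partial_deriv c f) x" for b c
  define \<delta> where "\<delta> b c = complex_of_real (b \<bullet> c)" for b c :: 'a
  \<comment> \<open>Stated for arbitrary coefficients, so that it serves both orders of the
    product.\<close>
  have E: "first_order l d (first_order l' d' f) x = (\<Sum>b\<in>Basis. \<Sum>c\<in>Basis. l b * l' c * (X b * X c * f x) + l b * d' c * (X b * F c)
      + d b * l' c * (\<delta> b c * f x + X c * F b) + d b * d' c * S b c)" for l d l' d'
  proof -
    have p: "partial_deriv b (first_order l' d' f) x = (\<Sum>c\<in>Basis. l' c * (\<delta> b c * f x + X c * F b) + d' c * S b c)" if b: "b \<in> Basis" for b
    proof -
      have "partial_deriv b (first_order l' d' f) x = (\<Sum>c\<in>Basis. 1 * partial_deriv b (\<lambda>x. l' c * coord_mult c f x + d' c * partial_deriv c f x) x)"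
      proof -
        have "partial_deriv b (\<lambda>x. \<Sum>c\<in>Basis. 1 * (l' c * coord_mult c f x + d' c * partial_deriv c f x)) x =
          (\<Sum>c\<in>Basis. 1 * partial_deriv b (\<lambda>x. l' c * coord_mult c f x + d' c * partial_deriv c f x) x)"
        proof (rule partial_deriv_sum[OF finite_Basis], rule PG_differentiable)
          show "(\<lambda>x. l' c * coord_mult c f x + d' c * partial_deriv c f x) \<in> PG" if "c \<in> Basis" for c
            by (intro PG_add PG_cmult PG_coord PG_partial_deriv f that)
        qed
        then show ?thesis by (simp add: first_order_def[abs_def])
      qed
      also have "\<dots> = (\<Sum>c\<in>Basis. l' c * (\<delta> b c * f x + X c * F b) + d' c * S b c)"
      proof (rule sum.cong[OF refl])
        fix c :: 'a assume c: "c \<in> Basis"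
        note D = PG_differentiable[OF f] PG_differentiable[OF PG_coord[OF f c]] PG_differentiable[OF PG_partial_deriv[OF f c]]
          PG_differentiable[OF PG_cmult[OF PG_coord[OF f c]]] PG_differentiable[OF PG_cmult[OF PG_partial_deriv[OF f c]]]
        show "1 * partial_deriv b (\<lambda>x. l' c * coord_mult c f x + d' c * partial_deriv c f x) x = l' c * (\<delta> b c * f x + X c * F b) + d' c * S b c"
          by (simp add: partial_deriv_add[OF D(4,5)] partial_deriv_cmult[OF D(2)] partial_deriv_cmult[OF D(3)] partial_deriv_coord_mult[OF D(1)]
              \<delta>_def X_def F_def S_def) (simp add: coord_mult_def)
      qed
      finally show ?thesis .
    qed
    have "first_order l d (first_order l' d' f) x = (\<Sum>b\<in>Basis. l b * (X b * (\<Sum>c\<in>Basis. l' c * (X c * f x) + d' c * F c)) + d b * partial_deriv b (first_order l' d' f) x)"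
      by (simp add: first_order_def[of l d] coord_mult_def X_def F_def first_order_def[of l' d' f])
    also have "\<dots> = (\<Sum>b\<in>Basis. l b * (X b * (\<Sum>c\<in>Basis. l' c * (X c * f x) + d' c * F c)) + d b * (\<Sum>c\<in>Basis. l' c * (\<delta> b c * f x + X c * F b) + d' c * S b c))"
      by (intro sum.cong refl) (simp add: p)
    finally show ?thesis by (simp add: sum_distrib_left sum.distrib[symmetric] algebra_simps)
  qed
  have "first_order l' d' (first_order l d f) x = (\<Sum>b\<in>Basis. \<Sum>c\<in>Basis. l' c * l b * (X c * X b * f x) + l' c * d b * (X c * F b)
      + d' c * l b * (\<delta> c b * f x + X b * F c) + d' c * d b * S c b)"
    unfolding E by (rule sum.swap)
  note swapped = this
  have "first_order l d (first_order l' d' f) x - first_order l' d' (first_order l d f) x =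
     (\<Sum>b\<in>Basis. \<Sum>c\<in>Basis. (d b * l' c - l b * d' c) * (\<delta> b c * f x) + d b * d' c * (S b c - S c b))"
    unfolding E[of l d l' d'] swapped sum_subtractf[symmetric] by (intro sum.cong refl) (simp add: \<delta>_def inner_commute algebra_simps)
  also have "\<dots> = (\<Sum>b\<in>Basis. \<Sum>c\<in>Basis. if c = b then (d b * l' b - l b * d' b) * f x else 0)"
    by (intro sum.cong refl) (auto simp: \<delta>_def inner_Basis S_def PG_sym[OF f])
  also have "\<dots> = (\<Sum>b\<in>Basis. d b * l' b - l b * d' b) * f x" by (simp add: sum_distrib_right)
  finally show ?thesis by (simp add: algebra_simps)
qed

end

text \<open>\<open>first_order l d\<close> annihilates and \<open>adj_first_order l d\<close> creates; \<open>ccr\<close> is the canonical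
  commutation relation between them.\<close>

locale ladder_mode = gaussian_space v0 Q for v0 :: "'a::euclidean_space \<Rightarrow> complex" and Q +
  fixes l d :: "'a \<Rightarrow> complex"
  assumes ccr: "(\<Sum>b\<in>Basis. d b * cnj (l b) + l b * cnj (d b)) = 1"
begin

text \<open>The excited states over a vacuum v. The vacuum is a parameter because in the plane the
  states of one mode serve as vacua of the other.\<close>

definition tower :: "('a \<Rightarrow> complex) \<Rightarrow> nat \<Rightarrow> 'a \<Rightarrow> complex" where
  "tower v m = (\<lambda>x. (1 / of_real (sqrt (fact m))) * (adj_first_order l d ^^ m) v x)"

lemma create_PG: "v \<in> PG \<Longrightarrow> (adj_first_order l d ^^ m) v \<in> PG"
  by (induction m) (auto intro: PG_first_order)

lemma tower_PG: "v \<in> PG \<Longrightarrow> tower v m \<in> PG"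
  unfolding tower_def by (intro PG_cmult create_PG)

lemma tower_0 [simp]: "tower v 0 = v"
  by (simp add: tower_def)

lemma sqrt_fact_Suc: "complex_of_real (sqrt (fact (Suc m))) = of_real (sqrt (real (Suc m))) * of_real (sqrt (fact m))"
  by (simp only: fact_Suc real_sqrt_mult of_real_mult of_nat_mult)

lemma create_tower: "v \<in> PG \<Longrightarrow> adj_first_order l d (tower v m) = (\<lambda>x. of_real (sqrt (real (Suc m))) * tower v (Suc m) x)"
proof -
  assume v: "v \<in> PG"
  have "(of_real (sqrt (real (Suc m))) :: complex) \<noteq> 0" by simp
  then have "of_real (sqrt (real (Suc m))) * (1 / complex_of_real (sqrt (fact (Suc m)))) = 1 / complex_of_real (sqrt (fact m))"
    unfolding sqrt_fact_Suc by (simp del: of_nat_Suc fact_Suc)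
  then show ?thesis unfolding tower_def first_order_cmult[OF create_PG[OF v]] mult.assoc[symmetric] by (simp del: of_nat_Suc fact_Suc)
qed

lemma annihilate_create: "f \<in> PG \<Longrightarrow> first_order l d (adj_first_order l d f) x = adj_first_order l d (first_order l d f) x + f x"
  using first_order_commutator[of f l d "\<lambda>b. cnj (l b)" "\<lambda>b. - cnj (d b)" x] ccr by simp

text \<open>Each passage of the annihilator across a creator leaves one extra copy of the lower
  state, and on the vacuum it gives 0.\<close>

lemma annihilate_power:
  assumes v: "v \<in> PG" and a: "first_order l d v = (\<lambda>x. 0)"
  shows "first_order l d ((adj_first_order l d ^^ Suc m) v) = (\<lambda>x. of_nat (Suc m) * (adj_first_order l d ^^ m) v x)"
proof (induction m)
  case 0
  show ?case using annihilate_create[OF v] by (auto simp: a first_order_zero)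
next
  case (Suc m)
  show ?case
  proof
    fix x
    have "first_order l d ((adj_first_order l d ^^ Suc (Suc m)) v) x =
      adj_first_order l d (first_order l d ((adj_first_order l d ^^ Suc m) v)) x + (adj_first_order l d ^^ Suc m) v x"
      using annihilate_create[OF create_PG[OF v, of "Suc m"], of x] by simp
    also have "\<dots> = of_nat (Suc m) * (adj_first_order l d ^^ Suc m) v x + (adj_first_order l d ^^ Suc m) v x"
      unfolding Suc first_order_cmult[OF create_PG[OF v]] by simp
    finally show "first_order l d ((adj_first_order l d ^^ Suc (Suc m)) v) x = of_nat (Suc (Suc m)) * (adj_first_order l d ^^ Suc m) v x"
      by (simp add: algebra_simps)
  qed
qed

lemma annihilate_tower:
  assumes v: "v \<in> PG" and a: "first_order l d v = (\<lambda>x. 0)"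
  shows "first_order l d (tower v (Suc m)) = (\<lambda>x. of_real (sqrt (real (Suc m))) * tower v m x)"
proof -
  have "(of_real (sqrt (real (Suc m))) :: complex) \<noteq> 0" by simp
  moreover have "of_nat (Suc m) = (of_real (sqrt (real (Suc m))) * of_real (sqrt (real (Suc m))) :: complex)"
    by (metis of_real_mult of_real_of_nat_eq of_nat_0_le_iff real_sqrt_mult_self abs_of_nonneg)
  ultimately have "(1 / complex_of_real (sqrt (fact (Suc m)))) * of_nat (Suc m) = of_real (sqrt (real (Suc m))) * (1 / complex_of_real (sqrt (fact m)))"
    unfolding sqrt_fact_Suc by (simp del: of_nat_Suc fact_Suc)
  then show ?thesis unfolding tower_def first_order_cmult[OF create_PG[OF v]] annihilate_power[OF v a] mult.assoc[symmetric] by (simp del: of_nat_Suc fact_Suc)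
qed

text \<open>A creator moved to the other factor becomes an annihilator, which lowers m and n
  together. The vacua may differ, as they do in the plane.\<close>

lemma tower_inner:
  assumes v: "v \<in> PG" "first_order l d v = (\<lambda>x. 0)" and w: "w \<in> PG" "first_order l d w = (\<lambda>x. 0)"
  shows "(LINT x|lborel. tower v m x * cnj (tower w n x)) = (if m = n then LINT x|lborel. v x * cnj (w x) else 0)"
proof (induction m arbitrary: n)
  case 0
  show ?case
  proof (cases n)
    case (Suc k)
    have "of_real (sqrt (real (Suc k))) * (LINT x|lborel. v x * cnj (tower w (Suc k) x)) = (LINT x|lborel. v x * cnj (adj_first_order l d (tower w k) x))"
    proof -
      have "(\<lambda>x. v x * cnj (adj_first_order l d (tower w k) x)) = (\<lambda>x. of_real (sqrt (real (Suc k))) * (v x * cnj (tower w (Suc k) x)))"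
        by (simp add: create_tower[OF w(1)] mult_ac del: of_nat_Suc)
      then show ?thesis by (simp only: integral_mult_right_zero)
    qed
    also have "\<dots> = 0" using first_order_adjoint[OF PG_schwartz[OF v(1)] PG_schwartz[OF tower_PG[OF w(1)]], of l d k] by (simp add: v(2))
    finally show ?thesis by (simp add: Suc del: of_nat_Suc)
  qed simp
next
  case (Suc m)
  note IH = Suc.IH
  have e: "of_real (sqrt (real (Suc m))) * (LINT x|lborel. tower v (Suc m) x * cnj (tower w n x)) = (LINT x|lborel. tower v m x * cnj (first_order l d (tower w n) x))"
    using first_order_adjoint'[OF PG_schwartz[OF tower_PG[OF v(1)]] PG_schwartz[OF tower_PG[OF w(1)]], of l d m n]
    by (simp add: create_tower[OF v(1)] mult.assoc del: of_nat_Suc)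
  have nz: "(of_real (sqrt (real (Suc m))) :: complex) \<noteq> 0" by simp
  show ?case
  proof (cases n)
    case 0
    then show ?thesis using e nz by (simp add: w(2) del: of_nat_Suc)
  next
    case (Suc k)
    have "of_real (sqrt (real (Suc m))) * (LINT x|lborel. tower v (Suc m) x * cnj (tower w n x)) = of_real (sqrt (real (Suc k))) * (LINT x|lborel. tower v m x * cnj (tower w k x))"
      unfolding e by (simp add: Suc annihilate_tower[OF w] mult.left_commute del: of_nat_Suc)
    then show ?thesis using nz IH[of k] by (cases "m = k") (auto simp: Suc simp del: of_nat_Suc)
  qed
qed

text \<open>By \<open>first_order_commutator\<close>, condition c says that the operator commutes
  with the creator.\<close>

lemma commuting_tower:
  assumes v: "v \<in> PG" and c: "(\<Sum>b\<in>Basis. d' b * cnj (l b) + l' b * cnj (d b)) = 0"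
  shows "first_order l' d' (tower v m) = tower (first_order l' d' v) m"
proof -
  have c': "first_order l' d' (adj_first_order l d f) = adj_first_order l d (first_order l' d' f)" if "f \<in> PG" for f
    using first_order_commutator[OF that, of l' d' "\<lambda>b. cnj (l b)" "\<lambda>b. - cnj (d b)"] c by (auto simp: fun_eq_iff)
  have "first_order l' d' ((adj_first_order l d ^^ m) v) = (adj_first_order l d ^^ m) (first_order l' d' v)"
    by (induction m) (simp_all add: c' create_PG[OF v])
  then show ?thesis by (simp only: tower_def first_order_cmult[OF create_PG[OF v]])
qed

lemma tower_cmult: "v \<in> PG \<Longrightarrow> tower (\<lambda>x. a * v x) m = (\<lambda>x. a * tower v m x)"
proof -
  assume v: "v \<in> PG"
  have "(adj_first_order l d ^^ m) (\<lambda>x. a * v x) = (\<lambda>x. a * (adj_first_order l d ^^ m) v x)"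
    by (induction m) (simp_all add: first_order_cmult create_PG[OF v])
  then show ?thesis by (simp add: tower_def mult.left_commute)
qed

end

text \<open>For norm x > 1 the power n is raised to 2 n and compared with one term of the
  exponential series of s |x|^2.\<close>

lemma norm_exp_le_decay:
  assumes "s > 0" shows "\<exists>C. \<forall>x::'a::euclidean_space. norm x ^ n * exp (- s * (norm x)\<^sup>2) \<le> C"
proof -
  have "norm x ^ n * exp (- s * (norm x)\<^sup>2) \<le> 1 + fact n / s ^ n" for x :: 'a
  proof (cases "norm x \<le> 1")
    case True
    have "norm x ^ n * exp (- s * (norm x)\<^sup>2) \<le> 1 * 1"
      using True assms by (intro mult_mono power_le_one) auto
    moreover have "0 \<le> fact n / s ^ n" using assms by simp
    ultimately show ?thesis by linarith
  next
    case False
    define t where "t = s * (norm x)\<^sup>2"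
    have t: "t \<ge> 0" using assms by (simp add: t_def)
    have "(\<Sum>k\<in>{n}. inverse (fact k) * t ^ k) \<le> (\<Sum>k. inverse (fact k) * t ^ k)"
      using t by (intro sum_le_suminf) (auto intro!: summable_exp)
    then have "t ^ n \<le> fact n * exp t" by (simp add: exp_def field_simps)
    then have 1: "t ^ n * exp (- t) \<le> fact n" by (simp add: exp_minus field_simps)
    have "norm x ^ n \<le> norm x ^ (2 * n)" using False by (intro power_increasing) auto
    also have "\<dots> = t ^ n / s ^ n" using assms by (simp add: t_def power_mult_distrib power_mult)
    finally have "norm x ^ n * exp (- t) \<le> t ^ n / s ^ n * exp (- t)" by (intro mult_right_mono) auto
    also have "\<dots> \<le> fact n / s ^ n" using 1 assms by (simp add: field_simps)
    finally show ?thesis by (simp add: t_def)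
  qed
  then show ?thesis by blast
qed

lemma gaussian_L2_pos:
  assumes f: "f \<in> schwartz_space" and nz: "\<And>x. f x \<noteq> 0"
  shows "L2_square f > 0"
proof (rule ccontr)
  assume "\<not> L2_square f > 0"
  then have "L2_square f = 0" using L2_square_nonneg[of f] by simp
  then have "(LINT x|lborel. (norm (f x))\<^sup>2) = 0" by (simp add: L2_square_def)
  then have "AE x in lborel. (norm (f x))\<^sup>2 = 0" using integral_nonneg_eq_0_iff_AE[OF L2_square_integrable[OF f]] by auto
  then have "AE x in (lborel :: 'a measure). False" using nz by simp
  then have "emeasure (lborel :: 'a measure) UNIV = 0" by (simp add: AE_iff_measurable[where N = UNIV])
  then show False by simp
qed

lemma integral_cnj_scale:
  "(LINT x|M. \<phi> x * cnj (of_real c * h x)) = of_real c * (LINT x|M. \<phi> x * cnj (h x))"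
proof -
  have "(\<lambda>x. \<phi> x * cnj (of_real c * h x)) = (\<lambda>x. of_real c * (\<phi> x * cnj (h x)))" by (simp add: mult_ac)
  then show ?thesis by (simp only: integral_mult_right_zero)
qed

section \<open>The Hermite basis on the line\<close>

definition gauss1 :: "real \<Rightarrow> complex" where "gauss1 x = of_real (exp (- (1 / 2) * (norm x)\<^sup>2))"

lemma first_order_real: "first_order l d f (x::real) = l 1 * (of_real x * f x) + d 1 * partial_deriv 1 f x"
  by (simp add: first_order_def coord_mult_def)

interpretation G1: gaussian_space gauss1 "\<lambda>_ _. - 1"
proof
  have "((\<lambda>x. exp (- (1 / 2) * x\<^sup>2)) has_real_derivative - x * exp (- (1 / 2) * x\<^sup>2)) (at x)" for x :: real
    by (auto intro!: derivative_eq_intros)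
  then have "(gauss1 has_vector_derivative of_real (- x * exp (- (1 / 2) * x\<^sup>2))) (at x)" for x
    unfolding gauss1_def[abs_def] by (intro has_vector_derivative_of_real) (simp add: has_real_derivative_iff_has_vector_derivative)
  then show "(gauss1 has_derivative (\<lambda>h. \<Sum>b\<in>Basis. of_real (h \<bullet> b) * (\<Sum>c\<in>Basis. - 1 * coord_mult c gauss1 x))) (at x)" for x
    by (simp add: has_vector_derivative_def coord_mult_def gauss1_def scaleR_conv_of_real mult.assoc)
  show "\<exists>C. \<forall>x. norm x ^ n * norm (gauss1 x) \<le> C" for n
    using norm_exp_le_decay[of "1/2", where 'a = real and n = n] by (simp add: gauss1_def)
qed auto

abbreviation inv_sqrt2 :: complex where "inv_sqrt2 \<equiv> 1 / of_real (sqrt 2)"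

lemma inv_sqrt2_sq: "inv_sqrt2 * inv_sqrt2 = 1 / 2"
  using sqrt2_sq by (simp add: field_simps)

interpretation M1: ladder_mode gauss1 "\<lambda>_ _. - 1" "\<lambda>_. inv_sqrt2" "\<lambda>_. inv_sqrt2"
  by unfold_locales (use inv_sqrt2_sq in simp)

definition hermite :: "nat \<Rightarrow> real \<Rightarrow> complex" where "hermite = M1.tower gauss1"

abbreviation annih1 :: "(real \<Rightarrow> complex) \<Rightarrow> real \<Rightarrow> complex" where
  "annih1 \<equiv> first_order (\<lambda>_. inv_sqrt2) (\<lambda>_. inv_sqrt2)"

abbreviation creat1 :: "(real \<Rightarrow> complex) \<Rightarrow> real \<Rightarrow> complex" where
  "creat1 \<equiv> adj_first_order (\<lambda>_. inv_sqrt2) (\<lambda>_. inv_sqrt2)"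

lemma annih1_gauss1: "annih1 gauss1 = (\<lambda>x. 0)"
  by (rule ext) (simp add: first_order_real G1.partial_deriv_v0 coord_mult_def)

lemma creat1_hermite: "creat1 (hermite m) = (\<lambda>x. of_real (sqrt (real (Suc m))) * hermite (Suc m) x)"
  unfolding hermite_def by (rule M1.create_tower[OF G1.PG_base])

lemma annih1_hermite: "annih1 (hermite m) = (\<lambda>x. of_real (sqrt (real m)) * hermite (m - 1) x)"
proof (cases m)
  case 0
  then show ?thesis by (simp add: hermite_def annih1_gauss1)
next
  case (Suc k)
  then show ?thesis unfolding hermite_def using M1.annihilate_tower[OF G1.PG_base annih1_gauss1, of k] by simp
qed

lemma hermite_PG: "hermite m \<in> G1.PG"
  unfolding hermite_def by (rule M1.tower_PG[OF G1.PG_base])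

lemma coord_mult_hermite_ops: "coord_mult 1 f x = inv_sqrt2 * annih1 f x + inv_sqrt2 * creat1 f x"
proof -
  have "inv_sqrt2 * annih1 f x + inv_sqrt2 * creat1 f x = 2 * (inv_sqrt2 * inv_sqrt2) * (of_real x * f x)"
    by (simp add: first_order_real algebra_simps del: divide_cancel_left)
  then show ?thesis unfolding inv_sqrt2_sq by (simp add: coord_mult_def)
qed

lemma partial_deriv_hermite_ops: "partial_deriv 1 f x = inv_sqrt2 * annih1 f x + - inv_sqrt2 * creat1 f x"
proof -
  have "inv_sqrt2 * annih1 f x + - inv_sqrt2 * creat1 f x = 2 * (inv_sqrt2 * inv_sqrt2) * partial_deriv 1 f x"
    by (simp add: first_order_real algebra_simps del: divide_cancel_left)
  then show ?thesis unfolding inv_sqrt2_sq by simp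
qed

lemma sqrt_le_Suc: "sqrt (real m) \<le> 1 + real m" "sqrt (real (Suc m)) \<le> 1 + real m"
  by (rule real_le_lsqrt; simp add: power2_eq_square algebra_simps)+

lemma norm_inv_sqrt2: "norm inv_sqrt2 \<le> 1"
  by (simp add: norm_divide)

text \<open>For i = 0 the truncated index i - 1 comes with the coefficient sqrt 0.\<close>

lemma band_hermite:
  assumes G: "G = (\<lambda>f x. \<alpha> * annih1 f x + \<beta> * creat1 f x)" and \<alpha>: "norm \<alpha> \<le> 1" "norm \<beta> \<le> 1"
  shows "band_operator hermite G"
  unfolding band_operator_def
proof (intro exI conjI allI impI)
  let ?T = "\<lambda>k i. if k = 0 then \<alpha> * of_real (sqrt (real i)) else \<beta> * of_real (sqrt (real (Suc i)))"
  let ?J = "\<lambda>k i. if k = (0::nat) then i - 1 else Suc i"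
  show "G (hermite i) = (\<lambda>x. \<Sum>k<2. ?T k i * hermite (?J k i) x)" for i
    unfolding G annih1_hermite creat1_hermite by (simp add: numeral_2_eq_2 mult.assoc del: of_nat_Suc)
  fix i k :: nat
  have "norm \<alpha> * sqrt (real i) \<le> 1 * (1 + real i)" "norm \<beta> * sqrt (real (Suc i)) \<le> 1 * (1 + real i)"
    by (rule mult_mono[OF \<alpha>(1) sqrt_le_Suc(1)]; simp) (rule mult_mono[OF \<alpha>(2) sqrt_le_Suc(2)]; simp)
  then have "norm (?T k i) \<le> 1 + real i"
    by (simp add: norm_mult del: of_nat_Suc)
  then show "norm (?T k i) \<le> 2 * (1 + real i) ^ 1" by simp
  show "1 + real (?J k i) \<le> 2 * (1 + real i) ^ 1" by auto
qed simp

text \<open>Annihilating after creating gives the eigenvalues i + 1; unlike those of the number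
  operator they are at least 1 on the vacuum too.\<close>

interpretation B1: ladder_basis hermite "L2_square gauss1" "1 / 2" "\<lambda>_. 1" "\<lambda>\<phi>. annih1 (creat1 \<phi>)" "\<lambda>i. real (Suc i)" "{[], [1]}"
proof
  show "hermite i \<in> schwartz_space" for i by (rule G1.PG_schwartz[OF hermite_PG])
  show "band_operator hermite (generator g)" if "snd g \<in> Basis" for g :: "bool \<times> real"
  proof -
    have g: "snd g = 1" using that by simp
    have "band_operator hermite (coord_mult 1)"
      by (rule band_hermite[OF _ norm_inv_sqrt2 norm_inv_sqrt2]) (intro ext coord_mult_hermite_ops)
    moreover have "band_operator hermite (partial_deriv 1)"
    proof (rule band_hermite[OF _ norm_inv_sqrt2])
      show "partial_deriv (1::real) = (\<lambda>f x. inv_sqrt2 * annih1 f x + - inv_sqrt2 * creat1 f x)"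
        by (intro ext partial_deriv_hermite_ops)
      show "norm (- inv_sqrt2) \<le> 1" unfolding norm_minus_cancel by (rule norm_inv_sqrt2)
    qed
    ultimately show ?thesis unfolding generator_def g by (cases "fst g") (simp_all only: if_True if_False)
  qed
  show "(LINT x|lborel. hermite i x * cnj (hermite j x)) = (if i = j then of_real (L2_square gauss1) else 0)" for i j
    unfolding hermite_def L2_square_eq by (rule M1.tower_inner[OF G1.PG_base annih1_gauss1 G1.PG_base annih1_gauss1])
  show "L2_square gauss1 > 0"
    by (rule gaussian_L2_pos[OF G1.PG_schwartz[OF G1.PG_base]]) (simp add: gauss1_def)
  show "schwartz_op (\<lambda>\<phi>. annih1 (creat1 \<phi>))"
    by (rule schwartz_op_compose[OF schwartz_op_first_order schwartz_op_first_order])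
  show "(LINT x|lborel. annih1 (creat1 \<phi>) x * cnj (hermite i x)) = of_real (real (Suc i)) * (LINT x|lborel. \<phi> x * cnj (hermite i x))"
    if \<phi>: "\<phi> \<in> schwartz_space" for \<phi> i
  proof -
    note S = G1.PG_schwartz[OF hermite_PG]
    have "creat1 \<phi> \<in> schwartz_space" by (rule schwartz_op_closed[OF schwartz_op_first_order \<phi>])
    from first_order_adjoint[OF this S[of i]]
    have "(LINT x|lborel. annih1 (creat1 \<phi>) x * cnj (hermite i x)) = (LINT x|lborel. creat1 \<phi> x * cnj (creat1 (hermite i) x))" .
    also have "\<dots> = (LINT x|lborel. \<phi> x * cnj (annih1 (creat1 (hermite i)) x))"
      by (rule first_order_adjoint'[OF \<phi> schwartz_op_closed[OF schwartz_op_first_order S]])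
    also have "annih1 (creat1 (hermite i)) = (\<lambda>x. of_real (real (Suc i)) * hermite i x)"
      unfolding creat1_hermite G1.first_order_cmult[OF hermite_PG] annih1_hermite
      by (simp add: mult.assoc[symmetric] of_real_mult[symmetric] del: of_real_mult of_nat_Suc)
    finally show ?thesis by (simp only: integral_cnj_scale)
  qed
  show "1 + real i \<le> (real (Suc i))\<^sup>2" "real (Suc i) \<ge> 1" for i by (simp_all add: power2_eq_square algebra_simps)
  show "hermite 0 x = 1 * of_real (exp (- (1 / 2) * (norm x)\<^sup>2))" for x by (simp add: hermite_def gauss1_def)
  show "(norm (f x))\<^sup>2 \<le> (\<Sum>bs\<in>{[], [1]}. L2_square (iter_deriv bs f))" if "f \<in> schwartz_space" for f :: "real \<Rightarrow> complex" and x
    by (rule sobolev_real[OF that])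
qed auto

section \<open>The basis adapted to the operators on the plane\<close>

lemma sum_Basis_plane: "(\<Sum>b\<in>(Basis :: (real \<times> real) set). g b) = g (1, 0) + g (0, 1)"
  by (subst Basis_prod_def) (simp add: add.commute)

lemma Basis_plane: "b \<in> (Basis :: (real \<times> real) set) \<longleftrightarrow> b = (1, 0) \<or> b = (0, 1)"
  by (subst Basis_prod_def) auto

lemma first_order_plane: "first_order l d f (x, y) =
    l (1, 0) * (of_real x * f (x, y)) + l (0, 1) * (of_real y * f (x, y)) + d (1, 0) * partial_deriv (1, 0) f (x, y) + d (0, 1) * partial_deriv (0, 1) f (x, y)"
  by (simp add: first_order_def coord_mult_def sum_Basis_plane)

locale wigner_plane =
  fixes p q :: real
  assumes pq: "q = 1 - p"
begin

text \<open>Applied to \<open>gauss2\<close>, both annihilators leave linear factors that vanish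
  when \<kappa> times p - q (p - q) = p (p - q) + q = p^2 + q^2 is 1.\<close>

definition \<kappa> :: real where "\<kappa> = 1 / (p\<^sup>2 + q\<^sup>2)"

lemma pq_pos: "p\<^sup>2 + q\<^sup>2 > 0"
proof -
  have "p \<noteq> 0 \<or> q \<noteq> 0" using pq by auto
  then show ?thesis by (auto intro: add_pos_nonneg add_nonneg_pos)
qed

lemma \<kappa>: "\<kappa> > 0" "\<kappa> * (p - q * (p - q)) = 1" "\<kappa> * (p * (p - q) + q) = 1"
proof -
  show "\<kappa> > 0" using pq_pos by (simp add: \<kappa>_def)
  have "p - q * (p - q) = p\<^sup>2 + q\<^sup>2" "p * (p - q) + q = p\<^sup>2 + q\<^sup>2" by (simp_all add: pq power2_eq_square algebra_simps)
  moreover have "1 / s * s = 1" if "s > 0" for s :: real using that by simp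
  ultimately show "\<kappa> * (p - q * (p - q)) = 1" "\<kappa> * (p * (p - q) + q) = 1" using pq_pos by (simp_all only: \<kappa>_def)
qed

text \<open>The mixed term compensates the asymmetry between p and q; for p = q = 1 / 2 the phase is
  1.\<close>

definition phase :: "real \<times> real \<Rightarrow> complex" where
  "phase z = exp (\<i> * of_real (\<kappa> * (p - q) * (fst z * snd z)))"

definition gauss2 :: "real \<times> real \<Rightarrow> complex" where
  "gauss2 z = phase z * of_real (exp (- (\<kappa> / 2) * (norm z)\<^sup>2))"

text \<open>The Hessian of the exponent in \<open>gauss2_exp\<close>.\<close>

definition Q2 :: "real \<times> real \<Rightarrow> real \<times> real \<Rightarrow> complex" where
  "Q2 b c = (if b = c then - of_real \<kappa> else \<i> * of_real (\<kappa> * (p - q)))"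

lemma gauss2_exp: "gauss2 z = exp (\<i> * of_real (\<kappa> * (p - q) * (fst z * snd z)) + of_real (- (\<kappa> / 2) * ((fst z)\<^sup>2 + (snd z)\<^sup>2)))"
  unfolding gauss2_def phase_def exp_of_real[symmetric] exp_add[symmetric] by (cases z) (simp add: norm_Pair)

lemma norm_phase: "norm (phase z) = 1"
  by (simp add: phase_def)

lemma gauss2_deriv:
  "(gauss2 has_derivative (\<lambda>h. \<Sum>b\<in>Basis. of_real (h \<bullet> b) * (\<Sum>c\<in>Basis. Q2 b c * coord_mult c gauss2 z))) (at z)"
proof -
  obtain x y where z: "z = (x, y)" by force
  let ?h = "\<lambda>z::real \<times> real. \<i> * of_real (\<kappa> * (p - q) * (fst z * snd z)) + of_real (- (\<kappa> / 2) * ((fst z)\<^sup>2 + (snd z)\<^sup>2))"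
  have h: "(?h has_derivative (\<lambda>k. \<i> * of_real (\<kappa> * (p - q) * (fst z * snd k + fst k * snd z)) + of_real (- (\<kappa> / 2) * (2 * (fst z * fst k) + 2 * (snd z * snd k))))) (at z)"
  proof -
    have f: "(fst has_derivative fst) (at z)" "(snd has_derivative snd) (at z)"
      by (auto intro!: bounded_linear_imp_has_derivative bounded_linear_fst bounded_linear_snd)
    have d1: "((\<lambda>z. \<kappa> * (p - q) * (fst z * snd z)) has_derivative (\<lambda>k. \<kappa> * (p - q) * (fst z * snd k + fst k * snd z))) (at z)"
      by (intro has_derivative_mult_right has_derivative_mult f)
    have d2: "((\<lambda>z. - (\<kappa> / 2) * ((fst z)\<^sup>2 + (snd z)\<^sup>2)) has_derivative (\<lambda>k. - (\<kappa> / 2) * (2 * (fst z * fst k) + 2 * (snd z * snd k)))) (at z)"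
    proof -
      have "((\<lambda>z. - (\<kappa> / 2) * (fst z * fst z + snd z * snd z)) has_derivative (\<lambda>k. - (\<kappa> / 2) * ((fst z * fst k + fst k * fst z) + (snd z * snd k + snd k * snd z)))) (at z)"
        by (intro has_derivative_mult_right has_derivative_add has_derivative_mult f)
      then show ?thesis by (simp add: power2_eq_square mult.commute)
    qed
    show ?thesis
      by (rule has_derivative_add[OF has_derivative_mult_right[OF has_derivative_of_real[OF d1]] has_derivative_of_real[OF d2]])
  qed
  have "((\<lambda>z. exp (?h z)) has_derivative (\<lambda>k. exp (?h z) * (\<i> * of_real (\<kappa> * (p - q) * (fst z * snd k + fst k * snd z)) + of_real (- (\<kappa> / 2) * (2 * (fst z * fst k) + 2 * (snd z * snd k)))))) (at z)"
    using has_derivative_compose[OF h DERIV_exp[of "?h z", unfolded has_field_derivative_def]] by simp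
  moreover have "(\<lambda>z. exp (?h z)) = gauss2" using gauss2_exp by auto
  moreover have "(\<lambda>k. exp (?h z) * (\<i> * of_real (\<kappa> * (p - q) * (fst z * snd k + fst k * snd z)) + of_real (- (\<kappa> / 2) * (2 * (fst z * fst k) + 2 * (snd z * snd k)))))
     = (\<lambda>h. \<Sum>b\<in>Basis. of_real (h \<bullet> b) * (\<Sum>c\<in>Basis. Q2 b c * coord_mult c gauss2 z))"
    unfolding gauss2_exp[symmetric] by (auto simp: fun_eq_iff sum_Basis_plane Q2_def coord_mult_def z algebra_simps)
  ultimately show ?thesis by simp
qed

sublocale G2: gaussian_space gauss2 Q2
proof
  show "\<exists>C. \<forall>x. norm x ^ n * norm (gauss2 x) \<le> C" for n
    using norm_exp_le_decay[of "\<kappa> / 2", where 'a = "real \<times> real" and n = n] \<kappa>(1) by (simp add: gauss2_def norm_mult norm_phase)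
qed (rule gauss2_deriv, auto simp: Q2_def)

text \<open>\<open>la\<close>, \<open>da\<close> encode (X - i Y) / sqrt 2 with X = x + q D_y and Y
  = y - p D_x, the transposes of the factors of \<open>B\<close>; \<open>lb\<close>,
  \<open>db\<close> encode (X' + i Y') / sqrt 2 with X' = x - p D_y and Y' = y + q D_x. The signs
  differ because [X, Y] = - i while [X', Y'] = i.\<close>

definition la :: "real \<times> real \<Rightarrow> complex" where "la b = inv_sqrt2 * (if b = (1, 0) then 1 else - \<i>)"
definition da :: "real \<times> real \<Rightarrow> complex" where "da b = inv_sqrt2 * (if b = (1, 0) then of_real p else - \<i> * of_real q)"
definition lb :: "real \<times> real \<Rightarrow> complex" where "lb b = inv_sqrt2 * (if b = (1, 0) then 1 else \<i>)"
definition db :: "real \<times> real \<Rightarrow> complex" where "db b = inv_sqrt2 * (if b = (1, 0) then of_real q else \<i> * of_real p)"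

lemmas coefficient_defs = la_def da_def lb_def db_def

lemma inv_sqrt2_mult: "inv_sqrt2 * u * (inv_sqrt2 * v) = u * v / 2"
proof -
  have "inv_sqrt2 * u * (inv_sqrt2 * v) = (inv_sqrt2 * inv_sqrt2) * (u * v)" by (simp only: mult_ac)
  then show ?thesis unfolding inv_sqrt2_sq by simp
qed

lemma pq_complex: "complex_of_real q = 1 - of_real p"
  by (simp add: pq)

text \<open>Here, and likewise for the second mode, the commutation relation comes down to p + q =
  1.\<close>

sublocale MA: ladder_mode gauss2 Q2 la da
  by unfold_locales (simp add: sum_Basis_plane coefficient_defs inv_sqrt2_mult pq_complex del: times_divide_eq_left times_divide_eq_right mult_1_left; simp add: field_simps)

sublocale MB: ladder_mode gauss2 Q2 lb db
  by unfold_locales (simp add: sum_Basis_plane coefficient_defs inv_sqrt2_mult pq_complex del: times_divide_eq_left times_divide_eq_right mult_1_left; simp add: field_simps)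

abbreviation "annA \<equiv> first_order la da"
abbreviation "creA \<equiv> adj_first_order la da"
abbreviation "annB \<equiv> first_order lb db"
abbreviation "creB \<equiv> adj_first_order lb db"

lemma pd_gauss2:
  "partial_deriv (1, 0) gauss2 (x, y) = (- of_real \<kappa> * of_real x + \<i> * of_real (\<kappa> * (p - q)) * of_real y) * gauss2 (x, y)"
  "partial_deriv (0, 1) gauss2 (x, y) = (\<i> * of_real (\<kappa> * (p - q)) * of_real x - of_real \<kappa> * of_real y) * gauss2 (x, y)"
  by (subst G2.partial_deriv_v0; simp add: Basis_plane sum_Basis_plane Q2_def coord_mult_def algebra_simps)+

lemma annA_gauss2: "annA gauss2 = (\<lambda>x. 0)"
proof
  fix z :: "real \<times> real"
  obtain x y where z: "z = (x, y)" by force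
  have "annA gauss2 z = inv_sqrt2 * (of_real x * (1 - of_real (\<kappa> * (p - q * (p - q)))) + \<i> * of_real y * (of_real (\<kappa> * (p * (p - q) + q)) - 1)) * gauss2 z"
    unfolding z first_order_plane pd_gauss2 by (simp add: coefficient_defs algebra_simps)
  then show "annA gauss2 z = 0" unfolding \<kappa> by simp
qed

lemma annB_gauss2: "annB gauss2 = (\<lambda>x. 0)"
proof
  fix z :: "real \<times> real"
  obtain x y where z: "z = (x, y)" by force
  have "annB gauss2 z = inv_sqrt2 * (of_real x * (1 - of_real (\<kappa> * (p * (p - q) + q))) + \<i> * of_real y * (1 - of_real (\<kappa> * (p - q * (p - q))))) * gauss2 z"
    unfolding z first_order_plane pd_gauss2 by (simp add: coefficient_defs algebra_simps)
  then show "annB gauss2 z = 0" unfolding \<kappa> by simp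
qed

text \<open>The first index counts excitations of the pair from which \<open>B\<close> is built, the
  second those of the commuting pair.\<close>

definition E :: "nat \<Rightarrow> nat \<Rightarrow> real \<times> real \<Rightarrow> complex" where
  "E m n = MA.tower (MB.tower gauss2 n) m"

lemma vac_PG: "MB.tower gauss2 n \<in> G2.PG"
  by (rule MB.tower_PG[OF G2.PG_base])

lemma E_PG: "E m n \<in> G2.PG"
  unfolding E_def by (rule MA.tower_PG[OF vac_PG])

text \<open>All states of the second mode over \<open>gauss2\<close> are vacua of the first, since
  \<open>annA\<close> commutes with \<open>creB\<close>.\<close>

lemma annA_vac: "annA (MB.tower gauss2 n) = (\<lambda>x. 0)"
proof -
  have "annA (MB.tower gauss2 n) = MB.tower (annA gauss2) n"
    by (rule MB.commuting_tower[OF G2.PG_base])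
      (simp add: sum_Basis_plane coefficient_defs inv_sqrt2_mult pq_complex del: times_divide_eq_left times_divide_eq_right mult_1_left; simp add: field_simps)
  also have "\<dots> = (\<lambda>x. 0)" unfolding annA_gauss2 using MB.tower_cmult[OF G2.PG_base, of 0 n] by simp
  finally show ?thesis .
qed

lemma annA_E: "annA (E m n) = (\<lambda>x. of_real (sqrt (real m)) * E (m - 1) n x)"
proof (cases m)
  case 0
  then show ?thesis by (simp add: E_def annA_vac)
next
  case (Suc k)
  then show ?thesis unfolding E_def using MA.annihilate_tower[OF vac_PG annA_vac] by simp
qed

lemma creA_E: "creA (E m n) = (\<lambda>x. of_real (sqrt (real (Suc m))) * E (Suc m) n x)"
  unfolding E_def by (rule MA.create_tower[OF vac_PG])

lemma annB_E: "annB (E m n) = (\<lambda>x. of_real (sqrt (real n)) * E m (n - 1) x)"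
proof -
  have "annB (E m n) = MA.tower (annB (MB.tower gauss2 n)) m" unfolding E_def
    by (rule MA.commuting_tower[OF vac_PG])
      (simp add: sum_Basis_plane coefficient_defs inv_sqrt2_mult pq_complex del: times_divide_eq_left times_divide_eq_right mult_1_left; simp add: field_simps)
  moreover have "annB (MB.tower gauss2 n) = (\<lambda>x. of_real (sqrt (real n)) * MB.tower gauss2 (n - 1) x)"
  proof (cases n)
    case 0
    then show ?thesis by (simp add: annB_gauss2)
  next
    case (Suc k)
    then show ?thesis using MB.annihilate_tower[OF G2.PG_base annB_gauss2] by simp
  qed
  ultimately show ?thesis by (simp add: MA.tower_cmult[OF vac_PG] E_def)
qed

lemma creB_E: "creB (E m n) = (\<lambda>x. of_real (sqrt (real (Suc n))) * E m (Suc n) x)"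
proof -
  have "creB (E m n) = MA.tower (creB (MB.tower gauss2 n)) m" unfolding E_def
    by (rule MA.commuting_tower[OF vac_PG])
      (simp add: sum_Basis_plane coefficient_defs inv_sqrt2_mult pq_complex del: times_divide_eq_left times_divide_eq_right mult_1_left; simp add: field_simps)
  then show ?thesis by (simp add: MB.create_tower[OF G2.PG_base] MA.tower_cmult[OF vac_PG] E_def)
qed

lemma ops_plane:
  fixes f :: "real \<times> real \<Rightarrow> complex" and x y :: real
  defines "X \<equiv> of_real x * f (x, y)" and "Y \<equiv> of_real y * f (x, y)"
    and "D1 \<equiv> partial_deriv (1, 0) f (x, y)" and "D2 \<equiv> partial_deriv (0, 1) f (x, y)"
  shows "annA f (x, y) = inv_sqrt2 * (X - \<i> * Y + of_real p * D1 - \<i> * of_real q * D2)"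
    "creA f (x, y) = inv_sqrt2 * (X + \<i> * Y - of_real p * D1 - \<i> * of_real q * D2)"
    "annB f (x, y) = inv_sqrt2 * (X + \<i> * Y + of_real q * D1 + \<i> * of_real p * D2)"
    "creB f (x, y) = inv_sqrt2 * (X - \<i> * Y - of_real q * D1 + \<i> * of_real p * D2)"
  unfolding first_order_plane X_def[symmetric] Y_def[symmetric] D1_def[symmetric] D2_def[symmetric]
  by (simp_all add: coefficient_defs add_divide_distrib diff_divide_distrib)

text \<open>The inversion of \<open>ops_plane\<close>: with p + q = 1 each combination collapses to
  a single coordinate or derivative.\<close>

lemma generator_ops:
  "coord_mult (1, 0) f z = inv_sqrt2 * of_real p * annA f z + inv_sqrt2 * of_real p * creA f z + inv_sqrt2 * of_real q * annB f z + inv_sqrt2 * of_real q * creB f z"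
  "coord_mult (0, 1) f z = inv_sqrt2 * (\<i> * of_real q) * annA f z + inv_sqrt2 * (- \<i> * of_real q) * creA f z + inv_sqrt2 * (- \<i> * of_real p) * annB f z + inv_sqrt2 * (\<i> * of_real p) * creB f z"
  "partial_deriv (1, 0) f z = inv_sqrt2 * 1 * annA f z + inv_sqrt2 * (- 1) * creA f z + inv_sqrt2 * 1 * annB f z + inv_sqrt2 * (- 1) * creB f z"
  "partial_deriv (0, 1) f z = inv_sqrt2 * \<i> * annA f z + inv_sqrt2 * \<i> * creA f z + inv_sqrt2 * (- \<i>) * annB f z + inv_sqrt2 * (- \<i>) * creB f z"
proof -
  obtain x y where z: "z = (x, y)" by force
  show "coord_mult (1, 0) f z = inv_sqrt2 * of_real p * annA f z + inv_sqrt2 * of_real p * creA f z + inv_sqrt2 * of_real q * annB f z + inv_sqrt2 * of_real q * creB f z"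
    unfolding z ops_plane inv_sqrt2_mult by (simp add: pq_complex coord_mult_def) (simp add: field_simps)
  show "coord_mult (0, 1) f z = inv_sqrt2 * (\<i> * of_real q) * annA f z + inv_sqrt2 * (- \<i> * of_real q) * creA f z + inv_sqrt2 * (- \<i> * of_real p) * annB f z + inv_sqrt2 * (\<i> * of_real p) * creB f z"
    unfolding z ops_plane inv_sqrt2_mult by (simp add: pq_complex coord_mult_def) (simp add: field_simps)
  show "partial_deriv (1, 0) f z = inv_sqrt2 * 1 * annA f z + inv_sqrt2 * (- 1) * creA f z + inv_sqrt2 * 1 * annB f z + inv_sqrt2 * (- 1) * creB f z"
    unfolding z ops_plane inv_sqrt2_mult by (simp add: pq_complex coord_mult_def) (simp add: field_simps)
  show "partial_deriv (0, 1) f z = inv_sqrt2 * \<i> * annA f z + inv_sqrt2 * \<i> * creA f z + inv_sqrt2 * (- \<i>) * annB f z + inv_sqrt2 * (- \<i>) * creB f z"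
    unfolding z ops_plane inv_sqrt2_mult by (simp add: pq_complex coord_mult_def) (simp add: field_simps)
qed

text \<open>\<open>ladder_basis\<close> expects a single index; by \<open>prod_encode_bound\<close>
  the pairing costs at most a square in growth estimates.\<close>

definition basis2 :: "nat \<Rightarrow> real \<times> real \<Rightarrow> complex" where
  "basis2 i = E (fst (prod_decode i)) (snd (prod_decode i))"

lemma basis2_encode: "basis2 (prod_encode (m, n)) = E m n"
  by (simp add: basis2_def)

lemma prod_encode_bound: "1 + real (prod_encode (a, b)) \<le> (1 + real a + real b)\<^sup>2"
proof -
  have "2 * triangle (a + b) = (a + b) * Suc (a + b)" by (simp add: triangle_def)
  then have "2 * real (triangle (a + b)) = real ((a + b) * Suc (a + b))" by (metis of_nat_mult of_nat_numeral)
  moreover have "0 \<le> real a * real a" "0 \<le> real b * real b" "0 \<le> real a * real b" by simp_all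
  ultimately show ?thesis by (simp add: prod_encode_def power2_eq_square algebra_simps)
qed

lemma prod_decode_le: "fst (prod_decode i) \<le> i" "snd (prod_decode i) \<le> i"
proof -
  have "prod_encode (fst (prod_decode i), snd (prod_decode i)) = i" by simp
  then show "fst (prod_decode i) \<le> i" "snd (prod_decode i) \<le> i" by (metis le_prod_encode_1, metis le_prod_encode_2)
qed

lemma band_basis2:
  assumes G: "G = (\<lambda>f z. \<alpha>1 * annA f z + \<alpha>2 * creA f z + \<alpha>3 * annB f z + \<alpha>4 * creB f z)"
  shows "band_operator basis2 G"
proof -
  define A where "A = norm \<alpha>1 + norm \<alpha>2 + norm \<alpha>3 + norm \<alpha>4"
  define T where "T k i = (let m = fst (prod_decode i); n = snd (prod_decode i) in
    if k = 0 then \<alpha>1 * of_real (sqrt (real m)) else if k = 1 then \<alpha>2 * of_real (sqrt (real (Suc m)))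
    else if k = 2 then \<alpha>3 * of_real (sqrt (real n)) else \<alpha>4 * of_real (sqrt (real (Suc n))))" for k i :: nat
  define J where "J k i = (let m = fst (prod_decode i); n = snd (prod_decode i) in
    if k = 0 then prod_encode (m - 1, n) else if k = 1 then prod_encode (Suc m, n)
    else if k = 2 then prod_encode (m, n - 1) else prod_encode (m, Suc n))" for k i :: nat
  have 1: "G (basis2 i) = (\<lambda>x. \<Sum>k<4. T k i * basis2 (J k i) x)" for i
    unfolding G basis2_def[of i] annA_E creA_E annB_E creB_E
    by (simp add: T_def J_def Let_def basis2_encode eval_nat_numeral mult.assoc del: of_nat_Suc)
  \<comment> \<open>\<open>A\<close> bounds the coefficients, and the 4 makes room for the code of a
    neighbouring pair, which is below (2 (1 + i))^2.\<close>
  have 2: "norm (T k i) \<le> (A + 4) * (1 + real i) ^ 2 \<and> 1 + real (J k i) \<le> (A + 4) * (1 + real i) ^ 2" for k i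
  proof
    obtain m n where mn: "prod_decode i = (m, n)" by force
    have le: "m \<le> i" "n \<le> i" using prod_decode_le[of i] by (simp_all add: mn)
    have sq: "sqrt (real m) \<le> 1 + real i" "sqrt (real n) \<le> 1 + real i" "sqrt (real (Suc m)) \<le> 1 + real i" "sqrt (real (Suc n)) \<le> 1 + real i"
      using sqrt_le_Suc[of m] sqrt_le_Suc[of n] le by linarith+
    have A: "norm \<alpha>1 \<le> A" "norm \<alpha>2 \<le> A" "norm \<alpha>3 \<le> A" "norm \<alpha>4 \<le> A" "0 \<le> A" by (auto simp: A_def)
    have "norm (T k i) \<le> A * (1 + real i)"
      unfolding T_def mn Let_def using A sq by (auto simp: norm_mult simp del: of_nat_Suc intro!: mult_mono)
    also have "\<dots> \<le> (A + 4) * (1 + real i)\<^sup>2"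
      using A(5) by (intro mult_mono) (auto simp: power2_eq_square)
    finally show "norm (T k i) \<le> (A + 4) * (1 + real i) ^ 2" .
    have enc: "1 + real (prod_encode (a, b)) \<le> 4 * (1 + real i)\<^sup>2" if "real a + real b \<le> 1 + 2 * real i" for a b
    proof -
      have "1 + real (prod_encode (a, b)) \<le> (1 + real a + real b)\<^sup>2" by (rule prod_encode_bound)
      also have "\<dots> \<le> (2 * (1 + real i))\<^sup>2" using that by (intro power_mono) auto
      finally show ?thesis unfolding power_mult_distrib by simp
    qed
    have "1 + real (J k i) \<le> 4 * (1 + real i)\<^sup>2"
      unfolding J_def mn Let_def using le by (auto intro!: enc)
    also have "\<dots> \<le> (A + 4) * (1 + real i)\<^sup>2" using A(5) by (intro mult_right_mono) auto
    finally show "1 + real (J k i) \<le> (A + 4) * (1 + real i) ^ 2" .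
  qed
  have "A + 4 \<ge> 0" by (simp add: A_def)
  then show ?thesis unfolding band_operator_def
    by (intro exI[of _ "4::nat"] exI[of _ T] exI[of _ J] exI[of _ "A + 4"] exI[of _ "2::nat"]) (use 1 2 in blast)
qed

text \<open>The relation for the first mode is used with vacua of different n, and their inner
  products are given by the relation for the second mode.\<close>

lemma E_inner:
  "(LINT x|lborel. E m n x * cnj (E m' n' x)) = (if m = m' \<and> n = n' then of_real (L2_square gauss2) else 0)"
  unfolding E_def L2_square_eq
  by (simp add: MA.tower_inner[OF vac_PG annA_vac vac_PG annA_vac] MB.tower_inner[OF G2.PG_base annB_gauss2 G2.PG_base annB_gauss2])

lemma annA_creA_inner:
  assumes \<phi>: "\<phi> \<in> schwartz_space"
  shows "(LINT x|lborel. annA (creA \<phi>) x * cnj (E m n x)) = of_real (real (Suc m)) * (LINT x|lborel. \<phi> x * cnj (E m n x))"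
proof -
  note S = G2.PG_schwartz[OF E_PG]
  have "(LINT x|lborel. annA (creA \<phi>) x * cnj (E m n x)) = (LINT x|lborel. creA \<phi> x * cnj (creA (E m n) x))"
    by (rule first_order_adjoint[OF schwartz_op_closed[OF schwartz_op_first_order \<phi>] S])
  also have "\<dots> = (LINT x|lborel. \<phi> x * cnj (annA (creA (E m n)) x))"
    by (rule first_order_adjoint'[OF \<phi> schwartz_op_closed[OF schwartz_op_first_order S]])
  also have "annA (creA (E m n)) = (\<lambda>x. of_real (real (Suc m)) * E m n x)"
    unfolding creA_E G2.first_order_cmult[OF E_PG] annA_E
    by (simp add: mult.assoc[symmetric] of_real_mult[symmetric] del: of_real_mult of_nat_Suc)
  finally show ?thesis by (simp only: integral_cnj_scale)
qed

lemma annB_creB_inner: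
  assumes \<phi>: "\<phi> \<in> schwartz_space"
  shows "(LINT x|lborel. annB (creB \<phi>) x * cnj (E m n x)) = of_real (real (Suc n)) * (LINT x|lborel. \<phi> x * cnj (E m n x))"
proof -
  note S = G2.PG_schwartz[OF E_PG]
  have "(LINT x|lborel. annB (creB \<phi>) x * cnj (E m n x)) = (LINT x|lborel. creB \<phi> x * cnj (creB (E m n) x))"
    by (rule first_order_adjoint[OF schwartz_op_closed[OF schwartz_op_first_order \<phi>] S])
  also have "\<dots> = (LINT x|lborel. \<phi> x * cnj (annB (creB (E m n)) x))"
    by (rule first_order_adjoint'[OF \<phi> schwartz_op_closed[OF schwartz_op_first_order S]])
  also have "annB (creB (E m n)) = (\<lambda>x. of_real (real (Suc n)) * E m n x)"
    unfolding creB_E G2.first_order_cmult[OF E_PG] annB_E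
    by (simp add: mult.assoc[symmetric] of_real_mult[symmetric] del: of_real_mult of_nat_Suc)
  finally show ?thesis by (simp only: integral_cnj_scale)
qed

text \<open>One annihilation-after-creation factor per mode gives the eigenvalues (m + 1) (n + 1).
  As 1 + m + n <= (1 + m) (1 + n), their squares dominate the pair code.\<close>

sublocale B2: ladder_basis basis2 "L2_square gauss2" "\<kappa> / 2" phase "\<lambda>\<phi>. annA (creA (annB (creB \<phi>)))"
    "\<lambda>i. real (Suc (fst (prod_decode i))) * real (Suc (snd (prod_decode i)))" "{[], [(1, 0)], [(0, 1)], [(0, 1), (1, 0)]}"
proof
  show "basis2 i \<in> schwartz_space" for i unfolding basis2_def by (rule G2.PG_schwartz[OF E_PG])
  show "band_operator basis2 (generator g)" if "snd g \<in> Basis" for g :: "bool \<times> real \<times> real"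
  proof -
    have 1: "band_operator basis2 (coord_mult (1, 0))" 
      by (rule band_basis2[of _ "inv_sqrt2 * of_real p" "inv_sqrt2 * of_real p" "inv_sqrt2 * of_real q" "inv_sqrt2 * of_real q"]) (intro ext generator_ops(1))
    have 2: "band_operator basis2 (coord_mult (0, 1))" 
      by (rule band_basis2[of _ "inv_sqrt2 * (\<i> * of_real q)" "inv_sqrt2 * (- \<i> * of_real q)" "inv_sqrt2 * (- \<i> * of_real p)" "inv_sqrt2 * (\<i> * of_real p)"]) (intro ext generator_ops(2))
    have 3: "band_operator basis2 (partial_deriv (1, 0))" 
      by (rule band_basis2[of _ "inv_sqrt2 * 1" "inv_sqrt2 * (- 1)" "inv_sqrt2 * 1" "inv_sqrt2 * (- 1)"]) (intro ext generator_ops(3))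
    have 4: "band_operator basis2 (partial_deriv (0, 1))" 
      by (rule band_basis2[of _ "inv_sqrt2 * \<i>" "inv_sqrt2 * \<i>" "inv_sqrt2 * (- \<i>)" "inv_sqrt2 * (- \<i>)"]) (intro ext generator_ops(4))
    have "snd g = (1, 0) \<or> snd g = (0, 1)" using that by (simp add: Basis_plane)
    then show ?thesis unfolding generator_def using 1 2 3 4 by (elim disjE) (simp_all only: split: if_split, simp_all)
  qed
  show "(LINT x|lborel. basis2 i x * cnj (basis2 j x)) = (if i = j then of_real (L2_square gauss2) else 0)" for i j
  proof -
    have "(fst (prod_decode i) = fst (prod_decode j) \<and> snd (prod_decode i) = snd (prod_decode j)) = (i = j)"
      by (metis prod_decode_inverse prod.expand)
    then show ?thesis unfolding basis2_def E_inner by simp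
  qed
  show "L2_square gauss2 > 0"
    by (rule gaussian_L2_pos[OF G2.PG_schwartz[OF G2.PG_base]]) (simp add: gauss2_exp)
  show "schwartz_op (\<lambda>\<phi>. annA (creA (annB (creB \<phi>))))"
    by (rule schwartz_op_compose[OF schwartz_op_first_order schwartz_op_compose[OF schwartz_op_first_order
          schwartz_op_compose[OF schwartz_op_first_order schwartz_op_first_order]]])
  show "(LINT x|lborel. annA (creA (annB (creB \<phi>))) x * cnj (basis2 i x)) =
      of_real (real (Suc (fst (prod_decode i))) * real (Suc (snd (prod_decode i)))) * (LINT x|lborel. \<phi> x * cnj (basis2 i x))"
    if \<phi>: "\<phi> \<in> schwartz_space" for \<phi> i
  proof -
    have "annB (creB \<phi>) \<in> schwartz_space" by (intro schwartz_op_closed[OF schwartz_op_first_order] \<phi>)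
    from annA_creA_inner[OF this] annB_creB_inner[OF \<phi>] show ?thesis
      by (simp add: basis2_def mult.assoc del: of_nat_Suc)
  qed
  fix i :: nat
  obtain m n where mn: "prod_decode i = (m, n)" by force
  then have i: "i = prod_encode (m, n)" by (metis prod_decode_inverse)
  have "(1 + real m + real n)\<^sup>2 \<le> (real (Suc m) * real (Suc n))\<^sup>2" by (intro power_mono) (auto simp: algebra_simps)
  with prod_encode_bound[of m n] have "1 + real i \<le> (real (Suc m) * real (Suc n))\<^sup>2"
    unfolding i by (rule order_trans)
  then show "1 + real i \<le> (real (Suc (fst (prod_decode i))) * real (Suc (snd (prod_decode i))))\<^sup>2"
    unfolding mn fst_conv snd_conv .
  have "1 * 1 \<le> real (Suc m) * real (Suc n)" by (intro mult_mono) auto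
  then show "1 \<le> real (Suc (fst (prod_decode i))) * real (Suc (snd (prod_decode i)))" by (simp add: mn)
next
  show "basis2 0 x = phase x * of_real (exp (- (\<kappa> / 2) * (norm x)\<^sup>2))" for x
  proof -
    have "prod_decode 0 = (0, 0)" by (simp add: prod_decode_def prod_decode_aux.simps)
    then show ?thesis by (simp add: basis2_def E_def gauss2_def)
  qed
  show "\<kappa> / 2 > 0" using \<kappa>(1) by simp
  show "norm (phase x) = 1" for x by (rule norm_phase)
  show "continuous_on UNIV phase" unfolding phase_def[abs_def] by (intro continuous_intros)
  show "{[], [(1, 0)], [(0, 1)], [(0, 1), (1, 0)]} \<subseteq> lists (Basis :: (real \<times> real) set)" by (auto simp: Basis_plane)
  show "(norm (f x))\<^sup>2 \<le> (\<Sum>bs\<in>{[], [(1, 0)], [(0, 1)], [(0, 1), (1, 0)]}. L2_square (iter_deriv bs f))"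
    if "f \<in> schwartz_space" for f :: "real \<times> real \<Rightarrow> complex" and x
    by (rule sobolev_plane[OF that])
qed auto

end

section \<open>Regularity and injectivity\<close>

lemma tempered_add:
  assumes "u \<in> tempered_distributions" "v \<in> tempered_distributions"
  shows "(\<lambda>\<phi>. u \<phi> + v \<phi>) \<in> tempered_distributions"
  using assms unfolding tempered_iff
  by (auto simp: algebra_simps intro: schwartz_bounded_mono[OF schwartz_bounded_add] norm_triangle_ineq)

lemma tempered_cmult:
  assumes "u \<in> tempered_distributions" shows "(\<lambda>\<phi>. a * u \<phi>) \<in> tempered_distributions"
  using assms unfolding tempered_iff
  by (auto simp: algebra_simps norm_mult intro: schwartz_bounded_cmult)

lemma tempered_zero: "(\<lambda>\<phi>. 0) \<in> tempered_distributions"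
  by (simp add: tempered_iff schwartz_bounded_zero)

lemma tempered_sum:
  "finite I \<Longrightarrow> (\<And>i. i \<in> I \<Longrightarrow> u i \<in> tempered_distributions) \<Longrightarrow> (\<lambda>\<phi>. \<Sum>i\<in>I. u i \<phi>) \<in> tempered_distributions"
  by (induction I rule: finite_induct) (auto intro: tempered_add tempered_zero)

lemma tempered_linear:
  assumes "u \<in> tempered_distributions" "\<phi> \<in> schwartz_space" "\<psi> \<in> schwartz_space"
  shows "u (\<lambda>x. a * \<phi> x + b * \<psi> x) = a * u \<phi> + b * u \<psi>"
  using assms unfolding tempered_iff by (simp add: schwartz_cmult)

text \<open>Transposes of continuous linear maps preserve tempered distributions; the case
  distinction restores the extension by 0.\<close>

lemma tempered_pullback:
  assumes u: "u \<in> tempered_distributions" and T: "schwartz_op T"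
    and add: "\<And>\<phi> \<psi>. \<phi> \<in> schwartz_space \<Longrightarrow> \<psi> \<in> schwartz_space \<Longrightarrow> T (\<lambda>x. \<phi> x + \<psi> x) = (\<lambda>x. T \<phi> x + T \<psi> x)"
    and scale: "\<And>a \<phi>. \<phi> \<in> schwartz_space \<Longrightarrow> T (\<lambda>x. a * \<phi> x) = (\<lambda>x. a * T \<phi> x)"
  shows "(\<lambda>\<phi>. if \<phi> \<in> schwartz_space then u (T \<phi>) else 0) \<in> tempered_distributions"
proof -
  have "schwartz_bounded (\<lambda>\<phi>. norm (u (T \<phi>)))"
    by (rule schwartz_bounded_compose[OF _ T]) (use u in \<open>simp add: tempered_iff\<close>)
  then have "schwartz_bounded (\<lambda>\<phi>. norm (if \<phi> \<in> schwartz_space then u (T \<phi>) else 0))"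
    by (rule schwartz_bounded_mono) auto
  then show ?thesis using u unfolding tempered_iff
    by (auto simp: add scale schwartz_add schwartz_cmult schwartz_op_closed[OF T])
qed

lemma distr_coord_tempered:
  assumes "u \<in> tempered_distributions" "b \<in> Basis" shows "distr_coord b u \<in> tempered_distributions"
proof -
  have "distr_coord b u = (\<lambda>\<phi>. if \<phi> \<in> schwartz_space then u (coord_mult b \<phi>) else 0)"
    by (auto simp: fun_eq_iff distr_coord_def coord_mult_def[abs_def])
  moreover have "\<dots> \<in> tempered_distributions"
    by (rule tempered_pullback[OF assms(1) schwartz_op_coord_mult[OF assms(2)]]) (auto simp: fun_eq_iff coord_mult_def algebra_simps)
  ultimately show ?thesis by simp
qed

lemma schwartz_differentiable: "\<phi> \<in> schwartz_space \<Longrightarrow> \<phi> differentiable (at x)"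
  using smooth_differentiable[OF schwartz_smooth, of \<phi> "[]"] by simp

lemma distr_D_tempered:
  assumes "u \<in> tempered_distributions" "b \<in> Basis" shows "distr_D b u \<in> tempered_distributions"
proof -
  have "(\<lambda>\<phi>. if \<phi> \<in> schwartz_space then u (\<lambda>x. - \<i> * partial_deriv b \<phi> x) else 0) \<in> tempered_distributions"
    by (rule tempered_pullback[OF assms(1) schwartz_op_cmult[OF schwartz_op_partial_deriv[OF assms(2)]]])
      (auto simp: fun_eq_iff partial_deriv_add partial_deriv_cmult schwartz_differentiable algebra_simps)
  moreover have "distr_D b u = (\<lambda>\<phi>. (-1) * (if \<phi> \<in> schwartz_space then u (\<lambda>x. - \<i> * partial_deriv b \<phi> x) else 0))"
    by (auto simp: fun_eq_iff distr_D_def)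
  ultimately show ?thesis by (metis tempered_cmult)
qed

lemma distr_coord_apply: "\<phi> \<in> schwartz_space \<Longrightarrow> distr_coord b u \<phi> = u (coord_mult b \<phi>)"
  by (simp add: distr_coord_def coord_mult_def[abs_def])

lemma distr_D_apply:
  "u \<in> tempered_distributions \<Longrightarrow> b \<in> Basis \<Longrightarrow> \<phi> \<in> schwartz_space \<Longrightarrow> distr_D b u \<phi> = \<i> * u (partial_deriv b \<phi>)"
  using tempered_linear[of u "partial_deriv b \<phi>" "partial_deriv b \<phi>" "- \<i>" 0] by (simp add: distr_D_def schwartz_partial_deriv)

text \<open>The family e is arbitrary: for \<open>A\<close> it is the Hermite basis, for
  \<open>B\<close> it is \<open>E m n\<close> with the second index fixed.\<close>

lemma operator_poly_coefficients:
  fixes P Q :: "(('a::euclidean_space \<Rightarrow> complex) \<Rightarrow> complex) \<Rightarrow> (('a \<Rightarrow> complex) \<Rightarrow> complex)"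
  assumes P: "\<And>u. u \<in> tempered_distributions \<Longrightarrow> P u \<in> tempered_distributions"
      "\<And>u n. u \<in> tempered_distributions \<Longrightarrow> P u (e n) = seq_X (\<lambda>m. u (e m)) n"
    and Q: "\<And>u. u \<in> tempered_distributions \<Longrightarrow> Q u \<in> tempered_distributions"
      "\<And>u n. u \<in> tempered_distributions \<Longrightarrow> Q u (e n) = seq_Y (\<lambda>m. u (e m)) n"
    and u: "u \<in> tempered_distributions"
  shows "operator_poly m c P Q u \<in> tempered_distributions"
    and "operator_poly m c P Q u (e n) = seq_poly m c (\<lambda>m. u (e m)) n"
proof -
  have Qk: "(Q ^^ k) u \<in> tempered_distributions \<and> (\<lambda>n. (Q ^^ k) u (e n)) = (seq_Y ^^ k) (\<lambda>n. u (e n))" for k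
    by (induction k) (auto simp: u Q)
  have Pj: "(P ^^ j) v \<in> tempered_distributions \<and> (\<lambda>n. (P ^^ j) v (e n)) = (seq_X ^^ j) (\<lambda>n. v (e n))"
    if "v \<in> tempered_distributions" for j v
    by (induction j) (auto simp: that P)
  have PQ: "(P ^^ j) ((Q ^^ k) u) \<in> tempered_distributions"
    "(P ^^ j) ((Q ^^ k) u) (e n) = (seq_X ^^ j) ((seq_Y ^^ k) (\<lambda>n. u (e n))) n" for j k n
    using Pj[of "(Q ^^ k) u" j] Qk[of k] by (auto dest: fun_cong)
  show "operator_poly m c P Q u \<in> tempered_distributions"
    unfolding operator_poly_def by (intro tempered_sum finite_triangle) (auto intro!: tempered_cmult PQ)
  show "operator_poly m c P Q u (e n) = seq_poly m c (\<lambda>m. u (e m)) n"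
    unfolding operator_poly_def seq_poly_def PQ ..
qed

lemma hermite_schwartz: "hermite m \<in> schwartz_space"
  by (rule G1.PG_schwartz[OF hermite_PG])

lemma ladder_schwartz: "\<phi> \<in> schwartz_space \<Longrightarrow> first_order l d \<phi> \<in> schwartz_space"
  by (rule schwartz_op_closed[OF schwartz_op_first_order])

lemma tempered_scale:
  assumes "u \<in> tempered_distributions" "\<phi> \<in> schwartz_space" shows "u (\<lambda>x. a * \<phi> x) = a * u \<phi>"
  using assms by (simp add: tempered_iff)

lemma distr_coord_hermite:
  assumes u: "u \<in> tempered_distributions" shows "distr_coord 1 u (hermite n) = seq_X (\<lambda>m. u (hermite m)) n"
proof -
  have "distr_coord 1 u (hermite n) = u (\<lambda>x. inv_sqrt2 * annih1 (hermite n) x + inv_sqrt2 * creat1 (hermite n) x)"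
    unfolding distr_coord_apply[OF hermite_schwartz] coord_mult_hermite_ops[symmetric] ..
  also have "\<dots> = inv_sqrt2 * u (annih1 (hermite n)) + inv_sqrt2 * u (creat1 (hermite n))"
    by (intro tempered_linear u ladder_schwartz hermite_schwartz)
  also have "\<dots> = seq_X (\<lambda>m. u (hermite m)) n"
    unfolding annih1_hermite creat1_hermite tempered_scale[OF u hermite_schwartz] seq_X_def by (simp add: field_simps del: of_nat_Suc)
  finally show ?thesis .
qed

lemma distr_D_hermite:
  assumes u: "u \<in> tempered_distributions" shows "distr_D 1 u (hermite n) = seq_Y (\<lambda>m. u (hermite m)) n"
proof -
  have "distr_D 1 u (hermite n) = \<i> * u (\<lambda>x. inv_sqrt2 * annih1 (hermite n) x + - inv_sqrt2 * creat1 (hermite n) x)"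
    unfolding partial_deriv_hermite_ops[symmetric] by (intro distr_D_apply u hermite_schwartz) simp
  also have "\<dots> = \<i> * (inv_sqrt2 * u (annih1 (hermite n)) + - inv_sqrt2 * u (creat1 (hermite n)))"
    by (intro arg_cong[where f = "\<lambda>z. \<i> * z"] tempered_linear u ladder_schwartz hermite_schwartz)
  also have "\<dots> = seq_Y (\<lambda>m. u (hermite m)) n"
    unfolding annih1_hermite creat1_hermite tempered_scale[OF u hermite_schwartz] seq_Y_def by (simp add: field_simps del: of_nat_Suc)
  finally show ?thesis .
qed

lemma operator_A_coefficients:
  assumes "u \<in> tempered_distributions"
  shows "operator_A m c u \<in> tempered_distributions"
    and "operator_A m c u (hermite n) = seq_poly m c (\<lambda>m. u (hermite m)) n"
  unfolding operator_A_def
  by (rule operator_poly_coefficients(1)[where e = hermite]; simp add: assms distr_coord_tempered distr_D_tempered distr_coord_hermite distr_D_hermite)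
    (rule operator_poly_coefficients(2); simp add: assms distr_coord_tempered distr_D_tempered distr_coord_hermite distr_D_hermite)

context wigner_plane
begin

lemma E_schwartz: "E m n \<in> schwartz_space"
  by (rule G2.PG_schwartz[OF E_PG])

text \<open>Transposed to test functions, x - q D_y is the sum of \<open>annA\<close> and
  \<open>creA\<close> over sqrt 2, so the second index is never touched.\<close>

lemma coord_operator_E:
  assumes u: "u \<in> tempered_distributions"
  shows "distr_coord (1, 0) u (E m n) - of_real q * distr_D (0, 1) u (E m n) = seq_X (\<lambda>m. u (E m n)) m"
proof -
  have "distr_coord (1, 0) u (E m n) - of_real q * distr_D (0, 1) u (E m n) =
      1 * u (coord_mult (1, 0) (E m n)) + (- \<i> * of_real q) * u (partial_deriv (0, 1) (E m n))"
    by (simp add: distr_coord_apply distr_D_apply E_schwartz u Basis_plane)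
  also have "\<dots> = u (\<lambda>x. 1 * coord_mult (1, 0) (E m n) x + (- \<i> * of_real q) * partial_deriv (0, 1) (E m n) x)"
    by (intro tempered_linear[symmetric] u schwartz_coord_mult schwartz_partial_deriv E_schwartz) (simp_all add: Basis_plane)
  also have "(\<lambda>x. 1 * coord_mult (1, 0) (E m n) x + (- \<i> * of_real q) * partial_deriv (0, 1) (E m n) x) =
      (\<lambda>x. inv_sqrt2 * 1 * annA (E m n) x + inv_sqrt2 * 1 * creA (E m n) x)" (is "?l = ?r")
  proof
    fix z show "?l z = ?r z"
      by (cases z) (simp only: ops_plane inv_sqrt2_mult, simp add: coord_mult_def, simp add: field_simps)
  qed
  also have "u \<dots> = inv_sqrt2 * 1 * u (annA (E m n)) + inv_sqrt2 * 1 * u (creA (E m n))"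
    by (intro tempered_linear u ladder_schwartz E_schwartz)
  also have "\<dots> = seq_X (\<lambda>m. u (E m n)) m"
    unfolding annA_E creA_E tempered_scale[OF u E_schwartz] seq_X_def by (simp add: field_simps del: of_nat_Suc)
  finally show ?thesis .
qed

lemma momentum_operator_E:
  assumes u: "u \<in> tempered_distributions"
  shows "distr_coord (0, 1) u (E m n) + of_real p * distr_D (1, 0) u (E m n) = seq_Y (\<lambda>m. u (E m n)) m"
proof -
  have "distr_coord (0, 1) u (E m n) + of_real p * distr_D (1, 0) u (E m n) =
      1 * u (coord_mult (0, 1) (E m n)) + (\<i> * of_real p) * u (partial_deriv (1, 0) (E m n))"
    by (simp add: distr_coord_apply distr_D_apply E_schwartz u Basis_plane)
  also have "\<dots> = u (\<lambda>x. 1 * coord_mult (0, 1) (E m n) x + (\<i> * of_real p) * partial_deriv (1, 0) (E m n) x)"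
    by (intro tempered_linear[symmetric] u schwartz_coord_mult schwartz_partial_deriv E_schwartz) (simp_all add: Basis_plane)
  also have "(\<lambda>x. 1 * coord_mult (0, 1) (E m n) x + (\<i> * of_real p) * partial_deriv (1, 0) (E m n) x) =
      (\<lambda>x. inv_sqrt2 * \<i> * annA (E m n) x + inv_sqrt2 * (- \<i>) * creA (E m n) x)" (is "?l = ?r")
  proof
    fix z show "?l z = ?r z"
      by (cases z) (simp only: ops_plane inv_sqrt2_mult, simp add: coord_mult_def, simp add: field_simps)
  qed
  also have "u \<dots> = inv_sqrt2 * \<i> * u (annA (E m n)) + inv_sqrt2 * (- \<i>) * u (creA (E m n))"
    by (intro tempered_linear u ladder_schwartz E_schwartz)
  also have "\<dots> = seq_Y (\<lambda>m. u (E m n)) m"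
    unfolding annA_E creA_E tempered_scale[OF u E_schwartz] seq_Y_def by (simp add: field_simps del: of_nat_Suc)
  finally show ?thesis .
qed

lemma operator_B_coefficients:
  assumes "u \<in> tempered_distributions"
  shows "operator_B l c p q u \<in> tempered_distributions"
    and "operator_B l c p q u (E m n) = seq_poly l c (\<lambda>m. u (E m n)) m"
proof -
  have 1: "(\<lambda>\<phi>. distr_coord (1, 0) u \<phi> - of_real q * distr_D (0, 1) u \<phi>) \<in> tempered_distributions"
    "(\<lambda>\<phi>. distr_coord (0, 1) u \<phi> + of_real p * distr_D (1, 0) u \<phi>) \<in> tempered_distributions"
    if "u \<in> tempered_distributions" for u :: "(real \<times> real \<Rightarrow> complex) \<Rightarrow> complex"
    using tempered_add[OF distr_coord_tempered[OF that, of "(1, 0)"] tempered_cmult[OF distr_D_tempered[OF that, of "(0, 1)"], of "- of_real q"]]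
      tempered_add[OF distr_coord_tempered[OF that, of "(0, 1)"] tempered_cmult[OF distr_D_tempered[OF that, of "(1, 0)"], of "of_real p"]]
    by (simp_all add: Basis_plane)
  show "operator_B l c p q u \<in> tempered_distributions" unfolding operator_B_def
    by (rule operator_poly_coefficients[where e = "\<lambda>m. E m n"]; intro assms 1 coord_operator_E momentum_operator_E)
  show "operator_B l c p q u (E m n) = seq_poly l c (\<lambda>m. u (E m n)) m" unfolding operator_B_def
    by (rule operator_poly_coefficients[where e = "\<lambda>m. E m n"]; intro assms 1 coord_operator_E momentum_operator_E)
qed

end

section \<open>From one-index estimates to regularity in the plane\<close>

lemma seq_poly_diff: "seq_poly l c (\<lambda>n. U n - V n) n = seq_poly l c U n - seq_poly l c V n"
proof -
  have Y: "(seq_Y ^^ k) (\<lambda>n. U n - V n) = (\<lambda>n. (seq_Y ^^ k) U n - (seq_Y ^^ k) V n)" for k U V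
    by (induction k) (auto simp: seq_Y_def diff_divide_distrib[symmetric] algebra_simps)
  have X: "(seq_X ^^ k) (\<lambda>n. U n - V n) = (\<lambda>n. (seq_X ^^ k) U n - (seq_X ^^ k) V n)" for k U V
    by (induction k) (auto simp: seq_X_def diff_divide_distrib[symmetric] algebra_simps)
  show ?thesis unfolding seq_poly_def Y X by (simp add: case_prod_unfold right_diff_distrib sum_subtractf)
qed

text \<open>The pair code is below the square of (1 + m) (1 + n), so N powers of it need the
  exponent 2 N in each index.\<close>

lemma rapid_decay_prod:
  assumes "\<And>N. \<exists>C. \<forall>m n. norm (U m n) \<le> C / ((1 + real m) ^ N * (1 + real n) ^ N)"
  shows "rapid_decay (\<lambda>i. case_prod U (prod_decode i))"
  unfolding rapid_decay_def
proof
  fix N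
  obtain C where C: "\<And>m n. norm (U m n) \<le> C / ((1 + real m) ^ (2 * N) * (1 + real n) ^ (2 * N))" using assms by blast
  have "C \<ge> 0" using order_trans[OF norm_ge_zero C[of 0 0]] by simp
  have "norm (case_prod U (prod_decode i)) \<le> C / (1 + real i) ^ N" for i
  proof -
    obtain m n where mn: "prod_decode i = (m, n)" by force
    \<comment> \<open>\<open>prod_encode_bound\<close> is stated in the context of
      \<open>wigner_plane\<close>, of which p = 0, q = 1 is an admissible instance.\<close>
    have "1 + real i \<le> (1 + real m + real n)\<^sup>2" using wigner_plane.prod_encode_bound[of 0 1 m n] by (simp add: wigner_plane_def mn[symmetric])
    also have "\<dots> \<le> ((1 + real m) * (1 + real n))\<^sup>2" by (intro power_mono) (auto simp: algebra_simps)
    finally have "(1 + real i) ^ N \<le> (((1 + real m) * (1 + real n))\<^sup>2) ^ N" by (intro power_mono) auto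
    also have "\<dots> = (1 + real m) ^ (2 * N) * (1 + real n) ^ (2 * N)" by (simp add: power_mult_distrib power_mult)
    finally have "C / ((1 + real m) ^ (2 * N) * (1 + real n) ^ (2 * N)) \<le> C / (1 + real i) ^ N"
      using \<open>C \<ge> 0\<close> by (intro divide_left_mono) auto
    then show ?thesis using C[of m n] by (simp add: mn)
  qed
  then show "\<exists>C. \<forall>i. norm (case_prod U (prod_decode i)) \<le> C / (1 + real i) ^ N" by blast
qed

theorem theorem7:
  fixes m :: nat and c :: "nat \<Rightarrow> nat \<Rightarrow> complex" and p q :: real
  assumes "q = 1 - p"
    and "hypo_elliptic (symbol_poly m c)"
  shows "regular_operator (operator_B m c p q) \<longleftrightarrow> inj_on (operator_A m c) tempered_distributions"
proof -
  interpret W: wigner_plane p q by unfold_locales (rule assms(1))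
  show ?thesis
  proof
    assume reg: "regular_operator (operator_B m c p q)"
    show "inj_on (operator_A m c) tempered_distributions"
    proof (rule inj_onI)
      fix u v :: "(real \<Rightarrow> complex) \<Rightarrow> complex"
      assume uv: "u \<in> tempered_distributions" "v \<in> tempered_distributions" "operator_A m c u = operator_A m c v"
      define w where "w k = u (hermite k) - v (hermite k)" for k
      have w0: "seq_poly m c w n = 0" for n
        unfolding w_def seq_poly_diff by (simp add: operator_A_coefficients(2)[symmetric] uv)
      have "(\<lambda>\<phi>. u \<phi> + (-1) * v \<phi>) \<in> tempered_distributions" by (intro tempered_add tempered_cmult uv)
      from B1.tempered_poly_growth[OF this] obtain K N where K: "\<And>k. norm (w k) \<le> K * (1 + real k) ^ N"
        by (auto simp: poly_growth_def w_def)
      have K0: "K \<ge> 0" using order_trans[OF norm_ge_zero K[of 0]] by simp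
      \<comment> \<open>The sequence \<open>w\<close> is extended constantly in the second index,
        written in the pair code.\<close>
      have "poly_growth (\<lambda>i. w (fst (prod_decode i)))" unfolding poly_growth_def
      proof (intro exI allI)
        fix i
        have "norm (w (fst (prod_decode i))) \<le> K * (1 + real (fst (prod_decode i))) ^ N" by (rule K)
        also have "\<dots> \<le> K * (1 + real i) ^ N"
          using K0 W.prod_decode_le(1)[of i] by (intro mult_left_mono power_mono) auto
        finally show "norm (w (fst (prod_decode i))) \<le> K * (1 + real i) ^ N" .
      qed
      from W.B2.tempered_from_coefficients[OF this]
      obtain U where U: "U \<in> tempered_distributions" "\<And>i. U (W.basis2 i) = w (fst (prod_decode i))" by blast
      have UE: "U (W.E k n) = w k" for k n
        using U(2)[of "prod_encode (k, n)"] by (simp add: W.basis2_encode)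
      have "operator_B m c p q U (W.basis2 i) = 0" for i
        unfolding W.basis2_def W.operator_B_coefficients(2)[OF U(1)] UE w0 ..
      then have "operator_B m c p q U = (\<lambda>\<phi>. 0)"
        by (intro W.B2.tempered_eqI W.operator_B_coefficients U tempered_zero)
      also have "\<dots> = distr_of (\<lambda>x. 0)" by (auto simp: fun_eq_iff distr_of_def)
      finally have "operator_B m c p q U \<in> distr_of ` schwartz_space" using schwartz_zero by blast
      then have "U \<in> distr_of ` schwartz_space" using reg U(1) by (auto simp: regular_operator_def)
      then obtain f where f: "f \<in> schwartz_space" "U = distr_of f" by blast
      \<comment> \<open>A single power of decay suffices: for fixed k the value \<open>w k\<close>
        is the same for all n, while C / (1 + n) tends to 0.\<close>
      from W.B2.distr_of_rapid[OF f(1)] obtain C where C: "\<And>i. norm (U (W.basis2 i)) \<le> C / (1 + real i) ^ 1"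
        unfolding rapid_decay_def f(2) by blast
      have "u (hermite k) = v (hermite k)" for k
      proof -
        have "norm (w k) \<le> C / (1 + real n)" for n
        proof -
          have C0: "C \<ge> 0" using order_trans[OF norm_ge_zero C[of 0]] by simp
          have "norm (w k) \<le> C / (1 + real (prod_encode (k, n)))" using C[of "prod_encode (k, n)"] by (simp add: W.basis2_encode UE)
          also have "\<dots> \<le> C / (1 + real n)" using C0 le_prod_encode_2[of n k] by (intro divide_left_mono) auto
          finally show ?thesis .
        qed
        moreover have "(\<lambda>n. C / (1 + real n)) \<longlonglongrightarrow> 0" by real_asymp
        ultimately have "norm (w k) \<le> 0" by (intro LIMSEQ_le_const) auto
        then show ?thesis by (simp add: w_def)
      qed
      then show "u = v" by (intro B1.tempered_eqI uv)
    qed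
  next
    assume inj: "inj_on (operator_A m c) tempered_distributions"
    \<comment> \<open>Injectivity passes to sequences by comparison with the zero
      distribution.\<close>
    have seq_inj: "U n = 0" if U: "poly_growth U" "\<And>n. seq_poly m c U n = 0" for U n
    proof -
      from B1.tempered_from_coefficients[OF U(1)]
      obtain u where u: "u \<in> tempered_distributions" "\<And>i. u (hermite i) = U i" by blast
      have "operator_A m c u (hermite i) = operator_A m c (\<lambda>\<phi>. 0) (hermite i)" for i
        unfolding operator_A_coefficients(2)[OF u(1)] operator_A_coefficients(2)[OF tempered_zero] u(2) U(2)
        using seq_poly_cmult[of m c 0 "\<lambda>_. 0" i] by simp
      then have "operator_A m c u = operator_A m c (\<lambda>\<phi>. 0)"
        by (intro B1.tempered_eqI operator_A_coefficients u tempered_zero)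
      then have "u = (\<lambda>\<phi>. 0)" using inj u(1) tempered_zero by (auto dest: inj_onD)
      then show ?thesis using u(2)[of n] by simp
    qed
    show "regular_operator (operator_B m c p q)" unfolding regular_operator_def
    proof (intro ballI impI)
      fix u :: "(real \<times> real \<Rightarrow> complex) \<Rightarrow> complex"
      assume u: "u \<in> tempered_distributions" and "operator_B m c p q u \<in> distr_of ` schwartz_space"
      then obtain f where f: "f \<in> schwartz_space" "operator_B m c p q u = distr_of f" by blast
      obtain K P where K: "\<And>i. norm (u (W.basis2 i)) \<le> K * (1 + real i) ^ P"
        using W.B2.tempered_poly_growth[OF u] unfolding poly_growth_def by blast
      have K0: "K \<ge> 0" using order_trans[OF norm_ge_zero K[of 0]] by simp
      \<comment> \<open>The constant of growth in k depends on n, which is harmless because the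
        estimate below does not involve it.\<close>
      have growth: "norm (u (W.E k n)) \<le> (K * (1 + real n) ^ (2 * P)) * (1 + real k) ^ (2 * P)" for k n
      proof -
        have "1 + real (prod_encode (k, n)) \<le> (1 + real k + real n)\<^sup>2" by (rule W.prod_encode_bound)
        also have "\<dots> \<le> ((1 + real n) * (1 + real k))\<^sup>2" by (intro power_mono) (auto simp: algebra_simps)
        finally have "(1 + real (prod_encode (k, n))) ^ P \<le> (((1 + real n) * (1 + real k))\<^sup>2) ^ P" by (intro power_mono) auto
        also have "\<dots> = (1 + real n) ^ (2 * P) * (1 + real k) ^ (2 * P)" by (simp add: power_mult_distrib power_mult)
        finally have "K * (1 + real (prod_encode (k, n))) ^ P \<le> K * ((1 + real n) ^ (2 * P) * (1 + real k) ^ (2 * P))"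
          using K0 by (rule mult_left_mono)
        with K[of "prod_encode (k, n)"] show ?thesis by (simp add: W.basis2_encode mult.assoc)
      qed
      have "\<exists>C. \<forall>k n. norm (u (W.E k n)) \<le> C / ((1 + real k) ^ N * (1 + real n) ^ N)" for N
      proof -
        \<comment> \<open>\<open>C\<close> is fixed before the column, so it is the same for every
          n.\<close>
        obtain C where C: "\<And>U K D. (\<forall>n. norm (U n) \<le> K * (1 + real n) ^ (2 * P)) \<Longrightarrow>
            (\<forall>n. norm (seq_poly m c U n) \<le> D / (1 + real n) ^ (2 * N + 4)) \<Longrightarrow>
            (\<forall>n. norm (U n) \<le> C * D / (1 + real n) ^ N)"
          using seq_estimate_injective[where m = m and c = c and P = "2 * P" and N = N] assms(2) seq_inj by blast
        \<comment> \<open>Of these powers 2 N + 4 serve the estimate in k, and N survive as decay in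
          n.\<close>
        obtain L where L: "\<And>i. norm (distr_of f (W.basis2 i)) \<le> L / (1 + real i) ^ (3 * N + 4)"
          using W.B2.distr_of_rapid[OF f(1)] unfolding rapid_decay_def by blast
        have L0: "L \<ge> 0" using order_trans[OF norm_ge_zero L[of 0]] by simp
        have "norm (seq_poly m c (\<lambda>k. u (W.E k n)) k) \<le> (L / (1 + real n) ^ N) / (1 + real k) ^ (2 * N + 4)" for k n
        proof -
          let ?i = "prod_encode (k, n)"
          have "(1 + real n) ^ N * (1 + real k) ^ (2 * N + 4) \<le> (1 + real ?i) ^ N * (1 + real ?i) ^ (2 * N + 4)"
            using le_prod_encode_1[of k n] le_prod_encode_2[of n k] by (intro mult_mono power_mono) auto
          also have "\<dots> = (1 + real ?i) ^ (3 * N + 4)" by (simp flip: power_add)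
          finally have "L / (1 + real ?i) ^ (3 * N + 4) \<le> L / ((1 + real n) ^ N * (1 + real k) ^ (2 * N + 4))"
            using L0 by (intro divide_left_mono) auto
          moreover have "seq_poly m c (\<lambda>k. u (W.E k n)) k = distr_of f (W.basis2 ?i)"
            unfolding W.basis2_encode f(2)[symmetric] W.operator_B_coefficients(2)[OF u] ..
          ultimately show ?thesis using L[of ?i] by simp
        qed
        then have "norm (u (W.E k n)) \<le> C * (L / (1 + real n) ^ N) / (1 + real k) ^ N" for k n
          using C[of "\<lambda>k. u (W.E k n)" "K * (1 + real n) ^ (2 * P)" "L / (1 + real n) ^ N"] growth by blast
        then show ?thesis by (intro exI[of _ "C * L"]) (simp add: mult.commute)
      qed
      then have "rapid_decay (\<lambda>i. case_prod (\<lambda>k n. u (W.E k n)) (prod_decode i))" by (rule rapid_decay_prod)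
      then have "rapid_decay (\<lambda>i. u (W.basis2 i))" by (simp add: W.basis2_def case_prod_unfold)
      then show "u \<in> distr_of ` schwartz_space" by (rule W.B2.rapid_imp_distr_of[OF u])
    qed
  qed
qed

end
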